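(* Let $u\in L^2(Q)$ be the optimal control of the problem of minimizing $\mathcal{J}(y(v),v)=\frac12\|y(v)-y_d\|^2+\frac\lambda2\|v\|^2$ over $v\in L^2(Q)$, where $y(v)$ is the time-periodic parabolic state belonging to $v$, and let $|||u-v|||_1^2:=\frac12\|y(u)-y(v)\|^2+\frac{\lambda\underline{\mu_1}^2}{2C_F^2}|y(u)-y(v)|_{1,\frac12}^2$. Then for every control $v\in L^2(Q)$, all $\alpha,\beta>0$ and arbitrary $\eta,\zeta\in H^{1,1}_{0,per}(Q)$, $\boldsymbol{\tau},\boldsymbol{\rho}\in H(\mathrm{div},Q)$, $$|||u-v|||_1^2\le\mathcal{M}_1^\oplus(\alpha,\beta;\eta,\zeta,\boldsymbol{\tau},\boldsymbol{\rho},v):=\mathcal{J}^\oplus(\alpha,\beta;\eta,\boldsymbol{\tau},v)-\mathcal{J}^\ominus(\eta,\zeta,\boldsymbol{\tau},\boldsymbol{\rho})+\frac{3\lambda}{4C_F^2}\big(C_F\|\mathcal{R}_1(\eta,\boldsymbol{\tau},v)\|+\|\mathcal{R}_2(\eta,\boldsymbol{\tau})\|\big)^2,$$ with $$\begin{aligned}\mathcal{M}_1^\oplus(\alpha,\beta;\eta,\zeta,\boldsymbol{\tau},\boldsymbol{\rho},v)=\ &\tfrac\alpha2\|\eta-y_d\|^2+\gamma\Big(\|\mathcal{R}_2(\eta,\boldsymbol{\tau})\|^2+\tfrac{C_F^2}{\beta}\|\mathcal{R}_1(\eta,\boldsymbol{\tau},v)\|^2\Big)+\tfrac\lambda2\|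v\|^2-\tfrac1{2\lambda}\|\zeta\|^2\\&+\int_Q\big(\nu\nabla\eta\cdot\nabla\zeta+\sigma\partial_t\eta\,\zeta+\lambda^{-1}\zeta^2\big)\,d\boldsymbol{x}\,dt+\frac{C_F^2}{\underline{\mu_1}^2\lambda}\big(C_F\|\mathcal{R}_3(\zeta,\boldsymbol{\rho},\eta)\|+\|\mathcal{R}_4(\zeta,\boldsymbol{\rho})\|\big)^2\\&+\frac1{\underline{\mu_1}}\big(C_F\|\mathcal{R}_1(\eta,\boldsymbol{\tau},-\lambda^{-1}\zeta)\|+\|\mathcal{R}_2(\eta,\boldsymbol{\tau})\|\big)\big(C_F\|\mathcal{R}_3(\zeta,\boldsymbol{\rho},\eta)\|+\|\mathcal{R}_4(\zeta,\boldsymbol{\rho})\|\big)\\&+\frac{3\lambda}{4C_F^2}\big(C_F\|\mathcal{R}_1(\eta,\boldsymbol{\tau},v)\|+\|\mathcal{R}_2(\eta,\boldsymbol{\tau})\|\big)^2.\end{aligned}$$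
   Context: Setting. $\Omega\subset\mathbb{R}^d$, $d\in\{1,2,3\}$, is a bounded Lipschitz domain with boundary $\Gamma$; $T>0$, $\omega=2\pi/T$, $Q=\Omega\times(0,T)$, $\Sigma=\Gamma\times(0,T)$. The coefficients $\sigma,\nu$ are functions on $\Omega$ with $0<\underline{\sigma}\le\sigma(\boldsymbol{x})\le\overline{\sigma}$ and $0<\underline{\nu}\le\nu(\boldsymbol{x})\le\overline{\nu}$ for constants; $\lambda>0$; $y_d\in L^2(Q)$. $\|\cdot\|$ is the norm in $L^2(Q)$ (or $[L^2(Q)]^d$), $\langle\cdot,\cdot\rangle_\Omega$, $\|\cdot\|_\Omega$ are those of $L^2(\Omega)$ (componentwise for vectors); $\nabla$, $\nabla\cdot$ act in space. $C_F>0$ is Friedrichs' constant: $\|w\|_\Omega\le C_F\|\nabla w\|_\Omega$ for all $w\in H^1_0(\Omega)$. Fourier series. Every $w\in L^2(Q)$ is written $w=w_0^c+\sum_{k\ge1}(w_k^c\cos(k\omega t)+w_k^s\sin(k\omega t))$ (usual Fourier coefficients in time, in $L^2(\Omega)$); $\boldsymbol{w}_k=(w_k^c,w_k^s)^T$, $\boldsymbol{w}_k^\perp=(-w_k^s,w_k^c)^T$, $w^\perp=\sum_{k\ge1}(\boldsymbol{w}_k^\perp)^T\cdot(\cos(k\omega t),\sin(k\omega t))^T$. Define $\|\partial_t^{1/2}w\|^2=\frac T2\sum_{k\ge1}k\omega\|\boldsymbol{w}_k\|_\Omega^2$, $|w|_{1,\frac12}^2=\|\nabla w\|^2+\|\partial_t^{1/2}w\|^2$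 and $\int_Q\sigma\,\partial_t^{1/2}w\,\partial_t^{1/2}z\,d\boldsymbol{x}\,dt=\frac T2\sum_{k\ge1}k\omega\langle\sigma\boldsymbol{w}_k,\boldsymbol{z}_k\rangle_\Omega$. With this convention $\int_Q\sigma\,\partial_t^{1/2}w\,\partial_t^{1/2}z^\perp=\int_Q\sigma\,\partial_tw\,z$ whenever $w$ is $T$-periodic in time with $\partial_tw\in L^2(Q)$. Spaces. $H^{1,\frac12}_{0,per}(Q)=\{w\in L^2(Q):\nabla w\in[L^2(Q)]^d,\ \|\partial_t^{1/2}w\|<\infty,\ w=0\text{ on }\Sigma\}$. $H^{1,1}_{0,per}(Q)=\{w\in L^2(Q):\nabla w\in[L^2(Q)]^d,\ \partial_tw\in L^2(Q),\ w=0\text{ on }\Sigma,\ w(0)=w(T)\text{ in }\overline\Omega\}$. $H(\mathrm{div},Q)=\{\boldsymbol{\tau}\in[L^2(Q)]^d:\ \nabla\cdot\boldsymbol{\tau}(\cdot,t)\in L^2(\Omega)\text{ for a.e. }t\in(0,T)\}$, with in addition $\nabla\cdot\boldsymbol{\tau}\in L^2(Q)$. State. For $v\in L^2(Q)$, $y(v)\in H^{1,\frac12}_{0,per}(Q)$ is the weak solution of $\sigma\partial_ty-\nabla\cdot(\nu\nabla y)=v$ in $Q$, $y=0$ on $\Sigma$, $y(0)=y(T)$ in $\overline\Omega$, i.e. $\int_Q(\nu\nabla y\cdot\nabla q+\sigma\partial_t^{1/2}y\,\partial_t^{1/2}q^\perp)\,d\boldsymbol{x}\,dt=\int_Qv\,q\,d\boldsymbol{x}\,dt$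 for all $q\in H^{1,\frac12}_{0,per}(Q)$. Residuals and constants. $\mathcal{R}_1(\eta,\boldsymbol{\tau},v)=\sigma\partial_t\eta-\nabla\cdot\boldsymbol{\tau}-v$, $\mathcal{R}_2(\eta,\boldsymbol{\tau})=\boldsymbol{\tau}-\nu\nabla\eta$, $\mathcal{R}_3(\zeta,\boldsymbol{\rho},\eta)=\eta-y_d+\nabla\cdot\boldsymbol{\rho}+\sigma\partial_t\zeta$, $\mathcal{R}_4(\zeta,\boldsymbol{\rho})=\boldsymbol{\rho}-\nu\nabla\zeta$; $\underline{\mu_1}=\frac1{\sqrt2}\min\{\underline\nu,\underline\sigma\}$; $\gamma=\frac{(1+\alpha)(1+\beta)C_F^2}{2\alpha\underline{\mu_1}^2}$. Majorant and minorant of the cost functional. $\mathcal{J}^\oplus(\alpha,\beta;\eta,\boldsymbol{\tau},v)=\frac{1+\alpha}2\|\eta-y_d\|^2+\gamma\big(\|\mathcal{R}_2(\eta,\boldsymbol{\tau})\|^2+\frac{C_F^2}\beta\|\mathcal{R}_1(\eta,\boldsymbol{\tau},v)\|^2\big)+\frac\lambda2\|v\|^2$, and $\mathcal{J}^\ominus(\eta,\zeta,\boldsymbol{\tau},\boldsymbol{\rho})=\frac12\|\eta-y_d\|^2+\frac1{2\lambda}\|\zeta\|^2-\int_Q(\nu\nabla\eta\cdot\nabla\zeta+\sigma\partial_t\eta\,\zeta+\lambda^{-1}\zeta^2)\,d\boldsymbol{x}\,dt-\frac{C_F^2}{\underline{\mu_1}^2\lambda}(C_F\|\mathcal{R}_3(\zeta,\boldsymbol{\rho},\eta)\|+\|\mathcal{R}_4(\zeta,\boldsymbol{\rho})\|)^2-\frac1{\underline{\mu_1}}(C_F\|\mathcal{R}_1(\eta,\boldsymbol{\tau},-\lambda^{-1}\zeta)\|+\|\mathcal{R}_2(\eta,\boldsymbol{\tau})\|)(C_F\|\mathcal{R}_3(\zeta,\boldsymbol{\rho},\eta)\|+\|\mathcal{R}_4(\zeta,\boldsymbol{\rho})\|)$.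 *)

theory Defs
  imports "HOL-Analysis.Analysis"
begin

section \<open>Square-integrable functions\<close>

text \<open>Elements of \<open>L2 M\<close> are functions, not classes; every notion below depends on them only up to
  null sets. For vector-valued functions the norm is the Euclidean one.\<close>

definition L2 :: "'a measure \<Rightarrow> ('a \<Rightarrow> 'b::real_normed_vector) set" where
  "L2 M = {f \<in> borel_measurable M. integrable M (\<lambda>x. (norm (f x))\<^sup>2)}"

definition L2_norm :: "'a measure \<Rightarrow> ('a \<Rightarrow> 'b::real_normed_vector) \<Rightarrow> real" where
  "L2_norm M f = sqrt (\<integral>x. (norm (f x))\<^sup>2 \<partial>M)"

section \<open>Domains, test functions and weak derivatives\<close>

text \<open>Near each boundary point \<open>p\<close> the domain is the strict epigraph of a Lipschitz function over
  the hyperplane orthogonal to some unit vector \<open>e\<close>.\<close>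

definition lipschitz_domain :: "'a::euclidean_space set \<Rightarrow> bool" where
  "lipschitz_domain \<Omega> \<longleftrightarrow>
     open \<Omega> \<and> connected \<Omega> \<and> \<Omega> \<noteq> {} \<and>
     (\<forall>p\<in>frontier \<Omega>. \<exists>r>0. \<exists>e h L.
        norm e = 1 \<and> L-lipschitz_on {z. z \<bullet> e = 0} h \<and>
        \<Omega> \<inter> ball p r = {x \<in> ball p r. h (x - (x \<bullet> e) *\<^sub>R e) < x \<bullet> e})"

text \<open>Being coinductive, \<open>smooth f\<close> says that \<open>f\<close> and all its iterated partial derivatives are
  Frechet differentiable everywhere, that is, \<open>f\<close> is of class $C^\infty$.\<close>

coinductive smooth :: "('a::euclidean_space \<Rightarrow> real) \<Rightarrow> bool" where
  "(\<forall>x. f differentiable (at x)) \<Longrightarrow>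
   (\<forall>b\<in>Basis. smooth (\<lambda>x. frechet_derivative f (at x) b)) \<Longrightarrow> smooth f"

definition test_function :: "'a::euclidean_space set \<Rightarrow> ('a \<Rightarrow> real) \<Rightarrow> bool" where
  "test_function S \<phi> \<longleftrightarrow> smooth \<phi> \<and> (\<exists>K. compact K \<and> K \<subseteq> S \<and> (\<forall>x. x \<notin> K \<longrightarrow> \<phi> x = 0))"

definition gradient :: "('a::euclidean_space \<Rightarrow> real) \<Rightarrow> 'a \<Rightarrow> 'a" where
  "gradient \<phi> x = (\<Sum>b\<in>Basis. frechet_derivative \<phi> (at x) b *\<^sub>R b)"

definition weak_gradient :: "'a::euclidean_space set \<Rightarrow> ('a \<Rightarrow> real) \<Rightarrow> ('a \<Rightarrow> 'a) \<Rightarrow> bool" where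
  "weak_gradient \<Omega> f g \<longleftrightarrow>
     (\<forall>\<phi>. test_function \<Omega> \<phi> \<longrightarrow>
        (\<forall>b\<in>Basis. (\<integral>x. f x * (gradient \<phi> x \<bullet> b) \<partial>lebesgue_on \<Omega>)
                  = - (\<integral>x. (g x \<bullet> b) * \<phi> x \<partial>lebesgue_on \<Omega>)))"

definition weak_divergence :: "'a::euclidean_space set \<Rightarrow> ('a \<Rightarrow> 'a) \<Rightarrow> ('a \<Rightarrow> real) \<Rightarrow> bool" where
  "weak_divergence \<Omega> \<tau> D \<longleftrightarrow>
     (\<forall>\<phi>. test_function \<Omega> \<phi> \<longrightarrow>
        (\<integral>x. \<tau> x \<bullet> gradient \<phi> x \<partial>lebesgue_on \<Omega>) = - (\<integral>x. D x * \<phi> x \<partial>lebesgue_on \<Omega>))"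

text \<open>The space $H^1_0(\Omega)$ as the closure of the test functions in $H^1(\Omega)$.\<close>

definition H10 :: "'a::euclidean_space set \<Rightarrow> ('a \<Rightarrow> real) set" where
  "H10 \<Omega> = {f \<in> L2 (lebesgue_on \<Omega>). \<exists>g \<in> L2 (lebesgue_on \<Omega>). weak_gradient \<Omega> f g \<and>
     (\<exists>\<phi>. (\<forall>n::nat. test_function \<Omega> (\<phi> n)) \<and>
        (\<lambda>n. L2_norm (lebesgue_on \<Omega>) (\<lambda>x. f x - \<phi> n x)) \<longlonglongrightarrow> 0 \<and>
        (\<lambda>n. L2_norm (lebesgue_on \<Omega>) (\<lambda>x. g x - gradient (\<phi> n) x)) \<longlonglongrightarrow> 0)}"

definition friedrichs_constant :: "'a::euclidean_space set \<Rightarrow> real \<Rightarrow> bool" where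
  "friedrichs_constant \<Omega> C \<longleftrightarrow>
     0 < C \<and> (\<forall>w \<in> H10 \<Omega>. \<forall>g \<in> L2 (lebesgue_on \<Omega>). weak_gradient \<Omega> w g \<longrightarrow>
        L2_norm (lebesgue_on \<Omega>) w \<le> C * L2_norm (lebesgue_on \<Omega>) g)"

section \<open>Functions on the space-time cylinder\<close>

text \<open>Spatial derivatives and boundary values of a function on $Q = \Omega \times (0,T)$ are taken on
  the time slices. The operators \<open>grad\<close>, \<open>diverg\<close> and \<open>dt\<close> select a representative, which is
  meaningful only if the derivative exists; the spaces defined below require this.\<close>

definition cyl :: "'a::euclidean_space set \<Rightarrow> real \<Rightarrow> ('a \<times> real) measure" where
  "cyl \<Omega> T = lebesgue_on (\<Omega> \<times> {0<..<T})"

definition is_grad ::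
  "'a::euclidean_space set \<Rightarrow> real \<Rightarrow> ('a \<times> real \<Rightarrow> real) \<Rightarrow> ('a \<times> real \<Rightarrow> 'a) \<Rightarrow> bool" where
  "is_grad \<Omega> T w g \<longleftrightarrow> g \<in> L2 (cyl \<Omega> T) \<and>
     (AE t in lebesgue_on {0<..<T}. weak_gradient \<Omega> (\<lambda>x. w (x, t)) (\<lambda>x. g (x, t)))"

definition grad ::
  "'a::euclidean_space set \<Rightarrow> real \<Rightarrow> ('a \<times> real \<Rightarrow> real) \<Rightarrow> 'a \<times> real \<Rightarrow> 'a" where
  "grad \<Omega> T w = (SOME g. is_grad \<Omega> T w g)"

definition is_div ::
  "'a::euclidean_space set \<Rightarrow> real \<Rightarrow> ('a \<times> real \<Rightarrow> 'a) \<Rightarrow> ('a \<times> real \<Rightarrow> real) \<Rightarrow> bool" where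
  "is_div \<Omega> T \<tau> D \<longleftrightarrow> D \<in> L2 (cyl \<Omega> T) \<and>
     (AE t in lebesgue_on {0<..<T}. weak_divergence \<Omega> (\<lambda>x. \<tau> (x, t)) (\<lambda>x. D (x, t)))"

definition diverg ::
  "'a::euclidean_space set \<Rightarrow> real \<Rightarrow> ('a \<times> real \<Rightarrow> 'a) \<Rightarrow> 'a \<times> real \<Rightarrow> real" where
  "diverg \<Omega> T \<tau> = (SOME D. is_div \<Omega> T \<tau> D)"

text \<open>Weak time derivative of $w$ as a function $(0,T) \to L^2(\Omega)$: the identity
  $\int_0^T w \psi' = - \int_0^T h \psi$ holds in $L^2(\Omega)$ for all scalar test functions.\<close>

definition is_dt ::
  "'a::euclidean_space set \<Rightarrow> real \<Rightarrow> ('a \<times> real \<Rightarrow> real) \<Rightarrow> ('a \<times> real \<Rightarrow> real) \<Rightarrow> bool" where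
  "is_dt \<Omega> T w h \<longleftrightarrow> h \<in> L2 (cyl \<Omega> T) \<and>
     (\<forall>\<psi>. test_function {0<..<T} \<psi> \<longrightarrow>
        (AE x in lebesgue_on \<Omega>.
           (\<integral>t. w (x, t) * deriv \<psi> t \<partial>lebesgue_on {0<..<T})
             = - (\<integral>t. h (x, t) * \<psi> t \<partial>lebesgue_on {0<..<T})))"

definition dt ::
  "'a::euclidean_space set \<Rightarrow> real \<Rightarrow> ('a \<times> real \<Rightarrow> real) \<Rightarrow> 'a \<times> real \<Rightarrow> real" where
  "dt \<Omega> T w = (SOME h. is_dt \<Omega> T w h)"

definition zero_on_boundary :: "'a::euclidean_space set \<Rightarrow> real \<Rightarrow> ('a \<times> real \<Rightarrow> real) \<Rightarrow> bool" where
  "zero_on_boundary \<Omega> T w \<longleftrightarrow> (AE t in lebesgue_on {0<..<T}. (\<lambda>x. w (x, t)) \<in> H10 \<Omega>)"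

text \<open>The condition $w(0) = w(T)$, where the values at the end points are those of the
  representative $W \in C([0,T]; L^2(\Omega))$ of $w$.\<close>

definition time_periodic :: "'a::euclidean_space set \<Rightarrow> real \<Rightarrow> ('a \<times> real \<Rightarrow> real) \<Rightarrow> bool" where
  "time_periodic \<Omega> T w \<longleftrightarrow>
     (\<exists>W :: real \<Rightarrow> 'a \<Rightarrow> real.
        (\<forall>t\<in>{0..T}. W t \<in> L2 (lebesgue_on \<Omega>)) \<and>
        (\<forall>t\<in>{0..T}. ((\<lambda>s. L2_norm (lebesgue_on \<Omega>) (\<lambda>x. W s x - W t x)) \<longlongrightarrow> 0)
                        (at t within {0..T})) \<and>
        (AE t in lebesgue_on {0<..<T}. AE x in lebesgue_on \<Omega>. W t x = w (x, t)) \<and>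
        (AE x in lebesgue_on \<Omega>. W 0 x = W T x))"

section \<open>Fourier coefficients in time\<close>

text \<open>\<open>fourier T w k x\<close> is the pair $(w_k^c(x), w_k^s(x))$ for \<open>k \<ge> 1\<close>; the coefficient of index 0
  does not enter any of the quantities below. The coefficients of $w^\perp$ are \<open>perp\<close> applied to
  those of $w$.\<close>

definition fourier :: "real \<Rightarrow> ('a \<times> real \<Rightarrow> real) \<Rightarrow> nat \<Rightarrow> 'a \<Rightarrow> real \<times> real" where
  "fourier T w k x =
     (2 / T * (\<integral>t. w (x, t) * cos (real k * (2 * pi / T) * t) \<partial>lebesgue_on {0<..<T}),
      2 / T * (\<integral>t. w (x, t) * sin (real k * (2 * pi / T) * t) \<partial>lebesgue_on {0<..<T}))"

definition perp :: "(nat \<Rightarrow> 'a \<Rightarrow> real \<times> real) \<Rightarrow> nat \<Rightarrow> 'a \<Rightarrow> real \<times> real" where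
  "perp Z k x = (- snd (Z k x), fst (Z k x))"

definition half_term :: "'a::euclidean_space set \<Rightarrow> real \<Rightarrow> ('a \<times> real \<Rightarrow> real) \<Rightarrow> nat \<Rightarrow> real" where
  "half_term \<Omega> T w k = real k * (2 * pi / T) * (L2_norm (lebesgue_on \<Omega>) (fourier T w k))\<^sup>2"

definition half_norm_sq :: "'a::euclidean_space set \<Rightarrow> real \<Rightarrow> ('a \<times> real \<Rightarrow> real) \<Rightarrow> real" where
  "half_norm_sq \<Omega> T w = T / 2 * (\<Sum>k. half_term \<Omega> T w (Suc k))"

text \<open>$\int_Q \sigma\, \partial_t^{1/2} w\, \partial_t^{1/2} z$, as a function of the families of
  Fourier coefficients of $w$ and $z$.\<close>

definition half_form ::
  "'a::euclidean_space set \<Rightarrow> real \<Rightarrow> ('a \<Rightarrow> real) \<Rightarrow>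
   (nat \<Rightarrow> 'a \<Rightarrow> real \<times> real) \<Rightarrow> (nat \<Rightarrow> 'a \<Rightarrow> real \<times> real) \<Rightarrow> real" where
  "half_form \<Omega> T \<sigma> W Z =
     T / 2 * (\<Sum>k. real (Suc k) * (2 * pi / T) *
                   (\<integral>x. \<sigma> x * (W (Suc k) x \<bullet> Z (Suc k) x) \<partial>lebesgue_on \<Omega>))"

section \<open>Function spaces on the cylinder\<close>

definition H1_half :: "'a::euclidean_space set \<Rightarrow> real \<Rightarrow> ('a \<times> real \<Rightarrow> real) set" where
  "H1_half \<Omega> T = {w \<in> L2 (cyl \<Omega> T). (\<exists>g. is_grad \<Omega> T w g) \<and>
     summable (\<lambda>k. half_term \<Omega> T w (Suc k)) \<and> zero_on_boundary \<Omega> T w}"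

definition H1_1 :: "'a::euclidean_space set \<Rightarrow> real \<Rightarrow> ('a \<times> real \<Rightarrow> real) set" where
  "H1_1 \<Omega> T = {w \<in> L2 (cyl \<Omega> T). (\<exists>g. is_grad \<Omega> T w g) \<and> (\<exists>h. is_dt \<Omega> T w h) \<and>
     zero_on_boundary \<Omega> T w \<and> time_periodic \<Omega> T w}"

definition Hdiv :: "'a::euclidean_space set \<Rightarrow> real \<Rightarrow> ('a \<times> real \<Rightarrow> 'a) set" where
  "Hdiv \<Omega> T = {\<tau> \<in> L2 (cyl \<Omega> T). \<exists>D. is_div \<Omega> T \<tau> D}"

definition seminorm_sq :: "'a::euclidean_space set \<Rightarrow> real \<Rightarrow> ('a \<times> real \<Rightarrow> real) \<Rightarrow> real" where
  "seminorm_sq \<Omega> T w = (L2_norm (cyl \<Omega> T) (grad \<Omega> T w))\<^sup>2 + half_norm_sq \<Omega> T w"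

section \<open>State equation and optimal control\<close>

definition weak_state ::
  "'a::euclidean_space set \<Rightarrow> real \<Rightarrow> ('a \<Rightarrow> real) \<Rightarrow> ('a \<Rightarrow> real) \<Rightarrow>
   ('a \<times> real \<Rightarrow> real) \<Rightarrow> ('a \<times> real \<Rightarrow> real) \<Rightarrow> bool" where
  "weak_state \<Omega> T \<sigma> \<nu> v y \<longleftrightarrow> y \<in> H1_half \<Omega> T \<and>
     (\<forall>q \<in> H1_half \<Omega> T.
        (\<integral>z. \<nu> (fst z) * (grad \<Omega> T y z \<bullet> grad \<Omega> T q z) \<partial>cyl \<Omega> T)
          + half_form \<Omega> T \<sigma> (fourier T y) (perp (fourier T q))
        = (\<integral>z. v z * q z \<partial>cyl \<Omega> T))"

definition cost ::
  "'a::euclidean_space set \<Rightarrow> real \<Rightarrow> ('a \<times> real \<Rightarrow> real) \<Rightarrow> real \<Rightarrow>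
   ('a \<times> real \<Rightarrow> real) \<Rightarrow> ('a \<times> real \<Rightarrow> real) \<Rightarrow> real" where
  "cost \<Omega> T yd lam y v =
     1 / 2 * (L2_norm (cyl \<Omega> T) (\<lambda>z. y z - yd z))\<^sup>2 + lam / 2 * (L2_norm (cyl \<Omega> T) v)\<^sup>2"

definition optimal_control ::
  "'a::euclidean_space set \<Rightarrow> real \<Rightarrow> ('a \<Rightarrow> real) \<Rightarrow> ('a \<Rightarrow> real) \<Rightarrow>
   ('a \<times> real \<Rightarrow> real) \<Rightarrow> real \<Rightarrow> ('a \<times> real \<Rightarrow> real) \<Rightarrow> bool" where
  "optimal_control \<Omega> T \<sigma> \<nu> yd lam u \<longleftrightarrow> u \<in> L2 (cyl \<Omega> T) \<and>
     (\<exists>y. weak_state \<Omega> T \<sigma> \<nu> u y \<and>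
        (\<forall>v \<in> L2 (cyl \<Omega> T). \<forall>y'. weak_state \<Omega> T \<sigma> \<nu> v y' \<longrightarrow>
           cost \<Omega> T yd lam y u \<le> cost \<Omega> T yd lam y' v))"

section \<open>Residuals, majorant and minorant\<close>

definition R1 ::
  "'a::euclidean_space set \<Rightarrow> real \<Rightarrow> ('a \<Rightarrow> real) \<Rightarrow>
   ('a \<times> real \<Rightarrow> real) \<Rightarrow> ('a \<times> real \<Rightarrow> 'a) \<Rightarrow> ('a \<times> real \<Rightarrow> real) \<Rightarrow> 'a \<times> real \<Rightarrow> real" where
  "R1 \<Omega> T \<sigma> \<eta> \<tau> v z = \<sigma> (fst z) * dt \<Omega> T \<eta> z - diverg \<Omega> T \<tau> z - v z"

definition R2 ::
  "'a::euclidean_space set \<Rightarrow> real \<Rightarrow> ('a \<Rightarrow> real) \<Rightarrow>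
   ('a \<times> real \<Rightarrow> real) \<Rightarrow> ('a \<times> real \<Rightarrow> 'a) \<Rightarrow> 'a \<times> real \<Rightarrow> 'a" where
  "R2 \<Omega> T \<nu> \<eta> \<tau> z = \<tau> z - \<nu> (fst z) *\<^sub>R grad \<Omega> T \<eta> z"

definition R3 ::
  "'a::euclidean_space set \<Rightarrow> real \<Rightarrow> ('a \<Rightarrow> real) \<Rightarrow> ('a \<times> real \<Rightarrow> real) \<Rightarrow>
   ('a \<times> real \<Rightarrow> real) \<Rightarrow> ('a \<times> real \<Rightarrow> 'a) \<Rightarrow> ('a \<times> real \<Rightarrow> real) \<Rightarrow> 'a \<times> real \<Rightarrow> real" where
  "R3 \<Omega> T \<sigma> yd \<zeta> \<rho> \<eta> z = \<eta> z - yd z + diverg \<Omega> T \<rho> z + \<sigma> (fst z) * dt \<Omega> T \<zeta> z"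

definition R4 ::
  "'a::euclidean_space set \<Rightarrow> real \<Rightarrow> ('a \<Rightarrow> real) \<Rightarrow>
   ('a \<times> real \<Rightarrow> real) \<Rightarrow> ('a \<times> real \<Rightarrow> 'a) \<Rightarrow> 'a \<times> real \<Rightarrow> 'a" where
  "R4 \<Omega> T \<nu> \<zeta> \<rho> z = \<rho> z - \<nu> (fst z) *\<^sub>R grad \<Omega> T \<zeta> z"

text \<open>\<open>nu0\<close> and \<open>sig0\<close> are the lower bounds of \<open>\<nu>\<close> and \<open>\<sigma>\<close>; \<open>CF\<close> is Friedrichs' constant and
  \<open>m\<close> below stands for \<open>mu1 nu0 sig0\<close>.\<close>

definition mu1 :: "real \<Rightarrow> real \<Rightarrow> real" where
  "mu1 nu0 sig0 = 1 / sqrt 2 * min nu0 sig0"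

definition gamma_coeff :: "real \<Rightarrow> real \<Rightarrow> real \<Rightarrow> real \<Rightarrow> real" where
  "gamma_coeff CF m \<alpha> \<beta> = (1 + \<alpha>) * (1 + \<beta>) * CF\<^sup>2 / (2 * \<alpha> * m\<^sup>2)"

definition J_major ::
  "'a::euclidean_space set \<Rightarrow> real \<Rightarrow> ('a \<Rightarrow> real) \<Rightarrow> ('a \<Rightarrow> real) \<Rightarrow> ('a \<times> real \<Rightarrow> real) \<Rightarrow>
   real \<Rightarrow> real \<Rightarrow> real \<Rightarrow> real \<Rightarrow> real \<Rightarrow>
   ('a \<times> real \<Rightarrow> real) \<Rightarrow> ('a \<times> real \<Rightarrow> 'a) \<Rightarrow> ('a \<times> real \<Rightarrow> real) \<Rightarrow> real" where
  "J_major \<Omega> T \<sigma> \<nu> yd lam CF m \<alpha> \<beta> \<eta> \<tau> v =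
     (1 + \<alpha>) / 2 * (L2_norm (cyl \<Omega> T) (\<lambda>z. \<eta> z - yd z))\<^sup>2
     + gamma_coeff CF m \<alpha> \<beta> * ((L2_norm (cyl \<Omega> T) (R2 \<Omega> T \<nu> \<eta> \<tau>))\<^sup>2
         + CF\<^sup>2 / \<beta> * (L2_norm (cyl \<Omega> T) (R1 \<Omega> T \<sigma> \<eta> \<tau> v))\<^sup>2)
     + lam / 2 * (L2_norm (cyl \<Omega> T) v)\<^sup>2"

definition J_minor ::
  "'a::euclidean_space set \<Rightarrow> real \<Rightarrow> ('a \<Rightarrow> real) \<Rightarrow> ('a \<Rightarrow> real) \<Rightarrow> ('a \<times> real \<Rightarrow> real) \<Rightarrow>
   real \<Rightarrow> real \<Rightarrow> real \<Rightarrow>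
   ('a \<times> real \<Rightarrow> real) \<Rightarrow> ('a \<times> real \<Rightarrow> real) \<Rightarrow> ('a \<times> real \<Rightarrow> 'a) \<Rightarrow> ('a \<times> real \<Rightarrow> 'a) \<Rightarrow> real" where
  "J_minor \<Omega> T \<sigma> \<nu> yd lam CF m \<eta> \<zeta> \<tau> \<rho> =
     1 / 2 * (L2_norm (cyl \<Omega> T) (\<lambda>z. \<eta> z - yd z))\<^sup>2
     + 1 / (2 * lam) * (L2_norm (cyl \<Omega> T) \<zeta>)\<^sup>2
     - (\<integral>z. \<nu> (fst z) * (grad \<Omega> T \<eta> z \<bullet> grad \<Omega> T \<zeta> z)
             + \<sigma> (fst z) * dt \<Omega> T \<eta> z * \<zeta> z + inverse lam * (\<zeta> z)\<^sup>2 \<partial>cyl \<Omega> T)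
     - CF\<^sup>2 / (m\<^sup>2 * lam) *
         (CF * L2_norm (cyl \<Omega> T) (R3 \<Omega> T \<sigma> yd \<zeta> \<rho> \<eta>) + L2_norm (cyl \<Omega> T) (R4 \<Omega> T \<nu> \<zeta> \<rho>))\<^sup>2
     - 1 / m *
         (CF * L2_norm (cyl \<Omega> T) (R1 \<Omega> T \<sigma> \<eta> \<tau> (\<lambda>z. - inverse lam * \<zeta> z))
            + L2_norm (cyl \<Omega> T) (R2 \<Omega> T \<nu> \<eta> \<tau>)) *
         (CF * L2_norm (cyl \<Omega> T) (R3 \<Omega> T \<sigma> yd \<zeta> \<rho> \<eta>) + L2_norm (cyl \<Omega> T) (R4 \<Omega> T \<nu> \<zeta> \<rho>))"

definition M1_major ::
  "'a::euclidean_space set \<Rightarrow> real \<Rightarrow> ('a \<Rightarrow> real) \<Rightarrow> ('a \<Rightarrow> real) \<Rightarrow> ('a \<times> real \<Rightarrow> real) \<Rightarrow>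
   real \<Rightarrow> real \<Rightarrow> real \<Rightarrow> real \<Rightarrow> real \<Rightarrow>
   ('a \<times> real \<Rightarrow> real) \<Rightarrow> ('a \<times> real \<Rightarrow> real) \<Rightarrow> ('a \<times> real \<Rightarrow> 'a) \<Rightarrow> ('a \<times> real \<Rightarrow> 'a) \<Rightarrow>
   ('a \<times> real \<Rightarrow> real) \<Rightarrow> real" where
  "M1_major \<Omega> T \<sigma> \<nu> yd lam CF m \<alpha> \<beta> \<eta> \<zeta> \<tau> \<rho> v =
     J_major \<Omega> T \<sigma> \<nu> yd lam CF m \<alpha> \<beta> \<eta> \<tau> v - J_minor \<Omega> T \<sigma> \<nu> yd lam CF m \<eta> \<zeta> \<tau> \<rho>
     + 3 * lam / (4 * CF\<^sup>2) *
         (CF * L2_norm (cyl \<Omega> T) (R1 \<Omega> T \<sigma> \<eta> \<tau> v) + L2_norm (cyl \<Omega> T) (R2 \<Omega> T \<nu> \<eta> \<tau>))\<^sup>2"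

text \<open>$|||u-v|||_1^2$ in terms of the states \<open>yu\<close> and \<open>yv\<close> belonging to the two controls.\<close>

definition error_sq ::
  "'a::euclidean_space set \<Rightarrow> real \<Rightarrow> real \<Rightarrow> real \<Rightarrow> real \<Rightarrow>
   ('a \<times> real \<Rightarrow> real) \<Rightarrow> ('a \<times> real \<Rightarrow> real) \<Rightarrow> real" where
  "error_sq \<Omega> T lam CF m yu yv =
     1 / 2 * (L2_norm (cyl \<Omega> T) (\<lambda>z. yu z - yv z))\<^sup>2
     + lam * m\<^sup>2 / (2 * CF\<^sup>2) * seminorm_sq \<Omega> T (\<lambda>z. yu z - yv z)"

end

theory Submission
  imports Defs
begin

text \<open>
  The cost is quadratic in the control and \<open>u\<close> minimises it. Comparing \<open>u\<close> with the points of the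
  segment from \<open>u\<close> to \<open>v\<close> shows that the cost at \<open>v\<close> exceeds the cost at \<open>u\<close> by at least
  \<open>1/2 \<parallel>y(u) - y(v)\<parallel>\<^sup>2 + \<lambda>/2 \<parallel>u - v\<parallel>\<^sup>2\<close> (\<open>optimal_control_gap\<close>). The second square dominates
  the seminorm part of the error, because a state with right-hand side \<open>f\<close> satisfies
  \<open>\<mu>\<^sub>1 |w| \<le> C\<^sub>F \<parallel>f\<parallel>\<close> in the seminorm of order one in space and one half in time (\<open>stability\<close>).
  It remains to bound the cost at \<open>v\<close> from above and the cost at \<open>u\<close> from below; the last summand
  of the majorant is nonnegative.

  Both bounds rest on one estimate: subtracting \<open>\<eta>\<close> from a state and testing the equation with the
  difference \<open>e\<close> itself removes the half-order term, so that \<open>\<mu>\<^sub>1 \<parallel>\<nabla>e\<parallel>\<close> is bounded by the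
  residuals (\<open>state_error_bound\<close>). With Friedrichs' inequality and two applications of Young's
  inequality this gives \<open>cost_le_J_major\<close>. For \<open>J_minor_le_cost\<close> both squares of the cost are
  expanded exactly around \<open>\<eta>\<close> and \<open>- \<zeta>/\<lambda>\<close>, and the mixed term of the control is rewritten by the
  state equation tested with \<open>\<zeta>\<close>. The linear terms that are left are the adjoint residuals of \<open>\<zeta>\<close>
  and \<open>\<rho>\<close> paired with \<open>y(u) - \<eta>\<close>, to which the same estimate applies.

  Stability is the one place where the half-order seminorm has to be estimated. It becomes visible
  when the equation is tested with the conjugate of \<open>w\<close> in time. Instead of constructing the
  conjugate function, one tests with finitely many conjugate harmonics, whose coefficients are time
  averages of \<open>w\<close>, and lets their number tend to infinity in the resulting inequality. These
  harmonics are admissible because time averages of functions with values in \<open>H10\<close> stay in \<open>H10\<close>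
  (\<open>time_average_H10\<close>).

  The remaining ingredients are the uniqueness of weak gradients, which makes \<open>grad\<close> linear up to
  null sets, and the identification of the half-order form with \<open>\<integral> \<sigma> \<partial>\<^sub>t\<eta> q\<close> for periodic
  \<open>\<eta>\<close> (\<open>half_form_dt\<close>). The latter combines integration by parts against trigonometric functions,
  where periodicity cancels the boundary values, with Parseval's identity in time.
\<close>

section \<open>Square-integrable functions as a semi-inner product space\<close>

lemma L2_measurable: "f \<in> L2 M \<Longrightarrow> f \<in> borel_measurable M"
  by (simp add: L2_def)

lemma L2_integrable_sq: "f \<in> L2 M \<Longrightarrow> integrable M (\<lambda>x. (norm (f x))\<^sup>2)"
  by (simp add: L2_def)

lemma L2_norm_nonneg [simp]: "0 \<le> L2_norm M f"
  by (simp add: L2_norm_def)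

lemma L2_norm_sq: "(L2_norm M f)\<^sup>2 = (\<integral>x. (norm (f x))\<^sup>2 \<partial>M)"
  by (simp add: L2_norm_def)

lemma L2_zero [simp]: "(\<lambda>x. 0) \<in> L2 M"
  by (simp add: L2_def)

lemma L2_dominated:
  fixes f :: "'a \<Rightarrow> 'b::real_normed_vector" and g :: "'a \<Rightarrow> 'c::real_normed_vector"
  assumes "g \<in> L2 M" "f \<in> borel_measurable M" "AE x in M. norm (f x) \<le> norm (g x)"
  shows "f \<in> L2 M"
proof -
  have "integrable M (\<lambda>x. (norm (f x))\<^sup>2)"
  proof (rule Bochner_Integration.integrable_bound[OF L2_integrable_sq[OF assms(1)]])
    show "AE x in M. norm ((norm (f x))\<^sup>2) \<le> norm ((norm (g x))\<^sup>2)"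
      using assms(3) by eventually_elim (simp add: power_mono)
  qed (use assms(2) in measurable)
  then show ?thesis using assms(2) by (simp add: L2_def)
qed

lemma L2_norm_cong_AE:
  assumes "AE x in M. f x = g x" "f \<in> borel_measurable M" "g \<in> borel_measurable M"
  shows "L2_norm M f = L2_norm M g"
proof -
  have "(\<integral>x. (norm (f x))\<^sup>2 \<partial>M) = (\<integral>x. (norm (g x))\<^sup>2 \<partial>M)"
    using assms by (intro integral_cong_AE) (measurable, auto)
  then show ?thesis by (simp add: L2_norm_def)
qed

lemma L2_scaleR:
  fixes f :: "'a \<Rightarrow> 'b::euclidean_space"
  assumes "f \<in> L2 M" shows "(\<lambda>x. c *\<^sub>R f x) \<in> L2 M"
  using assms by (auto simp: L2_def power_mult_distrib)

lemma L2_norm_scaleR: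
  fixes f :: "'a \<Rightarrow> 'b::euclidean_space"
  shows "L2_norm M (\<lambda>x. c *\<^sub>R f x) = \<bar>c\<bar> * L2_norm M f"
  by (simp add: L2_norm_def power_mult_distrib real_sqrt_mult)

lemma L2_add:
  fixes f g :: "'a \<Rightarrow> 'b::euclidean_space"
  assumes "f \<in> L2 M" "g \<in> L2 M" shows "(\<lambda>x. f x + g x) \<in> L2 M"
proof -
  have m: "(\<lambda>x. f x + g x) \<in> borel_measurable M"
    using assms by (auto dest!: L2_measurable)
  have "integrable M (\<lambda>x. 2 * (norm (f x))\<^sup>2 + 2 * (norm (g x))\<^sup>2)"
    using assms by (auto simp: L2_def)
  moreover have "norm ((norm (f x + g x))\<^sup>2) \<le> norm (2 * (norm (f x))\<^sup>2 + 2 * (norm (g x))\<^sup>2)" for x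
  proof -
    have "(norm (f x + g x))\<^sup>2 \<le> (norm (f x) + norm (g x))\<^sup>2"
      by (simp add: norm_triangle_ineq power_mono)
    also have "\<dots> \<le> 2 * (norm (f x))\<^sup>2 + 2 * (norm (g x))\<^sup>2"
      using sum_squares_bound[of "norm (f x)" "norm (g x)"] by (simp add: power2_sum)
    finally show ?thesis by simp
  qed
  ultimately have "integrable M (\<lambda>x. (norm (f x + g x))\<^sup>2)"
    using m by (elim Bochner_Integration.integrable_bound) auto
  then show ?thesis using m by (simp add: L2_def)
qed

lemma L2_diff:
  fixes f g :: "'a \<Rightarrow> 'b::euclidean_space"
  assumes "f \<in> L2 M" "g \<in> L2 M" shows "(\<lambda>x. f x - g x) \<in> L2 M"
  using L2_add[OF assms(1) L2_scaleR[OF assms(2), of "-1"]] by simp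

lemma L2_minus:
  fixes f :: "'a \<Rightarrow> 'b::euclidean_space"
  assumes "f \<in> L2 M" shows "(\<lambda>x. - f x) \<in> L2 M"
  using L2_scaleR[OF assms, of "-1"] by simp

lemma L2_cmult:
  fixes f :: "'a \<Rightarrow> real"
  assumes "f \<in> L2 M" shows "(\<lambda>x. c * f x) \<in> L2 M"
  using L2_scaleR[OF assms, of c] by simp

lemma L2_sum:
  fixes f :: "'i \<Rightarrow> 'a \<Rightarrow> 'b::euclidean_space"
  assumes "\<And>i. i \<in> I \<Longrightarrow> f i \<in> L2 M" shows "(\<lambda>x. \<Sum>i\<in>I. f i x) \<in> L2 M"
  using assms by (induction I rule: infinite_finite_induct) (auto intro: L2_add)

lemma L2_bounded_mult:
  fixes f :: "'a \<Rightarrow> 'b::euclidean_space"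
  assumes "f \<in> L2 M" "a \<in> borel_measurable M" "\<And>x. x \<in> space M \<Longrightarrow> \<bar>a x\<bar> \<le> C"
  shows "(\<lambda>x. a x *\<^sub>R f x) \<in> L2 M"
proof (rule L2_dominated[OF L2_scaleR[OF assms(1), of C]])
  show "(\<lambda>x. a x *\<^sub>R f x) \<in> borel_measurable M"
    using assms(1,2) by (auto dest!: L2_measurable)
  show "AE x in M. norm (a x *\<^sub>R f x) \<le> norm (C *\<^sub>R f x)"
    using assms(3) by (intro AE_I2) (force intro!: mult_right_mono)
qed

lemma L2_component:
  fixes f :: "'a \<Rightarrow> 'b::euclidean_space"
  assumes "f \<in> L2 M" shows "(\<lambda>x. f x \<bullet> b) \<in> L2 M"
proof (rule L2_dominated[OF L2_scaleR[OF assms, of "norm b"]])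
  show "(\<lambda>x. f x \<bullet> b) \<in> borel_measurable M"
    using assms by (auto dest!: L2_measurable)
  show "AE x in M. norm (f x \<bullet> b) \<le> norm (norm b *\<^sub>R f x)"
    using Cauchy_Schwarz_ineq2[of "f _" b] by (auto simp: mult.commute)
qed

lemma L2_vector:
  fixes f :: "'a \<Rightarrow> 'b::euclidean_space"
  assumes "\<And>b. b \<in> Basis \<Longrightarrow> (\<lambda>x. f x \<bullet> b) \<in> L2 M" shows "f \<in> L2 M"
proof -
  have "(\<lambda>x. \<Sum>b\<in>Basis. (f x \<bullet> b) *\<^sub>R b) \<in> L2 M"
  proof (rule L2_sum)
    fix b :: 'b assume b: "b \<in> Basis"
    have "(\<lambda>x. (f x \<bullet> b) *\<^sub>R b) \<in> borel_measurable M"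
      using L2_measurable[OF assms[OF b]] by measurable
    then show "(\<lambda>x. (f x \<bullet> b) *\<^sub>R b) \<in> L2 M"
      using b by (intro L2_dominated[OF assms[OF b]]) auto
  qed
  then show ?thesis by (simp add: euclidean_representation)
qed

lemma L2_integrable_inner:
  fixes f g :: "'a \<Rightarrow> 'b::euclidean_space"
  assumes "f \<in> L2 M" "g \<in> L2 M" shows "integrable M (\<lambda>x. f x \<bullet> g x)"
proof -
  have "integrable M (\<lambda>x. (norm (f x))\<^sup>2 + (norm (g x))\<^sup>2)"
    using assms by (auto simp: L2_def)
  moreover have "norm (f x \<bullet> g x) \<le> norm ((norm (f x))\<^sup>2 + (norm (g x))\<^sup>2)" for x
  proof -
    have "\<bar>f x \<bullet> g x\<bar> \<le> norm (f x) * norm (g x)" by (rule Cauchy_Schwarz_ineq2)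
    also have "\<dots> \<le> (norm (f x))\<^sup>2 + (norm (g x))\<^sup>2"
      using sum_squares_bound[of "norm (f x)" "norm (g x)"]
        mult_nonneg_nonneg[OF norm_ge_zero[of "f x"] norm_ge_zero[of "g x"]] by linarith
    finally show ?thesis by simp
  qed
  moreover have "(\<lambda>x. f x \<bullet> g x) \<in> borel_measurable M"
    using assms by (auto dest!: L2_measurable)
  ultimately show ?thesis by (elim Bochner_Integration.integrable_bound) auto
qed

lemma L2_integrable_mult:
  fixes f g :: "'a \<Rightarrow> real"
  assumes "f \<in> L2 M" "g \<in> L2 M" shows "integrable M (\<lambda>x. f x * g x)"
  using L2_integrable_inner[OF assms] by simp

lemma L2_norm_sq_inner:
  fixes f :: "'a \<Rightarrow> 'b::euclidean_space"
  shows "(L2_norm M f)\<^sup>2 = (\<integral>x. f x \<bullet> f x \<partial>M)"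
  by (simp add: L2_norm_sq power2_norm_eq_inner)

lemma L2_norm_sq_add:
  fixes f g :: "'a \<Rightarrow> 'b::euclidean_space"
  assumes "f \<in> L2 M" "g \<in> L2 M"
  shows "(L2_norm M (\<lambda>x. f x + c *\<^sub>R g x))\<^sup>2
    = (L2_norm M f)\<^sup>2 + 2 * c * (\<integral>x. f x \<bullet> g x \<partial>M) + c\<^sup>2 * (L2_norm M g)\<^sup>2"
proof -
  have i: "integrable M (\<lambda>x. f x \<bullet> f x)" "integrable M (\<lambda>x. f x \<bullet> g x)" "integrable M (\<lambda>x. g x \<bullet> g
      x)"
    using assms by (auto intro: L2_integrable_inner)
  have "(\<integral>x. (f x + c *\<^sub>R g x) \<bullet> (f x + c *\<^sub>R g x) \<partial>M)
      = (\<integral>x. f x \<bullet> f x + (2 * c) * (f x \<bullet> g x) + c\<^sup>2 * (g x \<bullet> g x) \<partial>M)"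
    by (intro Bochner_Integration.integral_cong)
       (auto simp: inner_add_left inner_add_right inner_commute power2_eq_square algebra_simps)
  also have "\<dots> = (\<integral>x. f x \<bullet> f x \<partial>M) + (2 * c) * (\<integral>x. f x \<bullet> g x \<partial>M) + c\<^sup>2 * (\<integral>x. g x \<bullet> g x \<partial>M)"
    using i by simp
  finally show ?thesis by (simp add: L2_norm_sq_inner)
qed

lemma L2_norm_eq_0_AE:
  fixes f :: "'a \<Rightarrow> 'b::euclidean_space"
  assumes "f \<in> L2 M" "L2_norm M f = 0" shows "AE x in M. f x = 0"
proof -
  have "(\<integral>x. (norm (f x))\<^sup>2 \<partial>M) = 0"
    using assms(2) L2_norm_sq[of M f] by simp
  then have "AE x in M. (norm (f x))\<^sup>2 = 0"
    using L2_integrable_sq[OF assms(1)] by (subst (asm) integral_nonneg_eq_0_iff_AE) auto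
  then show ?thesis by eventually_elim simp
qed

lemma L2_Cauchy_Schwarz:
  fixes f g :: "'a \<Rightarrow> 'b::euclidean_space"
  assumes "f \<in> L2 M" "g \<in> L2 M"
  shows "\<bar>\<integral>x. f x \<bullet> g x \<partial>M\<bar> \<le> L2_norm M f * L2_norm M g"
proof (cases "L2_norm M g = 0")
  case True
  have "(\<integral>x. f x \<bullet> g x \<partial>M) = (\<integral>x. 0 \<partial>M)"
    using L2_norm_eq_0_AE[OF assms(2) True] assms
    by (intro integral_cong_AE) (auto dest!: L2_measurable)
  then show ?thesis using True by simp
next
  case False
  define I where "I = (\<integral>x. f x \<bullet> g x \<partial>M)"
  define N where "N = (L2_norm M g)\<^sup>2"
  have N: "N > 0" using False by (simp add: N_def)
  have "0 \<le> (L2_norm M f)\<^sup>2 + 2 * (- (I / N)) * I + (- (I / N))\<^sup>2 * N"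
    using L2_norm_sq_add[OF assms, of "- (I / N)"] unfolding I_def N_def
    by (metis zero_le_power2)
  then have "0 \<le> (L2_norm M f)\<^sup>2 - I\<^sup>2 / N"
    using N by (simp add: power2_eq_square field_simps)
  then have "I\<^sup>2 \<le> (L2_norm M f)\<^sup>2 * N"
    using N by (simp add: field_simps)
  then have "\<bar>I\<bar>\<^sup>2 \<le> (L2_norm M f * L2_norm M g)\<^sup>2"
    by (simp add: N_def power_mult_distrib)
  then show ?thesis unfolding I_def by (rule power2_le_imp_le) simp
qed

lemma L2_norm_triangle:
  fixes f g :: "'a \<Rightarrow> 'b::euclidean_space"
  assumes "f \<in> L2 M" "g \<in> L2 M"
  shows "L2_norm M (\<lambda>x. f x + g x) \<le> L2_norm M f + L2_norm M g"
proof (rule power2_le_imp_le)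
  have "(L2_norm M (\<lambda>x. f x + g x))\<^sup>2
      = (L2_norm M f)\<^sup>2 + 2 * (\<integral>x. f x \<bullet> g x \<partial>M) + (L2_norm M g)\<^sup>2"
    using L2_norm_sq_add[OF assms, of 1] by simp
  then show "(L2_norm M (\<lambda>x. f x + g x))\<^sup>2 \<le> (L2_norm M f + L2_norm M g)\<^sup>2"
    using L2_Cauchy_Schwarz[OF assms] by (simp add: power2_sum)
qed simp

lemma L2_norm_minus:
  fixes f :: "'a \<Rightarrow> 'b::euclidean_space"
  shows "L2_norm M (\<lambda>x. - f x) = L2_norm M f"
  by (simp add: L2_norm_def)

lemma L2_norm_triangle_diff:
  fixes f g :: "'a \<Rightarrow> 'b::euclidean_space"
  assumes "f \<in> L2 M" "g \<in> L2 M"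
  shows "L2_norm M (\<lambda>x. f x - g x) \<le> L2_norm M f + L2_norm M g"
  using L2_norm_triangle[OF assms(1) L2_minus[OF assms(2)]] by (simp add: L2_norm_minus)

lemma L2_norm_dominated:
  fixes f :: "'a \<Rightarrow> 'b::real_normed_vector" and g :: "'a \<Rightarrow> 'c::real_normed_vector"
  assumes "g \<in> L2 M" "f \<in> borel_measurable M" "AE x in M. norm (f x) \<le> norm (g x)"
  shows "L2_norm M f \<le> L2_norm M g"
  unfolding L2_norm_def
proof (rule real_sqrt_le_mono, rule integral_mono_AE)
  show "integrable M (\<lambda>x. (norm (f x))\<^sup>2)" using L2_dominated[OF assms] by (simp add: L2_def)
  show "integrable M (\<lambda>x. (norm (g x))\<^sup>2)" using assms(1) by (simp add: L2_def)
  show "AE x in M. (norm (f x))\<^sup>2 \<le> (norm (g x))\<^sup>2"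
    using assms(3) by eventually_elim (simp add: power_mono)
qed

lemma L2_norm_sq_components:
  fixes f :: "'a \<Rightarrow> 'b::euclidean_space"
  assumes "f \<in> L2 M"
  shows "(L2_norm M f)\<^sup>2 = (\<Sum>b\<in>Basis. (L2_norm M (\<lambda>x. f x \<bullet> b))\<^sup>2)"
proof -
  have "(\<integral>x. (norm (f x))\<^sup>2 \<partial>M) = (\<integral>x. (\<Sum>b\<in>Basis. (norm (f x \<bullet> b))\<^sup>2) \<partial>M)"
    by (simp add: norm_eq_sqrt_inner euclidean_inner[of "f _" "f _"] power2_eq_square sum_nonneg)
  also have "\<dots> = (\<Sum>b\<in>Basis. \<integral>x. (norm (f x \<bullet> b))\<^sup>2 \<partial>M)"
    using L2_integrable_sq[OF L2_component[OF assms]]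
        by (intro Bochner_Integration.integral_sum) auto
  finally show ?thesis by (simp add: L2_norm_sq)
qed

lemma (in finite_measure) bounded_L2:
  assumes "f \<in> borel_measurable M" "\<And>x. x \<in> space M \<Longrightarrow> norm (f x) \<le> C"
  shows "f \<in> L2 M"
proof (rule L2_dominated[where g = "\<lambda>_. C"])
  show "(\<lambda>_. C) \<in> L2 M" by (simp add: L2_def)
  show "AE x in M. norm (f x) \<le> norm C"
    using assms(2) by (intro AE_I2) force
qed (rule assms(1))

lemma (in finite_measure) L2_integrable:
  fixes f :: "'a \<Rightarrow> 'b::euclidean_space"
  assumes "f \<in> L2 M" shows "integrable M f"
proof (rule Bochner_Integration.integrable_bound)
  show "integrable M (\<lambda>x. 1 + (norm (f x))\<^sup>2)"
    using L2_integrable_sq[OF assms] by simp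
  show "AE x in M. norm (f x) \<le> norm (1 + (norm (f x))\<^sup>2)"
  proof (rule AE_I2)
    fix x
    have "norm (f x) \<le> 1 + (norm (f x))\<^sup>2"
      using sum_squares_bound[of "norm (f x)" 1] norm_ge_zero[of "f x"]
      unfolding power2_eq_square by linarith
    then show "norm (f x) \<le> norm (1 + (norm (f x))\<^sup>2)" by simp
  qed
qed (rule L2_measurable[OF assms])

lemma L2_dominated_convergence:
  fixes f :: "'a \<Rightarrow> real" and s :: "nat \<Rightarrow> 'a \<Rightarrow> real"
  assumes G: "G \<in> L2 M" and s: "\<And>n. s n \<in> borel_measurable M" and f: "f \<in> borel_measurable M"
    and bound: "\<And>n. AE x in M. \<bar>s n x\<bar> \<le> G x" and lim: "AE x in M. (\<lambda>n. s n x) \<longlonglongrightarrow> f x"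
  shows "f \<in> L2 M" "\<And>n. s n \<in> L2 M" "(\<lambda>n. L2_norm M (\<lambda>x. s n x - f x)) \<longlonglongrightarrow> 0"
proof -
  show sL: "s n \<in> L2 M" for n
    by (rule L2_dominated[OF G s]) (use bound[of n] in eventually_elim, auto)
  have bound': "AE x in M. \<forall>n. \<bar>s n x\<bar> \<le> G x"
    using bound by (simp add: AE_all_countable)
  have fG: "AE x in M. \<bar>f x\<bar> \<le> G x"
    using lim bound'
  proof eventually_elim
    case (elim x)
    from tendsto_rabs[OF elim(1)] show ?case
      by (rule LIMSEQ_le_const2) (use elim(2) in auto)
  qed
  show fL: "f \<in> L2 M"
    by (rule L2_dominated[OF G f]) (use fG in eventually_elim, auto)
  have "(\<lambda>n. \<integral>x. (s n x - f x)\<^sup>2 \<partial>M) \<longlonglongrightarrow> (\<integral>x. 0 \<partial>M)"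
  proof (rule integral_dominated_convergence[where w = "\<lambda>x. (2 * G x)\<^sup>2"])
    show "(\<lambda>x. 0) \<in> borel_measurable M" by simp
    show "\<And>i. (\<lambda>x. (s i x - f x)\<^sup>2) \<in> borel_measurable M" using s f by measurable
    show "integrable M (\<lambda>x. (2 * G x)\<^sup>2)"
      using L2_integrable_sq[OF L2_cmult[OF G, of 2]] by simp
    show "AE x in M. (\<lambda>i. (s i x - f x)\<^sup>2) \<longlonglongrightarrow> 0"
      using lim
    proof eventually_elim
      case (elim x)
      then have "(\<lambda>i. (s i x - f x)\<^sup>2) \<longlonglongrightarrow> (f x - f x)\<^sup>2" by (intro tendsto_intros)
      then show ?case by simp
    qed
    show "AE x in M. norm ((s i x - f x)\<^sup>2) \<le> (2 * G x)\<^sup>2" for i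
      using bound[of i] fG
    proof eventually_elim
      case (elim x)
      then have "\<bar>s i x - f x\<bar> \<le> \<bar>2 * G x\<bar>" by linarith
      then have "\<bar>s i x - f x\<bar>\<^sup>2 \<le> \<bar>2 * G x\<bar>\<^sup>2" by (rule power_mono) simp
      then show ?case by simp
    qed
  qed
  then have "(\<lambda>n. sqrt (\<integral>x. (s n x - f x)\<^sup>2 \<partial>M)) \<longlonglongrightarrow> sqrt 0"
    by (intro tendsto_real_sqrt) simp
  then show "(\<lambda>n. L2_norm M (\<lambda>x. s n x - f x)) \<longlonglongrightarrow> 0"
    by (simp add: L2_norm_def)
qed

lemma L2_inner_tendsto:
  fixes f g :: "'a \<Rightarrow> 'b::euclidean_space"
  assumes "\<And>n. s n \<in> L2 M" "f \<in> L2 M" "g \<in> L2 M"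
    and lim: "(\<lambda>n. L2_norm M (\<lambda>x. f x - s n x)) \<longlonglongrightarrow> 0"
  shows "(\<lambda>n. \<integral>x. s n x \<bullet> g x \<partial>M) \<longlonglongrightarrow> (\<integral>x. f x \<bullet> g x \<partial>M)"
proof (rule Lim_transform2[OF tendsto_const])
  show "(\<lambda>n. (\<integral>x. f x \<bullet> g x \<partial>M) - (\<integral>x. s n x \<bullet> g x \<partial>M)) \<longlonglongrightarrow> 0"
  proof (rule tendsto_rabs_zero_cancel, rule tendsto_sandwich[where f = "\<lambda>_. 0"])
    show "(\<lambda>n. L2_norm M (\<lambda>x. f x - s n x) * L2_norm M g) \<longlonglongrightarrow> 0"
      using tendsto_mult_right[OF lim, of "L2_norm M g"] by simp
    have "\<bar>(\<integral>x. f x \<bullet> g x \<partial>M) - (\<integral>x. s n x \<bullet> g x \<partial>M)\<bar>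
        \<le> L2_norm M (\<lambda>x. f x - s n x) * L2_norm M g" for n
      using L2_Cauchy_Schwarz[OF L2_diff[OF assms(2) assms(1)[of n]] assms(3)] assms(1)[of n]
          assms(2,3)
      by (simp add: inner_diff_left L2_integrable_inner)
    then show "\<forall>\<^sub>F n in sequentially. \<bar>(\<integral>x. f x \<bullet> g x \<partial>M) - (\<integral>x. s n x \<bullet> g x \<partial>M)\<bar>
        \<le> L2_norm M (\<lambda>x. f x - s n x) * L2_norm M g" by simp
  qed simp_all
qed

section \<open>Fubini's theorem for Lebesgue measure on a product of domains\<close>

lemma AE_lebesgue_on_iff:
  fixes S :: "'a::euclidean_space set"
  assumes "S \<in> sets borel"
  shows "(AE x in lebesgue_on S. P x) \<longleftrightarrow> (AE x in lborel. x \<in> S \<longrightarrow> P x)"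
  using assms by (subst AE_restrict_space_iff) (auto simp: AE_completion_iff)

lemma measurable_lebesgue_on_AE:
  fixes f g :: "'a::euclidean_space \<Rightarrow> 'b::euclidean_space"
  assumes S: "S \<in> sets borel" and f: "f \<in> borel_measurable (lebesgue_on S)"
    and ae: "AE x in lebesgue_on S. f x = g x"
  shows "g \<in> borel_measurable (lebesgue_on S)"
proof -
  have "(\<lambda>x. indicator S x *\<^sub>R f x) \<in> borel_measurable lebesgue"
    using S f by (subst (asm) borel_measurable_restrict_space_iff) auto
  then have "(\<lambda>x. indicator S x *\<^sub>R g x) \<in> borel_measurable lebesgue"
  proof (rule borel_measurable_AE)
    show "AE x in lebesgue. indicator S x *\<^sub>R f x = indicator S x *\<^sub>R g x"
      using ae S by (subst (asm) AE_restrict_space_iff) (auto elim!: eventually_mono simp: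
          indicator_def)
  qed
  then show ?thesis
    using S by (subst borel_measurable_restrict_space_iff) auto
qed

text \<open>The product theorems are available for the Borel measure \<open>lborel \<Otimes>\<^sub>M lborel\<close>, while the
  cylinder carries the completed measure. Replacing a function by a Borel function that vanishes
  outside the domain transfers every statement about slices from one to the other.\<close>

lemma lebesgue_on_borel_representative:
  fixes f :: "'a::euclidean_space \<Rightarrow> real"
  assumes S: "S \<in> sets borel" and f: "f \<in> borel_measurable (lebesgue_on S)"
  obtains F where "F \<in> borel_measurable borel" "\<And>x. x \<notin> S \<Longrightarrow> F x = 0"
    "AE x in lebesgue_on S. f x = F x"
proof -
  have "(\<lambda>x. indicator S x *\<^sub>R f x) \<in> borel_measurable lebesgue"
    using S f by (subst (asm) borel_measurable_restrict_space_iff) auto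
  from completion_ex_borel_measurable_real[OF this]
  obtain F where F: "F \<in> borel_measurable borel" "AE x in lborel. indicator S x *\<^sub>R f x = F x"
    by auto
  show thesis
  proof (rule that[of "\<lambda>x. indicator S x * F x"])
    show "(\<lambda>x. indicator S x * F x) \<in> borel_measurable borel"
      using F(1) S by measurable
    show "AE x in lebesgue_on S. f x = indicator S x * F x"
      using F(2) unfolding AE_lebesgue_on_iff[OF S]
      by eventually_elim auto
  qed auto
qed

lemma
  fixes f F :: "'a::euclidean_space \<Rightarrow> real"
  assumes S: "S \<in> sets borel" and F: "F \<in> borel_measurable borel" "\<And>x. x \<notin> S \<Longrightarrow> F x = 0"
    and ae: "AE x in lebesgue_on S. f x = F x"
  shows lebesgue_on_representative_measurable: "f \<in> borel_measurable (lebesgue_on S)"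
    and lebesgue_on_representative_integrable: "integrable (lebesgue_on S) f \<longleftrightarrow> integrable lborel F"
    and lebesgue_on_representative_integral: "(\<integral>x. f x \<partial>lebesgue_on S) = (\<integral>x. F x \<partial>lborel)"
proof -
  have Fm: "F \<in> borel_measurable (lebesgue_on S)"
    using F(1) by (simp add: measurable_completion measurable_restrict_space1)
  have ae': "AE x in lebesgue_on S. F x = f x"
    using ae by eventually_elim simp
  show fm: "f \<in> borel_measurable (lebesgue_on S)"
    by (rule measurable_lebesgue_on_AE[OF S Fm ae'])
  have FF: "(\<lambda>x. indicator S x *\<^sub>R F x) = F"
    using F(2) by (auto simp: indicator_def fun_eq_iff)
  have "integrable (lebesgue_on S) f \<longleftrightarrow> integrable (lebesgue_on S) F"
    by (rule integrable_cong_AE[OF fm Fm ae])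
  also have "\<dots> \<longleftrightarrow> integrable lebesgue (\<lambda>x. indicator S x *\<^sub>R F x)"
    using S by (subst integrable_restrict_space) auto
  also have "\<dots> \<longleftrightarrow> integrable lborel F"
    unfolding FF using F(1) by (simp add: integrable_completion)
  finally show "integrable (lebesgue_on S) f \<longleftrightarrow> integrable lborel F" .
  have "(\<integral>x. f x \<partial>lebesgue_on S) = (\<integral>x. F x \<partial>lebesgue_on S)"
    by (rule integral_cong_AE[OF fm Fm ae])
  also have "\<dots> = (\<integral>x. indicator S x *\<^sub>R F x \<partial>lebesgue)"
    using S by (subst integral_restrict_space) auto
  also have "\<dots> = (\<integral>x. F x \<partial>lborel)"
    unfolding FF using F(1) by (simp add: integral_completion)
  finally show "(\<integral>x. f x \<partial>lebesgue_on S) = (\<integral>x. F x \<partial>lborel)" .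
qed

lemma AE_lborel_prod:
  fixes P :: "'a::euclidean_space \<times> 'b::euclidean_space \<Rightarrow> bool"
  assumes "AE z in lborel. P z"
  shows "AE x in lborel. AE y in lborel. P (x, y)" "AE y in lborel. AE x in lborel. P (x, y)"
proof -
  have ae: "AE z in (lborel \<Otimes>\<^sub>M lborel :: ('a \<times> 'b) measure). P z"
    unfolding lborel_prod by (rule assms)
  then show "AE x in lborel. AE y in lborel. P (x, y)"
    by (rule lborel_pair.AE_pair)
  obtain N where N0: "\<And>z. z \<in> space (lborel \<Otimes>\<^sub>M lborel) - N \<Longrightarrow> P z"
      "N \<in> null_sets (lborel \<Otimes>\<^sub>M lborel :: ('a \<times> 'b) measure)"
    using AE_E3[OF ae] by metis
  have N: "N \<in> sets (lborel \<Otimes>\<^sub>M lborel :: ('a \<times> 'b) measure)" "\<And>z. \<not> P z \<Longrightarrow> z \<in> N"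
    using N0 by (auto simp: space_pair_measure)
  have "AE z in (lborel \<Otimes>\<^sub>M lborel :: ('a \<times> 'b) measure). z \<notin> N"
    by (rule AE_not_in[OF N0(2)])
  then have "AE x in lborel. AE y in lborel. (x, y) \<notin> N"
    by (rule lborel_pair.AE_pair)
  then have "AE y in lborel. AE x in lborel. (x, y) \<notin> N"
  proof (rule lborel_pair.AE_commute[THEN iffD1, rotated])
    have eq: "{z \<in> space (lborel \<Otimes>\<^sub>M lborel :: ('a \<times> 'b) measure). (fst z, snd z) \<notin> N}
        = space (lborel \<Otimes>\<^sub>M lborel) - N" by auto
    show "{z \<in> space (lborel \<Otimes>\<^sub>M lborel :: ('a \<times> 'b) measure). (fst z, snd z) \<notin> N}
        \<in> sets (lborel \<Otimes>\<^sub>M lborel)"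
      unfolding eq by (rule sets.compl_sets[OF N(1)])
  qed
  then show "AE y in lborel. AE x in lborel. P (x, y)"
    by eventually_elim (use N(2) in \<open>auto elim!: eventually_mono\<close>)
qed

locale domain_product =
  fixes A :: "'a::euclidean_space set" and B :: "'b::euclidean_space set"
  assumes A: "A \<in> sets borel" and B: "B \<in> sets borel"
begin

lemma AB: "A \<times> B \<in> sets borel"
  using A B unfolding borel_prod[symmetric] by auto

lemma AE_fst:
  assumes "AE z in lebesgue_on (A \<times> B). P z"
  shows "AE x in lebesgue_on A. AE y in lebesgue_on B. P (x, y)"
proof -
  have "AE z in lborel. z \<in> A \<times> B \<longrightarrow> P z"
    using assms AB by (simp add: AE_lebesgue_on_iff)
  from AE_lborel_prod(1)[OF this] show ?thesis
    using A B by (auto simp: AE_lebesgue_on_iff elim!: eventually_mono)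
qed

lemma AE_snd:
  assumes "AE z in lebesgue_on (A \<times> B). P z"
  shows "AE y in lebesgue_on B. AE x in lebesgue_on A. P (x, y)"
proof -
  have "AE z in lborel. z \<in> A \<times> B \<longrightarrow> P z"
    using assms AB by (simp add: AE_lebesgue_on_iff)
  from AE_lborel_prod(2)[OF this] show ?thesis
    using A B by (auto simp: AE_lebesgue_on_iff elim!: eventually_mono)
qed

lemma
  fixes f :: "'a \<times> 'b \<Rightarrow> real"
  assumes f: "f \<in> borel_measurable (lebesgue_on (A \<times> B))"
  shows measurable_slice_fst: "AE x in lebesgue_on A. (\<lambda>y. f (x, y))
      \<in> borel_measurable (lebesgue_on B)"
    and measurable_slice_snd: "AE y in lebesgue_on B. (\<lambda>x. f (x, y))
        \<in> borel_measurable (lebesgue_on A)"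
proof -
  obtain F where F: "F \<in> borel_measurable borel" "\<And>z. z \<notin> A \<times> B \<Longrightarrow> F z = 0"
      "AE z in lebesgue_on (A \<times> B). f z = F z"
    using lebesgue_on_borel_representative[OF AB f] by blast
  have Fp [measurable]: "F \<in> borel_measurable (borel \<Otimes>\<^sub>M borel)" using F(1)
      by (simp add: borel_prod)
  have s1: "(\<lambda>y. F (x, y)) \<in> borel_measurable borel" for x by measurable
  have s2: "(\<lambda>x. F (x, y)) \<in> borel_measurable borel" for y by measurable
  show "AE x in lebesgue_on A. (\<lambda>y. f (x, y)) \<in> borel_measurable (lebesgue_on B)"
    using AE_fst[OF F(3)]
    by eventually_elim (rule lebesgue_on_representative_measurable[OF B s1], use F(2) in auto)
  show "AE y in lebesgue_on B. (\<lambda>x. f (x, y)) \<in> borel_measurable (lebesgue_on A)"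
    using AE_snd[OF F(3)]
    by eventually_elim (rule lebesgue_on_representative_measurable[OF A s2], use F(2) in auto)
qed

lemma
  fixes f :: "'a \<times> 'b \<Rightarrow> real"
  assumes f: "integrable (lebesgue_on (A \<times> B)) f"
  shows AE_integrable_slice_fst: "AE x in lebesgue_on A. integrable (lebesgue_on B) (\<lambda>y. f (x, y))"
    and integrable_slices_fst: "integrable (lebesgue_on A) (\<lambda>x. \<integral>y. f (x, y) \<partial>lebesgue_on B)"
    and integral_slices_fst: "(\<integral>x. (\<integral>y. f (x, y) \<partial>lebesgue_on B) \<partial>lebesgue_on A)
        = (\<integral>z. f z \<partial>lebesgue_on (A \<times> B))"
    and AE_integrable_slice_snd: "AE y in lebesgue_on B. integrable (lebesgue_on A) (\<lambda>x. f (x, y))"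
    and integrable_slices_snd: "integrable (lebesgue_on B) (\<lambda>y. \<integral>x. f (x, y) \<partial>lebesgue_on A)"
    and integral_slices_snd: "(\<integral>y. (\<integral>x. f (x, y) \<partial>lebesgue_on A) \<partial>lebesgue_on B)
        = (\<integral>z. f z \<partial>lebesgue_on (A \<times> B))"
proof -
  have fm: "f \<in> borel_measurable (lebesgue_on (A \<times> B))" using f by auto
  obtain F where F: "F \<in> borel_measurable borel" "\<And>z. z \<notin> A \<times> B \<Longrightarrow> F z = 0"
      "AE z in lebesgue_on (A \<times> B). f z = F z"
    using lebesgue_on_borel_representative[OF AB fm] by blast
  have Fp [measurable]: "F \<in> borel_measurable (borel \<Otimes>\<^sub>M borel)" using F(1)
      by (simp add: borel_prod)
  have s1: "(\<lambda>y. F (x, y)) \<in> borel_measurable borel" for x by measurable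
  have s2: "(\<lambda>x. F (x, y)) \<in> borel_measurable borel" for y by measurable
  have Fi: "integrable (lborel \<Otimes>\<^sub>M lborel) F"
    using f lebesgue_on_representative_integrable[OF AB F] by (simp add: lborel_prod)
  have Fi': "integrable (lborel \<Otimes>\<^sub>M lborel) (\<lambda>(x, y). F (x, y))"
    using Fi by simp
  note r1 = lebesgue_on_representative_integrable[OF B s1] lebesgue_on_representative_integral[OF
      B s1]
  note r2 = lebesgue_on_representative_integrable[OF A s2] lebesgue_on_representative_integral[OF
      A s2]
  have e1: "AE x in lebesgue_on A. (integrable (lebesgue_on B) (\<lambda>y. f (x, y))
      \<longleftrightarrow> integrable lborel (\<lambda>y. F (x, y)))
      \<and> (\<integral>y. f (x, y) \<partial>lebesgue_on B) = (\<integral>y. F (x, y) \<partial>lborel)"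
    using AE_fst[OF F(3)] by eventually_elim (rule conjI; rule r1; use F(2) in auto)
  have e2: "AE y in lebesgue_on B. (integrable (lebesgue_on A) (\<lambda>x. f (x, y))
      \<longleftrightarrow> integrable lborel (\<lambda>x. F (x, y)))
      \<and> (\<integral>x. f (x, y) \<partial>lebesgue_on A) = (\<integral>x. F (x, y) \<partial>lborel)"
    using AE_snd[OF F(3)] by eventually_elim (rule conjI; rule r2; use F(2) in auto)
  have m1: "(\<lambda>x. \<integral>y. F (x, y) \<partial>lborel) \<in> borel_measurable borel" 
    using lborel_pair.integrable_fst[OF Fi'] by auto
  have m2: "(\<lambda>y. \<integral>x. F (x, y) \<partial>lborel) \<in> borel_measurable borel"
    using lborel_pair.integrable_snd[OF Fi'] by auto
  have z1: "(\<integral>y. F (x, y) \<partial>lborel) = 0" if "x \<notin> A" for x using that F(2) by simp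
  have z2: "(\<integral>x. F (x, y) \<partial>lborel) = 0" if "y \<notin> B" for y using that F(2) by simp
  have c1: "AE x in lebesgue_on A. (\<integral>y. f (x, y) \<partial>lebesgue_on B) = (\<integral>y. F (x, y) \<partial>lborel)"
    using e1 by eventually_elim simp
  have c2: "AE y in lebesgue_on B. (\<integral>x. f (x, y) \<partial>lebesgue_on A) = (\<integral>x. F (x, y) \<partial>lborel)"
    using e2 by eventually_elim simp
  have "AE x in lborel. x \<in> A \<longrightarrow> integrable lborel (\<lambda>y. F (x, y))"
    using lborel_pair.AE_integrable_fst[OF Fi'] by eventually_elim simp
  then show "AE x in lebesgue_on A. integrable (lebesgue_on B) (\<lambda>y. f (x, y))"
    using e1 unfolding AE_lebesgue_on_iff[OF A] by eventually_elim simp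
  have "AE y in lborel. y \<in> B \<longrightarrow> integrable lborel (\<lambda>x. F (x, y))"
    using lborel_pair.AE_integrable_snd[OF Fi'] by eventually_elim simp
  then show "AE y in lebesgue_on B. integrable (lebesgue_on A) (\<lambda>x. f (x, y))"
    using e2 unfolding AE_lebesgue_on_iff[OF B] by eventually_elim simp
  show "integrable (lebesgue_on A) (\<lambda>x. \<integral>y. f (x, y) \<partial>lebesgue_on B)"
    using lebesgue_on_representative_integrable[OF A m1 z1 c1] lborel_pair.integrable_fst[OF Fi']
        by simp
  show "integrable (lebesgue_on B) (\<lambda>y. \<integral>x. f (x, y) \<partial>lebesgue_on A)"
    using lebesgue_on_representative_integrable[OF B m2 z2 c2] lborel_pair.integrable_snd[OF Fi']
        by simp
  have I: "(\<integral>z. f z \<partial>lebesgue_on (A \<times> B)) = integral\<^sup>L (lborel \<Otimes>\<^sub>M lborel) F"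
    using lebesgue_on_representative_integral[OF AB F] by (simp add: lborel_prod)
  show "(\<integral>x. (\<integral>y. f (x, y) \<partial>lebesgue_on B) \<partial>lebesgue_on A) = (\<integral>z. f z \<partial>lebesgue_on (A \<times> B))"
    using lebesgue_on_representative_integral[OF A m1 z1 c1] lborel_pair.integral_fst[OF Fi'] I
        by simp
  show "(\<integral>y. (\<integral>x. f (x, y) \<partial>lebesgue_on A) \<partial>lebesgue_on B) = (\<integral>z. f z \<partial>lebesgue_on (A \<times> B))"
    using lebesgue_on_representative_integral[OF B m2 z2 c2] lborel_pair.integral_snd[OF Fi'] I
        by simp
qed

lemma integrable_from_slices_fst:
  fixes f :: "'a \<times> 'b \<Rightarrow> real"
  assumes f: "f \<in> borel_measurable (lebesgue_on (A \<times> B))"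
    and i1: "AE x in lebesgue_on A. integrable (lebesgue_on B) (\<lambda>y. f (x, y))"
    and i2: "integrable (lebesgue_on A) (\<lambda>x. \<integral>y. \<bar>f (x, y)\<bar> \<partial>lebesgue_on B)"
  shows "integrable (lebesgue_on (A \<times> B)) f"
proof -
  obtain F where F: "F \<in> borel_measurable borel" "\<And>z. z \<notin> A \<times> B \<Longrightarrow> F z = 0"
      "AE z in lebesgue_on (A \<times> B). f z = F z"
    using lebesgue_on_borel_representative[OF AB f] by blast
  have Fp [measurable]: "F \<in> borel_measurable (borel \<Otimes>\<^sub>M borel)" using F(1)
      by (simp add: borel_prod)
  have s1: "(\<lambda>y. F (x, y)) \<in> borel_measurable borel" for x by measurable
  have s2: "(\<lambda>y. \<bar>F (x, y)\<bar>) \<in> borel_measurable borel" for x by measurable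
  have e1: "AE x in lebesgue_on A. integrable (lebesgue_on B) (\<lambda>y. f (x, y))
      \<longleftrightarrow> integrable lborel (\<lambda>y. F (x, y))"
    using AE_fst[OF F(3)]
    by eventually_elim (rule lebesgue_on_representative_integrable[OF B s1], use F(2) in auto)
  have e2: "AE x in lebesgue_on A. (\<integral>y. \<bar>f (x, y)\<bar> \<partial>lebesgue_on B) = (\<integral>y. \<bar>F (x, y)\<bar> \<partial>lborel)"
    using AE_fst[OF F(3)]
    by eventually_elim (rule lebesgue_on_representative_integral[OF B s2], use F(2) in auto)
  have "integrable (lborel \<Otimes>\<^sub>M lborel) F"
  proof (rule lborel_pair.Fubini_integrable)
    show "F \<in> borel_measurable (lborel \<Otimes>\<^sub>M lborel)"
      using F(1) by (simp add: lborel_prod)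
    have "(\<lambda>x. \<integral>y. \<bar>F (x, y)\<bar> \<partial>lborel) \<in> borel_measurable lborel" by measurable
    then show "integrable lborel (\<lambda>x. \<integral>y. norm (F (x, y)) \<partial>lborel)"
      using lebesgue_on_representative_integrable[OF A _ _ e2] i2 F(2) by simp
    show "AE x in lborel. integrable lborel (\<lambda>y. F (x, y))"
      using e1 i1 unfolding AE_lebesgue_on_iff[OF A]
    proof eventually_elim
      case (elim x)
      then show ?case by (cases "x \<in> A") (auto simp: F(2))
    qed
  qed
  then show ?thesis
    using lebesgue_on_representative_integrable[OF AB F] by (simp add: lborel_prod)
qed

lemma measurable_lift_fst:
  fixes a :: "'a \<Rightarrow> real"
  assumes a: "a \<in> borel_measurable (lebesgue_on A)"
  shows "(\<lambda>z. a (fst z)) \<in> borel_measurable (lebesgue_on (A \<times> B))"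
proof -
  obtain F where F: "F \<in> borel_measurable borel" "\<And>z. z \<notin> A \<Longrightarrow> F z = 0"
      "AE z in lebesgue_on A. a z = F z"
    using lebesgue_on_borel_representative[OF A a] by blast
  have [measurable]: "F \<in> borel_measurable borel" by fact
  have "(\<lambda>z. F (fst z)) \<in> borel_measurable (borel \<Otimes>\<^sub>M borel :: ('a \<times> 'b) measure)" by measurable
  then have m: "(\<lambda>z. F (fst z)) \<in> borel_measurable (borel :: ('a \<times> 'b) measure)"
    by (simp add: borel_prod)
  obtain N where N0: "\<And>x. x \<in> space lborel - N \<Longrightarrow> x \<in> A \<longrightarrow> a x = F x" "N \<in> null_sets lborel"
    using AE_E3[OF F(3)[unfolded AE_lebesgue_on_iff[OF A]]] by metis
  have "AE z in (lborel \<Otimes>\<^sub>M lborel :: ('a \<times> 'b) measure). fst z \<notin> N"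
  proof (rule lborel_pair.AE_pair_measure)
    have [measurable]: "N \<in> sets borel" using N0 by auto
    show "{z \<in> space (lborel \<Otimes>\<^sub>M lborel :: ('a \<times> 'b) measure). fst z \<notin> N}
        \<in> sets (lborel \<Otimes>\<^sub>M lborel)"
      by measurable
    have "AE x in lborel. x \<notin> N" by (rule AE_not_in[OF N0(2)])
    then show "AE x in lborel. AE y in (lborel :: 'b measure). fst (x, y) \<notin> N"
      by eventually_elim simp
  qed
  then have "AE z in (lborel :: ('a \<times> 'b) measure). z \<in> A \<times> B \<longrightarrow> F (fst z) = a (fst z)"
    unfolding lborel_prod by eventually_elim (use N0(1) in force)
  then have "AE z in lebesgue_on (A \<times> B). F (fst z) = a (fst z)"
    by (subst AE_lebesgue_on_iff[OF AB])
  moreover have "(\<lambda>z. F (fst z)) \<in> borel_measurable (lebesgue_on (A \<times> B))"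
    by (intro measurable_restrict_space1 measurable_completion) (use m in simp)
  ultimately show ?thesis by (rule measurable_lebesgue_on_AE[OF AB, rotated])
qed

text \<open>Measurability of both functions is essential here: it makes the set where they differ
  measurable, so that its measure can be computed from the slices.\<close>

lemma AE_from_slices_snd:
  fixes f g :: "'a \<times> 'b \<Rightarrow> real"
  assumes f: "f \<in> borel_measurable (lebesgue_on (A \<times> B))" and g: "g
      \<in> borel_measurable (lebesgue_on (A \<times> B))"
    and ae: "AE y in lebesgue_on B. AE x in lebesgue_on A. f (x, y) = g (x, y)"
  shows "AE z in lebesgue_on (A \<times> B). f z = g z"
proof -
  obtain F where F: "F \<in> borel_measurable borel" "\<And>z. z \<notin> A \<times> B \<Longrightarrow> F z = 0"
      "AE z in lebesgue_on (A \<times> B). f z - g z = F z"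
    using lebesgue_on_borel_representative[OF AB borel_measurable_diff[OF f g]] by blast
  have "AE y in lebesgue_on B. AE x in lebesgue_on A. F (x, y) = 0"
    using ae AE_snd[OF F(3)] by eventually_elim (auto elim: eventually_elim2)
  then have ae2: "AE y in lborel. AE x in lborel. F (x, y) = 0"
    unfolding AE_lebesgue_on_iff[OF B] AE_lebesgue_on_iff[OF A]
    by eventually_elim (use F(2) in \<open>auto elim!: eventually_mono\<close>)
  have Fm [measurable]: "F \<in> borel_measurable (lborel \<Otimes>\<^sub>M lborel)"
    using F(1) by (simp add: lborel_prod)
  have "AE x in lborel. AE y in lborel. F (x, y) = 0"
  proof (subst lborel_pair.AE_commute)
    show "{z \<in> space (lborel \<Otimes>\<^sub>M lborel). F (fst z, snd z) = 0} \<in> sets (lborel \<Otimes>\<^sub>M lborel)"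
      by measurable
  qed (rule ae2)
  then have "AE z in lborel \<Otimes>\<^sub>M lborel. F z = 0"
  proof (rule lborel_pair.AE_pair_measure[rotated])
    show "{z \<in> space (lborel \<Otimes>\<^sub>M lborel). F z = 0} \<in> sets (lborel \<Otimes>\<^sub>M lborel)"
      by measurable
  qed
  then have "AE z in lebesgue_on (A \<times> B). F z = 0"
    unfolding lborel_prod AE_lebesgue_on_iff[OF AB] by eventually_elim simp
  then show ?thesis using F(3) by eventually_elim simp
qed

end

section \<open>Density in \<open>L2\<close> of a box\<close>

lemma finite_measure_lebesgue_on_bounded:
  fixes S :: "'a::euclidean_space set"
  assumes "S \<in> sets borel" "bounded S" shows "finite_measure (lebesgue_on S)"
proof
  have "emeasure lborel S < \<infinity>" using assms(2) by (rule emeasure_bounded_finite)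
  moreover have "emeasure (lebesgue_on S) (space (lebesgue_on S)) = emeasure lborel S"
    using assms(1) by (simp add: emeasure_restrict_space)
  ultimately show "emeasure (lebesgue_on S) (space (lebesgue_on S)) \<noteq> \<infinity>" by simp
qed

text \<open>Since \<open>P\<close> is linear and stable under dominated limits, the Borel sets whose indicators
  satisfy \<open>P\<close> form a Dynkin system; it contains the boxes, hence everything. Null sets are
  absorbed by applying \<open>lim\<close> to a constant sequence, and monotone approximation leads from
  indicators to functions.\<close>

lemma L2_box_induct:
  fixes a b :: "'a::euclidean_space" and P :: "('a \<Rightarrow> real) \<Rightarrow> bool"
  defines "M \<equiv> lebesgue_on (box a b)"
  assumes box: "\<And>c d. box c d \<subseteq> box a b \<Longrightarrow> P (indicator (box c d))"
    and lin: "\<And>f g r. f \<in> L2 M \<Longrightarrow> g \<in> L2 M \<Longrightarrow> P f \<Longrightarrow> P g \<Longrightarrow> P (\<lambda>x. f x + r * g x)"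
    and lim: "\<And>f s G. (\<And>n::nat. s n \<in> L2 M) \<Longrightarrow> (\<And>n. P (s n)) \<Longrightarrow> f \<in> L2 M \<Longrightarrow> G \<in> L2 M \<Longrightarrow>
       (\<And>n. AE x in M. \<bar>s n x\<bar> \<le> G x) \<Longrightarrow> (AE x in M. (\<lambda>n. s n x) \<longlonglongrightarrow> f x) \<Longrightarrow> P f"
    and f: "f \<in> L2 M"
  shows "P f"
proof -
  let ?S = "box a b"
  interpret finite_measure M
    unfolding M_def by (rule finite_measure_lebesgue_on_bounded) auto
  have sp: "space M = ?S" by (simp add: M_def)
  have ind: "(indicator A :: 'a \<Rightarrow> real) \<in> L2 M" if "A \<in> sets M" for A
    using that by (intro bounded_L2[where C = 1]) (auto simp: indicator_def)
  have bsets: "A \<inter> ?S \<in> sets M" if "A \<in> sets borel" for A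
    using that by (simp add: M_def sets_restrict_space_iff)
  have cong: "P g" if "f \<in> L2 M" "P f" "g \<in> L2 M" "AE x in M. f x = g x" for f g
  proof (rule lim[where s = "\<lambda>_. f" and G = "\<lambda>x. \<bar>f x\<bar>"])
    show "(\<lambda>x. \<bar>f x\<bar>) \<in> L2 M"
      by (rule L2_dominated[OF that(1)]) (use that(1) in \<open>auto dest!: L2_measurable\<close>)
    show "AE x in M. (\<lambda>n. f x) \<longlonglongrightarrow> g x" using that(4) by eventually_elim simp
  qed (use that in auto)
  have zero: "P (\<lambda>x. 0)"
    using box[of b b] by (simp add: indicator_def[abs_def])
  have borel_ind: "P (indicator (A \<inter> ?S))" if "A \<in> sets borel" for A :: "'a set"
  proof -
    let ?G = "range (\<lambda>(c, d). box c d :: 'a set)"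
    have "Int_stable ?G" by (auto simp: Int_stable_def box_Int_box)
    moreover have "?G \<subseteq> Pow UNIV" by simp
    moreover have "A \<in> sigma_sets UNIV ?G" using that by (simp add: borel_eq_box)
    ultimately show ?thesis
    proof (induction rule: sigma_sets_induct_disjoint)
      case (basic A)
      then obtain c d where A: "A = box c d" by auto
      obtain c' d' where cd: "A \<inter> ?S = box c' d'"
        unfolding A box_Int_box by blast
      have "box c' d' \<subseteq> ?S" unfolding cd[symmetric] by (rule Int_lower2)
      then show ?case unfolding cd by (rule box)
    next
      case empty
      then show ?case using zero by (simp add: indicator_def[abs_def])
    next
      case (compl A)
      then have A: "A \<in> sets borel" by (simp add: borel_eq_box)
      have "P (\<lambda>x. indicator ?S x + (-1) * indicator (A \<inter> ?S) x)"
        by (intro lin ind bsets A box compl.IH subset_refl) (auto simp: M_def sets_restrict_space)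
      also have "(\<lambda>x. indicator ?S x + (-1) * indicator (A \<inter> ?S) x :: real)
          = indicator ((UNIV - A) \<inter> ?S)"
        by (rule ext) (simp split: split_indicator)
      finally show ?case .
    next
      case (union A)
      have A: "A i \<in> sets borel" for i using union(2) by (auto simp: borel_eq_box)
      have fin: "P (\<lambda>x. \<Sum>i<n. indicator (A i \<inter> ?S) x)" for n :: nat
      proof (induction n)
        case 0
        then show ?case using zero by simp
      next
        case (Suc n)
        have "P (\<lambda>x. (\<Sum>i<n. indicator (A i \<inter> ?S) x) + 1 * indicator (A n \<inter> ?S) x)"
          by (intro lin L2_sum ind bsets A Suc union.IH)
        then show ?case by simp
      qed
      have eq: "(\<Sum>i<n. indicator (A i \<inter> ?S) x) = (indicator ((\<Union>i<n. A i) \<inter> ?S) x :: real)" for n x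
      proof -
        have "disjoint_family_on (\<lambda>i. A i \<inter> ?S) {..<n}"
          using union(1) by (auto simp: disjoint_family_on_def)
        then have "(indicator (\<Union>i<n. A i \<inter> ?S) x :: real) = (\<Sum>i<n. indicator (A i \<inter> ?S) x)"
          by (rule indicator_UN_disjoint[rotated]) simp
        then show ?thesis by (simp add: Int_UN_distrib2)
      qed
      show ?case
      proof (rule lim[where s = "\<lambda>n x. \<Sum>i<n. indicator (A i \<inter> ?S) x" and G = "\<lambda>x. 1"])
        show "(\<lambda>x. \<Sum>i<n. indicator (A i \<inter> ?S) x :: real) \<in> L2 M" for n
          by (intro L2_sum ind bsets A)
        show "(indicator (\<Union> (range A) \<inter> ?S) :: 'a \<Rightarrow> real) \<in> L2 M"
          using A by (intro ind bsets) auto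
        show "(\<lambda>x. 1::real) \<in> L2 M" by (rule bounded_L2[where C = 1]) auto
        show "AE x in M. \<bar>\<Sum>i<n. indicator (A i \<inter> ?S) x\<bar> \<le> (1::real)" for n
          unfolding eq by (auto simp: indicator_def)
        show "AE x in M. (\<lambda>n. \<Sum>i<n. indicator (A i \<inter> ?S) x)
            \<longlonglongrightarrow> (indicator (\<Union> (range A) \<inter> ?S) x :: real)"
        proof (rule AE_I2)
          fix x
          show "(\<lambda>n. \<Sum>i<n. indicator (A i \<inter> ?S) x) \<longlonglongrightarrow> (indicator (\<Union> (range A) \<inter> ?S) x :: real)"
          proof (cases "x \<in> \<Union> (range A) \<inter> ?S")
            case True
            then obtain i where i: "x \<in> A i" by auto
            have "\<forall>\<^sub>F n in sequentially. (\<Sum>i<n. indicator (A i \<inter> ?S) x)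
                = (indicator (\<Union> (range A) \<inter> ?S) x :: real)"
              using eventually_gt_at_top[of i]
              by eventually_elim (unfold eq, use i True in \<open>auto simp: indicator_def\<close>)
            then show ?thesis by (rule tendsto_eventually)
          next
            case False
            then show ?thesis unfolding eq by (auto simp: indicator_def)
          qed
        qed
      qed (rule fin)
    qed
  qed
  have ind_P: "P (indicator A)" if A: "A \<in> sets M" for A
  proof -
    have "indicator A \<in> borel_measurable M" using A by simp
    then obtain F where F: "F \<in> borel_measurable borel" "AE x in M. indicator A x = (F x :: real)"
      unfolding M_def by (rule lebesgue_on_borel_representative[rotated]) auto
    have B: "F -` {1} \<in> sets borel" using measurable_sets[OF F(1), of "{1}"] by simp
    have "AE x in M. indicator (F -` {1} \<inter> ?S) x = (indicator A x :: real)"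
      using F(2) AE_space by eventually_elim (auto simp: sp split: split_indicator
          split_indicator_asm)
    then show ?thesis
      by (intro cong[OF ind[OF bsets[OF B]] borel_ind[OF B] ind[OF A]])
  qed
  have nonneg: "u \<in> L2 M \<longrightarrow> P u" if "u \<in> borel_measurable M" "\<And>x. 0 \<le> u x" for u
    using that
  proof (induction rule: borel_measurable_induct_real)
    case (set A)
    then show ?case using ind_P by blast
  next
    case (mult u c)
    show ?case
    proof (intro impI)
      assume cu: "(\<lambda>x. c * u x) \<in> L2 M"
      show "P (\<lambda>x. c * u x)"
      proof (cases "c = 0")
        case False
        then have u: "u \<in> L2 M" using L2_cmult[OF cu, of "inverse c"]
            by (simp add: mult.assoc[symmetric])
        then show ?thesis using lin[OF L2_zero u zero, of c] mult by simp
      qed (simp add: zero)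
    qed
  next
    case (add u v)
    show ?case
    proof (intro impI)
      assume vu: "(\<lambda>x. v x + u x) \<in> L2 M"
      have "u \<in> L2 M" "v \<in> L2 M"
        using add by (auto intro!: L2_dominated[OF vu])
      then show "P (\<lambda>x. v x + u x)"
        using lin[of v u 1] add by simp
    qed
  next
    case (seq U)
    show ?case
    proof (intro impI)
      assume u: "u \<in> L2 M"
      have le: "U i x \<le> u x" if "x \<in> space M" for i x
        by (rule incseq_le[OF _ seq.hyps(4)[OF that]])
           (use seq.hyps(3) in \<open>auto simp: incseq_def le_fun_def\<close>)
      have UL: "U i \<in> L2 M" for i
        by (rule L2_dominated[OF u])
           (use order_trans[OF le abs_ge_self] seq.hyps in \<open>auto intro!: AE_I2\<close>)
      show "P u"
        by (rule lim[where s = U and G = u])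
           (use UL seq u le in \<open>auto intro!: AE_I2\<close>)
    qed
  qed
  have fm: "f \<in> borel_measurable M" using f by (rule L2_measurable)
  have p: "(\<lambda>x. max 0 (f x)) \<in> L2 M" and n: "(\<lambda>x. max 0 (- f x)) \<in> L2 M"
    using fm by (auto intro!: L2_dominated[OF f])
  have "P (\<lambda>x. max 0 (f x) + (-1) * max 0 (- f x))"
    by (intro lin p n nonneg[rule_format]) (use fm in auto)
  also have "(\<lambda>x. max 0 (f x) + (-1) * max 0 (- f x)) = f" by (auto simp: max_def)
  finally show ?thesis .
qed

section \<open>Smooth bump functions\<close>

text \<open>These functions form a class that is closed under differentiation: away from zero, the
  derivative replaces \<open>p\<close> by the polynomial \<open>X\<^sup>2 (p - p')\<close>, and at zero the exponential beats
  every power of \<open>1 / t\<close>.\<close>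

definition flat :: "real poly \<Rightarrow> real \<Rightarrow> real" where
  "flat p t = (if t \<le> 0 then 0 else poly p (1 / t) * exp (- (1 / t)))"

lemma poly_times_exp_minus_tendsto_0:
  fixes p :: "real poly"
  shows "((\<lambda>x. poly p x * exp (- x)) \<longlongrightarrow> 0) at_top"
proof -
  have "((\<lambda>x. x ^ k * poly p x * exp (- x)) \<longlongrightarrow> 0) at_top" for k
  proof (induction p arbitrary: k)
    case 0
    then show ?case by simp
  next
    case (pCons a p)
    have "((\<lambda>x. a * (x ^ k / exp x) + x ^ Suc k * poly p x * exp (- x)) \<longlongrightarrow> a * 0 + 0) at_top"
      by (intro tendsto_intros tendsto_power_div_exp_0 pCons.IH)
    then show ?case
      by (simp add: algebra_simps exp_minus divide_inverse)
  qed
  from this[of 0] show ?thesis by simp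
qed

lemma flat_has_derivative:
  "(flat p has_real_derivative flat ([:0, 0, 1:] * (p - pderiv p)) t) (at t)"
proof -
  consider "t < 0" | "t = 0" | "t > 0" by linarith
  then show ?thesis
  proof cases
    case 1
    have "((\<lambda>_. 0) has_real_derivative 0) (at t)" by simp
    then have "(flat p has_real_derivative 0) (at t)"
      by (rule has_field_derivative_transform_within_open[where S = "{..<0}"]) (use 1
          in \<open>auto simp: flat_def\<close>)
    then show ?thesis using 1 by (simp add: flat_def)
  next
    case 2
    have r: "((\<lambda>h. flat p h / h) \<longlongrightarrow> 0) (at_right 0)"
    proof -
      have "((\<lambda>h. poly ([:0, 1:] * p) (inverse h) * exp (- inverse h)) \<longlongrightarrow> 0) (at_right 0)"
        by (rule filterlim_compose[OF poly_times_exp_minus_tendsto_0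
            filterlim_inverse_at_top_right])
      then show ?thesis
        by (rule Lim_transform_eventually)
           (auto simp: flat_def divide_inverse eventually_at_filter)
    qed
    have l: "((\<lambda>h. flat p h / h) \<longlongrightarrow> 0) (at_left 0)"
      by (rule tendsto_eventually) (auto simp: flat_def eventually_at_filter)
    have "((\<lambda>h. flat p h / h) \<longlongrightarrow> 0) (at 0)"
      using l r by (rule filterlim_split_at)
    then show ?thesis using 2 by (simp add: DERIV_def flat_def)
  next
    case 3
    have "((\<lambda>t. poly p (1 / t) * exp (- (1 / t))) has_real_derivative flat ([:0, 0, 1:] * (p -
        pderiv p)) t) (at t)"
      using 3 by (auto intro!: derivative_eq_intros simp: flat_def power2_eq_square field_simps)
    then show ?thesis
      by (rule has_field_derivative_transform_within_open[where S = "{0<..}"]) (use 3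
          in \<open>auto simp: flat_def\<close>)
  qed
qed

text \<open>Smoothness is coinductive, so it is proved by exhibiting a class of differentiable functions
  that is closed under partial derivatives. This one contains bump functions, the time cutoffs and
  the trigonometric functions, and its closure properties are syntactic.\<close>

inductive smooth_expr :: "('a::euclidean_space \<Rightarrow> real) \<Rightarrow> bool" where
  const: "smooth_expr (\<lambda>x. c)"
| inner: "smooth_expr (\<lambda>x. x \<bullet> a)"
| add: "smooth_expr f \<Longrightarrow> smooth_expr g \<Longrightarrow> smooth_expr (\<lambda>x. f x + g x)"
| mult: "smooth_expr f \<Longrightarrow> smooth_expr g \<Longrightarrow> smooth_expr (\<lambda>x. f x * g x)"
| cos: "smooth_expr f \<Longrightarrow> smooth_expr (\<lambda>x. cos (f x))"
| sin: "smooth_expr f \<Longrightarrow> smooth_expr (\<lambda>x. sin (f x))"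
| flat: "smooth_expr f \<Longrightarrow> smooth_expr (\<lambda>x. flat p (f x))"

lemma smooth_expr_derivative:
  assumes "smooth_expr f"
  shows "\<exists>D. (\<forall>x. (f has_derivative D x) (at x)) \<and> (\<forall>b. smooth_expr (\<lambda>x. D x b))"
  using assms
proof induction
  case (const c)
  have "\<forall>x. ((\<lambda>x. c) has_derivative (\<lambda>b. 0)) (at x)" by simp
  then show ?case using smooth_expr.const[of 0] by (intro exI[of _ "\<lambda>x b. 0"]) auto
next
  case (inner a)
  show ?case
    by (rule exI[of _ "\<lambda>x b. b \<bullet> a"]) (auto intro!: derivative_eq_intros smooth_expr.const)
next
  case (add f g)
  then obtain D E where "\<forall>x. (f has_derivative D x) (at x)" "\<forall>b. smooth_expr (\<lambda>x. D x b)"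
    "\<forall>x. (g has_derivative E x) (at x)" "\<forall>b. smooth_expr (\<lambda>x. E x b)" by blast
  then show ?case
    by (intro exI[of _ "\<lambda>x b. D x b + E x b"]) (auto intro!: has_derivative_add smooth_expr.add)
next
  case (mult f g)
  then obtain D E where "\<forall>x. (f has_derivative D x) (at x)" "\<forall>b. smooth_expr (\<lambda>x. D x b)"
    "\<forall>x. (g has_derivative E x) (at x)" "\<forall>b. smooth_expr (\<lambda>x. E x b)" by blast
  then show ?case using mult(1,2)
    by (intro exI[of _ "\<lambda>x b. f x * E x b + D x b * g x"])
       (auto intro!: has_derivative_mult smooth_expr.add smooth_expr.mult)
next
  case (cos f)
  then obtain D where D: "\<forall>x. (f has_derivative D x) (at x)" "\<forall>b. smooth_expr (\<lambda>x. D x b)" by blast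
  have "((\<lambda>x. cos (f x)) has_derivative (\<lambda>b. D x b * - sin (f x))) (at x)" for x
    using D(1) by (auto intro!: derivative_eq_intros)
  moreover have "smooth_expr (\<lambda>x. - sin (f x))"
    using smooth_expr.mult[OF smooth_expr.const[of "-1"] smooth_expr.sin[OF cos(1)]] by simp
  then have "smooth_expr (\<lambda>x. D x b * - sin (f x))" for b
    using D(2) smooth_expr.mult by blast
  ultimately show ?case
    by (intro exI[of _ "\<lambda>x b. D x b * - sin (f x)"] conjI allI)
next
  case (sin f)
  then obtain D where D: "\<forall>x. (f has_derivative D x) (at x)" "\<forall>b. smooth_expr (\<lambda>x. D x b)" by blast
  have "((\<lambda>x. sin (f x)) has_derivative (\<lambda>b. D x b * cos (f x))) (at x)" for x
    using D(1) by (auto intro!: derivative_eq_intros)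
  then show ?case using D(2) sin(1)
    by (intro exI[of _ "\<lambda>x b. D x b * cos (f x)"]) (auto intro!: smooth_expr.mult smooth_expr.cos)
next
  case (flat f p)
  then obtain D where D: "\<forall>x. (f has_derivative D x) (at x)" "\<forall>b. smooth_expr (\<lambda>x. D x b)" by blast
  let ?q = "[:0, 0, 1:] * (p - pderiv p)"
  have "((\<lambda>x. flat p (f x)) has_derivative (\<lambda>b. D x b * flat ?q (f x))) (at x)" for x
    using has_derivative_compose[OF D(1)[rule_format] flat_has_derivative[unfolded
        has_field_derivative_def]]
    by (simp add: mult.commute)
  then show ?case using D(2) flat(1)
    by (intro exI[of _ "\<lambda>x b. D x b * flat ?q (f x)"]) (auto intro!: smooth_expr.mult
        smooth_expr.flat)
qed

lemma smooth_expr_imp_smooth: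
  assumes "smooth_expr f" shows "smooth f"
  using assms
proof (coinduction arbitrary: f)
  case (smooth f)
  then obtain D where D: "\<forall>x. (f has_derivative D x) (at x)" "\<forall>b. smooth_expr (\<lambda>x. D x b)"
    using smooth_expr_derivative by blast
  have "frechet_derivative f (at x) = D x" for x
    using D(1) by (metis frechet_derivative_at)
  then show ?case using D by (auto simp: differentiable_def intro!: exI)
qed

lemma smoothD:
  assumes "smooth f"
  shows "f differentiable (at x)" "b \<in> Basis \<Longrightarrow> smooth (\<lambda>x. frechet_derivative f (at x) b)"
  using assms by (auto elim: smooth.cases)

text \<open>The set of all such linear combinations is itself closed under partial derivatives.\<close>

lemma smooth_lincomb:
  assumes "smooth f" "smooth g" shows "smooth (\<lambda>x. f x + c * g x)"
  using assms
proof (coinduction arbitrary: f g)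
  case (smooth f g)
  have d: "((\<lambda>x. f x + c * g x) has_derivative
      (\<lambda>b. frechet_derivative f (at x) b + c * frechet_derivative g (at x) b)) (at x)" for x
    using smooth smoothD(1) frechet_derivative_works by (auto intro!: derivative_eq_intros)
  have "frechet_derivative (\<lambda>x. f x + c * g x) (at x) b
      = frechet_derivative f (at x) b + c * frechet_derivative g (at x) b" for x b
    using frechet_derivative_at[OF d[of x]] by metis
  note eq = this
  show ?case
  proof (intro exI conjI allI ballI)
    show "(\<lambda>x. f x + c * g x) = (\<lambda>x. f x + c * g x)" ..
    show "(\<lambda>x. f x + c * g x) differentiable (at x)" for x
      using d by (auto simp: differentiable_def)
    show "(\<exists>f' g'. (\<lambda>x. frechet_derivative (\<lambda>x. f x + c * g x) (at x) b) = (\<lambda>x. f' x + c * g' x)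
        \<and> smooth f' \<and> smooth g') \<or> smooth (\<lambda>x. frechet_derivative (\<lambda>x. f x + c * g x) (at x) b)"
      if "b \<in> Basis" for b
      unfolding eq using smoothD(2)[OF smooth(1) that] smoothD(2)[OF smooth(2) that]
      by (intro disjI1 exI[of _ "\<lambda>x. frechet_derivative f (at x) b"]
          exI[of _ "\<lambda>x. frechet_derivative g (at x) b"] conjI refl)
  qed
qed

lemma gradient_lincomb:
  assumes "smooth f" "smooth g"
  shows "gradient (\<lambda>x. f x + c * g x) x = gradient f x + c *\<^sub>R gradient g x"
proof -
  have "((\<lambda>x. f x + c * g x) has_derivative
      (\<lambda>b. frechet_derivative f (at x) b + c * frechet_derivative g (at x) b)) (at x)"
    using assms smoothD(1) frechet_derivative_works by (auto intro!: derivative_eq_intros)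
  from frechet_derivative_at[OF this]
  have "frechet_derivative (\<lambda>x. f x + c * g x) (at x) b
      = frechet_derivative f (at x) b + c * frechet_derivative g (at x) b" for b by metis
  then show ?thesis
    by (simp add: gradient_def sum.distrib scaleR_add_left scaleR_sum_right)
qed

lemma test_function_lincomb:
  assumes "test_function S f" "test_function S g"
  shows "test_function S (\<lambda>x. f x + c * g x)"
proof -
  obtain K L where "compact K" "K \<subseteq> S" "\<forall>x. x \<notin> K \<longrightarrow> f x = 0" "compact L" "L \<subseteq> S" "\<forall>x. x \<notin> L \<longrightarrow> g x
      = 0"
    using assms by (auto simp: test_function_def)
  then show ?thesis
    using assms unfolding test_function_def
    by (auto intro!: smooth_lincomb exI[of _ "K \<union> L"])
qed

lemma test_function_zero: "test_function S (\<lambda>x. 0)"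
  unfolding test_function_def by (auto intro!: smooth_expr_imp_smooth smooth_expr.const exI[of _
      "{}"])

lemma test_function_mono: "test_function S f \<Longrightarrow> S \<subseteq> T \<Longrightarrow> test_function T f"
  unfolding test_function_def by blast

lemma continuous_compact_support_bounded:
  fixes f :: "'a::euclidean_space \<Rightarrow> 'b::real_normed_vector"
  assumes "continuous_on UNIV f" "compact K" "\<And>x. x \<notin> K \<Longrightarrow> f x = 0"
  obtains C where "\<And>x. norm (f x) \<le> C"
proof -
  have "compact (f ` K)"
    using assms by (auto intro: compact_continuous_image continuous_on_subset)
  then obtain C where "\<forall>y\<in>f ` K. norm y \<le> C" 
    using compact_imp_bounded bounded_iff by blast
  then have "norm (f x) \<le> max C 0" for x
    using assms(3)[of x] by (cases "x \<in> K") (auto simp: le_max_iff_disj)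
  then show thesis by (rule that)
qed

lemma smooth_continuous:
  assumes "smooth f" shows "continuous_on UNIV f"
  using smoothD(1)[OF assms]
  by (meson continuous_at_imp_continuous_on differentiable_imp_continuous_within)

lemma smooth_gradient_continuous:
  assumes "smooth f" shows "continuous_on UNIV (gradient f)"
  unfolding gradient_def[abs_def]
  by (intro continuous_on_sum continuous_on_scaleR continuous_on_const smooth_continuous
      smoothD(2)[OF assms])

lemma test_function_continuous:
  assumes "test_function S \<phi>"
  shows "continuous_on UNIV \<phi>" "continuous_on UNIV (gradient \<phi>)"
  using assms smooth_continuous smooth_gradient_continuous by (auto simp: test_function_def)

lemma test_function_support:
  assumes "test_function S \<phi>"
  obtains K where "compact K" "K \<subseteq> S" "\<And>x. x \<notin> K \<Longrightarrow> \<phi> x = 0" "\<And>x. x \<notin> K \<Longrightarrow> gradient \<phi> x = 0"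
proof -
  obtain K where K: "compact K" "K \<subseteq> S" "\<And>x. x \<notin> K \<Longrightarrow> \<phi> x = 0"
    using assms by (auto simp: test_function_def)
  have "gradient \<phi> x = 0" if "x \<notin> K" for x
  proof -
    have "((\<lambda>x. 0) has_derivative (\<lambda>_. 0)) (at x)" by simp
    then have "(\<phi> has_derivative (\<lambda>_. 0)) (at x)"
      by (rule has_derivative_transform_within_open[where s = "- K"])
         (use K that in \<open>auto intro: open_Compl compact_imp_closed\<close>)
    from frechet_derivative_at[OF this] have "frechet_derivative \<phi> (at x) = (\<lambda>_. 0)" by simp
    then show ?thesis by (simp add: gradient_def)
  qed
  with K show thesis by (intro that) auto
qed

lemma continuous_measurable_lebesgue_on:
  fixes f :: "'a::euclidean_space \<Rightarrow> 'b::euclidean_space"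
  assumes "continuous_on UNIV f" shows "f \<in> borel_measurable (lebesgue_on S)"
proof -
  have "f \<in> borel_measurable borel" using assms by (rule borel_measurable_continuous_onI)
  then show ?thesis by (simp add: measurable_completion measurable_restrict_space1)
qed

lemma test_function_bounded:
  assumes "test_function S \<phi>"
  obtains C where "\<And>x. \<bar>\<phi> x\<bar> \<le> C" "\<And>x. norm (gradient \<phi> x) \<le> C"
proof -
  obtain K where K: "compact K" "K \<subseteq> S" "\<And>x. x \<notin> K \<Longrightarrow> \<phi> x = 0" "\<And>x. x \<notin> K \<Longrightarrow> gradient \<phi> x = 0"
    using test_function_support[OF assms] by metis
  obtain C where "\<And>x. norm (\<phi> x) \<le> C"
    using continuous_compact_support_bounded[OF test_function_continuous(1)[OF assms] K(1,3)]
        by metis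
  moreover obtain D where "\<And>x. norm (gradient \<phi> x) \<le> D"
    using continuous_compact_support_bounded[OF test_function_continuous(2)[OF assms] K(1,4)]
        by metis
  ultimately show thesis
    by (intro that[of "max C D"]) (auto simp: le_max_iff_disj)
qed

lemma test_function_L2:
  fixes \<Omega> :: "'a::euclidean_space set"
  assumes "\<Omega> \<in> sets borel" "bounded \<Omega>" "test_function S \<phi>"
  shows "\<phi> \<in> L2 (lebesgue_on \<Omega>)" "gradient \<phi> \<in> L2 (lebesgue_on \<Omega>)"
proof -
  interpret finite_measure "lebesgue_on \<Omega>"
    by (rule finite_measure_lebesgue_on_bounded[OF assms(1,2)])
  obtain C where C: "\<And>x. \<bar>\<phi> x\<bar> \<le> C" "\<And>x. norm (gradient \<phi> x) \<le> C"
    using test_function_bounded[OF assms(3)] by metis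
  show "\<phi> \<in> L2 (lebesgue_on \<Omega>)" "gradient \<phi> \<in> L2 (lebesgue_on \<Omega>)"
    using C test_function_continuous[OF assms(3)]
    by (auto intro!: bounded_L2[where C = C] continuous_measurable_lebesgue_on)
qed

abbreviation smooth_ramp :: "real \<Rightarrow> real" where "smooth_ramp \<equiv> flat 1"

lemma smooth_ramp_bounds: "0 \<le> smooth_ramp t" "smooth_ramp t \<le> 1"
  by (auto simp: flat_def)

lemma smooth_ramp_tendsto_1:
  assumes "t > 0" shows "(\<lambda>n. smooth_ramp (real n * t - 1)) \<longlonglongrightarrow> 1"
proof -
  have lim: "filterlim (\<lambda>n. real n * t - 1) at_top sequentially"
    using assms by real_asymp
  have "(\<lambda>n. exp (- (1 / (real n * t - 1)))) \<longlonglongrightarrow> exp (- 0)"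
    by (intro tendsto_intros tendsto_divide_0[OF tendsto_const] filterlim_at_top_imp_at_infinity
        lim)
  moreover have "\<forall>\<^sub>F n in sequentially. exp (- (1 / (real n * t - 1)))
      = smooth_ramp (real n * t - 1)"
    using lim[unfolded filterlim_at_top_dense, rule_format, of 0]
    by eventually_elim (simp add: flat_def)
  ultimately show ?thesis by (simp add: Lim_transform_eventually)
qed

text \<open>The shift by one keeps each factor zero up to the distance \<open>1 / n\<close> from the boundary of the
  box, which makes the support a compact subset of the open box.\<close>

definition box_bump :: "'a::euclidean_space \<Rightarrow> 'a \<Rightarrow> nat \<Rightarrow> 'a \<Rightarrow> real" where
  "box_bump a b n x = (\<Prod>i\<in>Basis. smooth_ramp (real n * (x \<bullet> i - a \<bullet> i) - 1) * smooth_ramp (real n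
      * (b \<bullet> i - x \<bullet> i) - 1))"

lemma box_bump_bounds: "0 \<le> box_bump a b n x" "box_bump a b n x \<le> 1"
  unfolding box_bump_def
  by (auto intro!: prod_nonneg prod_le_1 mult_nonneg_nonneg mult_le_one smooth_ramp_bounds)

lemma smooth_expr_prod: "(\<And>i. i \<in> I \<Longrightarrow> smooth_expr (f i)) \<Longrightarrow> smooth_expr (\<lambda>x. \<Prod>i\<in>I. f i x)"
  by (induction I rule: infinite_finite_induct) (auto intro: smooth_expr.intros)

lemma smooth_expr_affine: "smooth_expr (\<lambda>x. r * (x \<bullet> i) + c)"
  by (intro smooth_expr.intros)

lemma smooth_expr_box_bump: "smooth_expr (box_bump a b n)"
proof -
  have "smooth_expr (\<lambda>x. smooth_ramp (real n * (x \<bullet> i - a \<bullet> i) - 1) * smooth_ramp (real n * (b \<bullet> i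
      - x \<bullet> i) - 1))" for i
    using smooth_expr.mult[OF smooth_expr.flat[OF smooth_expr_affine[of "real n" i "- real n * (a
        \<bullet> i) - 1"], of 1]
       smooth_expr.flat[OF smooth_expr_affine[of "- real n" i "real n * (b \<bullet> i) - 1"], of 1]]
    by (simp add: algebra_simps)
  then show ?thesis unfolding box_bump_def[abs_def] by (intro smooth_expr_prod)
qed

lemma test_function_box_bump: "test_function (box a b) (box_bump a b n)"
proof (cases "n = 0")
  case True
  obtain i :: 'a where i: "i \<in> Basis" using nonempty_Basis by blast
  have "box_bump a b n x = 0" for x
    unfolding box_bump_def using i True by (intro prod_zero) (auto simp: flat_def)
  then have "box_bump a b n = (\<lambda>x. 0)" by (simp add: fun_eq_iff)
  then show ?thesis by (simp add: test_function_zero)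
next
  case False
  define e :: 'a where "e = (\<Sum>i\<in>Basis. (1 / real n) *\<^sub>R i)"
  have e: "e \<bullet> i = 1 / real n" if "i \<in> Basis" for i
    using that by (simp add: e_def inner_sum_left inner_Basis if_distrib cong: if_cong)
  have "box_bump a b n x = 0" if x: "x \<notin> cbox (a + e) (b - e)" for x
  proof -
    obtain i where i: "i \<in> Basis" "x \<bullet> i < a \<bullet> i + 1 / real n \<or> b \<bullet> i - 1 / real n < x \<bullet> i"
      using x e by (auto simp: mem_box inner_add_left inner_diff_left not_le)
    then have "real n * (x \<bullet> i - a \<bullet> i) - 1 \<le> 0 \<or> real n * (b \<bullet> i - x \<bullet> i) - 1 \<le> 0"
      using False by (auto simp: field_simps)
    then show ?thesis
      unfolding box_bump_def using i(1) by (intro prod_zero) (auto simp: flat_def)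
  qed
  moreover have "cbox (a + e) (b - e) \<subseteq> box a b"
  proof
    fix x assume "x \<in> cbox (a + e) (b - e)"
    then have "a \<bullet> i + 1 / real n \<le> x \<bullet> i \<and> x \<bullet> i \<le> b \<bullet> i - 1 / real n" if "i \<in> Basis" for i
      using that e by (auto simp: mem_box inner_add_left inner_diff_left)
    moreover have "1 / real n > 0" using False by simp
    ultimately show "x \<in> box a b" unfolding mem_box by (smt (verit))
  qed
  ultimately show ?thesis
    unfolding test_function_def using smooth_expr_imp_smooth[OF smooth_expr_box_bump]
    by (auto intro!: exI[of _ "cbox (a + e) (b - e)"])
qed

lemma box_bump_tendsto: "(\<lambda>n. box_bump a b n x) \<longlonglongrightarrow> indicator (box a b) x"
proof (cases "x \<in> box a b")
  case True
  then have "x \<bullet> i - a \<bullet> i > 0" "b \<bullet> i - x \<bullet> i > 0" if "i \<in> Basis" for i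
    using that by (auto simp: mem_box)
  then have "(\<lambda>n. box_bump a b n x) \<longlonglongrightarrow> (\<Prod>i\<in>(Basis::'a set). 1 * 1)"
    unfolding box_bump_def by (intro tendsto_prod tendsto_mult smooth_ramp_tendsto_1)
  then show ?thesis using True by simp
next
  case False
  have "box_bump a b n x = 0" for n
    using test_function_box_bump[of a b n] False unfolding test_function_def by blast
  then show ?thesis using False by simp
qed

lemma integral_lebesgue_on_subset:
  fixes f :: "'a::euclidean_space \<Rightarrow> real"
  assumes "S \<in> sets borel" "\<Omega> \<in> sets borel" "S \<subseteq> \<Omega>" "\<And>x. x \<notin> S \<Longrightarrow> f x = 0"
  shows "(\<integral>x. f x \<partial>lebesgue_on S) = (\<integral>x. f x \<partial>lebesgue_on \<Omega>)"
proof -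
  have "(\<lambda>x. indicator S x *\<^sub>R f x) = (\<lambda>x. indicator \<Omega> x *\<^sub>R f x)"
    using assms(3,4) by (auto simp: indicator_def fun_eq_iff)
  then show ?thesis
    using assms(1,2) by (simp add: integral_restrict_space)
qed

text \<open>The fundamental lemma of the calculus of variations. On each box inside the domain, bump
  functions approximate the indicators of smaller boxes, so that \<open>g\<close> is orthogonal to all of \<open>L2\<close>
  of the box, in particular to itself; countably many boxes cover the domain.\<close>

lemma L2_orthogonal_test_functions:
  fixes g :: "'a::euclidean_space \<Rightarrow> real"
  assumes "open \<Omega>" and g: "g \<in> L2 (lebesgue_on \<Omega>)"
    and orth: "\<And>\<phi>. test_function \<Omega> \<phi> \<Longrightarrow> (\<integral>x. g x * \<phi> x \<partial>lebesgue_on \<Omega>) = 0"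
  shows "AE x in lebesgue_on \<Omega>. g x = 0"
proof -
  have on_box: "AE x in lebesgue_on (box a b). g x = 0" if sub: "box a b \<subseteq> \<Omega>" for a b
  proof -
    let ?M = "lebesgue_on (box a b)"
    interpret finite_measure ?M
      by (rule finite_measure_lebesgue_on_bounded) auto
    have gS: "g \<in> L2 ?M"
    proof -
      have i: "integrable (lebesgue_on \<Omega>) (\<lambda>x. (norm (g x))\<^sup>2)" and m: "g
          \<in> borel_measurable (lebesgue_on \<Omega>)"
        using g by (auto simp: L2_def)
      have "set_integrable lebesgue \<Omega> (\<lambda>x. (norm (g x))\<^sup>2)"
        using i assms(1) by (simp add: set_integrable_def integrable_restrict_space)
      then have "set_integrable lebesgue (box a b) (\<lambda>x. (norm (g x))\<^sup>2)"
        by (rule set_integrable_subset) (use sub in auto)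
      then have "integrable ?M (\<lambda>x. (norm (g x))\<^sup>2)"
        by (simp add: set_integrable_def integrable_restrict_space)
      moreover have "g \<in> borel_measurable ?M" by (rule measurable_restrict_mono[OF m sub])
      ultimately show ?thesis by (simp add: L2_def)
    qed
    have conv: "(\<integral>x. g x * f x \<partial>?M) = 0"
      if "\<And>n. s n \<in> L2 ?M" "\<And>n. (\<integral>x. g x * s n x \<partial>?M) = 0" "f \<in> L2 ?M" "G \<in> L2 ?M"
        "\<And>n. AE x in ?M. \<bar>s n x\<bar> \<le> G x" "AE x in ?M. (\<lambda>n. s n x) \<longlonglongrightarrow> f x"
            for s :: "nat \<Rightarrow> 'a \<Rightarrow> real" and f G
    proof -
      have "(\<lambda>n. L2_norm ?M (\<lambda>x. s n x - f x)) \<longlonglongrightarrow> 0"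
        by (rule L2_dominated_convergence(3)[OF that(4)]) (use that in \<open>auto dest!: L2_measurable\<close>)
      then have "(\<lambda>n. L2_norm ?M (\<lambda>x. f x - s n x)) \<longlonglongrightarrow> 0"
        by (simp add: L2_norm_def power2_commute)
      from L2_inner_tendsto[OF that(1) that(3) gS this]
      have "(\<lambda>n. 0) \<longlonglongrightarrow> (\<integral>x. g x * f x \<partial>?M)"
        using that(2) by (simp add: mult.commute)
      then show ?thesis using LIMSEQ_unique tendsto_const by metis
    qed
    have "(\<integral>x. g x * g x \<partial>?M) = 0"
    proof (rule L2_box_induct[where P = "\<lambda>f. (\<integral>x. g x * f x \<partial>?M) = 0", OF _ _ _ gS])
      fix c d assume cd: "box c d \<subseteq> box a b"
      show "(\<integral>x. g x * indicator (box c d) x \<partial>?M) = 0"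
      proof (rule conv[where s = "box_bump c d" and G = "\<lambda>_. 1"])
        show "box_bump c d n \<in> L2 ?M" for n
          by (rule test_function_L2(1)[OF _ _ test_function_box_bump]) auto
        show "(\<integral>x. g x * box_bump c d n x \<partial>?M) = 0" for n
        proof -
          have t: "test_function (box a b) (box_bump c d n)"
            using test_function_box_bump cd by (rule test_function_mono)
          have "(\<integral>x. g x * box_bump c d n x \<partial>?M) = (\<integral>x. g x * box_bump c d n x \<partial>lebesgue_on \<Omega>)"
            using sub assms(1) t by (intro integral_lebesgue_on_subset) (auto simp:
                test_function_def)
          also have "\<dots> = 0" by (intro orth test_function_mono[OF t sub])
          finally show ?thesis .
        qed
        have "(indicator (box c d) :: 'a \<Rightarrow> real) \<in> borel_measurable ?M"
          by (intro measurable_restrict_space1 measurable_completion) auto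
        then show "(indicator (box c d) :: 'a \<Rightarrow> real) \<in> L2 ?M"
          by (rule bounded_L2[where C = 1]) (auto simp: indicator_def)
        show "(\<lambda>_. 1::real) \<in> L2 ?M" by (rule bounded_L2[where C = 1]) auto
        show "AE x in ?M. \<bar>box_bump c d n x\<bar> \<le> 1" for n
          by (intro AE_I2) (simp add: abs_of_nonneg box_bump_bounds)
        show "AE x in ?M. (\<lambda>n. box_bump c d n x) \<longlonglongrightarrow> indicator (box c d) x"
          by (intro AE_I2 box_bump_tendsto)
      qed
    next
      fix f h :: "'a \<Rightarrow> real" and r
      assume "f \<in> L2 ?M" "h \<in> L2 ?M" "(\<integral>x. g x * f x \<partial>?M) = 0" "(\<integral>x. g x * h x \<partial>?M) = 0"
      then show "(\<integral>x. g x * (f x + r * h x) \<partial>?M) = 0"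
        using gS by (simp add: distrib_left mult.left_commute L2_integrable_mult)
    qed (rule conv)
    then have "L2_norm ?M g = 0" by (simp add: L2_norm_def power2_eq_square)
    then show ?thesis by (rule L2_norm_eq_0_AE[OF gS])
  qed
  obtain \<D> where D: "countable \<D>" "\<D> \<subseteq> Pow \<Omega>" "\<And>X. X \<in> \<D> \<Longrightarrow> \<exists>a b. X = box a b" "\<Union>\<D> = \<Omega>"
    using open_countable_Union_open_box[OF assms(1)] by metis
  have "\<forall>X\<in>\<D>. AE x in lborel. x \<in> X \<longrightarrow> g x = 0"
  proof
    fix X assume X: "X \<in> \<D>"
    then obtain a b where "X = box a b" "X \<subseteq> \<Omega>" using D by blast
    with on_box[of a b] show "AE x in lborel. x \<in> X \<longrightarrow> g x = 0"
      by (simp add: AE_lebesgue_on_iff)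
  qed
  then have "AE x in lborel. \<forall>X\<in>\<D>. x \<in> X \<longrightarrow> g x = 0"
    by (rule AE_ball_countable[OF D(1), THEN iffD2])
  then show ?thesis
    using assms(1) D(4) by (subst AE_lebesgue_on_iff) auto
qed

section \<open>Weak gradients and the space \<open>H10\<close>\<close>

lemma L2_Pair:
  fixes f :: "'a \<Rightarrow> 'b::euclidean_space" and g :: "'a \<Rightarrow> 'c::euclidean_space"
  assumes "f \<in> L2 M" "g \<in> L2 M" shows "(\<lambda>x. (f x, g x)) \<in> L2 M"
proof -
  have "integrable M (\<lambda>x. (norm (f x, g x))\<^sup>2)"
    using assms by (simp add: norm_Pair L2_def)
  moreover have "(\<lambda>x. (f x, g x)) \<in> borel_measurable M"
    using assms by (auto dest!: L2_measurable intro: borel_measurable_Pair)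
  ultimately show ?thesis by (simp add: L2_def)
qed

lemma L2_norm_sq_Pair:
  fixes f :: "'a \<Rightarrow> 'b::euclidean_space" and g :: "'a \<Rightarrow> 'c::euclidean_space"
  assumes "f \<in> L2 M" "g \<in> L2 M"
  shows "(L2_norm M (\<lambda>x. (f x, g x)))\<^sup>2 = (L2_norm M f)\<^sup>2 + (L2_norm M g)\<^sup>2"
  using assms by (simp add: L2_norm_sq norm_Pair L2_def)

text \<open>A projection argument that stays inside the possibly incomplete subspace \<open>D\<close>. The residuals
  \<open>A n\<close> of a minimising sequence of approximations of \<open>F\<close> are orthogonal to \<open>D\<close> up to a defect \<open>\<epsilon>
  n\<close> that tends to zero. The hypothesis, a quantitative way of saying that \<open>F\<close> is a weak limit of
  elements of \<open>D\<close>, makes them almost orthogonal to \<open>F\<close> too, hence to themselves.\<close>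

lemma L2_approximable:
  fixes F :: "'a \<Rightarrow> 'b::euclidean_space" and D :: "('a \<Rightarrow> 'b) set"
  assumes F: "F \<in> L2 M" and D: "D \<subseteq> L2 M" "D \<noteq> {}"
    and lin: "\<And>f g c. f \<in> D \<Longrightarrow> g \<in> D \<Longrightarrow> (\<lambda>x. f x + c *\<^sub>R g x) \<in> D"
    and K: "\<And>A \<epsilon>. A \<in> L2 M \<Longrightarrow> \<epsilon> \<ge> 0 \<Longrightarrow>
      (\<And>f. f \<in> D \<Longrightarrow> \<bar>\<integral>x. f x \<bullet> A x \<partial>M\<bar> \<le> \<epsilon> * L2_norm M f) \<Longrightarrow> \<bar>\<integral>x. F x \<bullet> A x \<partial>M\<bar> \<le> \<epsilon> * K"
  shows "\<exists>\<phi>. (\<forall>n::nat. \<phi> n \<in> D) \<and> (\<lambda>n. L2_norm M (\<lambda>x. F x - \<phi> n x)) \<longlonglongrightarrow> 0"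
proof -
  let ?R = "(\<lambda>f. L2_norm M (\<lambda>x. F x - f x)) ` D"
  define d where "d = Inf ?R"
  have bdd: "bdd_below ?R" by (rule bdd_belowI[of _ 0]) auto
  have d_le: "d \<le> L2_norm M (\<lambda>x. F x - f x)" if "f \<in> D" for f
    unfolding d_def using that bdd by (intro cInf_lower) auto
  have d0: "0 \<le> d" unfolding d_def using D(2) by (intro cInf_greatest) auto
  have "\<exists>f\<in>D. L2_norm M (\<lambda>x. F x - f x) < d + 1 / Suc n" for n
  proof -
    have "Inf ?R < d + 1 / Suc n" unfolding d_def by simp
    then show ?thesis using D(2) bdd by (subst (asm) cInf_less_iff) auto
  qed
  then obtain \<phi> where \<phi>: "\<And>n. \<phi> n \<in> D" "\<And>n. L2_norm M (\<lambda>x. F x - \<phi> n x) < d + 1 / Suc n"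
    by metis
  define A where "A n = (\<lambda>x. F x - \<phi> n x)" for n
  define \<epsilon> where "\<epsilon> n = sqrt ((d + 1 / Suc n)\<^sup>2 - d\<^sup>2)" for n
  have AL: "A n \<in> L2 M" for n
    unfolding A_def using F D(1) \<phi>(1) by (intro L2_diff) auto
  have \<epsilon>_sq: "(\<epsilon> n)\<^sup>2 = (d + 1 / Suc n)\<^sup>2 - d\<^sup>2" and \<epsilon>0: "0 \<le> \<epsilon> n" for n
    using d0 by (auto simp: \<epsilon>_def intro!: power_mono)
  have A_lt: "(L2_norm M (A n))\<^sup>2 \<le> (d + 1 / Suc n)\<^sup>2" for n
    using \<phi>(2)[of n] unfolding A_def by (intro power_mono) auto
  have orth: "\<bar>\<integral>x. f x \<bullet> A n x \<partial>M\<bar> \<le> \<epsilon> n * L2_norm M f" if f: "f \<in> D" for f n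
  proof -
    define I where "I = (\<integral>x. A n x \<bullet> f x \<partial>M)"
    define N where "N = (L2_norm M f)\<^sup>2"
    have fL: "f \<in> L2 M" using f D(1) by blast
    have le: "2 * s * I - s\<^sup>2 * N \<le> (\<epsilon> n)\<^sup>2" for s
    proof -
      have "(\<lambda>x. \<phi> n x + s *\<^sub>R f x) \<in> D" by (intro lin \<phi> f)
      from d_le[OF this] have "d \<le> L2_norm M (\<lambda>x. A n x + (- s) *\<^sub>R f x)"
        by (simp add: A_def algebra_simps)
      then have "d\<^sup>2 \<le> (L2_norm M (\<lambda>x. A n x + (- s) *\<^sub>R f x))\<^sup>2"
        using d0 by (rule power_mono)
      also have "\<dots> = (L2_norm M (A n))\<^sup>2 + 2 * (- s) * I + (- s)\<^sup>2 * N"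
        unfolding I_def N_def by (rule L2_norm_sq_add[OF AL fL])
      finally show ?thesis using A_lt[of n] \<epsilon>_sq[of n] by simp
    qed
    have "\<bar>I\<bar> \<le> \<epsilon> n * L2_norm M f"
    proof (cases "N = 0")
      case True
      have "I = 0"
        using L2_Cauchy_Schwarz[OF AL fL, of n] True by (simp add: I_def N_def)
      then show ?thesis using \<epsilon>0[of n] by simp
    next
      case False
      then have N: "N > 0" by (simp add: N_def)
      \<comment> \<open>The value \<open>s = I / N\<close> maximises the left-hand side of \<open>le\<close>.\<close>
      have "I\<^sup>2 / N \<le> (\<epsilon> n)\<^sup>2"
        using le[of "I / N"] N by (simp add: power2_eq_square field_simps)
      then have "\<bar>I\<bar>\<^sup>2 \<le> (\<epsilon> n * L2_norm M f)\<^sup>2"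
        using N by (simp add: field_simps N_def power_mult_distrib)
      then show ?thesis by (rule power2_le_imp_le) (use \<epsilon>0[of n] in simp)
    qed
    then show ?thesis by (simp add: I_def inner_commute)
  qed
  have bound: "(L2_norm M (A n))\<^sup>2 \<le> \<epsilon> n * (\<bar>K\<bar> + (L2_norm M F + (d + 1)))" for n
  proof -
    have \<phi>L: "\<phi> n \<in> L2 M" using \<phi>(1) D(1) by blast
    have "(L2_norm M (A n))\<^sup>2 = (\<integral>x. F x \<bullet> A n x - \<phi> n x \<bullet> A n x \<partial>M)"
      unfolding L2_norm_sq_inner by (simp add: A_def inner_diff_left)
    also have "\<dots> = (\<integral>x. F x \<bullet> A n x \<partial>M) - (\<integral>x. \<phi> n x \<bullet> A n x \<partial>M)"
      using L2_integrable_inner F \<phi>L AL by (intro Bochner_Integration.integral_diff) auto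
    also have "\<dots> \<le> \<epsilon> n * K + \<epsilon> n * L2_norm M (\<phi> n)"
      using K[OF AL \<epsilon>0 orth, of n] orth[OF \<phi>(1), of n n] by (simp add: abs_le_iff)
    also have "\<epsilon> n * K \<le> \<epsilon> n * \<bar>K\<bar>" using \<epsilon>0 by (intro mult_left_mono) auto
    also have "L2_norm M (\<phi> n) \<le> L2_norm M F + (d + 1)"
    proof -
      have "L2_norm M (\<phi> n) = L2_norm M (\<lambda>x. F x - A n x)" by (simp add: A_def)
      also have "\<dots> \<le> L2_norm M F + L2_norm M (A n)" by (rule L2_norm_triangle_diff[OF F AL])
      also have "L2_norm M (A n) \<le> d + 1"
      proof -
        have "L2_norm M (A n) \<le> d + 1 / Suc n" using \<phi>(2)[of n] by (simp add: A_def)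
        also have "\<dots> \<le> d + 1" by simp
        finally show ?thesis .
      qed
      finally show ?thesis by simp
    qed
    then have "\<epsilon> n * L2_norm M (\<phi> n) \<le> \<epsilon> n * (L2_norm M F + (d + 1))"
      using \<epsilon>0 by (intro mult_left_mono)
    finally show ?thesis by (simp add: distrib_left)
  qed
  have "\<epsilon> \<longlonglongrightarrow> 0"
  proof -
    have "(\<lambda>n. 1 / real (Suc n)) \<longlonglongrightarrow> 0" using LIMSEQ_inverse_real_of_nat by (simp add: divide_inverse)
    then have "(\<lambda>n. sqrt ((d + 1 / Suc n)\<^sup>2 - d\<^sup>2)) \<longlonglongrightarrow> sqrt ((d + 0)\<^sup>2 - d\<^sup>2)"
      by (intro tendsto_intros)
    then show ?thesis by (simp add: \<epsilon>_def[abs_def])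
  qed
  then have "(\<lambda>n. \<epsilon> n * (\<bar>K\<bar> + (L2_norm M F + (d + 1)))) \<longlonglongrightarrow> 0"
    by (rule tendsto_mult_left_zero)
  then have "(\<lambda>n. (L2_norm M (A n))\<^sup>2) \<longlonglongrightarrow> 0"
    by (rule tendsto_sandwich[OF _ _ tendsto_const, rotated 2]) (use bound in auto)
  then have "(\<lambda>n. sqrt ((L2_norm M (A n))\<^sup>2)) \<longlonglongrightarrow> sqrt 0" by (rule tendsto_real_sqrt)
  then have "(\<lambda>n. L2_norm M (\<lambda>x. F x - \<phi> n x)) \<longlonglongrightarrow> 0" by (simp add: A_def[abs_def])
  then show ?thesis using \<phi>(1) by blast
qed

locale bounded_open =
  fixes \<Omega> :: "'a::euclidean_space set"
  assumes open_domain: "open \<Omega>" and bounded_domain: "bounded \<Omega>"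
begin

abbreviation "M\<^sub>\<Omega> \<equiv> lebesgue_on \<Omega>"

lemma borel_domain: "\<Omega> \<in> sets borel"
  using open_domain by simp

sublocale fm_domain: finite_measure M\<^sub>\<Omega>
  by (rule finite_measure_lebesgue_on_bounded[OF borel_domain bounded_domain])

lemmas test_L2 = test_function_L2[OF borel_domain bounded_domain]

lemma weak_gradient_unique:
  assumes "g1 \<in> L2 M\<^sub>\<Omega>" "g2 \<in> L2 M\<^sub>\<Omega>" "weak_gradient \<Omega> f g1" "weak_gradient \<Omega> f g2"
  shows "AE x in M\<^sub>\<Omega>. g1 x = g2 x"
proof -
  have "AE x in M\<^sub>\<Omega>. g1 x \<bullet> b - g2 x \<bullet> b = 0" if b: "b \<in> Basis" for b
  proof (rule L2_orthogonal_test_functions[OF open_domain])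
    show "(\<lambda>x. g1 x \<bullet> b - g2 x \<bullet> b) \<in> L2 M\<^sub>\<Omega>"
      by (intro L2_diff L2_component assms)
    fix \<phi> assume \<phi>: "test_function \<Omega> \<phi>"
    have "(\<integral>x. (g1 x \<bullet> b) * \<phi> x \<partial>M\<^sub>\<Omega>) = (\<integral>x. (g2 x \<bullet> b) * \<phi> x \<partial>M\<^sub>\<Omega>)"
      using assms(3)[unfolded weak_gradient_def, rule_format, OF \<phi> b]
        assms(4)[unfolded weak_gradient_def, rule_format, OF \<phi> b] by linarith
    then show "(\<integral>x. (g1 x \<bullet> b - g2 x \<bullet> b) * \<phi> x \<partial>M\<^sub>\<Omega>) = 0"
      using L2_integrable_mult[OF L2_component[OF assms(1)] test_L2(1)[OF \<phi>]]
        L2_integrable_mult[OF L2_component[OF assms(2)] test_L2(1)[OF \<phi>]]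
      by (simp add: left_diff_distrib)
  qed
  then have "AE x in M\<^sub>\<Omega>. \<forall>b\<in>Basis. g1 x \<bullet> b - g2 x \<bullet> b = 0"
    by (simp add: AE_finite_all)
  then show ?thesis by eventually_elim (simp add: euclidean_eq_iff[of "g1 _"])
qed

lemma weak_gradient_lincomb:
  assumes "f1 \<in> L2 M\<^sub>\<Omega>" "f2 \<in> L2 M\<^sub>\<Omega>" "g1 \<in> L2 M\<^sub>\<Omega>" "g2 \<in> L2 M\<^sub>\<Omega>"
    and "weak_gradient \<Omega> f1 g1" "weak_gradient \<Omega> f2 g2"
  shows "weak_gradient \<Omega> (\<lambda>x. f1 x + c * f2 x) (\<lambda>x. g1 x + c *\<^sub>R g2 x)"
  unfolding weak_gradient_def
proof (intro allI impI ballI)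
  fix \<phi> :: "'a \<Rightarrow> real" and b :: 'a assume \<phi>: "test_function \<Omega> \<phi>" and b: "b \<in> Basis"
  note i = L2_integrable_mult[OF _ L2_component[OF test_L2(2)[OF \<phi>]]]
    L2_integrable_mult[OF L2_component test_L2(1)[OF \<phi>]]
  have "(\<integral>x. (f1 x + c * f2 x) * (gradient \<phi> x \<bullet> b) \<partial>M\<^sub>\<Omega>)
      = (\<integral>x. f1 x * (gradient \<phi> x \<bullet> b) \<partial>M\<^sub>\<Omega>) + c * (\<integral>x. f2 x * (gradient \<phi> x \<bullet> b) \<partial>M\<^sub>\<Omega>)"
    using i assms(1-4) by (simp add: distrib_right mult.assoc)
  also have "\<dots> = - ((\<integral>x. (g1 x \<bullet> b) * \<phi> x \<partial>M\<^sub>\<Omega>) + c * (\<integral>x. (g2 x \<bullet> b) * \<phi> x \<partial>M\<^sub>\<Omega>))"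
    using assms(5,6) \<phi> b by (simp add: weak_gradient_def)
  also have "(\<integral>x. (g1 x \<bullet> b) * \<phi> x \<partial>M\<^sub>\<Omega>) + c * (\<integral>x. (g2 x \<bullet> b) * \<phi> x \<partial>M\<^sub>\<Omega>)
      = (\<integral>x. (g1 x \<bullet> b) * \<phi> x + c * ((g2 x \<bullet> b) * \<phi> x) \<partial>M\<^sub>\<Omega>)"
    using i(2)[OF assms(3), of b] i(2)[OF assms(4), of b]
    by (subst Bochner_Integration.integral_add) auto
  also have "\<dots> = (\<integral>x. ((g1 x + c *\<^sub>R g2 x) \<bullet> b) * \<phi> x \<partial>M\<^sub>\<Omega>)"
    by (simp add: inner_add_left distrib_right mult.assoc)
  finally show "(\<integral>x. (f1 x + c * f2 x) * (gradient \<phi> x \<bullet> b) \<partial>M\<^sub>\<Omega>)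
     = - (\<integral>x. ((g1 x + c *\<^sub>R g2 x) \<bullet> b) * \<phi> x \<partial>M\<^sub>\<Omega>)" .
qed

text \<open>The closure of the pairs \<open>(\<phi>, \<nabla>\<phi>)\<close> in \<open>L2 \<times> L2\<close>. Keeping the second component explicit turns
  membership in \<open>H10\<close> into a closure property of pairs; that it is a weak gradient is shown
  separately.\<close>

definition test_limit :: "('a \<Rightarrow> real) \<Rightarrow> ('a \<Rightarrow> 'a) \<Rightarrow> bool" where
  "test_limit f g \<longleftrightarrow> f \<in> L2 M\<^sub>\<Omega> \<and> g \<in> L2 M\<^sub>\<Omega> \<and>
     (\<exists>\<phi>. (\<forall>n::nat. test_function \<Omega> (\<phi> n)) \<and>
        (\<lambda>n. L2_norm M\<^sub>\<Omega> (\<lambda>x. f x - \<phi> n x)) \<longlonglongrightarrow> 0 \<and>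
        (\<lambda>n. L2_norm M\<^sub>\<Omega> (\<lambda>x. g x - gradient (\<phi> n) x)) \<longlonglongrightarrow> 0)"

lemma test_limitE:
  assumes "test_limit f g"
  obtains \<phi> where "\<And>n::nat. test_function \<Omega> (\<phi> n)"
    "(\<lambda>n. L2_norm M\<^sub>\<Omega> (\<lambda>x. f x - \<phi> n x)) \<longlonglongrightarrow> 0"
    "(\<lambda>n. L2_norm M\<^sub>\<Omega> (\<lambda>x. g x - gradient (\<phi> n) x)) \<longlonglongrightarrow> 0"
  using assms unfolding test_limit_def by blast

lemma test_limit_L2: "test_limit f g \<Longrightarrow> f \<in> L2 M\<^sub>\<Omega>" "test_limit f g \<Longrightarrow> g \<in> L2 M\<^sub>\<Omega>"
  by (auto simp: test_limit_def)

lemma H10_I: "test_limit f g \<Longrightarrow> weak_gradient \<Omega> f g \<Longrightarrow> f \<in> H10 \<Omega>"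
  unfolding H10_def test_limit_def by blast

lemma test_limit_H10:
  assumes "f \<in> H10 \<Omega>" "g \<in> L2 M\<^sub>\<Omega>" "weak_gradient \<Omega> f g"
  shows "test_limit f g"
proof -
  obtain g' \<phi> where f: "f \<in> L2 M\<^sub>\<Omega>" and g': "g' \<in> L2 M\<^sub>\<Omega>" "weak_gradient \<Omega> f g'"
    and \<phi>: "\<And>n::nat. test_function \<Omega> (\<phi> n)" "(\<lambda>n. L2_norm M\<^sub>\<Omega> (\<lambda>x. f x - \<phi> n x)) \<longlonglongrightarrow> 0"
      "(\<lambda>n. L2_norm M\<^sub>\<Omega> (\<lambda>x. g' x - gradient (\<phi> n) x)) \<longlonglongrightarrow> 0"
    using assms(1) unfolding H10_def by blast
  have ae: "AE x in M\<^sub>\<Omega>. g' x = g x"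
    by (rule weak_gradient_unique[OF g'(1) assms(2) g'(2) assms(3)])
  have "L2_norm M\<^sub>\<Omega> (\<lambda>x. g' x - gradient (\<phi> n) x) = L2_norm M\<^sub>\<Omega> (\<lambda>x. g x - gradient (\<phi> n) x)" for n
    by (rule L2_norm_cong_AE)
       (use ae g' assms(2) test_L2(2)[OF \<phi>(1)]
           in \<open>auto intro!: L2_measurable L2_diff elim!: eventually_mono\<close>)
  then show ?thesis using f assms(2) \<phi> unfolding test_limit_def by auto
qed

lemma test_limit_lincomb:
  assumes "test_limit f1 g1" "test_limit f2 g2"
  shows "test_limit (\<lambda>x. f1 x + c * f2 x) (\<lambda>x. g1 x + c *\<^sub>R g2 x)"
proof -
  note L = test_limit_L2[OF assms(1)] test_limit_L2[OF assms(2)]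
  obtain \<phi> where \<phi>: "\<And>n::nat. test_function \<Omega> (\<phi> n)"
    "(\<lambda>n. L2_norm M\<^sub>\<Omega> (\<lambda>x. f1 x - \<phi> n x)) \<longlonglongrightarrow> 0"
    "(\<lambda>n. L2_norm M\<^sub>\<Omega> (\<lambda>x. g1 x - gradient (\<phi> n) x)) \<longlonglongrightarrow> 0"
    using assms(1) by (rule test_limitE) blast
  obtain \<psi> where \<psi>: "\<And>n::nat. test_function \<Omega> (\<psi> n)"
    "(\<lambda>n. L2_norm M\<^sub>\<Omega> (\<lambda>x. f2 x - \<psi> n x)) \<longlonglongrightarrow> 0"
    "(\<lambda>n. L2_norm M\<^sub>\<Omega> (\<lambda>x. g2 x - gradient (\<psi> n) x)) \<longlonglongrightarrow> 0"
    using assms(2) by (rule test_limitE) blast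
  have t: "test_function \<Omega> (\<lambda>x. \<phi> n x + c * \<psi> n x)" for n
    by (intro test_function_lincomb \<phi> \<psi>)
  have gr: "gradient (\<lambda>x. \<phi> n x + c * \<psi> n x) x = gradient (\<phi> n) x + c *\<^sub>R gradient (\<psi> n) x" for n x
    using \<phi>(1) \<psi>(1) by (intro gradient_lincomb) (auto simp: test_function_def)
  have aux: "(\<lambda>n. L2_norm M\<^sub>\<Omega> (\<lambda>x. (F x + c *\<^sub>R G x) - (p n x + c *\<^sub>R q n x))) \<longlonglongrightarrow> 0"
    if "F \<in> L2 M\<^sub>\<Omega>" "G \<in> L2 M\<^sub>\<Omega>" "\<And>n. p n \<in> L2 M\<^sub>\<Omega>" "\<And>n. q n \<in> L2 M\<^sub>\<Omega>"
      and l: "(\<lambda>n. L2_norm M\<^sub>\<Omega> (\<lambda>x. F x - p n x)) \<longlonglongrightarrow> 0" "(\<lambda>n. L2_norm M\<^sub>\<Omega> (\<lambda>x. G x - q n x)) \<longlonglongrightarrow> 0"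
    for F G :: "'a \<Rightarrow> 'b::euclidean_space" and p q
  proof (rule tendsto_sandwich[OF _ _ tendsto_const])
    show "(\<lambda>n. L2_norm M\<^sub>\<Omega> (\<lambda>x. F x - p n x) + \<bar>c\<bar> * L2_norm M\<^sub>\<Omega> (\<lambda>x. G x - q n x)) \<longlonglongrightarrow> 0"
      using tendsto_add[OF l(1) tendsto_mult_left[OF l(2), of "\<bar>c\<bar>"]] by simp
    have eq: "(F x + c *\<^sub>R G x) - (p n x + c *\<^sub>R q n x) = (F x - p n x) + c *\<^sub>R (G x - q n x)"
        for n x
      by (simp add: algebra_simps)
    have "L2_norm M\<^sub>\<Omega> (\<lambda>x. (F x + c *\<^sub>R G x) - (p n x + c *\<^sub>R q n x))
        \<le> L2_norm M\<^sub>\<Omega> (\<lambda>x. F x - p n x) + \<bar>c\<bar> * L2_norm M\<^sub>\<Omega> (\<lambda>x. G x - q n x)" for n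
      unfolding eq
      using L2_norm_triangle[OF L2_diff[OF that(1) that(3)[of n]] L2_scaleR[OF L2_diff[OF that(2)
          that(4)[of n]], of c]]
      by (simp only: L2_norm_scaleR)
    then show "\<forall>\<^sub>F n in sequentially. L2_norm M\<^sub>\<Omega> (\<lambda>x. (F x + c *\<^sub>R G x) - (p n x + c *\<^sub>R q n x))
        \<le> L2_norm M\<^sub>\<Omega> (\<lambda>x. F x - p n x) + \<bar>c\<bar> * L2_norm M\<^sub>\<Omega> (\<lambda>x. G x - q n x)" by simp
  qed auto
  have "(\<lambda>n. L2_norm M\<^sub>\<Omega> (\<lambda>x. (f1 x + c * f2 x) - (\<phi> n x + c * \<psi> n x))) \<longlonglongrightarrow> 0"
    using aux[OF L(1) L(3) test_L2(1)[OF \<phi>(1)] test_L2(1)[OF \<psi>(1)] \<phi>(2) \<psi>(2)] by simp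
  moreover have "(\<lambda>n. L2_norm M\<^sub>\<Omega> (\<lambda>x. (g1 x + c *\<^sub>R g2 x) - gradient (\<lambda>x. \<phi> n x + c * \<psi> n x) x))
      \<longlonglongrightarrow> 0"
    unfolding gr using aux[OF L(2) L(4) test_L2(2)[OF \<phi>(1)] test_L2(2)[OF \<psi>(1)] \<phi>(3) \<psi>(3)] by simp
  moreover have "(\<lambda>x. f1 x + c * f2 x) \<in> L2 M\<^sub>\<Omega>" "(\<lambda>x. g1 x + c *\<^sub>R g2 x) \<in> L2 M\<^sub>\<Omega>"
    using L by (auto intro!: L2_add L2_scaleR L2_cmult)
  ultimately show ?thesis
    using t unfolding test_limit_def by (intro conjI exI[of _ "\<lambda>n x. \<phi> n x + c * \<psi> n x"] allI)
qed

lemma H10_lincomb: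
  assumes "f1 \<in> H10 \<Omega>" "f2 \<in> H10 \<Omega>"
  shows "(\<lambda>x. f1 x + c * f2 x) \<in> H10 \<Omega>"
proof -
  obtain g1 g2 where g: "g1 \<in> L2 M\<^sub>\<Omega>" "weak_gradient \<Omega> f1 g1" "g2 \<in> L2 M\<^sub>\<Omega>" "weak_gradient \<Omega> f2 g2"
    using assms unfolding H10_def by blast
  note t = test_limit_H10[OF assms(1) g(1,2)] test_limit_H10[OF assms(2) g(3,4)]
  show ?thesis
    by (rule H10_I[OF test_limit_lincomb[OF t] weak_gradient_lincomb])
       (use t g test_limit_L2 in auto)
qed

text \<open>The definition of the weak divergence covers test functions only; the identity passes to
  their closure because both sides are continuous in \<open>L2\<close>.\<close>

lemma weak_divergence_test_limit:
  assumes "\<tau> \<in> L2 M\<^sub>\<Omega>" "D \<in> L2 M\<^sub>\<Omega>" "weak_divergence \<Omega> \<tau> D" "test_limit f g"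
  shows "(\<integral>x. \<tau> x \<bullet> g x \<partial>M\<^sub>\<Omega>) = - (\<integral>x. D x * f x \<partial>M\<^sub>\<Omega>)"
proof -
  note L = test_limit_L2[OF assms(4)]
  obtain \<phi> where \<phi>: "\<And>n::nat. test_function \<Omega> (\<phi> n)"
    "(\<lambda>n. L2_norm M\<^sub>\<Omega> (\<lambda>x. f x - \<phi> n x)) \<longlonglongrightarrow> 0"
    "(\<lambda>n. L2_norm M\<^sub>\<Omega> (\<lambda>x. g x - gradient (\<phi> n) x)) \<longlonglongrightarrow> 0"
    using assms(4) by (rule test_limitE) blast
  have "(\<lambda>n. \<integral>x. gradient (\<phi> n) x \<bullet> \<tau> x \<partial>M\<^sub>\<Omega>) \<longlonglongrightarrow> (\<integral>x. g x \<bullet> \<tau> x \<partial>M\<^sub>\<Omega>)"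
    by (intro L2_inner_tendsto test_L2[OF \<phi>(1)] \<phi> L assms)
  moreover have "(\<integral>x. gradient (\<phi> n) x \<bullet> \<tau> x \<partial>M\<^sub>\<Omega>) = - (\<integral>x. \<phi> n x \<bullet> D x \<partial>M\<^sub>\<Omega>)" for n
    using assms(3) \<phi>(1) unfolding weak_divergence_def by (simp add: inner_commute mult.commute)
  moreover have "(\<lambda>n. - (\<integral>x. \<phi> n x \<bullet> D x \<partial>M\<^sub>\<Omega>)) \<longlonglongrightarrow> - (\<integral>x. f x \<bullet> D x \<partial>M\<^sub>\<Omega>)"
    by (intro tendsto_minus L2_inner_tendsto test_L2[OF \<phi>(1)] \<phi> L assms)
  ultimately have "(\<integral>x. g x \<bullet> \<tau> x \<partial>M\<^sub>\<Omega>) = - (\<integral>x. f x \<bullet> D x \<partial>M\<^sub>\<Omega>)"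
    by (intro LIMSEQ_unique[where X = "\<lambda>n. \<integral>x. gradient (\<phi> n) x \<bullet> \<tau> x \<partial>M\<^sub>\<Omega>"]) (simp_all only:)
  then show ?thesis by (simp add: inner_commute mult.commute)
qed

text \<open>Pairs are treated as single functions into the product space, so that the approximation
  lemma for subspaces of \<open>L2\<close> applies.\<close>

lemma test_limit_iff_jet:
  fixes f :: "'a \<Rightarrow> real" and g :: "'a \<Rightarrow> 'a"
  assumes "f \<in> L2 M\<^sub>\<Omega>" "g \<in> L2 M\<^sub>\<Omega>"
  shows "test_limit f g \<longleftrightarrow> (\<exists>\<phi>. (\<forall>n::nat. test_function \<Omega> (\<phi> n)) \<and>
     (\<lambda>n. L2_norm M\<^sub>\<Omega> (\<lambda>x. (f x, g x) - (\<phi> n x, gradient (\<phi> n) x))) \<longlonglongrightarrow> 0)"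
proof -
  have "((\<lambda>n. L2_norm M\<^sub>\<Omega> (\<lambda>x. f x - \<phi> n x)) \<longlonglongrightarrow> 0 \<and>
        (\<lambda>n. L2_norm M\<^sub>\<Omega> (\<lambda>x. g x - gradient (\<phi> n) x)) \<longlonglongrightarrow> 0) \<longleftrightarrow>
     (\<lambda>n. L2_norm M\<^sub>\<Omega> (\<lambda>x. (f x, g x) - (\<phi> n x, gradient (\<phi> n) x))) \<longlonglongrightarrow> 0"
    if \<phi>: "\<And>n::nat. test_function \<Omega> (\<phi> n)" for \<phi>
  proof -
    let ?a = "\<lambda>n. L2_norm M\<^sub>\<Omega> (\<lambda>x. f x - \<phi> n x)" and ?b
        = "\<lambda>n. L2_norm M\<^sub>\<Omega> (\<lambda>x. g x - gradient (\<phi> n) x)"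
      and ?c = "\<lambda>n. L2_norm M\<^sub>\<Omega> (\<lambda>x. (f x, g x) - (\<phi> n x, gradient (\<phi> n) x))"
    have c: "?c n = sqrt ((?a n)\<^sup>2 + (?b n)\<^sup>2)" for n
      using L2_norm_sq_Pair[OF L2_diff[OF assms(1) test_L2(1)[OF \<phi>]] L2_diff[OF assms(2)
          test_L2(2)[OF \<phi>]], of n n]
      by (simp add: real_sqrt_unique)
    have le: "?a n \<le> ?c n" "?b n \<le> ?c n" for n
      unfolding c by (rule real_le_rsqrt, simp)+
    show ?thesis
    proof (intro iffI conjI)
      assume "?a \<longlonglongrightarrow> 0 \<and> ?b \<longlonglongrightarrow> 0"
      then have "(\<lambda>n. sqrt ((?a n)\<^sup>2 + (?b n)\<^sup>2)) \<longlonglongrightarrow> sqrt (0\<^sup>2 + 0\<^sup>2)" by (intro tendsto_intros) auto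
      then show "?c \<longlonglongrightarrow> 0" unfolding c by simp
    next
      assume l: "?c \<longlonglongrightarrow> 0"
      show "?a \<longlonglongrightarrow> 0"
        by (rule tendsto_sandwich[OF always_eventually always_eventually tendsto_const l])
           (intro allI L2_norm_nonneg le)+
      show "?b \<longlonglongrightarrow> 0"
        by (rule tendsto_sandwich[OF always_eventually always_eventually tendsto_const l])
           (intro allI L2_norm_nonneg le)+
    qed
  qed
  then show ?thesis unfolding test_limit_def using assms by blast
qed

end

section \<open>Slices and time averages\<close>

locale cylinder = bounded_open \<Omega> for \<Omega> :: "'a::euclidean_space set" +
  fixes T :: real
  assumes T_pos: "T > 0"
begin

abbreviation "M\<^sub>T \<equiv> lebesgue_on {0<..<T}"
abbreviation "M\<^sub>Q \<equiv> cyl \<Omega> T"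

lemma cyl_eq: "M\<^sub>Q = lebesgue_on (\<Omega> \<times> {0<..<T})"
  by (simp add: cyl_def)

sublocale domain_product \<Omega> "{0<..<T}"
  using borel_domain by unfold_locales auto

sublocale fm_time: finite_measure M\<^sub>T
  by (rule finite_measure_lebesgue_on_bounded) auto

sublocale fm_cyl: finite_measure M\<^sub>Q
  unfolding cyl_eq using AB bounded_domain
  by (intro finite_measure_lebesgue_on_bounded bounded_Times) auto

lemmas Q_AE_space = AE_fst[folded cyl_eq] and Q_AE_time = AE_snd[folded cyl_eq]
lemmas Q_slice_space = measurable_slice_snd[folded cyl_eq] and Q_slice_time
    = measurable_slice_fst[folded cyl_eq]
lemmas Q_integrable_space = AE_integrable_slice_snd[folded cyl_eq] integrable_slices_snd[folded
    cyl_eq]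
  and Q_integrable_time = AE_integrable_slice_fst[folded cyl_eq] integrable_slices_fst[folded
      cyl_eq]
lemmas Q_integral_space = integral_slices_snd[folded cyl_eq] and Q_integral_time
    = integral_slices_fst[folded cyl_eq]
lemmas Q_integrable_from_slices = integrable_from_slices_fst[folded cyl_eq]
lemmas Q_lift_measurable = measurable_lift_fst[folded cyl_eq]
lemmas Q_AE_from_slices = AE_from_slices_snd[folded cyl_eq]

lemma Q_lift_snd_measurable:
  fixes c :: "real \<Rightarrow> real"
  assumes "continuous_on UNIV c" shows "(\<lambda>z. c (snd z)) \<in> borel_measurable M\<^sub>Q"
  unfolding cyl_eq
  by (intro continuous_measurable_lebesgue_on continuous_on_compose2[OF assms]) (auto intro:
      continuous_intros)

lemma continuous_time_measurable:
  fixes c :: "real \<Rightarrow> real"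
  assumes "continuous_on UNIV c" shows "c \<in> borel_measurable M\<^sub>T"
  by (rule continuous_measurable_lebesgue_on[OF assms])

lemma L2_slice_space:
  fixes f :: "'a \<times> real \<Rightarrow> 'b::euclidean_space"
  assumes f: "f \<in> L2 M\<^sub>Q" shows "AE t in M\<^sub>T. (\<lambda>x. f (x, t)) \<in> L2 M\<^sub>\<Omega>"
proof -
  have "AE t in M\<^sub>T. (\<lambda>x. f (x, t) \<bullet> b) \<in> L2 M\<^sub>\<Omega>" for b
  proof -
    have fb: "(\<lambda>z. f z \<bullet> b) \<in> L2 M\<^sub>Q" by (rule L2_component[OF f])
    show ?thesis
      using Q_slice_space[OF L2_measurable[OF fb]] Q_integrable_space(1)[OF L2_integrable_sq[OF fb]]
      by eventually_elim (simp add: L2_def)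
  qed
  then have "AE t in M\<^sub>T. \<forall>b\<in>Basis. (\<lambda>x. f (x, t) \<bullet> b) \<in> L2 M\<^sub>\<Omega>"
    by (simp add: AE_finite_all)
  then show ?thesis by eventually_elim (rule L2_vector, simp)
qed

lemma L2_slice_time:
  fixes f :: "'a \<times> real \<Rightarrow> real"
  assumes f: "f \<in> L2 M\<^sub>Q" shows "AE x in M\<^sub>\<Omega>. (\<lambda>t. f (x, t)) \<in> L2 M\<^sub>T"
  using Q_slice_time[OF L2_measurable[OF f]] Q_integrable_time(1)[OF L2_integrable_sq[OF f]]
  by eventually_elim (simp add: L2_def)

lemma L2_norm_sq_slices:
  fixes f :: "'a \<times> real \<Rightarrow> 'b::euclidean_space"
  assumes f: "f \<in> L2 M\<^sub>Q"
  shows "integrable M\<^sub>T (\<lambda>t. (L2_norm M\<^sub>\<Omega> (\<lambda>x. f (x, t)))\<^sup>2)"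
    and "(L2_norm M\<^sub>Q f)\<^sup>2 = (\<integral>t. (L2_norm M\<^sub>\<Omega> (\<lambda>x. f (x, t)))\<^sup>2 \<partial>M\<^sub>T)"
  using Q_integrable_space(2)[OF L2_integrable_sq[OF f]] Q_integral_space[OF L2_integrable_sq[OF f]]
  by (simp_all add: L2_norm_sq)

lemma L2_norm_le_slices:
  fixes f :: "'a \<times> real \<Rightarrow> 'b::euclidean_space" and g :: "'a \<times> real \<Rightarrow> 'c::euclidean_space"
  assumes f: "f \<in> L2 M\<^sub>Q" and g: "g \<in> L2 M\<^sub>Q" and C: "C \<ge> 0"
    and le: "AE t in M\<^sub>T. L2_norm M\<^sub>\<Omega> (\<lambda>x. f (x, t)) \<le> C * L2_norm M\<^sub>\<Omega> (\<lambda>x. g (x, t))"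
  shows "L2_norm M\<^sub>Q f \<le> C * L2_norm M\<^sub>Q g"
proof (rule power2_le_imp_le)
  have "(L2_norm M\<^sub>Q f)\<^sup>2 \<le> (\<integral>t. C\<^sup>2 * (L2_norm M\<^sub>\<Omega> (\<lambda>x. g (x, t)))\<^sup>2 \<partial>M\<^sub>T)"
    unfolding L2_norm_sq_slices(2)[OF f]
  proof (rule integral_mono_AE)
    show "AE t in M\<^sub>T. (L2_norm M\<^sub>\<Omega> (\<lambda>x. f (x, t)))\<^sup>2 \<le> C\<^sup>2 * (L2_norm M\<^sub>\<Omega> (\<lambda>x. g (x, t)))\<^sup>2"
      using le by eventually_elim (simp add: power_mono power_mult_distrib[symmetric])
  qed (use L2_norm_sq_slices(1) f g in auto)
  then show "(L2_norm M\<^sub>Q f)\<^sup>2 \<le> (C * L2_norm M\<^sub>Q g)\<^sup>2"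
    by (simp add: L2_norm_sq_slices(2)[OF g] power_mult_distrib)
qed (use C in simp)

lemma L2_lift:
  fixes a :: "'a \<Rightarrow> real" and c :: "real \<Rightarrow> real"
  assumes a: "a \<in> L2 M\<^sub>\<Omega>" and c: "continuous_on UNIV c" "\<And>t. \<bar>c t\<bar> \<le> 1"
  shows "(\<lambda>z. a (fst z) * c (snd z)) \<in> L2 M\<^sub>Q"
proof -
  have am: "a \<in> borel_measurable M\<^sub>\<Omega>" by (rule L2_measurable[OF a])
  have m: "(\<lambda>z. a (fst z)) \<in> borel_measurable M\<^sub>Q" by (rule Q_lift_measurable[OF am])
  have "integrable M\<^sub>Q (\<lambda>z. (a (fst z))\<^sup>2)"
  proof (rule Q_integrable_from_slices)
    show "integrable M\<^sub>\<Omega> (\<lambda>x. \<integral>t. \<bar>(a (fst (x, t)))\<^sup>2\<bar> \<partial>M\<^sub>T)"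
      using L2_integrable_sq[OF a] by simp
  qed (use m in simp_all)
  then have "(\<lambda>z. a (fst z)) \<in> L2 M\<^sub>Q" using m by (simp add: L2_def)
  then show ?thesis
    using L2_bounded_mult[OF _ Q_lift_snd_measurable[OF c(1)], of "\<lambda>z. a (fst z)" 1] c(2)
    by (simp add: mult.commute)
qed

text \<open>With \<open>c\<close> a cosine or a sine these integrals are, up to the factor \<open>2 / T\<close>, the Fourier
  coefficients of \<open>f\<close> in time.\<close>

definition time_average :: "(real \<Rightarrow> real) \<Rightarrow> ('a \<times> real \<Rightarrow> real) \<Rightarrow> 'a \<Rightarrow> real" where
  "time_average c f x = (\<integral>t. f (x, t) * c t \<partial>M\<^sub>T)"

context
  fixes c :: "real \<Rightarrow> real"
  assumes c_cont: "continuous_on UNIV c" and c_bound: "\<And>t. \<bar>c t\<bar> \<le> 1"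
begin

lemma c_L2: "c \<in> L2 M\<^sub>T"
  using c_bound by (intro fm_time.bounded_L2[where C = 1] continuous_time_measurable c_cont) auto

lemma L2_mult_time:
  fixes f :: "'a \<times> real \<Rightarrow> real"
  assumes "f \<in> L2 M\<^sub>Q" shows "(\<lambda>z. f z * c (snd z)) \<in> L2 M\<^sub>Q"
  using L2_bounded_mult[OF assms Q_lift_snd_measurable[OF c_cont], of 1] c_bound
  by (simp add: mult.commute)

lemma time_average_sq_le:
  fixes f :: "'a \<times> real \<Rightarrow> real"
  assumes f: "f \<in> L2 M\<^sub>Q"
  shows "AE x in M\<^sub>\<Omega>. (time_average c f x)\<^sup>2 \<le> (L2_norm M\<^sub>T c)\<^sup>2 * (\<integral>t. (f (x, t))\<^sup>2 \<partial>M\<^sub>T)"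
  using L2_slice_time[OF f]
proof eventually_elim
  case (elim x)
  have "\<bar>time_average c f x\<bar> \<le> L2_norm M\<^sub>T (\<lambda>t. f (x, t)) * L2_norm M\<^sub>T c"
    unfolding time_average_def using L2_Cauchy_Schwarz[OF elim c_L2] by simp
  then have "\<bar>time_average c f x\<bar>\<^sup>2 \<le> (L2_norm M\<^sub>T (\<lambda>t. f (x, t)) * L2_norm M\<^sub>T c)\<^sup>2"
    by (rule power_mono) simp
  then show ?case by (simp add: power_mult_distrib L2_norm_sq[of _ "\<lambda>t. f (x, t)"] mult.commute)
qed

lemma time_average_L2:
  fixes f :: "'a \<times> real \<Rightarrow> real"
  assumes f: "f \<in> L2 M\<^sub>Q" shows "time_average c f \<in> L2 M\<^sub>\<Omega>"
proof -
  have m: "time_average c f \<in> borel_measurable M\<^sub>\<Omega>"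
    using Q_integrable_time(2)[OF fm_cyl.L2_integrable[OF L2_mult_time[OF f]]]
    unfolding time_average_def[abs_def] by auto
  have "integrable M\<^sub>\<Omega> (\<lambda>x. (L2_norm M\<^sub>T c)\<^sup>2 * (\<integral>t. (f (x, t))\<^sup>2 \<partial>M\<^sub>T))"
    using Q_integrable_time(2)[OF L2_integrable_sq[OF f]] by simp
  then have "integrable M\<^sub>\<Omega> (\<lambda>x. (time_average c f x)\<^sup>2)"
    by (rule Bochner_Integration.integrable_bound)
       (use m time_average_sq_le[OF f]
           in \<open>auto elim!: eventually_mono intro: order_trans[OF _ abs_ge_self]\<close>)
  then show ?thesis using m by (simp add: L2_def)
qed

lemma time_average_pairing_Q:
  fixes f :: "'a \<times> real \<Rightarrow> real"
  assumes f: "f \<in> L2 M\<^sub>Q" and a: "a \<in> L2 M\<^sub>\<Omega>"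
  shows "(\<integral>x. time_average c f x * a x \<partial>M\<^sub>\<Omega>) = (\<integral>z. f z * (a (fst z) * c (snd z)) \<partial>M\<^sub>Q)"
proof -
  have "integrable M\<^sub>Q (\<lambda>z. f z * (a (fst z) * c (snd z)))"
    by (intro L2_integrable_mult f L2_lift a c_cont c_bound)
  moreover have "(\<integral>t. f (x, t) * (a x * c t) \<partial>M\<^sub>T) = time_average c f x * a x" for x
  proof -
    have "(\<integral>t. f (x, t) * (a x * c t) \<partial>M\<^sub>T) = (\<integral>t. (f (x, t) * c t) * a x \<partial>M\<^sub>T)"
      by (intro Bochner_Integration.integral_cong) (auto simp: mult_ac)
    then show ?thesis by (simp add: time_average_def)
  qed
  ultimately show ?thesis using Q_integral_time[of "\<lambda>z. f z * (a (fst z) * c (snd z))"] by simp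
qed

text \<open>Pairing the average with a fixed function of space is the average of the pairings of the
  slices, by Fubini's theorem. Every property of slices that is expressed by pairings therefore
  passes to averages.\<close>

lemma time_average_pairing:
  fixes f :: "'a \<times> real \<Rightarrow> real"
  assumes f: "f \<in> L2 M\<^sub>Q" and a: "a \<in> L2 M\<^sub>\<Omega>"
  shows "integrable M\<^sub>T (\<lambda>t. c t * (\<integral>x. f (x, t) * a x \<partial>M\<^sub>\<Omega>))"
    and "(\<integral>x. time_average c f x * a x \<partial>M\<^sub>\<Omega>) = (\<integral>t. c t * (\<integral>x. f (x, t) * a x \<partial>M\<^sub>\<Omega>) \<partial>M\<^sub>T)"
proof -
  have i: "integrable M\<^sub>Q (\<lambda>z. f z * (a (fst z) * c (snd z)))"
    by (intro L2_integrable_mult f L2_lift a c_cont c_bound)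
  have eq: "(\<integral>x. f (x, t) * (a x * c t) \<partial>M\<^sub>\<Omega>) = c t * (\<integral>x. f (x, t) * a x \<partial>M\<^sub>\<Omega>)" for t
  proof -
    have "(\<integral>x. f (x, t) * (a x * c t) \<partial>M\<^sub>\<Omega>) = (\<integral>x. c t * (f (x, t) * a x) \<partial>M\<^sub>\<Omega>)"
      by (intro Bochner_Integration.integral_cong) (auto simp: mult_ac)
    then show ?thesis by simp
  qed
  show "integrable M\<^sub>T (\<lambda>t. c t * (\<integral>x. f (x, t) * a x \<partial>M\<^sub>\<Omega>))"
    using Q_integrable_space(2)[OF i] by (simp add: eq)
  show "(\<integral>x. time_average c f x * a x \<partial>M\<^sub>\<Omega>) = (\<integral>t. c t * (\<integral>x. f (x, t) * a x \<partial>M\<^sub>\<Omega>) \<partial>M\<^sub>T)"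
    using Q_integral_space[OF i] time_average_pairing_Q[OF f a] by (simp add: eq)
qed

definition time_average_vec :: "('a \<times> real \<Rightarrow> 'a) \<Rightarrow> 'a \<Rightarrow> 'a" where
  "time_average_vec g x = (\<Sum>b\<in>Basis. time_average c (\<lambda>z. g z \<bullet> b) x *\<^sub>R b)"

lemma time_average_vec_inner: "b \<in> Basis \<Longrightarrow> time_average_vec g x \<bullet> b
    = time_average c (\<lambda>z. g z \<bullet> b) x"
  by (simp add: time_average_vec_def inner_sum_left inner_Basis if_distrib cong: if_cong)

lemma time_average_vec_L2:
  assumes "g \<in> L2 M\<^sub>Q" shows "time_average_vec g \<in> L2 M\<^sub>\<Omega>"
  by (rule L2_vector) (simp add: time_average_vec_inner time_average_L2 L2_component assms)

lemma time_average_weak_gradient: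
  assumes w: "w \<in> L2 M\<^sub>Q" and g: "is_grad \<Omega> T w g"
  shows "weak_gradient \<Omega> (time_average c w) (time_average_vec g)"
  unfolding weak_gradient_def
proof (intro allI impI ballI)
  fix \<phi> :: "'a \<Rightarrow> real" and b :: 'a assume \<phi>: "test_function \<Omega> \<phi>" and b: "b \<in> Basis"
  have gL: "g \<in> L2 M\<^sub>Q" and wg: "AE t in M\<^sub>T. weak_gradient \<Omega> (\<lambda>x. w (x, t)) (\<lambda>x. g (x, t))"
    using g by (auto simp: is_grad_def)
  note p1 = time_average_pairing[OF w L2_component[OF test_L2(2)[OF \<phi>], of b]]
  note p2 = time_average_pairing[OF L2_component[OF gL, of b] test_L2(1)[OF \<phi>]]
  have "(\<integral>x. time_average c w x * (gradient \<phi> x \<bullet> b) \<partial>M\<^sub>\<Omega>)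
      = (\<integral>t. c t * (\<integral>x. w (x, t) * (gradient \<phi> x \<bullet> b) \<partial>M\<^sub>\<Omega>) \<partial>M\<^sub>T)" by (rule p1(2))
  also have "\<dots> = (\<integral>t. - (c t * (\<integral>x. (g (x, t) \<bullet> b) * \<phi> x \<partial>M\<^sub>\<Omega>)) \<partial>M\<^sub>T)"
  proof (rule integral_cong_AE)
    show "AE t in M\<^sub>T. c t * (\<integral>x. w (x, t) * (gradient \<phi> x \<bullet> b) \<partial>M\<^sub>\<Omega>)
        = - (c t * (\<integral>x. (g (x, t) \<bullet> b) * \<phi> x \<partial>M\<^sub>\<Omega>))"
      using wg by eventually_elim (use \<phi> b in \<open>simp add: weak_gradient_def\<close>)
  qed (use p1(1) p2(1) in auto)
  also have "\<dots> = - (\<integral>x. time_average c (\<lambda>z. g z \<bullet> b) x * \<phi> x \<partial>M\<^sub>\<Omega>)"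
    unfolding p2(2) by simp
  also have "\<dots> = - (\<integral>x. (time_average_vec g x \<bullet> b) * \<phi> x \<partial>M\<^sub>\<Omega>)"
    by (simp add: time_average_vec_inner[OF b])
  finally show "(\<integral>x. time_average c w x * (gradient \<phi> x \<bullet> b) \<partial>M\<^sub>\<Omega>) =
      - (\<integral>x. (time_average_vec g x \<bullet> b) * \<phi> x \<partial>M\<^sub>\<Omega>)" .
qed

text \<open>A functional that is small on all test functions, relative to their norm, is equally small
  on each slice, hence on the average. By \<open>L2_approximable\<close> this suffices for the average to be a
  limit of test functions; no measurable choice of approximating sequences is needed.\<close>

lemma time_average_test_limit:
  assumes w: "w \<in> L2 M\<^sub>Q" and g: "g \<in> L2 M\<^sub>Q"
    and tl: "AE t in M\<^sub>T. test_limit (\<lambda>x. w (x, t)) (\<lambda>x. g (x, t))"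
  shows "test_limit (time_average c w) (time_average_vec g)"
proof -
  let ?D = "{(\<lambda>x. (\<phi> x, gradient \<phi> x)) | \<phi>. test_function \<Omega> \<phi>}"
  let ?F = "\<lambda>x. (time_average c w x, time_average_vec g x)"
  let ?j = "\<lambda>t x. (w (x, t), g (x, t))"
  define K where "K = (\<integral>t. 1 + ((L2_norm M\<^sub>\<Omega> (\<lambda>x. w (x, t)))\<^sup>2
      + (L2_norm M\<^sub>\<Omega> (\<lambda>x. g (x, t)))\<^sup>2) \<partial>M\<^sub>T)"
  have Ki: "integrable M\<^sub>T (\<lambda>t. 1 + ((L2_norm M\<^sub>\<Omega> (\<lambda>x. w (x, t)))\<^sup>2
      + (L2_norm M\<^sub>\<Omega> (\<lambda>x. g (x, t)))\<^sup>2))"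
    using L2_norm_sq_slices(1)[OF w] L2_norm_sq_slices(1)[OF g] by simp
  have FL: "?F \<in> L2 M\<^sub>\<Omega>" by (intro L2_Pair time_average_L2 time_average_vec_L2 w g)
  have "\<exists>\<Phi>. (\<forall>n::nat. \<Phi> n \<in> ?D) \<and> (\<lambda>n. L2_norm M\<^sub>\<Omega> (\<lambda>x. ?F x - \<Phi> n x)) \<longlonglongrightarrow> 0"
  proof (rule L2_approximable[OF FL])
    show "?D \<subseteq> L2 M\<^sub>\<Omega>" using test_L2 by (auto intro: L2_Pair)
    show "?D \<noteq> {}" using test_function_zero by blast
    show "(\<lambda>x. f x + r *\<^sub>R h x) \<in> ?D" if f: "f \<in> ?D" and h: "h \<in> ?D" for f h r
    proof -
      obtain \<phi> \<psi> where *: "test_function \<Omega> \<phi>" "f = (\<lambda>x. (\<phi> x, gradient \<phi> x))"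
          "test_function \<Omega> \<psi>" "h = (\<lambda>x. (\<psi> x, gradient \<psi> x))" using f h by blast
      then have "(\<lambda>x. f x + r *\<^sub>R h x) = (\<lambda>x. (\<phi> x + r * \<psi> x, gradient (\<lambda>x. \<phi> x + r * \<psi> x) x))"
        using gradient_lincomb[of \<phi> \<psi> r] by (auto simp: test_function_def fun_eq_iff)
      then show ?thesis
        using test_function_lincomb[OF *(1,3), of r]
        by (intro CollectI exI[of _ "\<lambda>x. \<phi> x + r * \<psi> x"] conjI)
    qed
    fix A :: "'a \<Rightarrow> real \<times> 'a" and \<epsilon> :: real
    assume A: "A \<in> L2 M\<^sub>\<Omega>" and \<epsilon>: "\<epsilon> \<ge> 0"
      and orth: "\<And>f. f \<in> ?D \<Longrightarrow> \<bar>\<integral>x. f x \<bullet> A x \<partial>M\<^sub>\<Omega>\<bar> \<le> \<epsilon> * L2_norm M\<^sub>\<Omega> f"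
    have A1: "(\<lambda>x. fst (A x)) \<in> L2 M\<^sub>\<Omega>"
    proof (rule L2_dominated[OF A])
      have "fst \<in> borel_measurable (borel :: (real \<times> 'a) measure)"
        by (intro borel_measurable_continuous_onI continuous_intros)
      then show "(\<lambda>x. fst (A x)) \<in> borel_measurable M\<^sub>\<Omega>"
        by (rule measurable_compose[OF L2_measurable[OF A]])
      show "AE x in M\<^sub>\<Omega>. norm (fst (A x)) \<le> norm (A x)"
        using norm_fst_le[of "fst (A _)" "snd (A _)"] by (intro AE_I2) (simp add: norm_prod_def)
    qed
    have A2: "(\<lambda>x. snd (A x)) \<in> L2 M\<^sub>\<Omega>"
    proof (rule L2_dominated[OF A])
      have "snd \<in> borel_measurable (borel :: (real \<times> 'a) measure)"
        by (intro borel_measurable_continuous_onI continuous_intros)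
      then show "(\<lambda>x. snd (A x)) \<in> borel_measurable M\<^sub>\<Omega>"
        by (rule measurable_compose[OF L2_measurable[OF A]])
      show "AE x in M\<^sub>\<Omega>. norm (snd (A x)) \<le> norm (A x)"
        using norm_snd_le[of "snd (A _)" "fst (A _)"] by (intro AE_I2) (simp add: norm_prod_def)
    qed
    note A2b = L2_component[OF A2]
    have jet: "integrable M\<^sub>\<Omega> (\<lambda>x. f x * fst (A x))" "integrable M\<^sub>\<Omega> (\<lambda>x. (h x \<bullet> b) * (snd (A x) \<bullet>
        b))"
      "(\<integral>x. (f x, h x) \<bullet> A x \<partial>M\<^sub>\<Omega>)
        = (\<integral>x. f x * fst (A x) \<partial>M\<^sub>\<Omega>) + (\<Sum>b\<in>Basis. \<integral>x. (h x \<bullet> b) * (snd (A x) \<bullet> b) \<partial>M\<^sub>\<Omega>)"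
      if f: "f \<in> L2 M\<^sub>\<Omega>" and h: "h \<in> L2 M\<^sub>\<Omega>" for f h b
    proof -
      show i1: "integrable M\<^sub>\<Omega> (\<lambda>x. f x * fst (A x))" by (rule L2_integrable_mult[OF f A1])
      show i2: "integrable M\<^sub>\<Omega> (\<lambda>x. (h x \<bullet> b) * (snd (A x) \<bullet> b))" for b
        by (rule L2_integrable_mult[OF L2_component[OF h] A2b])
      have "(\<integral>x. (f x, h x) \<bullet> A x \<partial>M\<^sub>\<Omega>)
          = (\<integral>x. f x * fst (A x) + (\<Sum>b\<in>Basis. (h x \<bullet> b) * (snd (A x) \<bullet> b)) \<partial>M\<^sub>\<Omega>)"
      proof (intro Bochner_Integration.integral_cong refl)
        fix x
        have "h x \<bullet> snd (A x) = (\<Sum>b\<in>Basis. (h x \<bullet> b) * (snd (A x) \<bullet> b))" by (rule euclidean_inner)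
        then show "(f x, h x) \<bullet> A x = f x * fst (A x) + (\<Sum>b\<in>Basis. (h x \<bullet> b) * (snd (A x) \<bullet> b))"
          by (simp only: inner_prod_def fst_conv snd_conv inner_real_def)
      qed
      then show "(\<integral>x. (f x, h x) \<bullet> A x \<partial>M\<^sub>\<Omega>)
        = (\<integral>x. f x * fst (A x) \<partial>M\<^sub>\<Omega>) + (\<Sum>b\<in>Basis. \<integral>x. (h x \<bullet> b) * (snd (A x) \<bullet> b) \<partial>M\<^sub>\<Omega>)"
        using i1 i2 by simp
    qed
    note p1 = time_average_pairing[OF w A1]
    note p2 = time_average_pairing[OF L2_component[OF g] A2b]
    have F_int: "(\<integral>x. ?F x \<bullet> A x \<partial>M\<^sub>\<Omega>) = (\<integral>t. c t * (\<integral>x. w (x, t) * fst (A x) \<partial>M\<^sub>\<Omega>)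
        + (\<Sum>b\<in>Basis. c t * (\<integral>x. (g (x, t) \<bullet> b) * (snd (A x) \<bullet> b) \<partial>M\<^sub>\<Omega>)) \<partial>M\<^sub>T)"
      unfolding jet(3)[OF time_average_L2[OF w] time_average_vec_L2[OF g]]
      using p1 p2 by (simp add: time_average_vec_inner)
    have slice: "AE t in M\<^sub>T. \<bar>c t * (\<integral>x. w (x, t) * fst (A x) \<partial>M\<^sub>\<Omega>)
        + (\<Sum>b\<in>Basis. c t * (\<integral>x. (g (x, t) \<bullet> b) * (snd (A x) \<bullet> b) \<partial>M\<^sub>\<Omega>))\<bar>
        \<le> \<epsilon> * (1 + ((L2_norm M\<^sub>\<Omega> (\<lambda>x. w (x, t)))\<^sup>2 + (L2_norm M\<^sub>\<Omega> (\<lambda>x. g (x, t)))\<^sup>2))"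
      using tl
    proof eventually_elim
      case (elim t)
      note L = test_limit_L2[OF elim]
      have jL: "?j t \<in> L2 M\<^sub>\<Omega>" by (intro L2_Pair L)
      obtain \<phi> where \<phi>: "\<And>n::nat. test_function \<Omega> (\<phi> n)"
        "(\<lambda>n. L2_norm M\<^sub>\<Omega> (\<lambda>x. ?j t x - (\<phi> n x, gradient (\<phi> n) x))) \<longlonglongrightarrow> 0"
        using elim test_limit_iff_jet[OF L] by blast
      let ?\<Phi> = "\<lambda>n x. (\<phi> n x, gradient (\<phi> n) x)"
      have \<Phi>L: "?\<Phi> n \<in> L2 M\<^sub>\<Omega>" for n by (intro L2_Pair test_L2[OF \<phi>(1)])
      have "(\<lambda>n. \<bar>\<integral>x. ?\<Phi> n x \<bullet> A x \<partial>M\<^sub>\<Omega>\<bar>) \<longlonglongrightarrow> \<bar>\<integral>x. ?j t x \<bullet> A x \<partial>M\<^sub>\<Omega>\<bar>"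
        by (intro tendsto_rabs L2_inner_tendsto \<Phi>L jL A \<phi>(2))
      moreover have "(\<lambda>n. \<epsilon> * (L2_norm M\<^sub>\<Omega> (?j t) + L2_norm M\<^sub>\<Omega> (\<lambda>x. ?j t x - ?\<Phi> n x)))
          \<longlonglongrightarrow> \<epsilon> * (L2_norm M\<^sub>\<Omega> (?j t) + 0)"
        by (intro tendsto_intros \<phi>(2))
      moreover have "\<bar>\<integral>x. ?\<Phi> n x \<bullet> A x \<partial>M\<^sub>\<Omega>\<bar>
          \<le> \<epsilon> * (L2_norm M\<^sub>\<Omega> (?j t) + L2_norm M\<^sub>\<Omega> (\<lambda>x. ?j t x - ?\<Phi> n x))" for n
      proof -
        have "\<bar>\<integral>x. ?\<Phi> n x \<bullet> A x \<partial>M\<^sub>\<Omega>\<bar> \<le> \<epsilon> * L2_norm M\<^sub>\<Omega> (?\<Phi> n)"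
          using \<phi>(1) by (intro orth) blast
        also have "L2_norm M\<^sub>\<Omega> (?\<Phi> n) = L2_norm M\<^sub>\<Omega> (\<lambda>x. ?j t x - (?j t x - ?\<Phi> n x))" by simp
        also have "\<dots> \<le> L2_norm M\<^sub>\<Omega> (?j t) + L2_norm M\<^sub>\<Omega> (\<lambda>x. ?j t x - ?\<Phi> n x)"
          by (intro L2_norm_triangle_diff jL L2_diff \<Phi>L)
        finally show ?thesis using \<epsilon> by (simp add: mult_left_mono)
      qed
      ultimately have *: "\<bar>\<integral>x. ?j t x \<bullet> A x \<partial>M\<^sub>\<Omega>\<bar> \<le> \<epsilon> * L2_norm M\<^sub>\<Omega> (?j t)"
        by (metis (no_types, lifting) LIMSEQ_le add.right_neutral)
      have "L2_norm M\<^sub>\<Omega> (?j t) \<le> 1 + (L2_norm M\<^sub>\<Omega> (?j t))\<^sup>2"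
        using sum_squares_bound[of "L2_norm M\<^sub>\<Omega> (?j t)" 1] L2_norm_nonneg[of M\<^sub>\<Omega> "?j t"]
        unfolding power2_eq_square by linarith
      then have "\<epsilon> * L2_norm M\<^sub>\<Omega> (?j t) \<le> \<epsilon> * (1 + ((L2_norm M\<^sub>\<Omega> (\<lambda>x. w (x, t)))\<^sup>2
          + (L2_norm M\<^sub>\<Omega> (\<lambda>x. g (x, t)))\<^sup>2))"
        using \<epsilon> unfolding L2_norm_sq_Pair[OF L] by (intro mult_left_mono)
      with * have **: "\<bar>\<integral>x. ?j t x \<bullet> A x \<partial>M\<^sub>\<Omega>\<bar>
          \<le> \<epsilon> * (1 + ((L2_norm M\<^sub>\<Omega> (\<lambda>x. w (x, t)))\<^sup>2 + (L2_norm M\<^sub>\<Omega> (\<lambda>x. g (x, t)))\<^sup>2))" by linarith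
      have "\<bar>c t * (\<integral>x. ?j t x \<bullet> A x \<partial>M\<^sub>\<Omega>)\<bar> \<le> 1 * \<bar>\<integral>x. ?j t x \<bullet> A x \<partial>M\<^sub>\<Omega>\<bar>"
        unfolding abs_mult by (intro mult_right_mono c_bound) simp
      with ** show ?case unfolding jet(3)[OF L] by (simp add: distrib_left sum_distrib_left)
    qed
    have "\<bar>\<integral>x. ?F x \<bullet> A x \<partial>M\<^sub>\<Omega>\<bar> \<le> (\<integral>t. \<epsilon> * (1 + ((L2_norm M\<^sub>\<Omega> (\<lambda>x. w (x, t)))\<^sup>2
        + (L2_norm M\<^sub>\<Omega> (\<lambda>x. g (x, t)))\<^sup>2)) \<partial>M\<^sub>T)"
      unfolding F_int
      by (rule order_trans[OF integral_abs_bound integral_mono_AE[OF _ _ slice]])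
         (use Ki p1(1) p2(1) in auto)
    then show "\<bar>\<integral>x. ?F x \<bullet> A x \<partial>M\<^sub>\<Omega>\<bar> \<le> \<epsilon> * K" unfolding K_def by simp
  qed
  then obtain \<Phi> where \<Phi>: "\<And>n::nat. \<Phi> n \<in> ?D" "(\<lambda>n. L2_norm M\<^sub>\<Omega> (\<lambda>x. ?F x - \<Phi> n x)) \<longlonglongrightarrow> 0"
    by blast
  then have "\<forall>n. \<exists>\<phi>. test_function \<Omega> \<phi> \<and> \<Phi> n = (\<lambda>x. (\<phi> x, gradient \<phi> x))" by blast
  then obtain \<phi> where \<phi>: "\<And>n. test_function \<Omega> (\<phi> n)" "\<And>n. \<Phi> n = (\<lambda>x. (\<phi> n x, gradient (\<phi> n) x))"
      by metis
  show ?thesis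
    unfolding test_limit_iff_jet[OF time_average_L2[OF w] time_average_vec_L2[OF g]]
    using \<phi> \<Phi>(2) by auto
qed

lemma time_average_H10:
  assumes w: "w \<in> L2 M\<^sub>Q" and g: "is_grad \<Omega> T w g" and z: "zero_on_boundary \<Omega> T w"
  shows "time_average c w \<in> H10 \<Omega>"
proof (rule H10_I)
  have gL: "g \<in> L2 M\<^sub>Q" and wg: "AE t in M\<^sub>T. weak_gradient \<Omega> (\<lambda>x. w (x, t)) (\<lambda>x. g (x, t))"
    using g by (auto simp: is_grad_def)
  have "AE t in M\<^sub>T. test_limit (\<lambda>x. w (x, t)) (\<lambda>x. g (x, t))"
    using z[unfolded zero_on_boundary_def] wg L2_slice_space[OF gL]
    by eventually_elim (rule test_limit_H10)
  then show "test_limit (time_average c w) (time_average_vec g)"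
      by (rule time_average_test_limit[OF w gL])
  show "weak_gradient \<Omega> (time_average c w) (time_average_vec g)"
      by (rule time_average_weak_gradient[OF w g])
qed

end

end

section \<open>Fourier coefficients on an interval\<close>

definition fcoef :: "real \<Rightarrow> (real \<Rightarrow> real) \<Rightarrow> nat \<Rightarrow> real \<times> real" where
  "fcoef T f k =
     (2 / T * (\<integral>t. f t * cos (real k * (2 * pi / T) * t) \<partial>lebesgue_on {0<..<T}),
      2 / T * (\<integral>t. f t * sin (real k * (2 * pi / T) * t) \<partial>lebesgue_on {0<..<T}))"

lemma fourier_eq_fcoef: "fourier T w k x = fcoef T (\<lambda>t. w (x, t)) k"
  by (simp add: fourier_def fcoef_def)

locale period =
  fixes T :: real
  assumes period_pos: "T > 0"
begin

abbreviation "I\<^sub>T \<equiv> lebesgue_on {0<..<T}"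
definition \<omega> :: real where "\<omega> = 2 * pi / T"
abbreviation "co k t \<equiv> cos (real k * \<omega> * t)"
abbreviation "si k t \<equiv> sin (real k * \<omega> * t)"

sublocale fm_interval: finite_measure I\<^sub>T
  by (rule finite_measure_lebesgue_on_bounded) auto

lemma period_nonzero [simp]: "T \<noteq> 0"
  using period_pos by simp

lemma \<omega>_pos: "\<omega> > 0" and \<omega>_nonzero [simp]: "\<omega> \<noteq> 0" and \<omega>_T: "\<omega> * T = 2 * pi"
  using period_pos by (auto simp: \<omega>_def)

lemma fcoef_eq: "fcoef T f k = (2 / T * (\<integral>t. f t * co k t \<partial>I\<^sub>T), 2 / T * (\<integral>t. f t * si k t \<partial>I\<^sub>T))"
  by (simp add: fcoef_def \<omega>_def)

lemma continuous_L2: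
  fixes f :: "real \<Rightarrow> real"
  assumes "continuous_on UNIV f" "\<And>t. \<bar>f t\<bar> \<le> C" shows "f \<in> L2 I\<^sub>T"
  using assms by (intro fm_interval.bounded_L2[where C = C] continuous_measurable_lebesgue_on) auto

lemma co_L2: "co k \<in> L2 I\<^sub>T" and si_L2: "si k \<in> L2 I\<^sub>T"
  by (rule continuous_L2[where C = 1]; auto intro!: continuous_intros)+

lemma integral_FTC:
  assumes d: "\<And>t. (F has_real_derivative f t) (at t)" and f: "continuous_on UNIV f"
  shows "(\<integral>t. f t \<partial>I\<^sub>T) = F T - F 0"
proof -
  have i: "integrable (lebesgue_on {0..T}) f"
    using f by (intro continuous_imp_integrable_real) (auto intro: continuous_on_subset)
  have i': "integrable I\<^sub>T f"
  proof -
    have "set_integrable lebesgue {0..T} f"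
      using i by (simp add: set_integrable_def integrable_restrict_space)
    then have "set_integrable lebesgue {0<..<T} f"
      by (rule set_integrable_subset) auto
    then show ?thesis by (simp add: set_integrable_def integrable_restrict_space)
  qed
  have "(f has_integral F T - F 0) {0..T}"
    using period_pos d
    by (intro fundamental_theorem_of_calculus)
       (auto simp: has_real_derivative_iff_has_vector_derivative[symmetric] intro: DERIV_subset)
  then have "integral {0<..<T} f = F T - F 0"
    by (simp add: integral_open_interval_real[symmetric] integral_unique)
  then show ?thesis
    using lebesgue_integral_eq_integral[OF i'] by simp
qed

lemma sin_multiple_period: "sin (real_of_int n * \<omega> * T)
    = 0" and cos_multiple_period: "cos (real_of_int n * \<omega> * T) = 1"
proof -
  have eq: "real_of_int n * \<omega> * T = 2 * pi * real_of_int n" by (simp add: mult.assoc \<omega>_T)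
  show "sin (real_of_int n * \<omega> * T) = 0" "cos (real_of_int n * \<omega> * T) = 1"
    unfolding eq using sin_int_2pin[of n] cos_int_2pin[of n] by auto
qed

lemma integral_cos_int: "(\<integral>t. cos (real_of_int n * \<omega> * t) \<partial>I\<^sub>T) = (if n = 0 then T else 0)"
proof (cases "n = 0")
  case True
  have "(\<integral>t. 1 \<partial>I\<^sub>T) = T - 0"
    by (rule integral_FTC[where F = "\<lambda>t. t"]) (auto intro!: continuous_intros)
  then show ?thesis using True by simp
next
  case False
  have "(\<integral>t. cos (real_of_int n * \<omega> * t) \<partial>I\<^sub>T)
      = sin (real_of_int n * \<omega> * T) / (real_of_int n * \<omega>) - sin (real_of_int n * \<omega> * 0) /
          (real_of_int n * \<omega>)"
    using False period_pos by (intro integral_FTC) (auto intro!: continuous_intros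
        derivative_eq_intros)
  then show ?thesis using False sin_multiple_period by simp
qed

lemma integral_sin_int: "(\<integral>t. sin (real_of_int n * \<omega> * t) \<partial>I\<^sub>T) = 0"
proof (cases "n = 0")
  case False
  have "(\<integral>t. sin (real_of_int n * \<omega> * t) \<partial>I\<^sub>T)
      = - cos (real_of_int n * \<omega> * T) / (real_of_int n * \<omega>) - - cos (real_of_int n * \<omega> * 0) /
          (real_of_int n * \<omega>)"
    using False period_pos by (intro integral_FTC) (auto intro!: continuous_intros
        derivative_eq_intros)
  then show ?thesis using False cos_multiple_period by simp
qed simp

lemma integrable_cos_sin: "integrable I\<^sub>T (\<lambda>t. cos (a * t))" "integrable I\<^sub>T (\<lambda>t. sin (a * t))"
  by (intro fm_interval.L2_integrable continuous_L2[where C = 1]; auto intro!: continuous_intros)+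

lemma orthogonality:
  assumes "j \<ge> 1" "k \<ge> 1"
  shows "(\<integral>t. co j t * co k t \<partial>I\<^sub>T) = (if j = k then T / 2 else 0)"
    and "(\<integral>t. si j t * si k t \<partial>I\<^sub>T) = (if j = k then T / 2 else 0)"
    and "(\<integral>t. co j t * si k t \<partial>I\<^sub>T) = 0"
    and "(\<integral>t. si j t * co k t \<partial>I\<^sub>T) = 0"
proof -
  let ?m = "real_of_int (int j - int k) * \<omega>" and ?p = "real_of_int (int j + int k) * \<omega>"
  have e: "?m * t = real j * \<omega> * t - real k * \<omega> * t" "?p * t = real j * \<omega> * t + real k * \<omega> * t"
      for t
    by (simp_all only: of_int_diff of_int_add of_int_of_nat_eq left_diff_distrib distrib_right)
  note i = integrable_cos_sin[of ?m] integrable_cos_sin[of ?p]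
  note v = integral_cos_int[of "int j - int k"] integral_cos_int[of "int j + int k"]
    integral_sin_int[of "int j - int k"] integral_sin_int[of "int j + int k"]
  have "co j t * co k t = 1 / 2 * (cos (?m * t) + cos (?p * t))" for t
    unfolding e by (simp add: cos_times_cos)
  then have "(\<integral>t. co j t * co k t \<partial>I\<^sub>T) = (\<integral>t. 1 / 2 * (cos (?m * t) + cos (?p * t)) \<partial>I\<^sub>T)"
    by (simp only:)
  also have "\<dots> = 1 / 2 * ((\<integral>t. cos (?m * t) \<partial>I\<^sub>T) + (\<integral>t. cos (?p * t) \<partial>I\<^sub>T))"
    using i by simp
  finally show "(\<integral>t. co j t * co k t \<partial>I\<^sub>T) = (if j = k then T / 2 else 0)"
    unfolding v using assms by auto
  have "si j t * si k t = 1 / 2 * (cos (?m * t) - cos (?p * t))" for t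
    unfolding e by (simp add: sin_times_sin)
  then have "(\<integral>t. si j t * si k t \<partial>I\<^sub>T) = (\<integral>t. 1 / 2 * (cos (?m * t) - cos (?p * t)) \<partial>I\<^sub>T)"
    by (simp only:)
  also have "\<dots> = 1 / 2 * ((\<integral>t. cos (?m * t) \<partial>I\<^sub>T) - (\<integral>t. cos (?p * t) \<partial>I\<^sub>T))"
    using i by simp
  finally show "(\<integral>t. si j t * si k t \<partial>I\<^sub>T) = (if j = k then T / 2 else 0)"
    unfolding v using assms by auto
  have "co j t * si k t = 1 / 2 * (sin (?p * t) - sin (?m * t))" for t
    unfolding e by (simp add: cos_times_sin)
  then have "(\<integral>t. co j t * si k t \<partial>I\<^sub>T) = (\<integral>t. 1 / 2 * (sin (?p * t) - sin (?m * t)) \<partial>I\<^sub>T)"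
    by (simp only:)
  also have "\<dots> = 1 / 2 * ((\<integral>t. sin (?p * t) \<partial>I\<^sub>T) - (\<integral>t. sin (?m * t) \<partial>I\<^sub>T))"
    using i by simp
  finally show "(\<integral>t. co j t * si k t \<partial>I\<^sub>T) = 0" unfolding v by simp
  have "si j t * co k t = 1 / 2 * (sin (?p * t) + sin (?m * t))" for t
    unfolding e by (simp add: sin_times_cos)
  then have "(\<integral>t. si j t * co k t \<partial>I\<^sub>T) = (\<integral>t. 1 / 2 * (sin (?p * t) + sin (?m * t)) \<partial>I\<^sub>T)"
    by (simp only:)
  also have "\<dots> = 1 / 2 * ((\<integral>t. sin (?p * t) \<partial>I\<^sub>T) + (\<integral>t. sin (?m * t) \<partial>I\<^sub>T))"
    using i by simp
  finally show "(\<integral>t. si j t * co k t \<partial>I\<^sub>T) = 0" unfolding v by simp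
qed

lemma fcoef_lincomb:
  assumes "f \<in> L2 I\<^sub>T" "g \<in> L2 I\<^sub>T"
  shows "fcoef T (\<lambda>t. f t + r * g t) k = fcoef T f k + r *\<^sub>R fcoef T g k"
  using L2_integrable_mult[OF assms(1) co_L2[of k]] L2_integrable_mult[OF assms(2) co_L2[of k]]
    L2_integrable_mult[OF assms(1) si_L2[of k]] L2_integrable_mult[OF assms(2) si_L2[of k]]
  by (simp add: fcoef_eq distrib_right mult.assoc distrib_left mult.left_commute)

definition harmonic :: "nat \<Rightarrow> real \<times> real \<Rightarrow> real \<Rightarrow> real" where
  "harmonic k c t = fst c * co k t + snd c * si k t"

lemma harmonic_L2: "harmonic k c \<in> L2 I\<^sub>T"
  unfolding harmonic_def[abs_def] by (intro L2_add L2_cmult co_L2 si_L2)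

lemma integral_harmonic:
  assumes "f \<in> L2 I\<^sub>T"
  shows "(\<integral>t. f t * harmonic k c t \<partial>I\<^sub>T) = T / 2 * (fcoef T f k \<bullet> c)"
proof -
  note i = L2_integrable_mult[OF assms co_L2[of k]] L2_integrable_mult[OF assms si_L2[of k]]
  have "(\<integral>t. f t * harmonic k c t \<partial>I\<^sub>T) = (\<integral>t. fst c * (f t * co k t)
      + snd c * (f t * si k t) \<partial>I\<^sub>T)"
    by (intro Bochner_Integration.integral_cong) (auto simp: harmonic_def algebra_simps)
  also have "\<dots> = fst c * (\<integral>t. f t * co k t \<partial>I\<^sub>T) + snd c * (\<integral>t. f t * si k t \<partial>I\<^sub>T)"
    using i by simp
  also have "\<dots> = T / 2 * (fcoef T f k \<bullet> c)"
    using period_pos by (simp add: fcoef_eq inner_prod_def field_simps)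
  finally show ?thesis .
qed

lemma fcoef_harmonic:
  assumes "j \<ge> 1" "k \<ge> 1"
  shows "fcoef T (harmonic j c) k = (if j = k then c else 0)"
proof -
  note i = L2_integrable_mult[OF co_L2[of j] co_L2[of k]] L2_integrable_mult[OF si_L2[of j]
      co_L2[of k]]
    L2_integrable_mult[OF co_L2[of j] si_L2[of k]] L2_integrable_mult[OF si_L2[of j] si_L2[of k]]
  have "(\<integral>t. harmonic j c t * co k t \<partial>I\<^sub>T) = (\<integral>t. fst c * (co j t * co k t)
      + snd c * (si j t * co k t) \<partial>I\<^sub>T)"
    by (intro Bochner_Integration.integral_cong) (auto simp: harmonic_def algebra_simps)
  also have "\<dots> = fst c * (\<integral>t. co j t * co k t \<partial>I\<^sub>T) + snd c * (\<integral>t. si j t * co k t \<partial>I\<^sub>T)"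
    using i by simp
  finally have 1: "(\<integral>t. harmonic j c t * co k t \<partial>I\<^sub>T) = (if j = k then fst c * (T / 2) else 0)"
    unfolding orthogonality[OF assms] by simp
  have "(\<integral>t. harmonic j c t * si k t \<partial>I\<^sub>T) = (\<integral>t. fst c * (co j t * si k t)
      + snd c * (si j t * si k t) \<partial>I\<^sub>T)"
    by (intro Bochner_Integration.integral_cong) (auto simp: harmonic_def algebra_simps)
  also have "\<dots> = fst c * (\<integral>t. co j t * si k t \<partial>I\<^sub>T) + snd c * (\<integral>t. si j t * si k t \<partial>I\<^sub>T)"
    using i by simp
  finally have 2: "(\<integral>t. harmonic j c t * si k t \<partial>I\<^sub>T) = (if j = k then snd c * (T / 2) else 0)"
    unfolding orthogonality[OF assms] by simp
  show ?thesis
    using period_pos unfolding fcoef_eq 1 2 by (simp add: prod_eq_iff)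
qed

definition partial_sum :: "(real \<Rightarrow> real) \<Rightarrow> nat \<Rightarrow> real \<Rightarrow> real" where
  "partial_sum f N t = (\<Sum>k<N. harmonic (Suc k) (fcoef T f (Suc k)) t)"

lemma partial_sum_L2: "partial_sum f N \<in> L2 I\<^sub>T"
  unfolding partial_sum_def[abs_def] by (intro L2_sum harmonic_L2)

lemma integral_partial_sum:
  assumes "f \<in> L2 I\<^sub>T"
  shows "(\<integral>t. f t * partial_sum g N t \<partial>I\<^sub>T)
      = (\<Sum>k<N. T / 2 * (fcoef T f (Suc k) \<bullet> fcoef T g (Suc k)))"
proof -
  have "(\<integral>t. f t * partial_sum g N t \<partial>I\<^sub>T)
      = (\<integral>t. (\<Sum>k<N. f t * harmonic (Suc k) (fcoef T g (Suc k)) t) \<partial>I\<^sub>T)"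
    by (simp add: partial_sum_def sum_distrib_left)
  also have "\<dots> = (\<Sum>k<N. \<integral>t. f t * harmonic (Suc k) (fcoef T g (Suc k)) t \<partial>I\<^sub>T)"
    by (intro Bochner_Integration.integral_sum L2_integrable_mult assms harmonic_L2)
  finally show ?thesis by (simp add: integral_harmonic[OF assms])
qed

lemma L2_norm_partial_sum:
  "(L2_norm I\<^sub>T (partial_sum f N))\<^sup>2 = (\<Sum>k<N. T / 2 * (norm (fcoef T f (Suc k)))\<^sup>2)"
proof -
  have fc: "fcoef T (partial_sum f N) (Suc k) = (if k < N then fcoef T f (Suc k) else 0)" for k
  proof (induction N)
    case 0
    then show ?case by (simp add: partial_sum_def[abs_def] fcoef_eq zero_prod_def)
  next
    case (Suc N)
    have "partial_sum f (Suc N) = (\<lambda>t. partial_sum f N t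
        + 1 * harmonic (Suc N) (fcoef T f (Suc N)) t)"
      by (simp add: partial_sum_def fun_eq_iff)
    then have "fcoef T (partial_sum f (Suc N)) (Suc k)
        = fcoef T (partial_sum f N) (Suc k)
            + 1 *\<^sub>R fcoef T (harmonic (Suc N) (fcoef T f (Suc N))) (Suc k)"
      by (simp only: fcoef_lincomb[OF partial_sum_L2 harmonic_L2])
    then show ?case using Suc by (auto simp: fcoef_harmonic less_Suc_eq)
  qed
  have "(L2_norm I\<^sub>T (partial_sum f N))\<^sup>2 = (\<integral>t. partial_sum f N t * partial_sum f N t \<partial>I\<^sub>T)"
    by (simp add: L2_norm_sq_inner)
  also have "\<dots> = (\<Sum>k<N. T / 2 * (norm (fcoef T f (Suc k)))\<^sup>2)"
    unfolding integral_partial_sum[OF partial_sum_L2] fc by (simp add: power2_norm_eq_inner)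
  finally show ?thesis .
qed

text \<open>The right-hand side minus the left-hand side is the squared distance of \<open>f\<close> to its partial
  sum.\<close>

lemma Bessel:
  assumes "f \<in> L2 I\<^sub>T"
  shows "(\<Sum>k<N. T / 2 * (norm (fcoef T f (Suc k)))\<^sup>2) \<le> (L2_norm I\<^sub>T f)\<^sup>2"
proof -
  let ?S = "\<Sum>k<N. T / 2 * (norm (fcoef T f (Suc k)))\<^sup>2"
  have "0 \<le> (L2_norm I\<^sub>T (\<lambda>t. f t + (-1) *\<^sub>R partial_sum f N t))\<^sup>2" by simp
  also have "\<dots> = (L2_norm I\<^sub>T f)\<^sup>2 + 2 * (-1) * (\<integral>t. f t \<bullet> partial_sum f N t \<partial>I\<^sub>T)
      + (-1)\<^sup>2 * (L2_norm I\<^sub>T (partial_sum f N))\<^sup>2"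
    by (rule L2_norm_sq_add[OF assms partial_sum_L2])
  also have "\<dots> = (L2_norm I\<^sub>T f)\<^sup>2 - ?S"
    by (simp add: integral_partial_sum[OF assms] L2_norm_partial_sum power2_norm_eq_inner)
  finally show ?thesis by simp
qed

lemma partial_pairing_bound:
  assumes "f \<in> L2 I\<^sub>T" "g \<in> L2 I\<^sub>T"
  shows "\<bar>\<Sum>k<N. T / 2 * (fcoef T f (Suc k) \<bullet> fcoef T g (Suc k))\<bar> \<le> L2_norm I\<^sub>T f * L2_norm I\<^sub>T g"
proof -
  have "\<bar>\<integral>t. f t \<bullet> partial_sum g N t \<partial>I\<^sub>T\<bar> \<le> L2_norm I\<^sub>T f * L2_norm I\<^sub>T (partial_sum g N)"
    by (rule L2_Cauchy_Schwarz[OF assms(1) partial_sum_L2])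
  also have "L2_norm I\<^sub>T (partial_sum g N) \<le> L2_norm I\<^sub>T g"
    by (rule power2_le_imp_le) (use Bessel[OF assms(2)] in \<open>auto simp: L2_norm_partial_sum\<close>)
  finally show ?thesis
    by (simp add: integral_partial_sum[OF assms(1)] mult_left_mono)
qed

inductive trig_poly :: "(real \<Rightarrow> real) \<Rightarrow> bool" where
  base: "trig_poly (\<lambda>t. cos (real k * \<omega> * t + \<theta>))"
| lincomb: "trig_poly f \<Longrightarrow> trig_poly g \<Longrightarrow> trig_poly (\<lambda>t. f t + r * g t)"

lemma trig_poly_const: "trig_poly (\<lambda>t. c)"
proof -
  have "trig_poly (\<lambda>t. cos (real 0 * \<omega> * t + 0) + (c - 1) * cos (real 0 * \<omega> * t + 0))"
    by (intro trig_poly.intros)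
  then show ?thesis by simp
qed

lemma trig_poly_mult_cos: "trig_poly f \<Longrightarrow> trig_poly (\<lambda>t. f t * cos (\<omega> * t + \<phi>))"
proof (induction rule: trig_poly.induct)
  case (base k \<theta>)
  have "trig_poly (\<lambda>t. cos ((real k * \<omega> * t + \<theta>) - (\<omega> * t + \<phi>)))"
  proof (cases k)
    case 0
    have "cos ((real k * \<omega> * t + \<theta>) - (\<omega> * t + \<phi>)) = cos (real 1 * \<omega> * t + (\<phi> - \<theta>))" for t
      using 0 by (subst cos_minus[symmetric]) (simp add: algebra_simps)
    then show ?thesis by (simp only: trig_poly.base)
  next
    case (Suc l)
    have "(real k * \<omega> * t + \<theta>) - (\<omega> * t + \<phi>) = real l * \<omega> * t + (\<theta> - \<phi>)" for t
      using Suc by (simp add: algebra_simps)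
    then show ?thesis by (simp only: trig_poly.base)
  qed
  moreover have "trig_poly (\<lambda>t. cos ((real k * \<omega> * t + \<theta>) + (\<omega> * t + \<phi>)))"
  proof -
    have "(real k * \<omega> * t + \<theta>) + (\<omega> * t + \<phi>) = real (Suc k) * \<omega> * t + (\<theta> + \<phi>)" for t
      by (simp add: algebra_simps)
    then show ?thesis by (simp only: trig_poly.base)
  qed
  ultimately have "trig_poly (\<lambda>t. (0 + 1 / 2 * cos ((real k * \<omega> * t + \<theta>) - (\<omega> * t + \<phi>)))
      + 1 / 2 * cos ((real k * \<omega> * t + \<theta>) + (\<omega> * t + \<phi>)))"
    by (intro trig_poly.lincomb trig_poly_const)
  then show ?case by (simp add: cos_times_cos add_divide_distrib)
next
  case (lincomb f g r)
  from trig_poly.lincomb[OF lincomb.IH, of r] show ?case by (simp add: algebra_simps)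
qed

lemma trig_poly_real_polynomial:
  assumes "real_polynomial_function p" shows "trig_poly (\<lambda>t. p (cos (\<omega> * t + \<phi>)))"
proof -
  obtain a n where p: "p = (\<lambda>x. \<Sum>i\<le>n. a i * x ^ i)"
    using assms real_polynomial_function_iff_sum by auto
  have pow: "trig_poly (\<lambda>t. cos (\<omega> * t + \<phi>) ^ i)" for i
  proof (induction i)
    case 0
    then show ?case using trig_poly_const[of 1] by simp
  next
    case (Suc i)
    from trig_poly_mult_cos[OF this, of \<phi>] show ?case by (simp add: mult.commute)
  qed
  have "trig_poly (\<lambda>t. \<Sum>i\<le>n. a i * cos (\<omega> * t + \<phi>) ^ i)"
  proof (induction n)
    case 0
    show ?case using trig_poly_const by simp
  next
    case (Suc n)
    from trig_poly.lincomb[OF this pow[of "Suc n"], of "a (Suc n)"] show ?case by simp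
  qed
  then show ?thesis by (simp add: p)
qed

text \<open>A subinterval of the period is a superlevel set of a single shifted cosine. Its indicator is
  therefore a limit of continuous functions of that cosine, which in turn are limits of
  trigonometric polynomials.\<close>

lemma cos_greater_iff:
  assumes cd: "0 \<le> c" "c < d" "d \<le> T" and t: "0 < t" "t < T"
  shows "cos (\<omega> * ((d - c) / 2)) < cos (\<omega> * t + - (\<omega> * ((c + d) / 2))) \<longleftrightarrow> t \<in> {c<..<d}"
proof -
  define m r where "m = (c + d) / 2" and "r = (d - c) / 2"
  define \<theta> where "\<theta> = \<omega> * \<bar>t - m\<bar>"
  note w = \<omega>_pos
  have r: "0 < r" "r \<le> T / 2" and m: "r \<le> m" "m \<le> T - r"
    using cd by (auto simp: m_def r_def field_simps)
  have wr: "0 < \<omega> * r" "\<omega> * r \<le> pi"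
    using w r mult_left_mono[OF r(2), of \<omega>] \<omega>_T by auto
  have in_iff: "t \<in> {c<..<d} \<longleftrightarrow> \<theta> < \<omega> * r"
  proof -
    have "t \<in> {c<..<d} \<longleftrightarrow> \<bar>t - m\<bar> < r" by (auto simp: m_def r_def field_simps abs_if)
    also have "\<dots> \<longleftrightarrow> \<theta> < \<omega> * r" unfolding \<theta>_def using w by (simp add: mult_less_cancel_left_pos)
    finally show ?thesis .
  qed
  have \<theta>0: "0 \<le> \<theta>" using w by (simp add: \<theta>_def)
  have "\<bar>t - m\<bar> < T - r" using m t by auto
  then have "\<theta> < \<omega> * (T - r)" unfolding \<theta>_def using w by (rule mult_strict_left_mono)
  then have \<theta>2: "\<theta> < 2 * pi - \<omega> * r" using \<omega>_T by (simp add: right_diff_distrib)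
  have "\<omega> * t + - (\<omega> * m) = \<theta> \<or> \<omega> * t + - (\<omega> * m) = - \<theta>"
    by (auto simp: \<theta>_def abs_if right_diff_distrib)
  then have cos_eq: "cos (\<omega> * t + - (\<omega> * m)) = cos \<theta>" by auto
  have "cos (\<omega> * r) < cos \<theta> \<longleftrightarrow> \<theta> < \<omega> * r"
  proof (cases "\<theta> \<le> pi")
    case True
    then show ?thesis using cos_mono_less_eq[of "\<omega> * r" \<theta>] wr \<theta>0 by simp
  next
    case False
    have "cos \<theta> = cos (2 * pi - \<theta>)" by (simp add: cos_diff)
    moreover have "cos (2 * pi - \<theta>) < cos (\<omega> * r)"
      using cos_mono_less_eq[of "2 * pi - \<theta>" "\<omega> * r"] wr False \<theta>2 by simp
    ultimately show ?thesis using False wr by simp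
  qed
  then show ?thesis using cos_eq in_iff by (simp add: m_def r_def)
qed

text \<open>For fixed \<open>f\<close>, the set of all \<open>q\<close> for which the identity holds is closed under linear
  combinations and, by Bessel's inequality, under limits in \<open>L2\<close>. It contains the harmonics, by
  orthogonality, and the constants, because \<open>f\<close> has mean zero; hence also the indicators of
  intervals, from which \<open>L2_box_induct\<close> reaches all of \<open>L2\<close>.\<close>

theorem Parseval:
  assumes f: "f \<in> L2 I\<^sub>T" and f0: "(\<integral>t. f t \<partial>I\<^sub>T) = 0" and q: "q \<in> L2 I\<^sub>T"
  shows "(\<lambda>k. T / 2 * (fcoef T f (Suc k) \<bullet> fcoef T q (Suc k))) sums (\<integral>t. f t * q t \<partial>I\<^sub>T)"
proof -
  define S where "S N q = (\<Sum>k<N. T / 2 * (fcoef T f (Suc k) \<bullet> fcoef T q (Suc k)))" for N q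
  define P where "P q \<longleftrightarrow> (\<lambda>N. S N q) \<longlonglongrightarrow> (\<integral>t. f t * q t \<partial>I\<^sub>T)" for q
  have S_lin: "S N (\<lambda>t. g t + r * h t) = S N g + r * S N h" if "g \<in> L2 I\<^sub>T" "h \<in> L2 I\<^sub>T" for N g h r
    unfolding S_def fcoef_lincomb[OF that]
    by (simp add: inner_add_right sum.distrib distrib_left sum_distrib_left mult.left_commute)
  have lin: "P (\<lambda>t. g t + r * h t)" if "g \<in> L2 I\<^sub>T" "h \<in> L2 I\<^sub>T" "P g" "P h" for g h r
  proof -
    have "(\<integral>t. f t * (g t + r * h t) \<partial>I\<^sub>T) = (\<integral>t. f t * g t \<partial>I\<^sub>T) + r * (\<integral>t. f t * h t \<partial>I\<^sub>T)"
      using L2_integrable_mult[OF f that(1)] L2_integrable_mult[OF f that(2)]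
      by (simp add: distrib_left mult.left_commute)
    moreover have "(\<lambda>N. S N g + r * S N h) \<longlonglongrightarrow> (\<integral>t. f t * g t \<partial>I\<^sub>T) + r * (\<integral>t. f t * h t \<partial>I\<^sub>T)"
      using that(3,4) unfolding P_def by (intro tendsto_intros)
    ultimately show ?thesis unfolding P_def S_lin[OF that(1,2)] by simp
  qed
  have lim: "P g" if s: "\<And>n::nat. s n \<in> L2 I\<^sub>T" "\<And>n. P (s n)" and g: "g \<in> L2 I\<^sub>T" and "G \<in> L2 I\<^sub>T"
      "\<And>n. AE x in I\<^sub>T. \<bar>s n x\<bar> \<le> G x" "AE x in I\<^sub>T. (\<lambda>n. s n x) \<longlonglongrightarrow> g x" for s g G
  proof -
    have conv: "(\<lambda>n. L2_norm I\<^sub>T (\<lambda>x. s n x - g x)) \<longlonglongrightarrow> 0"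
      by (rule L2_dominated_convergence(3)[OF that(4)]) (use that in \<open>auto intro: L2_measurable\<close>)
    show ?thesis
      unfolding P_def
    proof (rule LIMSEQ_I)
      fix e :: real assume e: "e > 0"
      define F where "F = L2_norm I\<^sub>T f + 1"
      have F: "F > 0" unfolding F_def using L2_norm_nonneg[of I\<^sub>T f] by linarith
      have "\<forall>\<^sub>F n in sequentially. L2_norm I\<^sub>T (\<lambda>x. s n x - g x) < e / (3 * F)"
        using conv e F by (intro order_tendstoD) auto
      then obtain n where n: "L2_norm I\<^sub>T (\<lambda>x. s n x - g x) < e / (3 * F)"
        using eventually_happens' sequentially_bot by blast
      have d: "(\<lambda>x. s n x + (-1) * g x) \<in> L2 I\<^sub>T" using L2_diff[OF s(1)[of n] g] by simp
      have small: "L2_norm I\<^sub>T f * L2_norm I\<^sub>T (\<lambda>x. s n x + (-1) * g x) \<le> e / 3"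
      proof -
        have "L2_norm I\<^sub>T f * L2_norm I\<^sub>T (\<lambda>x. s n x + (-1) * g x) \<le> F * (e / (3 * F))"
          using n F by (intro mult_mono) (auto simp: F_def)
        then show ?thesis using F by simp
      qed
      have 1: "\<bar>S N (s n) - S N g\<bar> \<le> e / 3" for N
        using order_trans[OF partial_pairing_bound[OF f d, of N] small] S_lin[OF s(1)[of n] g, of
            N "-1"]
        by (simp add: S_def)
      have 2: "\<bar>(\<integral>t. f t * s n t \<partial>I\<^sub>T) - (\<integral>t. f t * g t \<partial>I\<^sub>T)\<bar> \<le> e / 3"
        using order_trans[OF L2_Cauchy_Schwarz[OF f d] small]
          L2_integrable_mult[OF f s(1)[of n]] L2_integrable_mult[OF f g]
        by (simp add: right_diff_distrib)
      have "\<exists>N0. \<forall>N\<ge>N0. norm (S N (s n) - (\<integral>t. f t * s n t \<partial>I\<^sub>T)) < e / 3"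
        using LIMSEQ_D[OF s(2)[of n, unfolded P_def], of "e / 3"] e by simp
      then obtain N0 where N0: "\<And>N. N \<ge> N0 \<Longrightarrow> norm (S N (s n) - (\<integral>t. f t * s n t \<partial>I\<^sub>T)) < e / 3"
        by blast
      have "norm (S N g - (\<integral>t. f t * g t \<partial>I\<^sub>T)) < e" if "N \<ge> N0" for N
        using N0[OF that] 1[of N] 2 unfolding real_norm_def abs_if by (auto split: if_splits)
      then show "\<exists>N0. \<forall>N\<ge>N0. norm (S N g - (\<integral>t. f t * g t \<partial>I\<^sub>T)) < e" by blast
    qed
  qed
  have P_harmonic: "P (harmonic (Suc k) c)" for k c
  proof -
    have "\<forall>\<^sub>F N in sequentially. S N (harmonic (Suc k) c) = (\<integral>t. f t * harmonic (Suc k) c t \<partial>I\<^sub>T)"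
      using eventually_gt_at_top[of k]
    proof eventually_elim
      case (elim N)
      have "S N (harmonic (Suc k) c) = (\<Sum>j<N. if j = k then T / 2 * (fcoef T f (Suc k) \<bullet> c) else 0)"
        unfolding S_def by (intro sum.cong) (auto simp: fcoef_harmonic)
      then show ?case using elim by (simp add: integral_harmonic[OF f])
    qed
    then show ?thesis unfolding P_def by (rule tendsto_eventually)
  qed
  have P_const: "P (\<lambda>t. c)" for c
  proof -
    have "fcoef T (\<lambda>t. c) (Suc k) = 0" for k
      using integral_cos_int[of "int (Suc k)"] integral_sin_int[of "int (Suc k)"]
      by (simp add: fcoef_eq zero_prod_def del: of_nat_Suc)
    then show ?thesis unfolding P_def S_def using f0 by simp
  qed
  have const_L2: "(\<lambda>t. c) \<in> L2 I\<^sub>T" for c :: real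
    by (rule continuous_L2[where C = "\<bar>c\<bar>"]) (auto intro: continuous_intros)
  have P_trig: "trig_poly g \<Longrightarrow> g \<in> L2 I\<^sub>T \<and> P g" for g
  proof (induction rule: trig_poly.induct)
    case (base k \<theta>)
    show ?case
    proof (cases k)
      case 0
      then show ?thesis using P_const const_L2 by simp
    next
      case (Suc l)
      have "(\<lambda>t. cos (real k * \<omega> * t + \<theta>)) = harmonic (Suc l) (cos \<theta>, - sin \<theta>)"
        unfolding harmonic_def fun_eq_iff Suc by (simp add: cos_add mult.commute)
      then show ?thesis using P_harmonic harmonic_L2 by simp
    qed
  next
    case (lincomb g h r)
    then show ?case by (auto intro!: lin L2_add L2_cmult)
  qed
  have P_cont: "P (\<lambda>t. F (cos (\<omega> * t + \<phi>)))"
    if F: "continuous_on UNIV F" "\<And>x. \<bar>F x\<bar> \<le> 1" for F \<phi>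
  proof -
    have "\<exists>p. real_polynomial_function p \<and> (\<forall>x\<in>{-1..1}. \<bar>F x - p x\<bar> < 1 / Suc n)" for n
    proof -
      have "compact {-1..1::real}" "continuous_on {-1..1} F" "0 < 1 / real (Suc n)"
        using F(1) by (auto intro: continuous_on_subset)
      then show ?thesis by (rule Stone_Weierstrass_real_polynomial_function) blast
    qed
    then obtain p where p: "\<And>n. real_polynomial_function (p n)"
        "\<And>n x. x \<in> {-1..1} \<Longrightarrow> \<bar>F x - p n x\<bar> < 1 / Suc n" by metis
    have FL: "(\<lambda>t. F (cos (\<omega> * t + \<phi>))) \<in> L2 I\<^sub>T"
      using F(2) by (intro continuous_L2[where C
          = 1] continuous_on_compose2[OF F(1)]) (auto intro!: continuous_intros)
    note tp = P_trig[OF trig_poly_real_polynomial[OF p(1)]]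
    show ?thesis
    proof (rule lim[where s = "\<lambda>n t. p n (cos (\<omega> * t + \<phi>))" and G = "\<lambda>_. 2"])
      show "AE t in I\<^sub>T. \<bar>p n (cos (\<omega> * t + \<phi>))\<bar> \<le> 2" for n
      proof (rule AE_I2)
        fix t
        have "\<bar>F (cos (\<omega> * t + \<phi>)) - p n (cos (\<omega> * t + \<phi>))\<bar> < 1 / Suc n" by (rule p(2)) simp
        moreover have "1 / real (Suc n) \<le> 1" by simp
        ultimately show "\<bar>p n (cos (\<omega> * t + \<phi>))\<bar> \<le> 2" using F(2)[of "cos (\<omega> * t + \<phi>)"] by linarith
      qed
      show "AE t in I\<^sub>T. (\<lambda>n. p n (cos (\<omega> * t + \<phi>))) \<longlonglongrightarrow> F (cos (\<omega> * t + \<phi>))"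
      proof (rule AE_I2)
        fix t
        let ?x = "cos (\<omega> * t + \<phi>)"
        have "(\<lambda>n. F ?x - p n ?x) \<longlonglongrightarrow> 0"
        proof (rule Lim_null_comparison)
          show "\<forall>\<^sub>F n in sequentially. norm (F ?x - p n ?x) \<le> 1 / Suc n"
            using p(2)[of ?x] by (auto intro!: always_eventually less_imp_le)
          show "(\<lambda>n. 1 / real (Suc n)) \<longlonglongrightarrow> 0" using LIMSEQ_inverse_real_of_nat
              by (simp add: divide_inverse)
        qed
        then have "(\<lambda>n. F ?x - (F ?x - p n ?x)) \<longlonglongrightarrow> F ?x - 0" by (intro tendsto_intros)
        then show "(\<lambda>n. p n ?x) \<longlonglongrightarrow> F ?x" by simp
      qed
    qed (use tp FL const_L2 in auto)
  qed
  have P_ind: "P (indicator (box c d))" if sub: "box c d \<subseteq> box 0 T" for c d :: real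
  proof (cases "c < d")
    case False
    then have "(indicator (box c d) :: real \<Rightarrow> real) = (\<lambda>_. 0)" by (auto simp: indicator_def)
    then show ?thesis using P_const by simp
  next
    case True
    then have cd: "0 \<le> c" "d \<le> T" using sub
        by (auto simp: box_real greaterThanLessThan_subseteq_greaterThanLessThan)
    define \<alpha> where "\<alpha> = cos (\<omega> * ((d - c) / 2))"
    define \<phi> where "\<phi> = - (\<omega> * ((c + d) / 2))"
    define F where "F n x = min 1 (max 0 (real n * (x - \<alpha>)))" for n x
    have F: "continuous_on UNIV (F n)" "\<bar>F n x\<bar> \<le> 1" for n x
      unfolding F_def by (auto intro!: continuous_intros)
    have FL: "(\<lambda>t. F n (cos (\<omega> * t + \<phi>))) \<in> L2 I\<^sub>T" for n
      using F by (intro continuous_L2[where C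
          = 1] continuous_on_compose2[OF F(1)]) (auto intro!: continuous_intros)
    show ?thesis
    proof (rule lim[where s = "\<lambda>n t. F n (cos (\<omega> * t + \<phi>))" and G = "\<lambda>_. 1"])
      have "(indicator (box c d) :: real \<Rightarrow> real) \<in> borel_measurable I\<^sub>T"
        by (intro measurable_restrict_space1 measurable_completion) auto
      then show "(indicator (box c d) :: real \<Rightarrow> real) \<in> L2 I\<^sub>T"
        by (rule fm_interval.bounded_L2[where C = 1]) (auto simp: indicator_def)
      show "AE t in I\<^sub>T. (\<lambda>n. F n (cos (\<omega> * t + \<phi>))) \<longlonglongrightarrow> indicator (box c d) t"
      proof (rule AE_I2)
        fix t assume "t \<in> space I\<^sub>T"
        then have t: "0 < t" "t < T" by auto
        let ?x = "cos (\<omega> * t + \<phi>)"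
        have iff: "\<alpha> < ?x \<longleftrightarrow> t \<in> box c d"
          unfolding \<alpha>_def \<phi>_def using cos_greater_iff[OF cd(1) True cd(2) t] by (simp add: box_real)
        show "(\<lambda>n. F n ?x) \<longlonglongrightarrow> indicator (box c d) t"
        proof (cases "\<alpha> < ?x")
          case True
          obtain n0 :: nat where n0: "1 / (?x - \<alpha>) < real n0" using reals_Archimedean2 by blast
          have "\<forall>\<^sub>F n in sequentially. F n ?x = indicator (box c d) t"
            using eventually_ge_at_top[of n0]
          proof eventually_elim
            case (elim n)
            have "1 < real n0 * (?x - \<alpha>)" using n0 True by (simp add: field_simps)
            also have "\<dots> \<le> real n * (?x - \<alpha>)" using elim True by (intro mult_right_mono) auto
            finally show ?case using iff True by (simp add: F_def)
          qed
          then show ?thesis by (rule tendsto_eventually)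
        next
          case False
          have "F n ?x = indicator (box c d) t" for n
          proof -
            have "real n * (?x - \<alpha>) \<le> 0" using False by (intro mult_nonneg_nonpos) auto
            then have "F n ?x = 0" by (simp add: F_def)
            then show ?thesis using iff False by simp
          qed
          then show ?thesis by simp
        qed
      qed
    qed (use F FL P_cont const_L2 in auto)
  qed
  have I_eq: "I\<^sub>T = lebesgue_on (box 0 T)" by (simp add: box_real)
  have "P q"
    by (rule L2_box_induct[where a = 0 and b = T and P = P])
       (erule P_ind, erule (3) lin[unfolded I_eq], rule lim[unfolded I_eq], assumption+, rule
           q[unfolded I_eq])
  then show ?thesis unfolding P_def S_def sums_def by simp
qed

end

section \<open>Fourier coefficients in time\<close>

sublocale cylinder \<subseteq> period T
  using T_pos by unfold_locales

context cylinder
begin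

lemma co_si_time: "continuous_on UNIV (co k)" "\<bar>co k t\<bar> \<le> 1" "continuous_on UNIV (si k)" "\<bar>si k t\<bar>
    \<le> 1"
  by (auto intro!: continuous_intros)

lemma fourier_eq: "fourier T w k x
    = (2 / T * time_average (co k) w x, 2 / T * time_average (si k) w x)"
  by (simp add: fourier_eq_fcoef fcoef_eq time_average_def)

lemma fourier_fst_L2: "w \<in> L2 M\<^sub>Q \<Longrightarrow> (\<lambda>x. fst (fourier T w k x)) \<in> L2 M\<^sub>\<Omega>"
  and fourier_snd_L2: "w \<in> L2 M\<^sub>Q \<Longrightarrow> (\<lambda>x. snd (fourier T w k x)) \<in> L2 M\<^sub>\<Omega>"
  by (auto simp: fourier_eq simp del: times_divide_eq_left intro!: L2_cmult time_average_L2
      co_si_time)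

lemma fourier_L2: "w \<in> L2 M\<^sub>Q \<Longrightarrow> fourier T w k \<in> L2 M\<^sub>\<Omega>"
  using L2_Pair[OF fourier_fst_L2[of w k] fourier_snd_L2[of w k]] by simp

lemma fourier_lincomb_AE:
  assumes "w1 \<in> L2 M\<^sub>Q" "w2 \<in> L2 M\<^sub>Q"
  shows "AE x in M\<^sub>\<Omega>. \<forall>k. fourier T (\<lambda>z. w1 z + c * w2 z) k x = fourier T w1 k x
      + c *\<^sub>R fourier T w2 k x"
  using L2_slice_time[OF assms(1)] L2_slice_time[OF assms(2)]
  by eventually_elim (auto simp: fourier_eq_fcoef fcoef_lincomb)

lemma L2_norm_sq_slices_time:
  fixes f :: "'a \<times> real \<Rightarrow> real"
  assumes f: "f \<in> L2 M\<^sub>Q"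
  shows "integrable M\<^sub>\<Omega> (\<lambda>x. (L2_norm M\<^sub>T (\<lambda>t. f (x, t)))\<^sup>2)"
    and "(L2_norm M\<^sub>Q f)\<^sup>2 = (\<integral>x. (L2_norm M\<^sub>T (\<lambda>t. f (x, t)))\<^sup>2 \<partial>M\<^sub>\<Omega>)"
  using Q_integrable_time(2)[OF L2_integrable_sq[OF f]] Q_integral_time[OF L2_integrable_sq[OF f]]
  by (simp_all add: L2_norm_sq)

lemma Bessel_cylinder:
  assumes f: "f \<in> L2 M\<^sub>Q"
  shows "(\<Sum>k<N. T / 2 * (L2_norm M\<^sub>\<Omega> (fourier T f (Suc k)))\<^sup>2) \<le> (L2_norm M\<^sub>Q f)\<^sup>2"
proof -
  note i = L2_integrable_sq[OF fourier_L2[OF f]]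
  have "(\<Sum>k<N. T / 2 * (L2_norm M\<^sub>\<Omega> (fourier T f (Suc k)))\<^sup>2)
      = (\<integral>x. (\<Sum>k<N. T / 2 * (norm (fourier T f (Suc k) x))\<^sup>2) \<partial>M\<^sub>\<Omega>)"
    using i by (simp add: L2_norm_sq)
  also have "\<dots> \<le> (\<integral>x. (L2_norm M\<^sub>T (\<lambda>t. f (x, t)))\<^sup>2 \<partial>M\<^sub>\<Omega>)"
  proof (rule integral_mono_AE)
    show "AE x in M\<^sub>\<Omega>. (\<Sum>k<N. T / 2 * (norm (fourier T f (Suc k) x))\<^sup>2)
        \<le> (L2_norm M\<^sub>T (\<lambda>t. f (x, t)))\<^sup>2"
      using L2_slice_time[OF f] by eventually_elim (simp add: fourier_eq_fcoef Bessel del: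
          times_divide_eq_left)
    show "integrable M\<^sub>\<Omega> (\<lambda>x. \<Sum>k<N. T / 2 * (norm (fourier T f (Suc k) x))\<^sup>2)"
      using i by (intro Bochner_Integration.integrable_sum integrable_mult_right)
  qed (rule L2_norm_sq_slices_time(1)[OF f])
  finally show ?thesis using L2_norm_sq_slices_time(2)[OF f] by simp
qed

lemma fourier_norm_summable:
  assumes f: "f \<in> L2 M\<^sub>Q"
  shows "summable (\<lambda>k. (L2_norm M\<^sub>\<Omega> (fourier T f (Suc k)))\<^sup>2)"
proof -
  have "summable (\<lambda>k. T / 2 * (L2_norm M\<^sub>\<Omega> (fourier T f (Suc k)))\<^sup>2)"
    using Bessel_cylinder[OF f] T_pos by (intro summableI_nonneg_bounded) auto
  then show ?thesis using T_pos by (subst (asm) summable_cmult_iff) auto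
qed

lemma Parseval_cylinder:
  assumes f: "f \<in> L2 M\<^sub>Q" and q: "q \<in> L2 M\<^sub>Q" and mean: "AE x in M\<^sub>\<Omega>. (\<integral>t. f (x, t) \<partial>M\<^sub>T) = 0"
  shows "(\<lambda>k. T / 2 * (\<integral>x. fourier T f (Suc k) x \<bullet> fourier T q (Suc k) x \<partial>M\<^sub>\<Omega>)) sums (\<integral>z. f z * q
      z \<partial>M\<^sub>Q)"
proof -
  define S where "S N x = (\<Sum>k<N. T / 2 * (fourier T f (Suc k) x \<bullet> fourier T q (Suc k) x))" for N x
  have i: "integrable M\<^sub>\<Omega> (\<lambda>x. fourier T f k x \<bullet> fourier T q k x)" for k
    by (intro L2_integrable_inner fourier_L2 f q)
  have Si: "integrable M\<^sub>\<Omega> (S N)" for N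
    unfolding S_def[abs_def] by (intro Bochner_Integration.integrable_sum integrable_mult_right i)
  have fq: "integrable M\<^sub>Q (\<lambda>z. f z * q z)" by (rule L2_integrable_mult[OF f q])
  have "(\<lambda>N. \<integral>x. S N x \<partial>M\<^sub>\<Omega>) \<longlonglongrightarrow> (\<integral>x. (\<integral>t. f (x, t) * q (x, t) \<partial>M\<^sub>T) \<partial>M\<^sub>\<Omega>)"
  proof (rule integral_dominated_convergence)
    show "(\<lambda>x. \<integral>t. f (x, t) * q (x, t) \<partial>M\<^sub>T) \<in> borel_measurable M\<^sub>\<Omega>"
      using Q_integrable_time(2)[OF fq] by auto
    show "S N \<in> borel_measurable M\<^sub>\<Omega>" for N using Si by auto
    show "integrable M\<^sub>\<Omega> (\<lambda>x. (L2_norm M\<^sub>T (\<lambda>t. f (x, t)))\<^sup>2 + (L2_norm M\<^sub>T (\<lambda>t. q (x, t)))\<^sup>2)"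
      using L2_norm_sq_slices_time(1)[OF f] L2_norm_sq_slices_time(1)[OF q] by simp
    show "AE x in M\<^sub>\<Omega>. (\<lambda>N. S N x) \<longlonglongrightarrow> (\<integral>t. f (x, t) * q (x, t) \<partial>M\<^sub>T)"
      using L2_slice_time[OF f] L2_slice_time[OF q] mean
      by eventually_elim (use Parseval in \<open>simp add: sums_def S_def fourier_eq_fcoef\<close>)
    show "AE x in M\<^sub>\<Omega>. norm (S N x) \<le> (L2_norm M\<^sub>T (\<lambda>t. f (x, t)))\<^sup>2
        + (L2_norm M\<^sub>T (\<lambda>t. q (x, t)))\<^sup>2" for N
      using L2_slice_time[OF f] L2_slice_time[OF q]
    proof eventually_elim
      case (elim x)
      let ?a = "L2_norm M\<^sub>T (\<lambda>t. f (x, t))" and ?b = "L2_norm M\<^sub>T (\<lambda>t. q (x, t))"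
      have "norm (S N x) \<le> ?a * ?b"
        using partial_pairing_bound[OF elim] by (simp add: S_def fourier_eq_fcoef)
      also have "\<dots> \<le> ?a\<^sup>2 + ?b\<^sup>2"
        using sum_squares_bound[of ?a ?b]
          mult_nonneg_nonneg[OF L2_norm_nonneg[of M\<^sub>T "\<lambda>t. f (x, t)"] L2_norm_nonneg[of M\<^sub>T "\<lambda>t. q
              (x, t)"]]
        by linarith
      finally show ?case .
    qed
  qed
  moreover have "(\<integral>x. S N x \<partial>M\<^sub>\<Omega>)
      = (\<Sum>k<N. T / 2 * (\<integral>x. fourier T f (Suc k) x \<bullet> fourier T q (Suc k) x \<partial>M\<^sub>\<Omega>))" for N
    unfolding S_def using i by (simp add: Bochner_Integration.integral_sum)
  ultimately show ?thesis
    using Q_integral_time[OF fq] by (simp add: sums_def)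
qed

end

section \<open>Integration by parts in time\<close>

text \<open>Composing the flat function with itself, \<open>r \<mapsto> flat 1 (1/2 - flat 1 r)\<close>, gives a function
  that is constant for \<open>r \<le> 0\<close> and vanishes as soon as \<open>flat 1 r\<close> exceeds one half, which happens
  before \<open>r = 2\<close>. The step is one minus this function, normalised.\<close>

lemma smooth_step_exists:
  "\<exists>s s' C. smooth_expr s \<and> (\<forall>r. (s has_real_derivative s' r) (at r)) \<and> continuous_on UNIV s' \<and>
     (\<forall>r\<le>0. s r = 0) \<and> (\<forall>r\<ge>2. s r = 1) \<and> (\<forall>r. 0 \<le> s r \<and> s r \<le> 1) \<and>
     (\<forall>r. \<bar>s' r\<bar> \<le> C) \<and> (\<forall>r>2. s' r = 0)"
proof -
  define s :: "real \<Rightarrow> real" where "s r = 1 + (-1 / smooth_ramp (1 / 2)) * smooth_ramp (1 / 2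
      + (-1) * smooth_ramp (r \<bullet> 1))" for r
  have e: "smooth_expr s"
    unfolding s_def[abs_def] by (intro smooth_expr.intros)
  obtain D where D: "\<And>x. (s has_derivative D x) (at x)" "\<And>b. smooth_expr (\<lambda>x. D x b)"
    using smooth_expr_derivative[OF e] by blast
  define s' where "s' r = D r 1" for r
  have d: "(s has_real_derivative s' r) (at r)" for r
  proof -
    have "D r = (*) (D r 1)"
      using has_derivative_bounded_linear[OF D(1), of r] real_bounded_linear
          by (metis mult.commute mult_1 ext)
    then show ?thesis using D(1)[of r] unfolding has_field_derivative_def s'_def by simp
  qed
  have c: "continuous_on UNIV s'"
    using smooth_continuous[OF smooth_expr_imp_smooth[OF D(2)]] unfolding s'_def[abs_def] .
  have half: "0 < smooth_ramp (1 / 2)" by (simp add: flat_def)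
  have s0: "s r = 0" if "r \<le> 0" for r
    using that half by (simp add: s_def flat_def)
  have s1: "s r = 1" if "r \<ge> 2" for r
  proof -
    have "1 / 2 \<le> exp (- (1 / r))"
    proof -
      have "1 / 2 \<le> 1 + - (1 / r)" using that by (simp add: field_simps)
      also have "\<dots> \<le> exp (- (1 / r))" by (rule exp_ge_add_one_self)
      finally show ?thesis .
    qed
    then show ?thesis using that by (simp add: s_def flat_def)
  qed
  have mono: "smooth_ramp a \<le> smooth_ramp b" if "a \<le> b" for a b
    using that by (auto simp: flat_def field_simps)
  have b01: "0 \<le> s r \<and> s r \<le> 1" for r
  proof -
    have "smooth_ramp (1 / 2 + (-1) * smooth_ramp r) \<le> smooth_ramp (1 / 2)"
      using smooth_ramp_bounds(1)[of r] by (intro mono) simp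
    then show ?thesis
      using half smooth_ramp_bounds(1)[of "1 / 2 + (-1) * smooth_ramp r"]
          by (simp add: s_def field_simps)
  qed
  have z: "s' r = 0" if "r < 0 \<or> r > 2" for r
  proof -
    have "(s has_real_derivative 0) (at r)"
    proof (cases "r < 0")
      case True
      have "((\<lambda>_. 0) has_real_derivative 0) (at r)" by simp
      then show ?thesis
        by (rule has_field_derivative_transform_within_open[where S = "{..<0}"])
            (use s0 True in auto)
    next
      case False
      have "((\<lambda>_. 1) has_real_derivative 0) (at r)" by simp
      then show ?thesis
        by (rule has_field_derivative_transform_within_open[where S = "{2<..}"])
            (use s1 that False in auto)
    qed
    then show ?thesis using d DERIV_unique by blast
  qed
  obtain C where "\<And>r. norm (s' r) \<le> C"
    by (rule continuous_compact_support_bounded[OF c, of "{0..2}"]) (use z in \<open>auto simp: not_le\<close>)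
  then have "\<forall>r. \<bar>s' r\<bar> \<le> C" by simp
  with e d c s0 s1 b01 z show ?thesis by blast
qed

context period
begin

lemma integral_indicator_end:
  assumes "a \<ge> 0"
  shows "(\<integral>t. indicator {..a} t \<partial>I\<^sub>T) \<le> a" "(\<integral>t. indicator {T - a..} t \<partial>I\<^sub>T) \<le> a"
proof -
  have "(\<integral>t. indicator {..a} t \<partial>I\<^sub>T) = measure I\<^sub>T ({..a} \<inter> {0<..<T})" by simp
  also have "\<dots> = measure lebesgue ({..a} \<inter> {0<..<T})"
    by (rule measure_restrict_space) auto
  also have "\<dots> \<le> measure lebesgue {0..a}"
    by (intro measure_mono_fmeasurable) auto
  finally show "(\<integral>t. indicator {..a} t \<partial>I\<^sub>T) \<le> a" using assms by simp
  have "(\<integral>t. indicator {T - a..} t \<partial>I\<^sub>T) = measure I\<^sub>T ({T - a..} \<inter> {0<..<T})" by simp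
  also have "\<dots> = measure lebesgue ({T - a..} \<inter> {0<..<T})"
    by (rule measure_restrict_space) auto
  also have "\<dots> \<le> measure lebesgue {T - a..T}"
    by (intro measure_mono_fmeasurable) auto
  finally show "(\<integral>t. indicator {T - a..} t \<partial>I\<^sub>T) \<le> a" using assms by simp
qed

text \<open>The cutoffs rise from zero to one within the distance \<open>3 / (n + 1)\<close> of the two ends of the
  interval. The bound on the derivative implies that its integral in absolute value is bounded
  uniformly in \<open>n\<close>, although the derivative itself is not.\<close>

lemma cutoff_sequence_exists:
  "\<exists>\<kappa> \<kappa>' C. (\<forall>n. smooth_expr (\<kappa> n)) \<and> (\<forall>n t. (\<kappa> n has_real_derivative \<kappa>' n t) (at t)) \<and>
     (\<forall>n. continuous_on UNIV (\<kappa>' n)) \<and> (\<forall>n. test_function {0<..<T} (\<kappa> n)) \<and>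
     (\<forall>n t. \<bar>\<kappa> n t\<bar> \<le> 1) \<and> (\<forall>t. 0 < t \<longrightarrow> t < T \<longrightarrow> (\<lambda>n. \<kappa> n t) \<longlonglongrightarrow> 1) \<and>
     (\<forall>n t. \<bar>\<kappa>' n t\<bar> \<le> real (Suc n) * C * (indicator {..3 / real (Suc n)} t
         + indicator {T - 3 / real (Suc n)..} t))"
proof -
  obtain s s' C where s: "smooth_expr s" "\<And>r. (s has_real_derivative s' r) (at r)" "continuous_on
      UNIV s'"
     "\<And>r. r \<le> 0 \<Longrightarrow> s r = 0" "\<And>r. r \<ge> 2 \<Longrightarrow> s r = 1" "\<And>r. 0 \<le> s r" "\<And>r. s r \<le> 1"
     "\<And>r. \<bar>s' r\<bar> \<le> C" "\<And>r. r > 2 \<Longrightarrow> s' r = 0"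
    using smooth_step_exists by metis
  define \<kappa> where "\<kappa> n t = s (real (Suc n) * t - 1) * s (real (Suc n) * (T - t) - 1)" for n t
  define \<kappa>' where "\<kappa>' n t = real (Suc n) * s' (real (Suc n) * t - 1) * s (real (Suc n) * (T - t) -
      1)
     - real (Suc n) * s (real (Suc n) * t - 1) * s' (real (Suc n) * (T - t) - 1)" for n t
  have cs: "continuous_on UNIV s" by (rule smooth_continuous[OF smooth_expr_imp_smooth[OF s(1)]])
  have C0: "C \<ge> 0" using s(8)[of 0] abs_ge_zero[of "s' 0"] by linarith
  have comp: "smooth_expr (\<lambda>t. f (r * t + c))" if "smooth_expr f" for f :: "real \<Rightarrow> real" and r c
    using that
  proof induction
    case (inner a)
    have "smooth_expr (\<lambda>t::real. t \<bullet> (r * a) + c * a)" by (intro smooth_expr.intros)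
    then show ?case by (simp add: algebra_simps)
  qed (intro smooth_expr.intros; assumption)+
  have "smooth_expr (\<kappa> n)" for n
  proof -
    have "smooth_expr (\<lambda>t. s (real (Suc n) * t + (- 1)) * s (- real (Suc n) * t
        + (real (Suc n) * T - 1)))"
      by (intro smooth_expr.mult comp s(1))
    moreover have "(\<lambda>t. s (real (Suc n) * t + (- 1)) * s (- real (Suc n) * t
        + (real (Suc n) * T - 1))) = \<kappa> n"
      by (simp add: \<kappa>_def fun_eq_iff algebra_simps)
    ultimately show ?thesis by simp
  qed
  note e = this
  have d: "(\<kappa> n has_real_derivative \<kappa>' n t) (at t)" for n t
  proof -
    have 1: "((\<lambda>t. s (real (Suc n) * t - 1)) has_real_derivative s' (real (Suc n) * t - 1) * real
        (Suc n)) (at t)"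
      by (rule DERIV_chain2[OF s(2)]) (auto intro!: derivative_eq_intros)
    have 2: "((\<lambda>t. s (real (Suc n) * (T - t) - 1)) has_real_derivative s' (real (Suc n) * (T - t)
        - 1) * - real (Suc n)) (at t)"
      by (rule DERIV_chain2[OF s(2)]) (auto intro!: derivative_eq_intros)
    from DERIV_mult[OF 1 2] show ?thesis
      unfolding \<kappa>_def[abs_def] by (rule DERIV_cong) (simp add: \<kappa>'_def algebra_simps)
  qed
  have c: "continuous_on UNIV (\<kappa>' n)" for n
    unfolding \<kappa>'_def[abs_def]
    by (intro continuous_intros continuous_on_compose2[OF s(3)] continuous_on_compose2[OF cs]) auto
  have supp: "\<kappa> n t = 0" if "t \<notin> {1 / real (Suc n)..T - 1 / real (Suc n)}" for n t
  proof -
    have "real (Suc n) * t - 1 \<le> 0 \<or> real (Suc n) * (T - t) - 1 \<le> 0"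
      using that by (auto simp: field_simps simp del: of_nat_Suc)
    then show ?thesis using s(4) unfolding \<kappa>_def by auto
  qed
  have t: "test_function {0<..<T} (\<kappa> n)" for n
  proof -
    have "{1 / real (Suc n)..T - 1 / real (Suc n)} \<subseteq> {0<..<T}"
    proof
      fix t assume t: "t \<in> {1 / real (Suc n)..T - 1 / real (Suc n)}"
      have "1 / real (Suc n) > 0" by simp
      then show "t \<in> {0<..<T}" using t unfolding atLeastAtMost_iff greaterThanLessThan_iff
          by linarith
    qed
    then show ?thesis
      unfolding test_function_def using supp smooth_expr_imp_smooth[OF e]
      by (intro conjI exI[of _ "{1 / real (Suc n)..T - 1 / real (Suc n)}"]) auto
  qed
  have bd: "\<bar>\<kappa> n t\<bar> \<le> 1" for n t
    unfolding \<kappa>_def abs_mult using s(6,7) by (intro mult_le_one) auto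
  have lim: "(\<lambda>n. \<kappa> n t) \<longlonglongrightarrow> 1" if "0 < t" "t < T" for t
  proof (rule tendsto_eventually)
    have top: "filterlim (\<lambda>n. real (Suc n) * u) at_top sequentially" if "u > 0" for u
      using that by real_asymp
    have "filterlim (\<lambda>n. real (Suc n) * t) at_top sequentially" "filterlim (\<lambda>n. real (Suc n) * (T
        - t)) at_top sequentially"
      using top[OF that(1)] top[of "T - t"] that(2) by auto
    then have "\<forall>\<^sub>F n in sequentially. real (Suc n) * t \<ge> 3" "\<forall>\<^sub>F n in sequentially. real (Suc n) *
        (T - t) \<ge> 3"
      unfolding filterlim_at_top by blast+
    then show "\<forall>\<^sub>F n in sequentially. \<kappa> n t = 1"
      by eventually_elim (simp add: \<kappa>_def s(5))
  qed
  have b': "\<bar>\<kappa>' n t\<bar> \<le> real (Suc n) * C * (indicator {..3 / real (Suc n)} t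
      + indicator {T - 3 / real (Suc n)..} t)" for n t
  proof -
    let ?n = "real (Suc n)"
    have n: "?n > 0" by simp
    have 1: "\<bar>s' (?n * t - 1)\<bar> \<le> C * indicator {..3 / ?n} t"
    proof (cases "t \<le> 3 / ?n")
      case False
      then have "?n * t - 1 > 2" using n by (simp add: field_simps del: of_nat_Suc)
      then show ?thesis using s(9) False by simp
    qed (use s(8) in simp)
    have 2: "\<bar>s' (?n * (T - t) - 1)\<bar> \<le> C * indicator {T - 3 / ?n..} t"
    proof (cases "T - 3 / ?n \<le> t")
      case False
      then have "?n * (T - t) - 1 > 2" using n by (simp add: field_simps del: of_nat_Suc)
      then show ?thesis using s(9) False by simp
    qed (use s(8) in simp)
    have "\<bar>\<kappa>' n t\<bar> \<le> \<bar>?n * s' (?n * t - 1) * s (?n * (T - t) - 1)\<bar>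
        + \<bar>?n * s (?n * t - 1) * s' (?n * (T - t) - 1)\<bar>"
      unfolding \<kappa>'_def by (rule abs_triangle_ineq4)
    also have "\<bar>?n * s' (?n * t - 1) * s (?n * (T - t) - 1)\<bar>
        \<le> ?n * (C * indicator {..3 / ?n} t) * 1"
      unfolding abs_mult using 1 n s(6,7) C0 by (intro mult_mono) auto
    also have "\<bar>?n * s (?n * t - 1) * s' (?n * (T - t) - 1)\<bar>
        \<le> ?n * 1 * (C * indicator {T - 3 / ?n..} t)"
      unfolding abs_mult using 2 n s(6,7) C0 by (intro mult_mono) auto
    finally show ?thesis by (simp add: algebra_simps)
  qed
  show ?thesis
    using e d c t bd lim b' by (intro exI[of _ \<kappa>] exI[of _ \<kappa>'] exI[of _ C]) blast
qed

end

context cylinder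
begin

lemma L2_mult_bounded_time:
  fixes f :: "'a \<times> real \<Rightarrow> real" and c :: "real \<Rightarrow> real"
  assumes "f \<in> L2 M\<^sub>Q" "continuous_on UNIV c" "\<And>t. \<bar>c t\<bar> \<le> B"
  shows "(\<lambda>z. f z * c (snd z)) \<in> L2 M\<^sub>Q"
  using L2_bounded_mult[OF assms(1) Q_lift_snd_measurable[OF assms(2)], of B] assms(3)
  by (simp add: mult.commute)

lemma L2_lift_fst:
  fixes a :: "'a \<Rightarrow> real"
  assumes "a \<in> L2 M\<^sub>\<Omega>" shows "(\<lambda>z. a (fst z)) \<in> L2 M\<^sub>Q"
  using L2_lift[OF assms, of "\<lambda>_. 1"] by simp

lemma L1_le_L2:
  fixes f :: "'a \<Rightarrow> real"
  assumes "f \<in> L2 M\<^sub>\<Omega>"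
  shows "(\<integral>x. \<bar>f x\<bar> \<partial>M\<^sub>\<Omega>) \<le> L2_norm M\<^sub>\<Omega> (\<lambda>x. 1 :: real) * L2_norm M\<^sub>\<Omega> f"
proof -
  have a: "(\<lambda>x. \<bar>f x\<bar>) \<in> L2 M\<^sub>\<Omega>"
    by (rule L2_dominated[OF assms]) (use L2_measurable[OF assms] in auto)
  have 1: "(\<lambda>x. 1 :: real) \<in> L2 M\<^sub>\<Omega>" by (rule fm_domain.bounded_L2[where C = 1]) auto
  have "\<bar>\<integral>x. 1 \<bullet> \<bar>f x\<bar> \<partial>M\<^sub>\<Omega>\<bar> \<le> L2_norm M\<^sub>\<Omega> (\<lambda>x. 1 :: real) * L2_norm M\<^sub>\<Omega> (\<lambda>x. \<bar>f x\<bar>)"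
    by (rule L2_Cauchy_Schwarz[OF 1 a])
  moreover have "L2_norm M\<^sub>\<Omega> (\<lambda>x. \<bar>f x\<bar>) = L2_norm M\<^sub>\<Omega> f" by (simp add: L2_norm_def)
  ultimately show ?thesis by simp
qed

text \<open>Because the end values of \<open>w\<close> and of \<open>\<psi>\<close> agree, one function \<open>a\<close> is the limit of the slices
  of \<open>w \<psi>\<close> at both ends of the interval.\<close>

lemma trace_distance_small:
  fixes \<psi> :: "real \<Rightarrow> real"
  assumes w: "w \<in> L2 M\<^sub>Q" and per: "time_periodic \<Omega> T w"
    and \<psi>: "continuous_on UNIV \<psi>" "\<psi> 0 = \<psi> T" "\<And>t. \<bar>\<psi> t\<bar> \<le> B"
  shows "\<exists>a. a \<in> L2 M\<^sub>\<Omega> \<and> (\<forall>\<epsilon>>0. \<exists>\<delta>>0. AE t in M\<^sub>T. t < \<delta> \<or> T - t < \<delta> \<longrightarrow>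
     (\<integral>x. \<bar>w (x, t) * \<psi> t - a x\<bar> \<partial>M\<^sub>\<Omega>) \<le> \<epsilon>)"
proof -
  from per[unfolded time_periodic_def] obtain W where W:
    "(\<forall>t\<in>{0..T}. W t \<in> L2 M\<^sub>\<Omega>) \<and>
     (\<forall>t\<in>{0..T}. ((\<lambda>s. L2_norm M\<^sub>\<Omega> (\<lambda>x. W s x - W t x)) \<longlongrightarrow> 0) (at t within {0..T})) \<and>
     (AE t in M\<^sub>T. AE x in M\<^sub>\<Omega>. W t x = w (x, t)) \<and> (AE x in M\<^sub>\<Omega>. W 0 x = W T x)" ..
  then have WL: "\<And>t. t \<in> {0..T} \<Longrightarrow> W t \<in> L2 M\<^sub>\<Omega>"
    and Wc: "\<And>t. t \<in> {0..T} \<Longrightarrow> ((\<lambda>s. L2_norm M\<^sub>\<Omega> (\<lambda>x. W s x - W t x)) \<longlongrightarrow> 0) (at t within {0..T})"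
    and Ww: "AE t in M\<^sub>T. AE x in M\<^sub>\<Omega>. W t x = w (x, t)"
    and W0T: "AE x in M\<^sub>\<Omega>. W 0 x = W T x"
    by blast+
  define m where "m = L2_norm M\<^sub>\<Omega> (\<lambda>x. 1 :: real)"
  have m0: "m \<ge> 0" by (simp add: m_def)
  have ends: "0 \<in> {0..T}" "T \<in> {0..T}" using T_pos by auto
  define a where "a x = \<psi> 0 * W 0 x" for x
  define E where "E p t = B * (m * L2_norm M\<^sub>\<Omega> (\<lambda>x. W t x - W p x))
      + \<bar>\<psi> t - \<psi> p\<bar> * (m * L2_norm M\<^sub>\<Omega> (W p))" for p t
  have aL: "a \<in> L2 M\<^sub>\<Omega>" unfolding a_def by (intro L2_cmult WL ends)
  have Elim: "(E p \<longlongrightarrow> 0) (at p within {0..T})" if p: "p \<in> {0..T}" for p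
  proof -
    have "(\<psi> \<longlongrightarrow> \<psi> p) (at p within {0..T})"
      using \<psi>(1) by (metis UNIV_I continuous_on_def continuous_on_subset p subset_UNIV)
    then have "(E p \<longlongrightarrow> B * (m * 0) + \<bar>\<psi> p - \<psi> p\<bar> * (m * L2_norm M\<^sub>\<Omega> (W p))) (at p within {0..T})"
      unfolding E_def by (intro tendsto_intros Wc p)
    then show ?thesis by simp
  qed
  have bound: "AE t in M\<^sub>T. (\<integral>x. \<bar>w (x, t) * \<psi> t - a x\<bar> \<partial>M\<^sub>\<Omega>) \<le> E p t"
    if p: "p \<in> {0..T}" and a: "AE x in M\<^sub>\<Omega>. a x = \<psi> p * W p x" for p
    using Ww L2_slice_space[OF w] AE_space
  proof eventually_elim
    case (elim t)
    then have t: "t \<in> {0..T}" by auto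
    have Bm: "0 \<le> B" using \<psi>(3)[of 0] abs_ge_zero[of "\<psi> 0"] by linarith
    note Lt = WL[OF t] and Lp = WL[OF p] and Ltp = L2_diff[OF WL[OF t] WL[OF p]]
    have abs_i: "integrable M\<^sub>\<Omega> (\<lambda>x. \<bar>f x\<bar>)" if "f \<in> L2 M\<^sub>\<Omega>" for f :: "'a \<Rightarrow> real"
      using fm_domain.L2_integrable[OF that] by simp
    have "(\<integral>x. \<bar>w (x, t) * \<psi> t - a x\<bar> \<partial>M\<^sub>\<Omega>)
        \<le> (\<integral>x. B * \<bar>W t x - W p x\<bar> + \<bar>\<psi> t - \<psi> p\<bar> * \<bar>W p x\<bar> \<partial>M\<^sub>\<Omega>)"
    proof (rule integral_mono_AE)
      have "(\<lambda>x. w (x, t) * \<psi> t - a x) \<in> L2 M\<^sub>\<Omega>"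
        using L2_diff[OF L2_cmult[OF elim(2), of "\<psi> t"] aL] by (simp add: mult.commute)
      then show "integrable M\<^sub>\<Omega> (\<lambda>x. \<bar>w (x, t) * \<psi> t - a x\<bar>)" by (rule abs_i)
      show "integrable M\<^sub>\<Omega> (\<lambda>x. B * \<bar>W t x - W p x\<bar> + \<bar>\<psi> t - \<psi> p\<bar> * \<bar>W p x\<bar>)"
        using abs_i[OF Ltp] abs_i[OF Lp] by simp
      show "AE x in M\<^sub>\<Omega>. \<bar>w (x, t) * \<psi> t - a x\<bar> \<le> B * \<bar>W t x - W p x\<bar> + \<bar>\<psi> t - \<psi> p\<bar> * \<bar>W p x\<bar>"
        using elim(1) a
      proof eventually_elim
        case (elim x)
        have "w (x, t) * \<psi> t - a x = \<psi> t * (W t x - W p x) + (\<psi> t - \<psi> p) * W p x"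
          using elim by (simp add: algebra_simps)
        then have "\<bar>w (x, t) * \<psi> t - a x\<bar> \<le> \<bar>\<psi> t\<bar> * \<bar>W t x - W p x\<bar> + \<bar>\<psi> t - \<psi> p\<bar> * \<bar>W p x\<bar>"
          by (metis abs_mult abs_triangle_ineq)
        moreover have "\<bar>\<psi> t\<bar> * \<bar>W t x - W p x\<bar> \<le> B * \<bar>W t x - W p x\<bar>"
          using \<psi>(3) by (intro mult_right_mono) auto
        ultimately show ?case by linarith
      qed
    qed
    also have "\<dots> = B * (\<integral>x. \<bar>W t x - W p x\<bar> \<partial>M\<^sub>\<Omega>) + \<bar>\<psi> t - \<psi> p\<bar> * (\<integral>x. \<bar>W p x\<bar> \<partial>M\<^sub>\<Omega>)"
      using abs_i[OF Ltp] abs_i[OF Lp] by simp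
    also have "\<dots> \<le> E p t"
      unfolding E_def m_def using Bm
      by (intro add_mono mult_left_mono L1_le_L2 Ltp Lp) auto
    finally show ?case .
  qed
  have b0: "AE t in M\<^sub>T. (\<integral>x. \<bar>w (x, t) * \<psi> t - a x\<bar> \<partial>M\<^sub>\<Omega>) \<le> E 0 t"
    by (rule bound) (use T_pos in \<open>auto simp: a_def\<close>)
  have bT: "AE t in M\<^sub>T. (\<integral>x. \<bar>w (x, t) * \<psi> t - a x\<bar> \<partial>M\<^sub>\<Omega>) \<le> E T t"
    by (rule bound) (use T_pos W0T \<psi>(2) in \<open>auto simp: a_def\<close>)
  have "\<exists>\<delta>>0. AE t in M\<^sub>T. t < \<delta> \<or> T - t < \<delta> \<longrightarrow> (\<integral>x. \<bar>w (x, t) * \<psi> t - a x\<bar> \<partial>M\<^sub>\<Omega>) \<le> \<epsilon>"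
      if \<epsilon>: "\<epsilon> > 0" for \<epsilon>
  proof -
    have "\<forall>\<^sub>F t in at 0 within {0..T}. E 0 t < \<epsilon>" "\<forall>\<^sub>F t in at T within {0..T}. E T t < \<epsilon>"
      using Elim[OF ends(1)] Elim[OF ends(2)] \<epsilon> by (auto intro: order_tendstoD)
    then obtain d1 d2 where d: "d1 > 0" "\<And>t. t \<in> {0..T} \<Longrightarrow> t \<noteq> 0 \<Longrightarrow> dist t 0 < d1 \<Longrightarrow> E 0 t < \<epsilon>"
        "d2 > 0" "\<And>t. t \<in> {0..T} \<Longrightarrow> t \<noteq> T \<Longrightarrow> dist t T < d2 \<Longrightarrow> E T t < \<epsilon>"
      unfolding eventually_at by metis
    have "AE t in M\<^sub>T. t < min d1 d2 \<or> T - t < min d1 d2 \<longrightarrow> (\<integral>x. \<bar>w (x, t) * \<psi> t - a x\<bar> \<partial>M\<^sub>\<Omega>) \<le> \<epsilon>"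
      using b0 bT AE_space
    proof eventually_elim
      case (elim t)
      then have t: "0 < t" "t < T" by auto
      show ?case
      proof
        assume "t < min d1 d2 \<or> T - t < min d1 d2"
        then consider "t < d1" | "T - t < d2" by auto
        then show "(\<integral>x. \<bar>w (x, t) * \<psi> t - a x\<bar> \<partial>M\<^sub>\<Omega>) \<le> \<epsilon>"
        proof cases
          case 1
          then have "E 0 t < \<epsilon>" using t by (intro d(2)) (auto simp: dist_real_def)
          then show ?thesis using elim(1) by linarith
        next
          case 2
          then have "E T t < \<epsilon>" using t by (intro d(4)) (auto simp: dist_real_def)
          then show ?thesis using elim(2) by linarith
        qed
      qed
    qed
    then show ?thesis using d by (intro exI[of _ "min d1 d2"]) auto
  qed
  then show ?thesis using aL by blast
qed

text \<open>The weak time derivative is defined by test functions that vanish near the ends of the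
  interval. For a periodic \<open>\<psi>\<close> one applies it to \<open>\<kappa> n * \<psi>\<close> with the cutoffs \<open>\<kappa> n\<close>. The boundary
  contribution \<open>zz n\<close> contains the derivative of the cutoff, which has integral zero and is
  concentrated near the two ends; there \<open>w \<psi>\<close> is close to one common function \<open>a\<close>, so that \<open>zz n\<close>
  tends to zero in \<open>L1\<close>. On the other hand it converges pointwise to the defect of the claimed
  identity.\<close>

lemma periodic_integration_by_parts:
  fixes \<psi> \<psi>' :: "real \<Rightarrow> real"
  assumes w: "w \<in> L2 M\<^sub>Q" and h: "is_dt \<Omega> T w h" and per: "time_periodic \<Omega> T w"
    and \<psi>: "smooth_expr \<psi>" "\<And>t. (\<psi> has_real_derivative \<psi>' t) (at t)" "continuous_on UNIV \<psi>'"
      "\<psi> 0 = \<psi> T" "\<And>t. \<bar>\<psi> t\<bar> \<le> B" "\<And>t. \<bar>\<psi>' t\<bar> \<le> B"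
  shows "AE x in M\<^sub>\<Omega>. (\<integral>t. w (x, t) * \<psi>' t \<partial>M\<^sub>T) = - (\<integral>t. h (x, t) * \<psi> t \<partial>M\<^sub>T)"
proof -
  have hL: "h \<in> L2 M\<^sub>Q"
    and hw: "\<And>\<phi>. test_function {0<..<T} \<phi> \<Longrightarrow> AE x in M\<^sub>\<Omega>. (\<integral>t. w (x, t) * deriv \<phi> t \<partial>M\<^sub>T) =
        - (\<integral>t. h (x, t) * \<phi> t \<partial>M\<^sub>T)"
    using h unfolding is_dt_def by auto
  have \<psi>c: "continuous_on UNIV \<psi>" by (rule smooth_continuous[OF smooth_expr_imp_smooth[OF \<psi>(1)]])
  have B0: "0 \<le> B" using \<psi>(5)[of 0] abs_ge_zero[of "\<psi> 0"] by linarith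
  obtain \<kappa> \<kappa>' C where \<kappa>: "\<And>n. smooth_expr (\<kappa> n)" "\<And>n t. (\<kappa> n has_real_derivative \<kappa>' n t) (at t)"
     "\<And>n. continuous_on UNIV (\<kappa>' n)" "\<And>n. test_function {0<..<T} (\<kappa> n)"
     "\<And>n t. \<bar>\<kappa> n t\<bar> \<le> 1" "\<And>t. 0 < t \<Longrightarrow> t < T \<Longrightarrow> (\<lambda>n. \<kappa> n t) \<longlonglongrightarrow> 1"
     "\<And>n t. \<bar>\<kappa>' n t\<bar> \<le> real (Suc n) * C * (indicator {..3 / real (Suc n)} t
         + indicator {T - 3 / real (Suc n)..} t)"
    using cutoff_sequence_exists by metis
  have \<kappa>c: "continuous_on UNIV (\<kappa> n)" for n
      by (rule smooth_continuous[OF smooth_expr_imp_smooth[OF \<kappa>(1)]])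
  have C0: "C \<ge> 0"
  proof -
    have "0 \<le> \<bar>\<kappa>' 0 0\<bar>" by simp
    also have "\<dots> \<le> C * (indicator {..3} (0::real) + indicator {T - 3..} (0::real))"
        using \<kappa>(7)[of 0 0] by simp
    finally have "0 \<le> C * (1 + indicator {T - 3..} (0::real))" by simp
    moreover have "(0::real) < 1 + indicator {T - 3..} (0::real)" by (rule add_pos_nonneg) auto
    ultimately show ?thesis by (simp only: zero_le_mult_iff) linarith
  qed
  have \<kappa>'b: "\<bar>\<kappa>' n t\<bar> \<le> real (Suc n) * C * 2" for n t
  proof -
    have "real (Suc n) * C * (indicator {..3 / real (Suc n)} t
        + indicator {T - 3 / real (Suc n)..} t) \<le> real (Suc n) * C * 2"
      using C0 by (intro mult_left_mono) (auto simp: indicator_def)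
    then show ?thesis using \<kappa>(7)[of n t] by linarith
  qed
  have tf: "test_function {0<..<T} (\<lambda>t. \<kappa> n t * \<psi> t)" for n
  proof -
    have "smooth (\<lambda>t. \<kappa> n t * \<psi> t)" by (intro smooth_expr_imp_smooth smooth_expr.mult \<kappa> \<psi>)
    then show ?thesis using \<kappa>(4)[of n] unfolding test_function_def by auto
  qed
  have der: "deriv (\<lambda>t. \<kappa> n t * \<psi> t) t = \<kappa>' n t * \<psi> t + \<kappa> n t * \<psi>' t" for n t
    by (rule DERIV_imp_deriv) (auto intro!: derivative_eq_intros \<kappa>(2) \<psi>(2))
  have ae1: "AE x in M\<^sub>\<Omega>. \<forall>n. (\<integral>t. w (x, t) * (\<kappa>' n t * \<psi> t + \<kappa> n t * \<psi>' t) \<partial>M\<^sub>T) =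
      - (\<integral>t. h (x, t) * (\<kappa> n t * \<psi> t) \<partial>M\<^sub>T)"
    using hw[OF tf] unfolding der by (simp add: AE_all_countable)
  define zz where "zz n x = (\<integral>t. w (x, t) * (\<kappa>' n t * \<psi> t) \<partial>M\<^sub>T)" for n x
  define Z where "Z x = - (\<integral>t. h (x, t) * \<psi> t \<partial>M\<^sub>T) - (\<integral>t. w (x, t) * \<psi>' t \<partial>M\<^sub>T)" for x
  define dom where "dom x = B * (\<integral>t. \<bar>h (x, t)\<bar> \<partial>M\<^sub>T) + B * (\<integral>t. \<bar>w (x, t)\<bar> \<partial>M\<^sub>T)" for x
  have bi: "integrable M\<^sub>T (\<lambda>t. f t * c t)" if "f \<in> L2 M\<^sub>T" "continuous_on UNIV c" "\<And>t. \<bar>c t\<bar> \<le> D"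
      for f c :: "real \<Rightarrow> real" and D
    by (rule L2_integrable_mult[OF that(1) continuous_L2[OF that(2,3)]])
  have \<kappa>B: "\<bar>\<kappa> n t * \<psi>' t\<bar> \<le> B" for n t
    using mult_mono[OF \<kappa>(5)[of n t] \<psi>(6)[of t]] by (simp add: abs_mult)
  have zz_eq: "AE x in M\<^sub>\<Omega>. \<forall>n. zz n x = - (\<integral>t. h (x, t) * (\<kappa> n t * \<psi> t) \<partial>M\<^sub>T)
      - (\<integral>t. w (x, t) * (\<kappa> n t * \<psi>' t) \<partial>M\<^sub>T)"
    using ae1 L2_slice_time[OF w]
  proof eventually_elim
    case (elim x)
    show ?case
    proof
      fix n
      have "integrable M\<^sub>T (\<lambda>t. w (x, t) * (\<kappa>' n t * \<psi> t))"
        by (rule bi[OF elim(2), where D = "real (Suc n) * C * 2 * B"])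
           (use \<kappa>'b \<psi>(5) C0 in \<open>auto simp: abs_mult intro!: continuous_intros \<kappa>(3) \<psi>c mult_mono
               simp del: of_nat_Suc\<close>)
      moreover have "integrable M\<^sub>T (\<lambda>t. w (x, t) * (\<kappa> n t * \<psi>' t))"
        by (rule bi[OF elim(2) _ \<kappa>B]) (intro continuous_intros \<kappa>c \<psi>(3))
      ultimately have "(\<integral>t. w (x, t) * (\<kappa>' n t * \<psi> t + \<kappa> n t * \<psi>' t) \<partial>M\<^sub>T)
          = zz n x + (\<integral>t. w (x, t) * (\<kappa> n t * \<psi>' t) \<partial>M\<^sub>T)"
        by (simp add: distrib_left zz_def)
      then show "zz n x = - (\<integral>t. h (x, t) * (\<kappa> n t * \<psi> t) \<partial>M\<^sub>T)
          - (\<integral>t. w (x, t) * (\<kappa> n t * \<psi>' t) \<partial>M\<^sub>T)"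
        using elim(1)[rule_format, of n] by linarith
    qed
  qed
  have dc: "(\<lambda>n. \<integral>t. f t * (\<kappa> n t * c t) \<partial>M\<^sub>T) \<longlonglongrightarrow> (\<integral>t. f t * c t \<partial>M\<^sub>T)"
      and db: "\<bar>\<integral>t. f t * (\<kappa> n t * c t) \<partial>M\<^sub>T\<bar> \<le> B * (\<integral>t. \<bar>f t\<bar> \<partial>M\<^sub>T)"
    if f: "f \<in> L2 M\<^sub>T" and c: "continuous_on UNIV c" "\<And>t. \<bar>c t\<bar> \<le> B" for f c :: "real \<Rightarrow> real" and n
  proof -
    have le: "norm (f t * (\<kappa> n t * c t)) \<le> B * \<bar>f t\<bar>" for n t
    proof -
      have "\<bar>\<kappa> n t\<bar> * \<bar>c t\<bar> \<le> 1 * B" using \<kappa>(5) c(2) by (intro mult_mono) auto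
      then have "\<bar>f t\<bar> * (\<bar>\<kappa> n t\<bar> * \<bar>c t\<bar>) \<le> \<bar>f t\<bar> * B" by (intro mult_left_mono) auto
      then show ?thesis by (simp add: abs_mult mult.commute)
    qed
    have fi: "integrable M\<^sub>T (\<lambda>t. B * \<bar>f t\<bar>)" using fm_time.L2_integrable[OF f] by simp
    have m: "(\<lambda>t. f t * (\<kappa> n t * c t)) \<in> borel_measurable M\<^sub>T" for n
      using L2_measurable[OF f] continuous_time_measurable[OF \<kappa>c] continuous_time_measurable[OF
          c(1)] by measurable
    show "(\<lambda>n. \<integral>t. f t * (\<kappa> n t * c t) \<partial>M\<^sub>T) \<longlonglongrightarrow> (\<integral>t. f t * c t \<partial>M\<^sub>T)"
    proof (rule integral_dominated_convergence[OF _ m fi])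
      show "(\<lambda>t. f t * c t) \<in> borel_measurable M\<^sub>T"
        using L2_measurable[OF f] continuous_time_measurable[OF c(1)] by measurable
      show "AE t in M\<^sub>T. (\<lambda>n. f t * (\<kappa> n t * c t)) \<longlonglongrightarrow> f t * c t"
      proof (rule AE_I2)
        fix t assume "t \<in> space M\<^sub>T"
        then have "(\<lambda>n. \<kappa> n t) \<longlonglongrightarrow> 1" by (intro \<kappa>(6)) auto
        then have "(\<lambda>n. f t * (\<kappa> n t * c t)) \<longlonglongrightarrow> f t * (1 * c t)" by (intro tendsto_intros)
        then show "(\<lambda>n. f t * (\<kappa> n t * c t)) \<longlonglongrightarrow> f t * c t" by simp
      qed
    qed (use le in auto)
    have "\<bar>\<integral>t. f t * (\<kappa> n t * c t) \<partial>M\<^sub>T\<bar> \<le> (\<integral>t. B * \<bar>f t\<bar> \<partial>M\<^sub>T)"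
    proof (rule integral_abs_bound_integral[OF _ fi])
      show "integrable M\<^sub>T (\<lambda>t. f t * (\<kappa> n t * c t))"
        by (rule Bochner_Integration.integrable_bound[OF fi m])
           (use le[of _ n] in \<open>auto intro!: AE_I2 intro: order_trans[OF _ abs_ge_self]\<close>)
    qed (use le[of _ n] in simp)
    then show "\<bar>\<integral>t. f t * (\<kappa> n t * c t) \<partial>M\<^sub>T\<bar> \<le> B * (\<integral>t. \<bar>f t\<bar> \<partial>M\<^sub>T)" by simp
  qed
  have zlim: "AE x in M\<^sub>\<Omega>. (\<lambda>n. zz n x) \<longlonglongrightarrow> Z x"
    using zz_eq L2_slice_time[OF w] L2_slice_time[OF hL]
  proof eventually_elim
    case (elim x)
    have "(\<lambda>n. - (\<integral>t. h (x, t) * (\<kappa> n t * \<psi> t) \<partial>M\<^sub>T) - (\<integral>t. w (x, t) * (\<kappa> n t * \<psi>' t) \<partial>M\<^sub>T)) \<longlonglongrightarrow> Z x"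
      unfolding Z_def by (intro tendsto_intros dc elim \<psi>c \<psi>)
    then show ?case using elim(1) by simp
  qed
  have zdom: "AE x in M\<^sub>\<Omega>. norm (\<bar>zz n x\<bar>) \<le> dom x" for n
    using zz_eq L2_slice_time[OF w] L2_slice_time[OF hL]
  proof eventually_elim
    case (elim x)
    have "\<bar>\<integral>t. h (x, t) * (\<kappa> n t * \<psi> t) \<partial>M\<^sub>T\<bar> \<le> B * (\<integral>t. \<bar>h (x, t)\<bar> \<partial>M\<^sub>T)"
      by (intro db elim \<psi>c \<psi>)
    moreover have "\<bar>\<integral>t. w (x, t) * (\<kappa> n t * \<psi>' t) \<partial>M\<^sub>T\<bar> \<le> B * (\<integral>t. \<bar>w (x, t)\<bar> \<partial>M\<^sub>T)"
      by (intro db elim \<psi>)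
    ultimately show ?case using elim(1) unfolding dom_def by auto
  qed
  have domi: "integrable M\<^sub>\<Omega> dom"
    unfolding dom_def[abs_def]
    using Q_integrable_time(2)[of "\<lambda>z. \<bar>h z\<bar>"] Q_integrable_time(2)[of "\<lambda>z. \<bar>w z\<bar>"]
      fm_cyl.L2_integrable[OF hL] fm_cyl.L2_integrable[OF w] by simp
  have zzi: "integrable M\<^sub>Q (\<lambda>z. w z * (\<kappa>' n (snd z) * \<psi> (snd z)))" for n
  proof -
    have "(\<lambda>z. w z * (\<lambda>t. \<kappa>' n t * \<psi> t) (snd z)) \<in> L2 M\<^sub>Q"
      by (rule L2_mult_bounded_time[OF w, where B = "real (Suc n) * C * 2 * B"])
         (use \<kappa>'b \<psi>(5) C0 in \<open>auto simp: abs_mult intro!: continuous_intros \<kappa>(3) \<psi>c mult_mono simp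
             del: of_nat_Suc\<close>)
    then show ?thesis by (intro fm_cyl.L2_integrable) simp
  qed
  have zm: "zz n \<in> borel_measurable M\<^sub>\<Omega>" for n
    using Q_integrable_time(2)[OF zzi] unfolding zz_def[abs_def] by auto
  have Zm: "Z \<in> borel_measurable M\<^sub>\<Omega>"
  proof -
    have "integrable M\<^sub>Q (\<lambda>z. h z * \<psi> (snd z))" "integrable M\<^sub>Q (\<lambda>z. w z * \<psi>' (snd z))"
      by (rule fm_cyl.L2_integrable[OF L2_mult_bounded_time[OF hL \<psi>c \<psi>(5)]],
          rule fm_cyl.L2_integrable[OF L2_mult_bounded_time[OF w \<psi>(3,6)]])
    from this[THEN Q_integrable_time(2)] show ?thesis unfolding Z_def[abs_def] by auto
  qed
  have lim1: "(\<lambda>n. \<integral>x. \<bar>zz n x\<bar> \<partial>M\<^sub>\<Omega>) \<longlonglongrightarrow> (\<integral>x. \<bar>Z x\<bar> \<partial>M\<^sub>\<Omega>)"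
  proof (rule integral_dominated_convergence[OF _ _ domi])
    show "AE x in M\<^sub>\<Omega>. (\<lambda>n. \<bar>zz n x\<bar>) \<longlonglongrightarrow> \<bar>Z x\<bar>"
      using zlim by eventually_elim (rule tendsto_rabs)
  qed (use zm Zm zdom in auto)
  obtain a where aL: "a \<in> L2 M\<^sub>\<Omega>" and a: "\<And>\<epsilon>. \<epsilon> > 0 \<Longrightarrow> \<exists>\<delta>>0. AE t in M\<^sub>T. t < \<delta> \<or> T - t < \<delta> \<longrightarrow>
     (\<integral>x. \<bar>w (x, t) * \<psi> t - a x\<bar> \<partial>M\<^sub>\<Omega>) \<le> \<epsilon>"
    using trace_distance_small[OF w per \<psi>c \<psi>(4,5)] by blast
  define g where "g z = w z * \<psi> (snd z) - a (fst z)" for z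
  have gL: "g \<in> L2 M\<^sub>Q"
    unfolding g_def by (rule L2_diff[OF L2_mult_bounded_time[OF w \<psi>c \<psi>(5)] L2_lift_fst[OF aL]])
  have gi: "integrable M\<^sub>Q (\<lambda>z. g z * \<kappa>' n (snd z))" for n
    by (rule fm_cyl.L2_integrable[OF L2_mult_bounded_time[OF gL \<kappa>(3) \<kappa>'b]])
  have \<kappa>'_mean: "(\<integral>t. \<kappa>' n t \<partial>M\<^sub>T) = 0" for n
  proof -
    have "\<kappa> n 0 = 0" "\<kappa> n T = 0" using \<kappa>(4)[of n] unfolding test_function_def by auto
    then show ?thesis using integral_FTC[OF \<kappa>(2) \<kappa>(3), of n] by simp
  qed
  have zle: "(\<integral>x. \<bar>zz n x\<bar> \<partial>M\<^sub>\<Omega>) \<le> (\<integral>t. \<bar>\<kappa>' n t\<bar> * (\<integral>x. \<bar>g (x, t)\<bar> \<partial>M\<^sub>\<Omega>) \<partial>M\<^sub>T)" for n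
  proof -
    have gabs: "integrable M\<^sub>Q (\<lambda>z. \<bar>g z * \<kappa>' n (snd z)\<bar>)" using gi by simp
    have "(\<integral>x. \<bar>zz n x\<bar> \<partial>M\<^sub>\<Omega>) \<le> (\<integral>x. (\<integral>t. \<bar>g (x, t) * \<kappa>' n t\<bar> \<partial>M\<^sub>T) \<partial>M\<^sub>\<Omega>)"
    proof (rule integral_mono_AE)
      show "integrable M\<^sub>\<Omega> (\<lambda>x. \<bar>zz n x\<bar>)"
        using Q_integrable_time(2)[OF zzi] by (simp add: zz_def)
      show "integrable M\<^sub>\<Omega> (\<lambda>x. \<integral>t. \<bar>g (x, t) * \<kappa>' n t\<bar> \<partial>M\<^sub>T)"
        using Q_integrable_time(2)[OF gabs] by simp
      show "AE x in M\<^sub>\<Omega>. \<bar>zz n x\<bar> \<le> (\<integral>t. \<bar>g (x, t) * \<kappa>' n t\<bar> \<partial>M\<^sub>T)"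
        using Q_integrable_time(1)[OF zzi[of n]]
      proof eventually_elim
        case (elim x)
        have k: "integrable M\<^sub>T (\<lambda>t. \<kappa>' n t)"
          by (intro fm_time.L2_integrable continuous_L2[where C = "real (Suc n) * C * 2"] \<kappa>(3) \<kappa>'b)
        have "(\<integral>t. g (x, t) * \<kappa>' n t \<partial>M\<^sub>T) = (\<integral>t. w (x, t) * (\<kappa>' n t * \<psi> t) - a x * \<kappa>' n t \<partial>M\<^sub>T)"
          by (simp add: g_def algebra_simps)
        also have "\<dots> = zz n x"
          using elim k \<kappa>'_mean by (simp add: zz_def)
        finally show ?case by (metis integral_abs_bound)
      qed
    qed
    also have "\<dots> = (\<integral>t. (\<integral>x. \<bar>g (x, t) * \<kappa>' n t\<bar> \<partial>M\<^sub>\<Omega>) \<partial>M\<^sub>T)"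
      using Q_integral_time[OF gabs] Q_integral_space[OF gabs] by simp
    also have "\<dots> = (\<integral>t. \<bar>\<kappa>' n t\<bar> * (\<integral>x. \<bar>g (x, t)\<bar> \<partial>M\<^sub>\<Omega>) \<partial>M\<^sub>T)"
      by (simp add: abs_mult mult.commute)
    finally show ?thesis .
  qed
  \<comment> \<open>The derivative of the cutoff is bounded by \<open>(n
      + 1) C\<close> on each of two intervals of length \<open>3 / (n + 1)\<close>.\<close>
  have small: "\<exists>n0. \<forall>n\<ge>n0. (\<integral>x. \<bar>zz n x\<bar> \<partial>M\<^sub>\<Omega>) \<le> 6 * C * \<epsilon>" if \<epsilon>: "\<epsilon> > 0" for \<epsilon>
  proof -
    obtain \<delta> where \<delta>: "\<delta> > 0" "AE t in M\<^sub>T. t < \<delta> \<or> T - t < \<delta> \<longrightarrow> (\<integral>x. \<bar>g (x, t)\<bar> \<partial>M\<^sub>\<Omega>) \<le> \<epsilon>"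
      using a[OF \<epsilon>] by (auto simp: g_def)
    obtain n0 :: nat where n0: "3 / \<delta> < real n0" using reals_Archimedean2 by blast
    have "(\<integral>x. \<bar>zz n x\<bar> \<partial>M\<^sub>\<Omega>) \<le> 6 * C * \<epsilon>" if n: "n \<ge> n0" for n
    proof -
      let ?N = "real (Suc n)"
      have "3 / \<delta> < ?N" using n0 n by linarith
      then have N\<delta>: "3 / ?N < \<delta>" using \<delta>(1) by (simp add: field_simps del: of_nat_Suc)
      let ?J = "\<lambda>t. indicator {..3 / ?N} t + indicator {T - 3 / ?N..} t :: real"
      have Ji: "integrable M\<^sub>T (\<lambda>t. indicator {..3 / ?N} t :: real)" "integrable M\<^sub>T (\<lambda>t.
          indicator {T - 3 / ?N..} t :: real)"
      proof -
        have "(indicator A :: real \<Rightarrow> real) \<in> L2 M\<^sub>T" if "A \<in> sets borel" for A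
        proof (rule fm_time.bounded_L2[where C = 1])
          show "(indicator A :: real \<Rightarrow> real) \<in> borel_measurable M\<^sub>T"
            by (intro measurable_restrict_space1 measurable_completion) (use that in auto)
        qed (auto simp: indicator_def)
        then show "integrable M\<^sub>T (\<lambda>t. indicator {..3 / ?N} t :: real)" "integrable M\<^sub>T (\<lambda>t.
            indicator {T - 3 / ?N..} t :: real)"
          by (auto intro!: fm_time.L2_integrable)
      qed
      note zle[of n]
      also have "(\<integral>t. \<bar>\<kappa>' n t\<bar> * (\<integral>x. \<bar>g (x, t)\<bar> \<partial>M\<^sub>\<Omega>) \<partial>M\<^sub>T) \<le> (\<integral>t. (?N * C * \<epsilon>) * ?J t \<partial>M\<^sub>T)"
      proof (rule integral_mono_AE)
        have "integrable M\<^sub>Q (\<lambda>z. \<bar>g z * \<kappa>' n (snd z)\<bar>)" using gi by simp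
        from Q_integrable_space(2)[OF this] show "integrable M\<^sub>T (\<lambda>t. \<bar>\<kappa>' n t\<bar> * (\<integral>x. \<bar>g (x, t)\<bar>
            \<partial>M\<^sub>\<Omega>))"
          by (simp add: abs_mult mult.commute)
        show "integrable M\<^sub>T (\<lambda>t. (?N * C * \<epsilon>) * ?J t)" using Ji by simp
        show "AE t in M\<^sub>T. \<bar>\<kappa>' n t\<bar> * (\<integral>x. \<bar>g (x, t)\<bar> \<partial>M\<^sub>\<Omega>) \<le> (?N * C * \<epsilon>) * ?J t"
          using \<delta>(2)
        proof eventually_elim
          case (elim t)
          show ?case
          proof (cases "t \<le> 3 / ?N \<or> T - 3 / ?N \<le> t")
            case True
            then have "t < \<delta> \<or> T - t < \<delta>" using N\<delta> by auto
            then have "\<bar>\<kappa>' n t\<bar> * (\<integral>x. \<bar>g (x, t)\<bar> \<partial>M\<^sub>\<Omega>) \<le> (?N * C * ?J t) * \<epsilon>"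
              using elim \<kappa>(7)[of n t] C0 by (intro mult_mono) (auto simp del: of_nat_Suc)
            then show ?thesis by (simp add: mult_ac)
          next
            case False
            then have "?J t = 0" by simp
            then have "\<kappa>' n t = 0" using \<kappa>(7)[of n t] by simp
            then show ?thesis using \<open>?J t = 0\<close> by simp
          qed
        qed
      qed
      also have "\<dots> = (?N * C * \<epsilon>) * ((\<integral>t. indicator {..3 / ?N} t \<partial>M\<^sub>T)
          + (\<integral>t. indicator {T - 3 / ?N..} t \<partial>M\<^sub>T))"
        using Ji by simp
      also have "\<dots> \<le> (?N * C * \<epsilon>) * (3 / ?N + 3 / ?N)"
        using C0 \<epsilon> by (intro mult_left_mono add_mono integral_indicator_end) auto
      also have "\<dots> = 6 * C * \<epsilon>" by (simp add: field_simps del: of_nat_Suc)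
      finally show ?thesis .
    qed
    then show ?thesis by blast
  qed
  have "(\<lambda>n. \<integral>x. \<bar>zz n x\<bar> \<partial>M\<^sub>\<Omega>) \<longlonglongrightarrow> 0"
  proof (rule LIMSEQ_I)
    fix e :: real assume e: "e > 0"
    obtain n0 where "\<forall>n\<ge>n0. (\<integral>x. \<bar>zz n x\<bar> \<partial>M\<^sub>\<Omega>) \<le> 6 * C * (e / (6 * C + 1))"
      using small[of "e / (6 * C + 1)"] e C0 by auto
    moreover have "6 * C * (e / (6 * C + 1)) < e" using e C0 by (simp add: field_simps)
    ultimately show "\<exists>n0. \<forall>n\<ge>n0. norm ((\<integral>x. \<bar>zz n x\<bar> \<partial>M\<^sub>\<Omega>) - 0) < e"
      by (intro exI[of _ n0]) (auto simp: abs_of_nonneg)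
  qed
  then have Z0: "(\<integral>x. \<bar>Z x\<bar> \<partial>M\<^sub>\<Omega>) = 0" using lim1 LIMSEQ_unique by blast
  have "integrable M\<^sub>\<Omega> (\<lambda>x. \<bar>Z x\<bar>)"
  proof (rule integrable_dominated_convergence[OF _ _ domi])
    show "AE x in M\<^sub>\<Omega>. (\<lambda>n. \<bar>zz n x\<bar>) \<longlonglongrightarrow> \<bar>Z x\<bar>"
      using zlim by eventually_elim (rule tendsto_rabs)
  qed (use zm Zm zdom in auto)
  then have "AE x in M\<^sub>\<Omega>. \<bar>Z x\<bar> = 0"
    using Z0 by (subst (asm) integral_nonneg_eq_0_iff_AE) auto
  then show ?thesis by eventually_elim (auto simp: Z_def)
qed

section \<open>Time derivatives and the half-order form\<close>

lemma smooth_expr_co_si: "smooth_expr (co k)" "smooth_expr (si k)"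
  using smooth_expr.cos[OF smooth_expr.inner[of "real k * \<omega>"]] smooth_expr.sin[OF
      smooth_expr.inner[of "real k * \<omega>"]]
  by (simp_all add: mult.commute)

lemma dt_fourier:
  assumes w: "w \<in> L2 M\<^sub>Q" and h: "is_dt \<Omega> T w h" and per: "time_periodic \<Omega> T w"
  shows "AE x in M\<^sub>\<Omega>. (\<integral>t. h (x, t) \<partial>M\<^sub>T) = 0 \<and>
    (\<forall>k. fourier T h k x = (real k * \<omega> * snd (fourier T w k x),
        - (real k * \<omega> * fst (fourier T w k x))))"
proof -
  have b: "\<bar>real k * \<omega> * s\<bar> \<le> 1 + real k * \<omega>" if "\<bar>s\<bar> \<le> 1" for k s
  proof -
    have "\<bar>real k * \<omega> * s\<bar> \<le> (real k * \<omega>) * 1"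
      unfolding abs_mult using that \<omega>_pos by (intro mult_mono) auto
    then show ?thesis by simp
  qed
  have b1: "\<bar>s\<bar> \<le> 1 + real k * \<omega>" if "\<bar>s\<bar> \<le> 1" for k and s :: real
    using that mult_nonneg_nonneg[of "real k" \<omega>] \<omega>_pos by linarith
  have pT: "co k 0 = co k T" "si k 0 = si k T" for k
    using cos_multiple_period[of "int k"] sin_multiple_period[of "int k"] by simp_all
  have c: "AE x in M\<^sub>\<Omega>. (\<integral>t. w (x, t) * (- (real k * \<omega> * si k t)) \<partial>M\<^sub>T) =
      - (\<integral>t. h (x, t) * co k t \<partial>M\<^sub>T)" for k
  proof (rule periodic_integration_by_parts[OF w h per smooth_expr_co_si(1) _ _ pT(1), where B
      = "1 + real k * \<omega>"])
    show "(co k has_real_derivative - (real k * \<omega> * si k t)) (at t)" for t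
      by (auto intro!: derivative_eq_intros)
    show "\<bar>- (real k * \<omega> * si k t)\<bar> \<le> 1 + real k * \<omega>" for t using b[of "si k t" k] by simp
  qed (auto intro!: continuous_intros b1)
  have s: "AE x in M\<^sub>\<Omega>. (\<integral>t. w (x, t) * (real k * \<omega> * co k t) \<partial>M\<^sub>T) =
      - (\<integral>t. h (x, t) * si k t \<partial>M\<^sub>T)" for k
  proof (rule periodic_integration_by_parts[OF w h per smooth_expr_co_si(2) _ _ pT(2), where B
      = "1 + real k * \<omega>"])
    show "(si k has_real_derivative real k * \<omega> * co k t) (at t)" for t
      by (auto intro!: derivative_eq_intros)
    show "\<bar>real k * \<omega> * co k t\<bar> \<le> 1 + real k * \<omega>" for t by (rule b) simp
  qed (auto intro!: continuous_intros b1)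
  have "AE x in M\<^sub>\<Omega>. \<forall>k. time_average (co k) h x = real k * \<omega> * time_average (si k) w x
      \<and> time_average (si k) h x = - (real k * \<omega> * time_average (co k) w x)"
    unfolding AE_all_countable
  proof
    fix k
    show "AE x in M\<^sub>\<Omega>. time_average (co k) h x = real k * \<omega> * time_average (si k) w x
        \<and> time_average (si k) h x = - (real k * \<omega> * time_average (co k) w x)"
      using c[of k] s[of k]
    proof eventually_elim
      case (elim x)
      have "(\<integral>t. w (x, t) * (- (real k * \<omega> * si k t)) \<partial>M\<^sub>T) =
          - (real k * \<omega> * time_average (si k) w x)"
        unfolding time_average_def by (simp add: mult.left_commute[of "w _"])
      moreover have "(\<integral>t. w (x, t) * (real k * \<omega> * co k t) \<partial>M\<^sub>T)
          = real k * \<omega> * time_average (co k) w x"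
        unfolding time_average_def by (simp add: mult.left_commute[of "w _"])
      ultimately show ?case using elim by (simp add: time_average_def)
    qed
  qed
  then show ?thesis
  proof eventually_elim
    case (elim x)
    have "(\<integral>t. h (x, t) \<partial>M\<^sub>T) = time_average (co 0) h x" by (simp add: time_average_def)
    also have "\<dots> = 0" using elim[rule_format, of 0] by simp
    finally show ?case using elim by (simp add: fourier_eq mult_ac)
  qed
qed

lemma fourier_coefficient_mult:
  fixes a :: "'a \<Rightarrow> real"
  shows "fourier T (\<lambda>z. a (fst z) * w z) k x = a x *\<^sub>R fourier T w k x"
  unfolding fourier_eq time_average_def by (simp add: mult.assoc)

lemma L2_mult_space:
  fixes f :: "'a \<times> real \<Rightarrow> 'b::euclidean_space" and a :: "'a \<Rightarrow> real"
  assumes "f \<in> L2 M\<^sub>Q" "a \<in> borel_measurable M\<^sub>\<Omega>" "\<And>x. x \<in> \<Omega> \<Longrightarrow> \<bar>a x\<bar> \<le> C"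
  shows "(\<lambda>z. a (fst z) *\<^sub>R f z) \<in> L2 M\<^sub>Q"
  by (rule L2_bounded_mult[OF assms(1) Q_lift_measurable[OF assms(2)]]) (use assms(3)
      in \<open>auto simp: cyl_eq\<close>)

text \<open>Differentiation multiplies the \<open>k\<close>-th coefficient by \<open>- k \<omega>\<close> and applies \<open>perp\<close>, so each
  term of the half-order form is a term of Parseval's identity for \<open>a h\<close> and \<open>q\<close>. Since \<open>perp\<close> is
  skew, exchanging the arguments changes the sign.\<close>

lemma half_form_dt:
  assumes w: "w \<in> L2 M\<^sub>Q" and h: "is_dt \<Omega> T w h" and per: "time_periodic \<Omega> T w" and q: "q \<in> L2 M\<^sub>Q"
    and a: "a \<in> borel_measurable M\<^sub>\<Omega>" "\<And>x. x \<in> \<Omega> \<Longrightarrow> \<bar>a x\<bar> \<le> C"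
  shows "half_form \<Omega> T a (fourier T w) (perp (fourier T q)) = (\<integral>z. a (fst z) * h z * q z \<partial>M\<^sub>Q)"
    and "half_form \<Omega> T a (fourier T q) (perp (fourier T w)) = - (\<integral>z. a (fst z) * h z * q z \<partial>M\<^sub>Q)"
proof -
  have hL: "h \<in> L2 M\<^sub>Q" using h by (simp add: is_dt_def)
  have ah: "(\<lambda>z. a (fst z) * h z) \<in> L2 M\<^sub>Q" using L2_mult_space[OF hL a] by simp
  note co = dt_fourier[OF w h per]
  have "AE x in M\<^sub>\<Omega>. (\<integral>t. a (fst (x, t)) * h (x, t) \<partial>M\<^sub>T) = 0"
    using co by eventually_elim simp
  from Parseval_cylinder[OF ah q this]
  have P: "(\<lambda>k. T / 2 * (\<integral>x. a x * (fourier T h (Suc k) x \<bullet> fourier T q (Suc k) x) \<partial>M\<^sub>\<Omega>)) sums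
      (\<integral>z. a (fst z) * h z * q z \<partial>M\<^sub>Q)"
    by (simp add: fourier_coefficient_mult)
  have fm: "fourier T f k \<in> borel_measurable M\<^sub>\<Omega>" if "f \<in> L2 M\<^sub>Q" for f k
    by (rule L2_measurable[OF fourier_L2[OF that]])
  have pm: "perp (fourier T f) k \<in> borel_measurable M\<^sub>\<Omega>" if "f \<in> L2 M\<^sub>Q" for f k
    using L2_measurable[OF L2_Pair[OF L2_minus[OF fourier_snd_L2[OF that]] fourier_fst_L2[OF
        that], of k k]]
    by (simp add: perp_def[abs_def])
  have i1: "real k * \<omega> * (\<integral>x. a x * (fourier T w k x \<bullet> perp (fourier T q) k x) \<partial>M\<^sub>\<Omega>)
      = (\<integral>x. a x * (fourier T h k x \<bullet> fourier T q k x) \<partial>M\<^sub>\<Omega>)" for k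
  proof -
    have "(\<integral>x. (real k * \<omega>) * (a x * (fourier T w k x \<bullet> perp (fourier T q) k x)) \<partial>M\<^sub>\<Omega>)
        = (\<integral>x. a x * (fourier T h k x \<bullet> fourier T q k x) \<partial>M\<^sub>\<Omega>)"
    proof (rule integral_cong_AE)
      show "AE x in M\<^sub>\<Omega>. (real k * \<omega>) * (a x * (fourier T w k x \<bullet> perp (fourier T q) k x))
          = a x * (fourier T h k x \<bullet> fourier T q k x)"
        using co by eventually_elim (simp add: perp_def inner_prod_def algebra_simps)
    qed (use a(1) fm[OF w] fm[OF q] fm[OF hL] pm[OF q] in measurable)
    then show ?thesis by simp
  qed
  have i2: "real k * \<omega> * (\<integral>x. a x * (fourier T q k x \<bullet> perp (fourier T w) k x) \<partial>M\<^sub>\<Omega>)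
      = - (\<integral>x. a x * (fourier T h k x \<bullet> fourier T q k x) \<partial>M\<^sub>\<Omega>)" for k
  proof -
    have "(\<integral>x. (real k * \<omega>) * (a x * (fourier T q k x \<bullet> perp (fourier T w) k x)) \<partial>M\<^sub>\<Omega>)
        = (\<integral>x. - (a x * (fourier T h k x \<bullet> fourier T q k x)) \<partial>M\<^sub>\<Omega>)"
    proof (rule integral_cong_AE)
      show "AE x in M\<^sub>\<Omega>. (real k * \<omega>) * (a x * (fourier T q k x \<bullet> perp (fourier T w) k x)) =
          - (a x * (fourier T h k x \<bullet> fourier T q k x))"
        using co by eventually_elim (simp add: perp_def inner_prod_def algebra_simps)
    qed (use a(1) fm[OF w] fm[OF q] fm[OF hL] pm[OF w] in measurable)
    then show ?thesis by simp
  qed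
  have T2: "summable (\<lambda>k. (\<integral>x. a x * (fourier T h (Suc k) x \<bullet> fourier T q (Suc k) x) \<partial>M\<^sub>\<Omega>))"
    using sums_summable[OF P] T_pos by (subst (asm) summable_cmult_iff) auto
  have S: "T / 2 * (\<Sum>k. (\<integral>x. a x * (fourier T h (Suc k) x \<bullet> fourier T q (Suc k) x) \<partial>M\<^sub>\<Omega>))
      = (\<integral>z. a (fst z) * h z * q z \<partial>M\<^sub>Q)"
    using suminf_mult[OF T2, of "T / 2"] sums_unique[OF P] by simp
  show "half_form \<Omega> T a (fourier T w) (perp (fourier T q)) = (\<integral>z. a (fst z) * h z * q z \<partial>M\<^sub>Q)"
    unfolding half_form_def \<omega>_def[symmetric] i1 by (rule S)
  show "half_form \<Omega> T a (fourier T q) (perp (fourier T w)) = - (\<integral>z. a (fst z) * h z * q z \<partial>M\<^sub>Q)"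
    unfolding half_form_def \<omega>_def[symmetric] i2 suminf_minus[OF T2] using S by simp
qed

section \<open>Linear structure of the energy space\<close>

lemma half_term_eq: "half_term \<Omega> T w k = real k * \<omega> * (L2_norm M\<^sub>\<Omega> (fourier T w k))\<^sup>2"
  by (simp add: half_term_def \<omega>_def)

lemma half_term_nonneg: "0 \<le> half_term \<Omega> T w k"
  unfolding half_term_eq using \<omega>_pos by simp

lemma H1_half_D:
  assumes "w \<in> H1_half \<Omega> T"
  shows "w \<in> L2 M\<^sub>Q" "is_grad \<Omega> T w (grad \<Omega> T w)" "grad \<Omega> T w \<in> L2 M\<^sub>Q"
    "summable (\<lambda>k. half_term \<Omega> T w (Suc k))" "zero_on_boundary \<Omega> T w"
proof -
  have "\<exists>g. is_grad \<Omega> T w g" using assms by (simp add: H1_half_def)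
  then show "is_grad \<Omega> T w (grad \<Omega> T w)" unfolding grad_def by (rule someI_ex)
  then show "grad \<Omega> T w \<in> L2 M\<^sub>Q" by (simp add: is_grad_def)
qed (use assms in \<open>auto simp: H1_half_def\<close>)

lemma H1_1_D:
  assumes "w \<in> H1_1 \<Omega> T"
  shows "w \<in> L2 M\<^sub>Q" "is_dt \<Omega> T w (dt \<Omega> T w)" "dt \<Omega> T w \<in> L2 M\<^sub>Q" "time_periodic \<Omega> T w"
proof -
  have "\<exists>h. is_dt \<Omega> T w h" using assms by (simp add: H1_1_def)
  then show "is_dt \<Omega> T w (dt \<Omega> T w)" unfolding dt_def by (rule someI_ex)
  then show "dt \<Omega> T w \<in> L2 M\<^sub>Q" by (simp add: is_dt_def)
qed (use assms in \<open>auto simp: H1_1_def\<close>)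

text \<open>The half-order weight is dominated by the weights of orders zero and one: \<open>k \<omega> \<le> 1 + (k
  \<omega>)\<^sup>2\<close>.\<close>

lemma H1_1_subset_H1_half: "H1_1 \<Omega> T \<subseteq> H1_half \<Omega> T"
proof
  fix w assume w: "w \<in> H1_1 \<Omega> T"
  note D = H1_1_D[OF w]
  let ?h = "dt \<Omega> T w"
  have le: "half_term \<Omega> T w k \<le> (L2_norm M\<^sub>\<Omega> (fourier T ?h k))\<^sup>2
      + (L2_norm M\<^sub>\<Omega> (fourier T w k))\<^sup>2" for k
  proof -
    have "half_term \<Omega> T w k = (\<integral>x. real k * \<omega> * (norm (fourier T w k x))\<^sup>2 \<partial>M\<^sub>\<Omega>)"
      by (simp add: half_term_eq L2_norm_sq)
    also have "\<dots> \<le> (\<integral>x. (norm (fourier T ?h k x))\<^sup>2 + (norm (fourier T w k x))\<^sup>2 \<partial>M\<^sub>\<Omega>)"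
    proof (rule integral_mono_AE)
      show "integrable M\<^sub>\<Omega> (\<lambda>x. real k * \<omega> * (norm (fourier T w k x))\<^sup>2)"
        "integrable M\<^sub>\<Omega> (\<lambda>x. (norm (fourier T ?h k x))\<^sup>2 + (norm (fourier T w k x))\<^sup>2)"
        using L2_integrable_sq[OF fourier_L2[OF D(1)]] L2_integrable_sq[OF fourier_L2[OF D(3)]]
            by auto
      show "AE x in M\<^sub>\<Omega>. real k * \<omega> * (norm (fourier T w k x))\<^sup>2 \<le> (norm (fourier T ?h k x))\<^sup>2
          + (norm (fourier T w k x))\<^sup>2"
        using dt_fourier[OF D(1,2,4)]
      proof eventually_elim
        case (elim x)
        let ?n = "real k * \<omega>"
        have "(norm (fourier T ?h k x))\<^sup>2 = ?n\<^sup>2 * (norm (fourier T w k x))\<^sup>2"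
          unfolding power2_norm_eq_inner using elim
              by (simp add: inner_prod_def power2_eq_square algebra_simps)
        moreover have "?n \<le> ?n\<^sup>2 + 1"
          using sum_squares_bound[of ?n 1] \<omega>_pos mult_nonneg_nonneg[of "real k" \<omega>]
              by (simp only: power_one mult_1_right) linarith
        then have "?n * (norm (fourier T w k x))\<^sup>2 \<le> (?n\<^sup>2 + 1) * (norm (fourier T w k x))\<^sup>2"
          by (rule mult_right_mono) simp
        ultimately show ?case by (simp add: distrib_right)
      qed
    qed
    also have "\<dots> = (L2_norm M\<^sub>\<Omega> (fourier T ?h k))\<^sup>2 + (L2_norm M\<^sub>\<Omega> (fourier T w k))\<^sup>2"
      using L2_integrable_sq[OF fourier_L2[OF D(1)]] L2_integrable_sq[OF fourier_L2[OF D(3)]]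
          by (simp add: L2_norm_sq)
    finally show ?thesis .
  qed
  have "summable (\<lambda>k. half_term \<Omega> T w (Suc k))"
    by (rule summable_comparison_test[OF _ summable_add[OF fourier_norm_summable[OF D(3)]
        fourier_norm_summable[OF D(1)]]])
       (use le half_term_nonneg in auto)
  then show "w \<in> H1_half \<Omega> T" using w by (auto simp: H1_1_def H1_half_def)
qed

lemma is_grad_unique:
  assumes "is_grad \<Omega> T w g1" "is_grad \<Omega> T w g2"
  shows "AE z in M\<^sub>Q. g1 z = g2 z"
proof -
  have g: "g1 \<in> L2 M\<^sub>Q" "g2 \<in> L2 M\<^sub>Q"
    "AE t in M\<^sub>T. weak_gradient \<Omega> (\<lambda>x. w (x, t)) (\<lambda>x. g1 (x, t))"
    "AE t in M\<^sub>T. weak_gradient \<Omega> (\<lambda>x. w (x, t)) (\<lambda>x. g2 (x, t))"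
    using assms by (auto simp: is_grad_def)
  have ae: "AE t in M\<^sub>T. AE x in M\<^sub>\<Omega>. g1 (x, t) = g2 (x, t)"
    using g(3,4) L2_slice_space[OF g(1)] L2_slice_space[OF g(2)]
    by eventually_elim (rule weak_gradient_unique)
  have "AE z in M\<^sub>Q. g1 z \<bullet> b = g2 z \<bullet> b" for b
  proof (rule Q_AE_from_slices)
    show "AE t in M\<^sub>T. AE x in M\<^sub>\<Omega>. g1 (x, t) \<bullet> b = g2 (x, t) \<bullet> b"
      using ae by eventually_elim (auto elim: eventually_mono)
  qed (use L2_measurable[OF L2_component[OF g(1)]] L2_measurable[OF L2_component[OF g(2)]] in auto)
  then have "AE z in M\<^sub>Q. \<forall>b\<in>Basis. g1 z \<bullet> b = g2 z \<bullet> b"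
    by (simp add: AE_finite_all)
  then show ?thesis by eventually_elim (simp add: euclidean_eq_iff[of "g1 _"])
qed

lemma is_grad_lincomb:
  assumes w: "w1 \<in> L2 M\<^sub>Q" "w2 \<in> L2 M\<^sub>Q" and g: "is_grad \<Omega> T w1 g1" "is_grad \<Omega> T w2 g2"
  shows "is_grad \<Omega> T (\<lambda>z. w1 z + c * w2 z) (\<lambda>z. g1 z + c *\<^sub>R g2 z)"
proof -
  have gL: "g1 \<in> L2 M\<^sub>Q" "g2 \<in> L2 M\<^sub>Q"
    and wg: "AE t in M\<^sub>T. weak_gradient \<Omega> (\<lambda>x. w1 (x, t)) (\<lambda>x. g1 (x, t))"
    "AE t in M\<^sub>T. weak_gradient \<Omega> (\<lambda>x. w2 (x, t)) (\<lambda>x. g2 (x, t))"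
    using g by (auto simp: is_grad_def)
  show ?thesis
    unfolding is_grad_def
  proof
    show "(\<lambda>z. g1 z + c *\<^sub>R g2 z) \<in> L2 M\<^sub>Q" by (intro L2_add L2_scaleR gL)
    show "AE t in M\<^sub>T. weak_gradient \<Omega> (\<lambda>x. w1 (x, t) + c * w2 (x, t)) (\<lambda>x. g1 (x, t)
        + c *\<^sub>R g2 (x, t))"
      using wg L2_slice_space[OF w(1)] L2_slice_space[OF w(2)] L2_slice_space[OF gL(1)]
          L2_slice_space[OF gL(2)]
      by eventually_elim (rule weak_gradient_lincomb)
  qed
qed

lemma half_term_lincomb_le:
  assumes "w1 \<in> L2 M\<^sub>Q" "w2 \<in> L2 M\<^sub>Q"
  shows "half_term \<Omega> T (\<lambda>z. w1 z + c * w2 z) k \<le> 2 * half_term \<Omega> T w1 k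
      + 2 * c\<^sup>2 * half_term \<Omega> T w2 k"
proof -
  let ?a = "fourier T w1 k" and ?b = "fourier T w2 k"
  have L: "?a \<in> L2 M\<^sub>\<Omega>" "(\<lambda>x. c *\<^sub>R ?b x) \<in> L2 M\<^sub>\<Omega>"
    by (intro fourier_L2 L2_scaleR assms)+
  have lL: "(\<lambda>z. w1 z + c * w2 z) \<in> L2 M\<^sub>Q" by (intro L2_add L2_cmult assms)
  have "L2_norm M\<^sub>\<Omega> (fourier T (\<lambda>z. w1 z + c * w2 z) k) = L2_norm M\<^sub>\<Omega> (\<lambda>x. ?a x + c *\<^sub>R ?b x)"
    using fourier_lincomb_AE[OF assms, of c]
    by (intro L2_norm_cong_AE L2_measurable fourier_L2 lL L2_add L) (auto elim: eventually_mono)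
  also have "\<dots> \<le> L2_norm M\<^sub>\<Omega> ?a + \<bar>c\<bar> * L2_norm M\<^sub>\<Omega> ?b"
    using L2_norm_triangle[OF L] by (simp add: L2_norm_scaleR)
  finally have "(L2_norm M\<^sub>\<Omega> (fourier T (\<lambda>z. w1 z + c * w2 z) k))\<^sup>2 \<le> (L2_norm M\<^sub>\<Omega> ?a
      + \<bar>c\<bar> * L2_norm M\<^sub>\<Omega> ?b)\<^sup>2"
    by (rule power_mono) simp
  also have "\<dots> \<le> 2 * (L2_norm M\<^sub>\<Omega> ?a)\<^sup>2 + 2 * c\<^sup>2 * (L2_norm M\<^sub>\<Omega> ?b)\<^sup>2"
    using sum_squares_bound[of "L2_norm M\<^sub>\<Omega> ?a" "\<bar>c\<bar> * L2_norm M\<^sub>\<Omega> ?b"]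
    by (simp add: power2_sum power_mult_distrib)
  finally have "real k * \<omega> * (L2_norm M\<^sub>\<Omega> (fourier T (\<lambda>z. w1 z + c * w2 z) k))\<^sup>2
      \<le> real k * \<omega> * (2 * (L2_norm M\<^sub>\<Omega> ?a)\<^sup>2 + 2 * c\<^sup>2 * (L2_norm M\<^sub>\<Omega> ?b)\<^sup>2)"
    using \<omega>_pos by (intro mult_left_mono) auto
  then show ?thesis by (simp add: half_term_eq algebra_simps)
qed

lemma H1_half_lincomb:
  assumes "w1 \<in> H1_half \<Omega> T" "w2 \<in> H1_half \<Omega> T"
  shows "(\<lambda>z. w1 z + c * w2 z) \<in> H1_half \<Omega> T"
proof -
  note D1 = H1_half_D[OF assms(1)] and D2 = H1_half_D[OF assms(2)]
  have "(\<lambda>z. w1 z + c * w2 z) \<in> L2 M\<^sub>Q" by (intro L2_add L2_cmult D1 D2)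
  moreover have "\<exists>g. is_grad \<Omega> T (\<lambda>z. w1 z + c * w2 z) g"
    using is_grad_lincomb[OF D1(1) D2(1) D1(2) D2(2)] by blast
  moreover have "summable (\<lambda>k. half_term \<Omega> T (\<lambda>z. w1 z + c * w2 z) (Suc k))"
    by (rule summable_comparison_test[OF _ summable_add[OF summable_mult[OF D1(4), of 2]
        summable_mult[OF D2(4), of "2 * c\<^sup>2"]]])
       (use half_term_lincomb_le[OF D1(1) D2(1), of c] half_term_nonneg in auto)
  moreover have "zero_on_boundary \<Omega> T (\<lambda>z. w1 z + c * w2 z)"
    unfolding zero_on_boundary_def
    using D1(5)[unfolded zero_on_boundary_def] D2(5)[unfolded zero_on_boundary_def]
    by eventually_elim (rule H10_lincomb)
  ultimately show ?thesis unfolding H1_half_def by blast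
qed

lemma H1_half_diff:
  assumes "w1 \<in> H1_half \<Omega> T" "w2 \<in> H1_half \<Omega> T"
  shows "(\<lambda>z. w1 z - w2 z) \<in> H1_half \<Omega> T"
  using H1_half_lincomb[OF assms, of "-1"] by simp

lemma grad_lincomb_AE:
  assumes "w1 \<in> H1_half \<Omega> T" "w2 \<in> H1_half \<Omega> T"
  shows "AE z in M\<^sub>Q. grad \<Omega> T (\<lambda>z. w1 z + c * w2 z) z = grad \<Omega> T w1 z + c *\<^sub>R grad \<Omega> T w2 z"
  using H1_half_D[OF assms(1)] H1_half_D[OF assms(2)] H1_half_D(2)[OF H1_half_lincomb[OF assms]]
  by (intro is_grad_unique[OF _ is_grad_lincomb])

end

section \<open>The bilinear form of the state equation\<close>

locale periodic_parabolic = cylinder \<Omega> T for \<Omega> :: "'a::euclidean_space set" and T +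
  fixes \<sigma> \<nu> :: "'a \<Rightarrow> real" and sig0 sig1 nu0 nu1 CF :: real
  assumes \<sigma>_measurable: "\<sigma> \<in> borel_measurable M\<^sub>\<Omega>" and \<nu>_measurable: "\<nu> \<in> borel_measurable M\<^sub>\<Omega>"
    and sig0_pos: "0 < sig0" and \<sigma>_bounds: "\<And>x. x \<in> \<Omega> \<Longrightarrow> sig0 \<le> \<sigma> x \<and> \<sigma> x \<le> sig1"
    and nu0_pos: "0 < nu0" and \<nu>_bounds: "\<And>x. x \<in> \<Omega> \<Longrightarrow> nu0 \<le> \<nu> x \<and> \<nu> x \<le> nu1"
    and friedrichs: "friedrichs_constant \<Omega> CF"
begin

lemma \<sigma>_abs: "x \<in> \<Omega> \<Longrightarrow> \<bar>\<sigma> x\<bar> \<le> sig1" and \<nu>_abs: "x \<in> \<Omega> \<Longrightarrow> \<bar>\<nu> x\<bar> \<le> nu1"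
  using \<sigma>_bounds[of x] \<nu>_bounds[of x] sig0_pos nu0_pos by auto

lemma CF_pos: "CF > 0" using friedrichs by (simp add: friedrichs_constant_def)

definition form_term :: "('a \<times> real \<Rightarrow> real) \<Rightarrow> ('a \<times> real \<Rightarrow> real) \<Rightarrow> nat \<Rightarrow> real" where
  "form_term y q k = (\<integral>x. \<sigma> x * (fourier T y k x \<bullet> perp (fourier T q) k x) \<partial>M\<^sub>\<Omega>)"

lemma perp_L2: "f \<in> L2 M\<^sub>Q \<Longrightarrow> perp (fourier T f) k \<in> L2 M\<^sub>\<Omega>"
  using L2_Pair[OF L2_minus[OF fourier_snd_L2[of f k]] fourier_fst_L2[of f k]]
  by (simp add: perp_def[abs_def])

lemma L2_norm_perp: "L2_norm M\<^sub>\<Omega> (perp (fourier T f) k) = L2_norm M\<^sub>\<Omega> (fourier T f k)"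
  by (simp add: L2_norm_def perp_def norm_prod_def add.commute)

lemma \<sigma>_fourier_L2: "f \<in> L2 M\<^sub>Q \<Longrightarrow> (\<lambda>x. \<sigma> x *\<^sub>R fourier T f k x) \<in> L2 M\<^sub>\<Omega>"
  by (rule L2_bounded_mult[OF fourier_L2 \<sigma>_measurable]) (use \<sigma>_abs in auto)

lemma form_term_integrable:
  assumes "y \<in> L2 M\<^sub>Q" "q \<in> L2 M\<^sub>Q"
  shows "integrable M\<^sub>\<Omega> (\<lambda>x. \<sigma> x * (fourier T y k x \<bullet> perp (fourier T q) k x))"
  using L2_integrable_inner[OF \<sigma>_fourier_L2[OF assms(1)] perp_L2[OF assms(2)]] by simp

lemma form_term_abs_le:
  assumes "y \<in> L2 M\<^sub>Q" "q \<in> L2 M\<^sub>Q"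
  shows "\<bar>form_term y q k\<bar> \<le> \<bar>sig1\<bar> * (L2_norm M\<^sub>\<Omega> (fourier T y k) * L2_norm M\<^sub>\<Omega> (fourier T q k))"
proof -
  have "\<bar>form_term y q k\<bar> \<le> L2_norm M\<^sub>\<Omega> (\<lambda>x. \<sigma> x *\<^sub>R fourier T y k x) * L2_norm M\<^sub>\<Omega> (perp (fourier
      T q) k)"
    unfolding form_term_def
    using L2_Cauchy_Schwarz[OF \<sigma>_fourier_L2[OF assms(1)] perp_L2[OF assms(2)]] by simp
  also have "L2_norm M\<^sub>\<Omega> (\<lambda>x. \<sigma> x *\<^sub>R fourier T y k x) \<le> L2_norm M\<^sub>\<Omega> (\<lambda>x. sig1 *\<^sub>R fourier T y k x)"
    by (intro L2_norm_dominated L2_scaleR L2_measurable \<sigma>_fourier_L2 fourier_L2 assms AE_I2)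
       (use order_trans[OF \<sigma>_abs abs_ge_self] in \<open>auto intro!: mult_right_mono\<close>)
  also have "L2_norm M\<^sub>\<Omega> (\<lambda>x. sig1 *\<^sub>R fourier T y k x) = \<bar>sig1\<bar> * L2_norm M\<^sub>\<Omega> (fourier T y k)"
    by (rule L2_norm_scaleR)
  finally show ?thesis
    by (simp add: L2_norm_perp mult_right_mono mult.assoc)
qed

lemma form_summable:
  assumes "y \<in> H1_half \<Omega> T" "q \<in> H1_half \<Omega> T"
  shows "summable (\<lambda>k. real (Suc k) * \<omega> * form_term y q (Suc k))"
proof (rule summable_comparison_test)
  note Y = H1_half_D[OF assms(1)] and Q = H1_half_D[OF assms(2)]
  show "summable (\<lambda>k. \<bar>sig1\<bar> * (half_term \<Omega> T y (Suc k) + half_term \<Omega> T q (Suc k)))"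
    by (intro summable_mult summable_add Y Q)
  have "norm (real k * \<omega> * form_term y q k) \<le> \<bar>sig1\<bar> * (half_term \<Omega> T y k + half_term \<Omega> T q k)"
      for k
  proof -
    let ?a = "L2_norm M\<^sub>\<Omega> (fourier T y k)" and ?b = "L2_norm M\<^sub>\<Omega> (fourier T q k)"
    have w: "0 \<le> real k * \<omega>" using \<omega>_pos by simp
    have "norm (real k * \<omega> * form_term y q k) = (real k * \<omega>) * \<bar>form_term y q k\<bar>"
      unfolding real_norm_def abs_mult[of "real k * \<omega>"] abs_of_nonneg[OF w] ..
    also have "\<dots> \<le> (real k * \<omega>) * (\<bar>sig1\<bar> * (?a * ?b))"
      by (intro mult_left_mono form_term_abs_le Y Q w)
    also have "\<dots> \<le> (real k * \<omega>) * (\<bar>sig1\<bar> * (?a\<^sup>2 + ?b\<^sup>2))"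
    proof (intro mult_left_mono w abs_ge_zero)
      show "?a * ?b \<le> ?a\<^sup>2 + ?b\<^sup>2"
        using sum_squares_bound[of ?a ?b]
          mult_nonneg_nonneg[OF L2_norm_nonneg[of M\<^sub>\<Omega> "fourier T y k"] L2_norm_nonneg[of M\<^sub>\<Omega>
              "fourier T q k"]]
        by linarith
    qed
    finally show ?thesis by (simp add: half_term_eq algebra_simps)
  qed
  then show "\<exists>N. \<forall>k\<ge>N. norm (real (Suc k) * \<omega> * form_term y q (Suc k))
      \<le> \<bar>sig1\<bar> * (half_term \<Omega> T y (Suc k) + half_term \<Omega> T q (Suc k))"
    by blast
qed

definition half_pairing :: "('a \<times> real \<Rightarrow> real) \<Rightarrow> ('a \<times> real \<Rightarrow> real) \<Rightarrow> real" where
  "half_pairing y q = half_form \<Omega> T \<sigma> (fourier T y) (perp (fourier T q))"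

lemma half_pairing_eq: "half_pairing y q = T / 2 * (\<Sum>k. real (Suc k) * \<omega> * form_term y q (Suc k))"
  by (simp add: half_pairing_def half_form_def form_term_def \<omega>_def)

lemma form_term_lincomb:
  assumes "y1 \<in> L2 M\<^sub>Q" "y2 \<in> L2 M\<^sub>Q" "q \<in> L2 M\<^sub>Q"
  shows "form_term (\<lambda>z. y1 z + c * y2 z) q k = form_term y1 q k + c * form_term y2 q k"
    and "form_term q (\<lambda>z. y1 z + c * y2 z) k = form_term q y1 k + c * form_term q y2 k"
proof -
  have yL: "(\<lambda>z. y1 z + c * y2 z) \<in> L2 M\<^sub>Q" by (intro L2_add L2_cmult assms)
  note m = borel_measurable_integrable[OF form_term_integrable]
  note i = form_term_integrable
  have "form_term (\<lambda>z. y1 z + c * y2 z) q k = (\<integral>x. \<sigma> x * (fourier T y1 k x \<bullet> perp (fourier T q) k x)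
      + c * (\<sigma> x * (fourier T y2 k x \<bullet> perp (fourier T q) k x)) \<partial>M\<^sub>\<Omega>)"
    unfolding form_term_def
  proof (rule integral_cong_AE)
    show "AE x in M\<^sub>\<Omega>. \<sigma> x * (fourier T (\<lambda>z. y1 z + c * y2 z) k x \<bullet> perp (fourier T q) k x)
      = \<sigma> x * (fourier T y1 k x \<bullet> perp (fourier T q) k x)
          + c * (\<sigma> x * (fourier T y2 k x \<bullet> perp (fourier T q) k x))"
      using fourier_lincomb_AE[OF assms(1,2), of c]
      by eventually_elim (simp add: inner_add_left algebra_simps)
  qed (intro borel_measurable_add borel_measurable_times borel_measurable_const m yL assms)+
  then show "form_term (\<lambda>z. y1 z + c * y2 z) q k = form_term y1 q k + c * form_term y2 q k"
    using i assms by (simp add: form_term_def)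
  have "form_term q (\<lambda>z. y1 z + c * y2 z) k = (\<integral>x. \<sigma> x * (fourier T q k x \<bullet> perp (fourier T y1) k x)
      + c * (\<sigma> x * (fourier T q k x \<bullet> perp (fourier T y2) k x)) \<partial>M\<^sub>\<Omega>)"
    unfolding form_term_def
  proof (rule integral_cong_AE)
    show "AE x in M\<^sub>\<Omega>. \<sigma> x * (fourier T q k x \<bullet> perp (fourier T (\<lambda>z. y1 z + c * y2 z)) k x)
      = \<sigma> x * (fourier T q k x \<bullet> perp (fourier T y1) k x)
          + c * (\<sigma> x * (fourier T q k x \<bullet> perp (fourier T y2) k x))"
      using fourier_lincomb_AE[OF assms(1,2), of c]
      by eventually_elim (simp add: perp_def inner_prod_def algebra_simps)
  qed (intro borel_measurable_add borel_measurable_times borel_measurable_const m yL assms)+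
  then show "form_term q (\<lambda>z. y1 z + c * y2 z) k = form_term q y1 k + c * form_term q y2 k"
    using i assms by (simp add: form_term_def)
qed

lemma half_pairing_lincomb:
  assumes "y1 \<in> H1_half \<Omega> T" "y2 \<in> H1_half \<Omega> T" "q \<in> H1_half \<Omega> T"
  shows "half_pairing (\<lambda>z. y1 z + c * y2 z) q = half_pairing y1 q + c * half_pairing y2 q"
    and "half_pairing q (\<lambda>z. y1 z + c * y2 z) = half_pairing q y1 + c * half_pairing q y2"
proof -
  note L = assms[THEN H1_half_D(1)]
  have *: "T / 2 * (\<Sum>k. real (Suc k) * \<omega> * (a (Suc k) + c * b (Suc k)))
      = T / 2 * (\<Sum>k. real (Suc k) * \<omega> * a (Suc k))
          + c * (T / 2 * (\<Sum>k. real (Suc k) * \<omega> * b (Suc k)))"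
    if "summable (\<lambda>k. real (Suc k) * \<omega> * a (Suc k))" "summable (\<lambda>k. real (Suc k) * \<omega> * b (Suc k))"
        for a b
  proof -
    have "(\<Sum>k. real (Suc k) * \<omega> * (a (Suc k) + c * b (Suc k)))
        = (\<Sum>k. real (Suc k) * \<omega> * a (Suc k) + c * (real (Suc k) * \<omega> * b (Suc k)))"
      by (intro suminf_cong) (simp add: algebra_simps)
    also have "\<dots> = (\<Sum>k. real (Suc k) * \<omega> * a (Suc k)) + c * (\<Sum>k. real (Suc k) * \<omega> * b (Suc k))"
      using that by (simp only: suminf_add[symmetric] suminf_mult summable_mult)
    finally show ?thesis by (simp add: distrib_left)
  qed
  show "half_pairing (\<lambda>z. y1 z + c * y2 z) q = half_pairing y1 q + c * half_pairing y2 q"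
    unfolding half_pairing_eq form_term_lincomb(1)[OF L] by (intro * form_summable assms)
  show "half_pairing q (\<lambda>z. y1 z + c * y2 z) = half_pairing q y1 + c * half_pairing q y2"
    unfolding half_pairing_eq form_term_lincomb(2)[OF L] by (intro * form_summable assms)
qed

lemma half_pairing_self: "half_pairing w w = 0"
proof -
  have "form_term w w k = 0" for k
    unfolding form_term_def by (simp add: perp_def inner_prod_def mult.commute)
  then show ?thesis by (simp add: half_pairing_eq)
qed

definition grad_pairing :: "('a \<times> real \<Rightarrow> real) \<Rightarrow> ('a \<times> real \<Rightarrow> real) \<Rightarrow> real" where
  "grad_pairing y q = (\<integral>z. \<nu> (fst z) * (grad \<Omega> T y z \<bullet> grad \<Omega> T q z) \<partial>M\<^sub>Q)"

lemma \<nu>_L2: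
  fixes g :: "'a \<times> real \<Rightarrow> 'b::euclidean_space"
  shows "g \<in> L2 M\<^sub>Q \<Longrightarrow> (\<lambda>z. \<nu> (fst z) *\<^sub>R g z) \<in> L2 M\<^sub>Q"
  by (rule L2_mult_space[OF _ \<nu>_measurable \<nu>_abs])

lemma \<sigma>_L2:
  fixes g :: "'a \<times> real \<Rightarrow> 'b::euclidean_space"
  shows "g \<in> L2 M\<^sub>Q \<Longrightarrow> (\<lambda>z. \<sigma> (fst z) *\<^sub>R g z) \<in> L2 M\<^sub>Q"
  by (rule L2_mult_space[OF _ \<sigma>_measurable \<sigma>_abs])

lemma \<nu>_integrable:
  fixes g h :: "'a \<times> real \<Rightarrow> 'b::euclidean_space"
  assumes "g \<in> L2 M\<^sub>Q" "h \<in> L2 M\<^sub>Q"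
  shows "integrable M\<^sub>Q (\<lambda>z. \<nu> (fst z) * (g z \<bullet> h z))"
  using L2_integrable_inner[OF \<nu>_L2[OF assms(1)] assms(2)] by simp

lemma grad_pairing_lincomb:
  assumes "y1 \<in> H1_half \<Omega> T" "y2 \<in> H1_half \<Omega> T" "q \<in> H1_half \<Omega> T"
  shows "grad_pairing (\<lambda>z. y1 z + c * y2 z) q = grad_pairing y1 q + c * grad_pairing y2 q"
    and "grad_pairing q (\<lambda>z. y1 z + c * y2 z) = grad_pairing q y1 + c * grad_pairing q y2"
proof -
  note G = assms[THEN H1_half_D(3)] and Gl = H1_half_D(3)[OF H1_half_lincomb[OF assms(1,2), of c]]
  note ae = grad_lincomb_AE[OF assms(1,2), of c]
  note m = borel_measurable_integrable[OF \<nu>_integrable]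
  have "grad_pairing (\<lambda>z. y1 z + c * y2 z) q = (\<integral>z. \<nu> (fst z) * (grad \<Omega> T y1 z \<bullet> grad \<Omega> T q z)
      + c * (\<nu> (fst z) * (grad \<Omega> T y2 z \<bullet> grad \<Omega> T q z)) \<partial>M\<^sub>Q)"
    unfolding grad_pairing_def
  proof (rule integral_cong_AE)
    show "AE z in M\<^sub>Q. \<nu> (fst z) * (grad \<Omega> T (\<lambda>z. y1 z + c * y2 z) z \<bullet> grad \<Omega> T q z)
      = \<nu> (fst z) * (grad \<Omega> T y1 z \<bullet> grad \<Omega> T q z)
          + c * (\<nu> (fst z) * (grad \<Omega> T y2 z \<bullet> grad \<Omega> T q z))"
      using ae by eventually_elim (simp add: inner_add_left algebra_simps)
  qed (intro borel_measurable_add borel_measurable_times[OF borel_measurable_const] m G Gl)+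
  then show left: "grad_pairing (\<lambda>z. y1 z + c * y2 z) q = grad_pairing y1 q + c * grad_pairing y2 q"
    using \<nu>_integrable[OF G(1) G(3)] \<nu>_integrable[OF G(2) G(3)] by (simp add: grad_pairing_def)
  have sym: "grad_pairing a b = grad_pairing b a" for a b
    by (simp add: grad_pairing_def inner_commute)
  show "grad_pairing q (\<lambda>z. y1 z + c * y2 z) = grad_pairing q y1 + c * grad_pairing q y2"
    using left by (simp only: sym[of q])
qed

definition form :: "('a \<times> real \<Rightarrow> real) \<Rightarrow> ('a \<times> real \<Rightarrow> real) \<Rightarrow> real" where
  "form y q = grad_pairing y q + half_pairing y q"

lemma form_lincomb:
  assumes "y1 \<in> H1_half \<Omega> T" "y2 \<in> H1_half \<Omega> T" "q \<in> H1_half \<Omega> T"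
  shows "form (\<lambda>z. y1 z + c * y2 z) q = form y1 q + c * form y2 q"
    and "form q (\<lambda>z. y1 z + c * y2 z) = form q y1 + c * form q y2"
  using grad_pairing_lincomb[OF assms] half_pairing_lincomb[OF assms]
  by (simp_all add: form_def algebra_simps)

lemma form_diff:
  assumes "y1 \<in> H1_half \<Omega> T" "y2 \<in> H1_half \<Omega> T" "q \<in> H1_half \<Omega> T"
  shows "form (\<lambda>z. y1 z - y2 z) q = form y1 q - form y2 q"
  using form_lincomb(1)[OF assms, of "-1"] by simp

text \<open>The half-order part of the form is skew and vanishes on the diagonal, so it contributes
  nothing here; its size is recovered by the conjugate harmonics below.\<close>

lemma form_coercive:
  assumes "w \<in> H1_half \<Omega> T"
  shows "nu0 * (L2_norm M\<^sub>Q (grad \<Omega> T w))\<^sup>2 \<le> form w w"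
proof -
  note G = H1_half_D(3)[OF assms]
  have "nu0 * (L2_norm M\<^sub>Q (grad \<Omega> T w))\<^sup>2 = (\<integral>z. nu0 * (grad \<Omega> T w z \<bullet> grad \<Omega> T w z) \<partial>M\<^sub>Q)"
    by (simp add: L2_norm_sq_inner)
  also have "\<dots> \<le> grad_pairing w w"
    unfolding grad_pairing_def
  proof (rule integral_mono_AE)
    show "integrable M\<^sub>Q (\<lambda>z. nu0 * (grad \<Omega> T w z \<bullet> grad \<Omega> T w z))"
      using L2_integrable_inner[OF G G] by simp
    show "AE z in M\<^sub>Q. nu0 * (grad \<Omega> T w z \<bullet> grad \<Omega> T w z)
        \<le> \<nu> (fst z) * (grad \<Omega> T w z \<bullet> grad \<Omega> T w z)"
      by (intro AE_I2 mult_right_mono) (use \<nu>_bounds in \<open>auto simp: cyl_eq\<close>)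
  qed (rule \<nu>_integrable[OF G G])
  finally show ?thesis by (simp add: form_def half_pairing_self)
qed

lemma weak_state_iff:
  "weak_state \<Omega> T \<sigma> \<nu> v y \<longleftrightarrow> y \<in> H1_half \<Omega> T \<and> (\<forall>q\<in>H1_half \<Omega> T. form y q = (\<integral>z. v z * q z \<partial>M\<^sub>Q))"
  by (simp add: weak_state_def form_def grad_pairing_def half_pairing_def)

lemma weak_state_lincomb:
  assumes "weak_state \<Omega> T \<sigma> \<nu> v1 y1" "weak_state \<Omega> T \<sigma> \<nu> v2 y2" "v1 \<in> L2 M\<^sub>Q" "v2 \<in> L2 M\<^sub>Q"
  shows "weak_state \<Omega> T \<sigma> \<nu> (\<lambda>z. v1 z + c * v2 z) (\<lambda>z. y1 z + c * y2 z)"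
proof -
  have y: "y1 \<in> H1_half \<Omega> T" "y2 \<in> H1_half \<Omega> T" using assms by (auto simp: weak_state_iff)
  have "form (\<lambda>z. y1 z + c * y2 z) q = (\<integral>z. (v1 z + c * v2 z) * q z \<partial>M\<^sub>Q)" if q: "q \<in> H1_half \<Omega> T"
      for q
  proof -
    note qL = H1_half_D(1)[OF q]
    have "form (\<lambda>z. y1 z + c * y2 z) q = (\<integral>z. v1 z * q z \<partial>M\<^sub>Q) + c * (\<integral>z. v2 z * q z \<partial>M\<^sub>Q)"
      using form_lincomb(1)[OF y q] assms(1,2) q by (simp add: weak_state_iff)
    also have "\<dots> = (\<integral>z. (v1 z + c * v2 z) * q z \<partial>M\<^sub>Q)"
      using L2_integrable_mult[OF assms(3) qL] L2_integrable_mult[OF assms(4) qL]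
      by (simp add: distrib_right mult.assoc)
    finally show ?thesis .
  qed
  then show ?thesis using H1_half_lincomb[OF y] by (simp add: weak_state_iff)
qed

lemma friedrichs_cylinder:
  assumes w: "w \<in> L2 M\<^sub>Q" and g: "is_grad \<Omega> T w g" and z: "zero_on_boundary \<Omega> T w"
  shows "L2_norm M\<^sub>Q w \<le> CF * L2_norm M\<^sub>Q g"
proof -
  have gL: "g \<in> L2 M\<^sub>Q" and wg: "AE t in M\<^sub>T. weak_gradient \<Omega> (\<lambda>x. w (x, t)) (\<lambda>x. g (x, t))"
    using g by (auto simp: is_grad_def)
  show ?thesis
  proof (rule L2_norm_le_slices[OF w gL])
    show "AE t in M\<^sub>T. L2_norm M\<^sub>\<Omega> (\<lambda>x. w (x, t)) \<le> CF * L2_norm M\<^sub>\<Omega> (\<lambda>x. g (x, t))"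
      using wg L2_slice_space[OF gL] z[unfolded zero_on_boundary_def]
      by eventually_elim (use friedrichs in \<open>auto simp: friedrichs_constant_def\<close>)
  qed (use CF_pos in simp)
qed

lemma friedrichs_H1_half:
  assumes "w \<in> H1_half \<Omega> T" shows "L2_norm M\<^sub>Q w \<le> CF * L2_norm M\<^sub>Q (grad \<Omega> T w)"
  by (intro friedrichs_cylinder H1_half_D assms)

text \<open>Integration by parts in space, slice by slice: the slices of \<open>e\<close> lie in \<open>H10\<close>, so no
  boundary term occurs.\<close>

lemma divergence_pairing:
  assumes \<tau>: "\<tau> \<in> Hdiv \<Omega> T" and e: "e \<in> H1_half \<Omega> T"
  shows "diverg \<Omega> T \<tau> \<in> L2 M\<^sub>Q" "\<tau> \<in> L2 M\<^sub>Q"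
    "(\<integral>z. \<tau> z \<bullet> grad \<Omega> T e z \<partial>M\<^sub>Q) = - (\<integral>z. diverg \<Omega> T \<tau> z * e z \<partial>M\<^sub>Q)"
proof -
  have "\<exists>D. is_div \<Omega> T \<tau> D" using \<tau> by (simp add: Hdiv_def)
  then have "is_div \<Omega> T \<tau> (diverg \<Omega> T \<tau>)" unfolding diverg_def by (rule someI_ex)
  then have DL: "diverg \<Omega> T \<tau> \<in> L2 M\<^sub>Q"
    and wd: "AE t in M\<^sub>T. weak_divergence \<Omega> (\<lambda>x. \<tau> (x, t)) (\<lambda>x. diverg \<Omega> T \<tau> (x, t))"
    by (auto simp: is_div_def)
  have \<tau>L: "\<tau> \<in> L2 M\<^sub>Q" using \<tau> by (simp add: Hdiv_def)
  show "diverg \<Omega> T \<tau> \<in> L2 M\<^sub>Q" "\<tau> \<in> L2 M\<^sub>Q" by (fact DL, fact \<tau>L)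
  note E = H1_half_D[OF e]
  have wg: "AE t in M\<^sub>T. weak_gradient \<Omega> (\<lambda>x. e (x, t)) (\<lambda>x. grad \<Omega> T e (x, t))"
    using E(2) by (simp add: is_grad_def)
  have i1: "integrable M\<^sub>Q (\<lambda>z. \<tau> z \<bullet> grad \<Omega> T e z)" by (rule L2_integrable_inner[OF \<tau>L E(3)])
  have i2: "integrable M\<^sub>Q (\<lambda>z. diverg \<Omega> T \<tau> z * e z)" by (rule L2_integrable_mult[OF DL E(1)])
  have "(\<integral>t. (\<integral>x. \<tau> (x, t) \<bullet> grad \<Omega> T e (x, t) \<partial>M\<^sub>\<Omega>) \<partial>M\<^sub>T)
      = (\<integral>t. - (\<integral>x. diverg \<Omega> T \<tau> (x, t) * e (x, t) \<partial>M\<^sub>\<Omega>) \<partial>M\<^sub>T)"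
  proof (rule integral_cong_AE)
    show "AE t in M\<^sub>T. (\<integral>x. \<tau> (x, t) \<bullet> grad \<Omega> T e (x, t) \<partial>M\<^sub>\<Omega>) =
        - (\<integral>x. diverg \<Omega> T \<tau> (x, t) * e (x, t) \<partial>M\<^sub>\<Omega>)"
      using wd wg E(5)[unfolded zero_on_boundary_def] L2_slice_space[OF \<tau>L] L2_slice_space[OF DL]
          L2_slice_space[OF E(3)]
      by eventually_elim (intro weak_divergence_test_limit test_limit_H10)
  qed (use Q_integrable_space(2)[OF i1] Q_integrable_space(2)[OF i2] in auto)
  then show "(\<integral>z. \<tau> z \<bullet> grad \<Omega> T e z \<partial>M\<^sub>Q) = - (\<integral>z. diverg \<Omega> T \<tau> z * e z \<partial>M\<^sub>Q)"
    using Q_integral_space[OF i1] Q_integral_space[OF i2] by simp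
qed

end

section \<open>Conjugate harmonics and stability of the state equation\<close>

context cylinder
begin

text \<open>The inverse of the rotation that \<open>perp\<close> applies to each coefficient pair.\<close>

definition rot :: "real \<times> real \<Rightarrow> real \<times> real" where "rot c = (snd c, - fst c)"

lemma norm_rot: "norm (rot c) = norm c"
  by (simp add: rot_def norm_prod_def add.commute)

lemma inner_rot_self: "c \<bullet> rot c = 0"
  by (simp add: rot_def inner_prod_def mult.commute)

text \<open>One harmonic of the conjugate function, normalised such that \<open>perp\<close> of its coefficients
  gives back the \<open>k\<close>-th harmonic of \<open>f\<close>.\<close>

definition conjugate :: "('a \<times> real \<Rightarrow> real) \<Rightarrow> nat \<Rightarrow> 'a \<times> real \<Rightarrow> real" where
  "conjugate f k z = harmonic k (rot (fourier T f k (fst z))) (snd z)"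

lemma conjugate_eq:
  "conjugate f k z = snd (fourier T f k (fst z)) * co k (snd z) - fst (fourier T f k (fst z)) * si
      k (snd z)"
  by (simp add: conjugate_def harmonic_def rot_def)

lemma conjugate_L2:
  assumes "f \<in> L2 M\<^sub>Q" shows "conjugate f k \<in> L2 M\<^sub>Q"
  unfolding conjugate_eq[abs_def]
  by (intro L2_diff L2_lift fourier_fst_L2 fourier_snd_L2 assms co_si_time)

lemma rot_fourier_L2:
  assumes "f \<in> L2 M\<^sub>Q" shows "(\<lambda>x. rot (fourier T f k x)) \<in> L2 M\<^sub>\<Omega>"
  unfolding rot_def by (intro L2_Pair L2_minus fourier_fst_L2 fourier_snd_L2 assms)

lemma conjugate_pairing:
  assumes f: "f \<in> L2 M\<^sub>Q" and g: "g \<in> L2 M\<^sub>Q"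
  shows "(\<integral>z. g z * conjugate f k z \<partial>M\<^sub>Q)
      = T / 2 * (\<integral>x. fourier T g k x \<bullet> rot (fourier T f k x) \<partial>M\<^sub>\<Omega>)"
proof -
  have i: "integrable M\<^sub>Q (\<lambda>z. g z * conjugate f k z)"
      by (intro L2_integrable_mult g conjugate_L2 f)
  have j: "integrable M\<^sub>\<Omega> (\<lambda>x. fourier T g k x \<bullet> rot (fourier T f k x))"
    by (intro L2_integrable_inner fourier_L2 rot_fourier_L2 f g)
  have "(\<integral>x. (\<integral>t. g (x, t) * conjugate f k (x, t) \<partial>M\<^sub>T) \<partial>M\<^sub>\<Omega>)
      = (\<integral>x. T / 2 * (fourier T g k x \<bullet> rot (fourier T f k x)) \<partial>M\<^sub>\<Omega>)"
  proof (rule integral_cong_AE)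
    show "AE x in M\<^sub>\<Omega>. (\<integral>t. g (x, t) * conjugate f k (x, t) \<partial>M\<^sub>T)
        = T / 2 * (fourier T g k x \<bullet> rot (fourier T f k x))"
      using L2_slice_time[OF g]
      by eventually_elim (simp add: conjugate_def integral_harmonic fourier_eq_fcoef del:
          times_divide_eq_left)
  qed (use Q_integrable_time(2)[OF i] j in auto)
  then show ?thesis using Q_integral_time[OF i] by simp
qed

text \<open>By orthogonality in time only the \<open>k\<close>-th harmonic of \<open>f\<close> meets its conjugate, and the two
  coefficient pairs are perpendicular at every point of the domain. Hence a weight that depends on
  space only does not destroy the orthogonality, and the elliptic part of the form does not see
  conjugate harmonics.\<close>

lemma conjugate_orthogonal:
  assumes f: "f \<in> L2 M\<^sub>Q" and a: "a \<in> borel_measurable M\<^sub>\<Omega>" "\<And>x. x \<in> \<Omega> \<Longrightarrow> \<bar>a x\<bar> \<le> C"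
  shows "(\<integral>z. a (fst z) * f z * conjugate f k z \<partial>M\<^sub>Q) = 0"
proof -
  have af: "(\<lambda>z. a (fst z) * f z) \<in> L2 M\<^sub>Q" using L2_mult_space[OF f a] by simp
  show ?thesis
    unfolding conjugate_pairing[OF f af] fourier_coefficient_mult by (simp add: inner_rot_self)
qed

lemma fourier_conjugate_sum:
  "fourier T (\<lambda>z. \<Sum>k<N. conjugate f (Suc k) z) (Suc j) x
      = (if j < N then rot (fourier T f (Suc j) x) else 0)"
proof (induction N)
  case 0
  then show ?case by (simp add: fourier_eq time_average_def zero_prod_def)
next
  case (Suc N)
  have L: "(\<lambda>t. \<Sum>k<N. conjugate f (Suc k) (x, t)) \<in> L2 I\<^sub>T"
    unfolding conjugate_def by (simp add: L2_sum harmonic_L2)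
  have "fourier T (\<lambda>z. \<Sum>k<Suc N. conjugate f (Suc k) z) (Suc j) x
      = fcoef T (\<lambda>t. (\<Sum>k<N. conjugate f (Suc k) (x, t))
          + 1 * harmonic (Suc N) (rot (fourier T f (Suc N) x)) t) (Suc j)"
    unfolding fourier_eq_fcoef[of T "\<lambda>z. \<Sum>k<Suc N. conjugate f (Suc k) z"]
    by (simp add: conjugate_def)
  also have "\<dots> = fourier T (\<lambda>z. \<Sum>k<N. conjugate f (Suc k) z) (Suc j) x
      + 1 *\<^sub>R fcoef T (harmonic (Suc N) (rot (fourier T f (Suc N) x))) (Suc j)"
    by (simp only: fcoef_lincomb[OF L harmonic_L2] fourier_eq_fcoef[of _ "\<lambda>z. \<Sum>k<N. conjugate f
        (Suc k) z"])
  finally show ?case using Suc by (auto simp: fcoef_harmonic less_Suc_eq)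
qed

lemma fourier_conjugate:
  "fourier T (conjugate f (Suc k)) (Suc j) x = (if j = k then rot (fourier T f (Suc k) x) else 0)"
  by (simp add: fourier_eq_fcoef[of _ "conjugate f (Suc k)"] conjugate_def fcoef_harmonic)

text \<open>By Pythagoras, since the conjugate harmonics are orthogonal to \<open>f\<close>, and their sum is no
  larger than \<open>f\<close> by Bessel's inequality. The factor two is the source of \<open>1 / sqrt 2\<close> in \<open>mu1\<close>.\<close>

lemma L2_norm_add_conjugates_le:
  assumes f: "f \<in> L2 M\<^sub>Q"
  shows "(L2_norm M\<^sub>Q (\<lambda>z. f z + (\<Sum>k<N. conjugate f (Suc k) z)))\<^sup>2 \<le> 2 * (L2_norm M\<^sub>Q f)\<^sup>2"
proof -
  let ?P = "\<lambda>z. \<Sum>k<N. conjugate f (Suc k) z"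
  have P: "?P \<in> L2 M\<^sub>Q" by (intro L2_sum conjugate_L2 f)
  have "(\<integral>z. f z \<bullet> ?P z \<partial>M\<^sub>Q) = (\<Sum>k<N. \<integral>z. f z * conjugate f (Suc k) z \<partial>M\<^sub>Q)"
    using L2_integrable_mult[OF f conjugate_L2[OF f]]
    by (simp add: sum_distrib_left Bochner_Integration.integral_sum)
  also have "\<dots> = 0"
    using conjugate_orthogonal[OF f, of "\<lambda>_. 1" 1] by simp
  finally have o: "(\<integral>z. f z \<bullet> ?P z \<partial>M\<^sub>Q) = 0" .
  have "(L2_norm M\<^sub>Q ?P)\<^sup>2 = (\<integral>z. (\<Sum>k<N. ?P z * conjugate f (Suc k) z) \<partial>M\<^sub>Q)"
    by (simp add: L2_norm_sq_inner sum_distrib_left)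
  also have "\<dots> = (\<Sum>k<N. \<integral>z. ?P z * conjugate f (Suc k) z \<partial>M\<^sub>Q)"
    by (intro Bochner_Integration.integral_sum L2_integrable_mult P conjugate_L2 f)
  also have "\<dots> = (\<Sum>k<N. T / 2 * (L2_norm M\<^sub>\<Omega> (fourier T f (Suc k)))\<^sup>2)"
    unfolding conjugate_pairing[OF f P] fourier_conjugate_sum
    by (intro sum.cong refl) (simp add: L2_norm_sq power2_norm_eq_inner[symmetric] norm_rot)
  also have "\<dots> \<le> (L2_norm M\<^sub>Q f)\<^sup>2" by (rule Bessel_cylinder[OF f])
  finally show ?thesis
    using L2_norm_sq_add[OF f P, of 1] o by simp
qed

definition conjugate_vec :: "('a \<times> real \<Rightarrow> 'a) \<Rightarrow> nat \<Rightarrow> 'a \<times> real \<Rightarrow> 'a" where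
  "conjugate_vec g k z = (\<Sum>b\<in>Basis. conjugate (\<lambda>z. g z \<bullet> b) k z *\<^sub>R b)"

lemma conjugate_vec_inner: "b \<in> Basis \<Longrightarrow> conjugate_vec g k z \<bullet> b = conjugate (\<lambda>z. g z \<bullet> b) k z"
  by (simp add: conjugate_vec_def inner_sum_left inner_Basis if_distrib cong: if_cong)

lemma conjugate_vec_L2:
  assumes "g \<in> L2 M\<^sub>Q" shows "conjugate_vec g k \<in> L2 M\<^sub>Q"
  by (rule L2_vector) (simp add: conjugate_vec_inner conjugate_L2 L2_component assms)

text \<open>A conjugate harmonic is at every time a combination of two time averages of \<open>w\<close>. Adding and
  subtracting one of them brings it into the form \<open>f + c g\<close> of the closure lemmas.\<close>

lemma conjugate_slice:
  "conjugate w k (x, t) = (time_average (si k) w x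
      + (2 / T * co k t - 1) * time_average (si k) w x)
          + (- (2 / T * si k t)) * time_average (co k) w x"
  by (simp add: conjugate_eq fourier_eq algebra_simps)

lemma is_grad_conjugate:
  assumes w: "w \<in> L2 M\<^sub>Q" and g: "is_grad \<Omega> T w g"
  shows "is_grad \<Omega> T (conjugate w k) (conjugate_vec g k)"
proof -
  have gL: "g \<in> L2 M\<^sub>Q" using g by (simp add: is_grad_def)
  have "weak_gradient \<Omega> (\<lambda>x. conjugate w k (x, t)) (\<lambda>x. conjugate_vec g k (x, t))" for t
  proof -
    let ?A = "time_average (si k) w" and ?B = "time_average (co k) w"
    let ?GA = "time_average_vec (si k) g" and ?GB = "time_average_vec (co k) g"
    have L: "?A \<in> L2 M\<^sub>\<Omega>" "?B \<in> L2 M\<^sub>\<Omega>" "?GA \<in> L2 M\<^sub>\<Omega>" "?GB \<in> L2 M\<^sub>\<Omega>"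
      by (intro time_average_L2 time_average_vec_L2 co_si_time w gL)+
    have W: "weak_gradient \<Omega> ?A ?GA" "weak_gradient \<Omega> ?B ?GB"
      by (intro time_average_weak_gradient co_si_time w g)+
    have "weak_gradient \<Omega> (\<lambda>x. (?A x + (2 / T * co k t - 1) * ?A x) + (- (2 / T * si k t)) * ?B x)
        (\<lambda>x. (?GA x + (2 / T * co k t - 1) *\<^sub>R ?GA x) + (- (2 / T * si k t)) *\<^sub>R ?GB x)"
      by (intro weak_gradient_lincomb L2_add L2_cmult L2_scaleR L W)
    moreover have "(?GA x + (2 / T * co k t - 1) *\<^sub>R ?GA x) + (- (2 / T * si k t)) *\<^sub>R ?GB x
        = conjugate_vec g k (x, t)" for x
      by (rule euclidean_eqI)
         (simp add: inner_add_left inner_diff_left time_average_vec_inner[OF co_si_time(1,2)]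
             time_average_vec_inner[OF co_si_time(3,4)]
           conjugate_vec_inner conjugate_slice)
    ultimately show ?thesis by (simp add: conjugate_slice)
  qed
  then show ?thesis using conjugate_vec_L2[OF gL] by (simp add: is_grad_def)
qed

lemma conjugate_H1_half:
  assumes "w \<in> H1_half \<Omega> T"
  shows "conjugate w (Suc k) \<in> H1_half \<Omega> T"
proof -
  note D = H1_half_D[OF assms]
  have "(\<lambda>x. conjugate w (Suc k) (x, t)) \<in> H10 \<Omega>" for t
    unfolding conjugate_slice by (intro H10_lincomb time_average_H10[OF co_si_time(1,2) D(1,2,5)]
        time_average_H10[OF co_si_time(3,4) D(1,2,5)])
  then have "zero_on_boundary \<Omega> T (conjugate w (Suc k))" by (simp add: zero_on_boundary_def)
  moreover have "summable (\<lambda>j. half_term \<Omega> T (conjugate w (Suc k)) (Suc j))"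
  proof (rule summable_finite[of "{k}"])
    fix j assume "j \<notin> {k}"
    then have "fourier T (conjugate w (Suc k)) (Suc j) = (\<lambda>x. 0)"
      by (auto simp: fourier_conjugate)
    then show "half_term \<Omega> T (conjugate w (Suc k)) (Suc j) = 0"
      unfolding half_term_eq by (simp add: L2_norm_def)
  qed simp
  ultimately show ?thesis
    unfolding H1_half_def using conjugate_L2[OF D(1)] is_grad_conjugate[OF D(1,2)] by blast
qed

lemma conjugate_sum_H1_half:
  assumes "w \<in> H1_half \<Omega> T"
  shows "(\<lambda>z. w z + (\<Sum>k<N. conjugate w (Suc k) z)) \<in> H1_half \<Omega> T"
    and "is_grad \<Omega> T (\<lambda>z. w z + (\<Sum>k<N. conjugate w (Suc k) z))
      (\<lambda>z. grad \<Omega> T w z + (\<Sum>k<N. conjugate_vec (grad \<Omega> T w) (Suc k) z))"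
proof (induction N)
  case 0
  {
    case 1
    show ?case using assms by simp
  next
    case 2
    show ?case using H1_half_D(2)[OF assms] by simp
  }
next
  case (Suc N)
  note D = H1_half_D[OF assms]
  {
    case 1
    show ?case using H1_half_lincomb[OF Suc(1) conjugate_H1_half[OF assms, of N], of 1]
        by (simp add: add.assoc)
  next
    case 2
    show ?case
      using is_grad_lincomb[OF H1_half_D(1)[OF Suc(1)] conjugate_L2[OF D(1), of "Suc N"] Suc(2)
          is_grad_conjugate[OF D(1,2), of "Suc N"], of 1]
      by (simp add: add.assoc)
  }
qed

end

context periodic_parabolic
begin

lemma grad_pairing_conjugate:
  assumes "w \<in> H1_half \<Omega> T" shows "grad_pairing w (conjugate w (Suc k)) = 0"
proof -
  note D = H1_half_D[OF assms]
  let ?g = "grad \<Omega> T w" and ?c = "conjugate w (Suc k)"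
  note C = H1_half_D[OF conjugate_H1_half[OF assms, of k]]
  have ae: "AE z in M\<^sub>Q. grad \<Omega> T ?c z = conjugate_vec ?g (Suc k) z"
    by (rule is_grad_unique[OF C(2) is_grad_conjugate[OF D(1,2)]])
  note gb = L2_component[OF D(3)]
  have "grad_pairing w ?c = (\<integral>z. \<nu> (fst z) * (?g z \<bullet> conjugate_vec ?g (Suc k) z) \<partial>M\<^sub>Q)"
    unfolding grad_pairing_def
  proof (rule integral_cong_AE)
    show "AE z in M\<^sub>Q. \<nu> (fst z) * (?g z \<bullet> grad \<Omega> T ?c z)
        = \<nu> (fst z) * (?g z \<bullet> conjugate_vec ?g (Suc k) z)"
      using ae by eventually_elim simp
  qed (intro borel_measurable_integrable \<nu>_integrable D C conjugate_vec_L2)+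
  also have "\<dots> = (\<integral>z. (\<Sum>b\<in>Basis. \<nu> (fst z) * (?g z \<bullet> b) * conjugate (\<lambda>z. ?g z \<bullet> b) (Suc k) z) \<partial>M\<^sub>Q)"
  proof (intro Bochner_Integration.integral_cong refl)
    fix z
    have "?g z \<bullet> conjugate_vec ?g (Suc k) z
        = (\<Sum>b\<in>Basis. (?g z \<bullet> b) * conjugate (\<lambda>z. ?g z \<bullet> b) (Suc k) z)"
      unfolding conjugate_vec_def inner_sum_right by (simp add: mult.commute)
    then show "\<nu> (fst z) * (?g z \<bullet> conjugate_vec ?g (Suc k) z)
        = (\<Sum>b\<in>Basis. \<nu> (fst z) * (?g z \<bullet> b) * conjugate (\<lambda>z. ?g z \<bullet> b) (Suc k) z)"
      by (simp add: sum_distrib_left mult.assoc)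
  qed
  also have "\<dots> = (\<Sum>b\<in>Basis. \<integral>z. \<nu> (fst z) * (?g z \<bullet> b) * conjugate (\<lambda>z. ?g z \<bullet> b) (Suc k) z \<partial>M\<^sub>Q)"
    using L2_integrable_mult[OF \<nu>_L2[OF gb] conjugate_L2[OF gb]]
    by (intro Bochner_Integration.integral_sum) simp
  also have "\<dots> = 0"
    using conjugate_orthogonal[OF gb \<nu>_measurable \<nu>_abs] by simp
  finally show ?thesis .
qed

text \<open>Here \<open>perp\<close> undoes \<open>rot\<close>, so the half-order form turns into \<open>\<integral> \<sigma> |w\<^sub>k|\<^sup>2\<close>.\<close>

lemma half_pairing_conjugate:
  assumes "w \<in> L2 M\<^sub>Q"
  shows "sig0 * (T / 2 * half_term \<Omega> T w (Suc k)) \<le> half_pairing w (conjugate w (Suc k))"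
proof -
  have ft: "form_term w (conjugate w (Suc k)) (Suc j)
      = (if j = k then \<integral>x. \<sigma> x * (fourier T w (Suc k) x \<bullet> fourier T w (Suc k) x) \<partial>M\<^sub>\<Omega> else 0)" for j
    unfolding form_term_def perp_def fourier_conjugate
    by (cases "j = k") (simp_all add: rot_def inner_prod_def)
  have "(\<Sum>j. real (Suc j) * \<omega> * form_term w (conjugate w (Suc k)) (Suc j))
      = (\<Sum>j\<in>{k}. real (Suc j) * \<omega> * form_term w (conjugate w (Suc k)) (Suc j))"
    by (rule suminf_finite) (auto simp: ft)
  then have eq: "half_pairing w (conjugate w (Suc k))
      = T / 2 * (real (Suc k) * \<omega> * (\<integral>x. \<sigma> x * (fourier T w (Suc k) x \<bullet> fourier T w (Suc k) x)
          \<partial>M\<^sub>\<Omega>))"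
    by (simp add: half_pairing_eq ft)
  have "sig0 * (L2_norm M\<^sub>\<Omega> (fourier T w (Suc k)))\<^sup>2
      = (\<integral>x. sig0 * (fourier T w (Suc k) x \<bullet> fourier T w (Suc k) x) \<partial>M\<^sub>\<Omega>)"
    by (simp add: L2_norm_sq_inner)
  also have "\<dots> \<le> (\<integral>x. \<sigma> x * (fourier T w (Suc k) x \<bullet> fourier T w (Suc k) x) \<partial>M\<^sub>\<Omega>)"
  proof (rule integral_mono_AE)
    show "integrable M\<^sub>\<Omega> (\<lambda>x. sig0 * (fourier T w (Suc k) x \<bullet> fourier T w (Suc k) x))"
      using L2_integrable_inner[OF fourier_L2[OF assms] fourier_L2[OF assms]] by simp
    show "integrable M\<^sub>\<Omega> (\<lambda>x. \<sigma> x * (fourier T w (Suc k) x \<bullet> fourier T w (Suc k) x))"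
      using L2_integrable_inner[OF \<sigma>_fourier_L2[OF assms] fourier_L2[OF assms]] by simp
    show "AE x in M\<^sub>\<Omega>. sig0 * (fourier T w (Suc k) x \<bullet> fourier T w (Suc k) x)
        \<le> \<sigma> x * (fourier T w (Suc k) x \<bullet> fourier T w (Suc k) x)"
      by (intro AE_I2 mult_right_mono) (use \<sigma>_bounds in auto)
  qed
  finally have "T / 2 * (real (Suc k) * \<omega> * (sig0 * (L2_norm M\<^sub>\<Omega> (fourier T w (Suc k)))\<^sup>2))
      \<le> half_pairing w (conjugate w (Suc k))"
    unfolding eq using T_pos \<omega>_pos by (intro mult_left_mono) auto
  then show ?thesis by (simp add: half_term_eq mult_ac)
qed

lemma half_norm_nonneg:
  assumes "w \<in> H1_half \<Omega> T" shows "0 \<le> half_norm_sq \<Omega> T w"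
  unfolding half_norm_sq_def using H1_half_D(4)[OF assms] half_term_nonneg T_pos
  by (intro mult_nonneg_nonneg suminf_nonneg) auto

text \<open>Testing with \<open>w\<close> plus its first \<open>N\<close> conjugate harmonics makes both parts of the form
  positive: \<open>w\<close> contributes the gradient, the conjugates contribute the half-order terms, and the
  mixed elliptic terms vanish by orthogonality. The right-hand side is bounded independently of
  \<open>N\<close> by Friedrichs' inequality for the sum and \<open>L2_norm_add_conjugates_le\<close> for each component of
  its gradient.\<close>

theorem stability:
  assumes w: "w \<in> H1_half \<Omega> T" and f: "f \<in> L2 M\<^sub>Q"
    and eq: "\<And>q. q \<in> H1_half \<Omega> T \<Longrightarrow> form w q = (\<integral>z. f z * q z \<partial>M\<^sub>Q)"
  shows "(mu1 nu0 sig0)\<^sup>2 * seminorm_sq \<Omega> T w \<le> CF\<^sup>2 * (L2_norm M\<^sub>Q f)\<^sup>2"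
proof -
  note D = H1_half_D[OF w]
  let ?g = "grad \<Omega> T w"
  define a where "a = L2_norm M\<^sub>Q ?g"
  define n where "n = L2_norm M\<^sub>Q f"
  define H where "H = half_norm_sq \<Omega> T w"
  define m where "m = min nu0 sig0"
  have m: "m > 0" "m \<le> nu0" "m \<le> sig0" using nu0_pos sig0_pos by (auto simp: m_def)
  have pos: "0 \<le> a" "0 \<le> n" "0 \<le> H" using half_norm_nonneg[OF w] by (auto simp: a_def n_def H_def)
  have partial: "nu0 * a\<^sup>2 + (\<Sum>k<N. sig0 * (T / 2 * half_term \<Omega> T w (Suc k)))
      \<le> n * (CF * (sqrt 2 * a))" for N
  proof -
    let ?P = "\<lambda>z. \<Sum>k<N. conjugate w (Suc k) z"
    let ?q = "\<lambda>z. w z + ?P z" and ?G = "\<lambda>z. ?g z + (\<Sum>k<N. conjugate_vec ?g (Suc k) z)"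
    note q = conjugate_sum_H1_half[OF w, of N]
    have GL: "?G \<in> L2 M\<^sub>Q" using q(2) by (simp add: is_grad_def)
    have "(\<integral>z. f z * ?q z \<partial>M\<^sub>Q) = (\<integral>z. f z * w z \<partial>M\<^sub>Q)
        + (\<Sum>k<N. \<integral>z. f z * conjugate w (Suc k) z \<partial>M\<^sub>Q)"
      using L2_integrable_mult[OF f D(1)] L2_integrable_mult[OF f conjugate_L2[OF D(1)]]
      by (simp add: distrib_left sum_distrib_left Bochner_Integration.integral_sum)
    also have "\<dots> = form w w + (\<Sum>k<N. form w (conjugate w (Suc k)))"
      using eq w conjugate_H1_half[OF w] by simp
    also have "\<dots> \<ge> nu0 * a\<^sup>2 + (\<Sum>k<N. sig0 * (T / 2 * half_term \<Omega> T w (Suc k)))"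
      using form_coercive[OF w] half_pairing_conjugate[OF D(1)]
      by (intro add_mono sum_mono) (auto simp: a_def form_def grad_pairing_conjugate[OF w])
    finally have lower: "nu0 * a\<^sup>2 + (\<Sum>k<N. sig0 * (T / 2 * half_term \<Omega> T w (Suc k)))
        \<le> (\<integral>z. f z * ?q z \<partial>M\<^sub>Q)" .
    have "(\<integral>z. f z * ?q z \<partial>M\<^sub>Q) \<le> n * L2_norm M\<^sub>Q ?q"
      using L2_Cauchy_Schwarz[OF f H1_half_D(1)[OF q(1)]] by (simp add: n_def)
    also have "L2_norm M\<^sub>Q ?q \<le> CF * L2_norm M\<^sub>Q ?G"
      by (rule friedrichs_cylinder[OF H1_half_D(1)[OF q(1)] q(2) H1_half_D(5)[OF q(1)]])
    also have "L2_norm M\<^sub>Q ?G \<le> sqrt 2 * a"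
    proof (rule power2_le_imp_le)
      have Gb: "?G z \<bullet> b = ?g z \<bullet> b + (\<Sum>k<N. conjugate (\<lambda>z. ?g z \<bullet> b) (Suc k) z)" if "b \<in> Basis"
          for b z
        using that by (simp add: inner_add_left inner_sum_left conjugate_vec_inner)
      have "(L2_norm M\<^sub>Q ?G)\<^sup>2 = (\<Sum>b\<in>Basis. (L2_norm M\<^sub>Q (\<lambda>z. ?g z \<bullet> b
          + (\<Sum>k<N. conjugate (\<lambda>z. ?g z \<bullet> b) (Suc k) z)))\<^sup>2)"
        unfolding L2_norm_sq_components[OF GL] by (intro sum.cong refl) (simp only: Gb)
      also have "\<dots> \<le> (\<Sum>b\<in>Basis. 2 * (L2_norm M\<^sub>Q (\<lambda>z. ?g z \<bullet> b))\<^sup>2)"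
        by (intro sum_mono L2_norm_add_conjugates_le L2_component D(3))
      also have "\<dots> = (sqrt 2 * a)\<^sup>2"
        by (simp add: a_def power_mult_distrib L2_norm_sq_components[OF D(3)] sum_distrib_left)
      finally show "(L2_norm M\<^sub>Q ?G)\<^sup>2 \<le> (sqrt 2 * a)\<^sup>2" .
    qed (use pos in simp)
    finally have "(\<integral>z. f z * ?q z \<partial>M\<^sub>Q) \<le> n * (CF * (sqrt 2 * a))"
      using pos CF_pos by (simp add: mult_left_mono)
    then show ?thesis using lower by linarith
  qed
  have "(\<lambda>N. nu0 * a\<^sup>2 + (\<Sum>k<N. sig0 * (T / 2 * half_term \<Omega> T w (Suc k)))) \<longlonglongrightarrow> nu0 * a\<^sup>2 + sig0 * H"
  proof -
    have "(\<lambda>k. sig0 * (T / 2 * half_term \<Omega> T w (Suc k))) sums (sig0 * (T / 2 * (\<Sum>k. half_term \<Omega> T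
        w (Suc k))))"
      by (intro sums_mult summable_sums D)
    then show ?thesis unfolding sums_def H_def half_norm_sq_def by (intro tendsto_intros)
  qed
  then have main: "nu0 * a\<^sup>2 + sig0 * H \<le> n * (CF * (sqrt 2 * a))"
    by (rule LIMSEQ_le_const2) (use partial in blast)
  define X where "X = a\<^sup>2 + H"
  have X: "0 \<le> X" "a\<^sup>2 \<le> X" using pos by (auto simp: X_def)
  have "m * X \<le> nu0 * a\<^sup>2 + sig0 * H"
    unfolding X_def distrib_left using m pos by (intro add_mono mult_right_mono) auto
  with main have "m * X \<le> n * (CF * (sqrt 2 * a))" by linarith
  then have "(m * X)\<^sup>2 \<le> (n * (CF * (sqrt 2 * a)))\<^sup>2"
    using m X by (intro power_mono) auto
  then have "m\<^sup>2 * X * X \<le> 2 * CF\<^sup>2 * n\<^sup>2 * a\<^sup>2"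
    by (simp add: power_mult_distrib power2_eq_square[of X] mult_ac)
  also have "\<dots> \<le> 2 * CF\<^sup>2 * n\<^sup>2 * X" using X by (intro mult_left_mono) auto
  finally have "m\<^sup>2 * X * X \<le> 2 * CF\<^sup>2 * n\<^sup>2 * X" .
  then have "m\<^sup>2 * X \<le> 2 * CF\<^sup>2 * n\<^sup>2"
    using X(1) by (cases "X = 0") (auto simp: mult_le_cancel_right)
  then have "1 / 2 * m\<^sup>2 * X \<le> CF\<^sup>2 * n\<^sup>2" by simp
  moreover have "(mu1 nu0 sig0)\<^sup>2 = 1 / 2 * m\<^sup>2"
    by (simp add: mu1_def m_def power_mult_distrib power_divide)
  ultimately have "(mu1 nu0 sig0)\<^sup>2 * X \<le> CF\<^sup>2 * n\<^sup>2" by (simp only:)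
  then show ?thesis by (simp add: seminorm_sq_def X_def a_def H_def n_def)
qed

section \<open>Bounds for the cost functional\<close>

abbreviation "nQ f \<equiv> L2_norm M\<^sub>Q f"
abbreviation "\<mu> \<equiv> mu1 nu0 sig0"

lemma mu1_bounds: "0 < \<mu>" "\<mu> \<le> nu0"
proof -
  have "1 / sqrt 2 \<le> (1::real)" by simp
  then have "\<mu> \<le> 1 * min nu0 sig0"
    unfolding mu1_def using nu0_pos sig0_pos by (intro mult_right_mono) auto
  then show "\<mu> \<le> nu0" by simp
qed (use nu0_pos sig0_pos in \<open>simp add: mu1_def\<close>)

lemma form_H1_1:
  assumes "\<eta> \<in> H1_1 \<Omega> T" "q \<in> H1_half \<Omega> T"
  shows "form \<eta> q = grad_pairing \<eta> q + (\<integral>z. \<sigma> (fst z) * dt \<Omega> T \<eta> z * q z \<partial>M\<^sub>Q)"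
    and "form q \<eta> = grad_pairing q \<eta> - (\<integral>z. \<sigma> (fst z) * dt \<Omega> T \<eta> z * q z \<partial>M\<^sub>Q)"
  using half_form_dt[OF H1_1_D(1,2,4)[OF assms(1)] H1_half_D(1)[OF assms(2)] \<sigma>_measurable \<sigma>_abs]
  by (simp_all add: form_def half_pairing_def)

text \<open>The same identity serves for the flux \<open>\<rho>\<close> and the function \<open>\<zeta>\<close>, because \<open>R4\<close> is \<open>R2\<close> of
  those arguments.\<close>

lemma flux_residual_pairing:
  assumes \<tau>: "\<tau> \<in> Hdiv \<Omega> T" and \<eta>: "\<eta> \<in> H1_half \<Omega> T" and q: "q \<in> H1_half \<Omega> T"
  shows "R2 \<Omega> T \<nu> \<eta> \<tau> \<in> L2 M\<^sub>Q"
    and "(\<integral>z. R2 \<Omega> T \<nu> \<eta> \<tau> z \<bullet> grad \<Omega> T q z \<partial>M\<^sub>Q) =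
        - (\<integral>z. diverg \<Omega> T \<tau> z * q z \<partial>M\<^sub>Q) - grad_pairing \<eta> q"
proof -
  note \<tau>L = divergence_pairing[OF \<tau> q]
  note G = H1_half_D(3)[OF \<eta>] H1_half_D(3)[OF q]
  show "R2 \<Omega> T \<nu> \<eta> \<tau> \<in> L2 M\<^sub>Q"
    unfolding R2_def[abs_def] by (intro L2_diff \<tau>L \<nu>_L2 G)
  have "(\<integral>z. R2 \<Omega> T \<nu> \<eta> \<tau> z \<bullet> grad \<Omega> T q z \<partial>M\<^sub>Q)
      = (\<integral>z. \<tau> z \<bullet> grad \<Omega> T q z - \<nu> (fst z) * (grad \<Omega> T \<eta> z \<bullet> grad \<Omega> T q z) \<partial>M\<^sub>Q)"
    by (simp add: R2_def inner_diff_left)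
  also have "\<dots> = (\<integral>z. \<tau> z \<bullet> grad \<Omega> T q z \<partial>M\<^sub>Q) - grad_pairing \<eta> q"
    unfolding grad_pairing_def
    by (intro Bochner_Integration.integral_diff L2_integrable_inner \<tau>L G \<nu>_integrable)
  finally show "(\<integral>z. R2 \<Omega> T \<nu> \<eta> \<tau> z \<bullet> grad \<Omega> T q z \<partial>M\<^sub>Q) =
      - (\<integral>z. diverg \<Omega> T \<tau> z * q z \<partial>M\<^sub>Q) - grad_pairing \<eta> q"
    using \<tau>L(3) by simp
qed

lemma \<sigma>_dt_L2:
  assumes "\<eta> \<in> H1_1 \<Omega> T" shows "(\<lambda>z. \<sigma> (fst z) * dt \<Omega> T \<eta> z) \<in> L2 M\<^sub>Q"
  using \<sigma>_L2[OF H1_1_D(3)[OF assms]] by simp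

lemma R1_L2:
  assumes "\<eta> \<in> H1_1 \<Omega> T" "\<tau> \<in> Hdiv \<Omega> T" "v \<in> L2 M\<^sub>Q"
  shows "R1 \<Omega> T \<sigma> \<eta> \<tau> v \<in> L2 M\<^sub>Q"
  unfolding R1_def[abs_def]
  using H1_1_subset_H1_half assms(1)
  by (intro L2_diff \<sigma>_dt_L2 divergence_pairing(1)[OF assms(2)] assms) auto

lemma R3_L2:
  assumes "\<zeta> \<in> H1_1 \<Omega> T" "\<rho> \<in> Hdiv \<Omega> T" "\<eta> \<in> H1_1 \<Omega> T" "yd \<in> L2 M\<^sub>Q"
  shows "R3 \<Omega> T \<sigma> yd \<zeta> \<rho> \<eta> \<in> L2 M\<^sub>Q"
  unfolding R3_def[abs_def]
  using H1_1_subset_H1_half assms(1)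
  by (intro L2_add L2_diff \<sigma>_dt_L2 divergence_pairing(1)[OF assms(2)] assms H1_1_D) auto

lemma residual_bound:
  assumes "f \<in> L2 M\<^sub>Q" "g \<in> L2 M\<^sub>Q" "q \<in> H1_half \<Omega> T"
  shows "\<bar>(\<integral>z. f z * q z \<partial>M\<^sub>Q) + (\<integral>z. g z \<bullet> grad \<Omega> T q z \<partial>M\<^sub>Q)\<bar> \<le> (CF * nQ f
      + nQ g) * nQ (grad \<Omega> T q)"
proof -
  note Q = H1_half_D[OF assms(3)]
  have "\<bar>\<integral>z. f z * q z \<partial>M\<^sub>Q\<bar> \<le> nQ f * nQ q"
    using L2_Cauchy_Schwarz[OF assms(1) Q(1)] by simp
  also have "\<dots> \<le> nQ f * (CF * nQ (grad \<Omega> T q))"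
    by (intro mult_left_mono friedrichs_H1_half assms) simp
  finally have 1: "\<bar>\<integral>z. f z * q z \<partial>M\<^sub>Q\<bar> \<le> nQ f * (CF * nQ (grad \<Omega> T q))" .
  have 2: "\<bar>\<integral>z. g z \<bullet> grad \<Omega> T q z \<partial>M\<^sub>Q\<bar> \<le> nQ g * nQ (grad \<Omega> T q)"
    by (rule L2_Cauchy_Schwarz[OF assms(2) Q(3)])
  have "(CF * nQ f + nQ g) * nQ (grad \<Omega> T q) = nQ f * (CF * nQ (grad \<Omega> T q))
      + nQ g * nQ (grad \<Omega> T q)"
    by (simp add: algebra_simps)
  with 1 2 show ?thesis by linarith
qed

text \<open>In \<open>form e e\<close> the divergence of \<open>\<tau>\<close> is added and subtracted, so that the data of \<open>\<eta>\<close> enter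
  only through the two residuals. One factor \<open>\<parallel>\<nabla>e\<parallel>\<close> cancels.\<close>

lemma state_error_bound:
  assumes y: "weak_state \<Omega> T \<sigma> \<nu> v y" and v: "v \<in> L2 M\<^sub>Q" and \<eta>: "\<eta> \<in> H1_1 \<Omega> T" and \<tau>: "\<tau>
      \<in> Hdiv \<Omega> T"
  shows "\<mu> * nQ (grad \<Omega> T (\<lambda>z. y z - \<eta> z)) \<le> CF * nQ (R1 \<Omega> T \<sigma> \<eta> \<tau> v) + nQ (R2 \<Omega> T \<nu> \<eta> \<tau>)"
proof -
  have \<eta>h: "\<eta> \<in> H1_half \<Omega> T" using \<eta> H1_1_subset_H1_half by blast
  have yh: "y \<in> H1_half \<Omega> T" using y by (simp add: weak_state_iff)
  define e where "e = (\<lambda>z. y z - \<eta> z)"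
  have e: "e \<in> H1_half \<Omega> T" unfolding e_def by (rule H1_half_diff[OF yh \<eta>h])
  note eL = H1_half_D(1)[OF e] and \<tau>L = divergence_pairing[OF \<tau> e]
  note R1L = R1_L2[OF \<eta> \<tau> v] and R2p = flux_residual_pairing[OF \<tau> \<eta>h e]
  have "(\<integral>z. R1 \<Omega> T \<sigma> \<eta> \<tau> v z * e z \<partial>M\<^sub>Q)
      = (\<integral>z. \<sigma> (fst z) * dt \<Omega> T \<eta> z * e z - diverg \<Omega> T \<tau> z * e z - v z * e z \<partial>M\<^sub>Q)"
    by (simp add: R1_def left_diff_distrib)
  also have "\<dots> = (\<integral>z. \<sigma> (fst z) * dt \<Omega> T \<eta> z * e z \<partial>M\<^sub>Q) - (\<integral>z. diverg \<Omega> T \<tau> z * e z \<partial>M\<^sub>Q)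
      - (\<integral>z. v z * e z \<partial>M\<^sub>Q)"
    using L2_integrable_mult[OF \<sigma>_dt_L2[OF \<eta>] eL] L2_integrable_mult[OF \<tau>L(1) eL]
        L2_integrable_mult[OF v eL]
    by simp
  finally have R1p: "(\<integral>z. R1 \<Omega> T \<sigma> \<eta> \<tau> v z * e z \<partial>M\<^sub>Q)
      = (\<integral>z. \<sigma> (fst z) * dt \<Omega> T \<eta> z * e z \<partial>M\<^sub>Q) - (\<integral>z. diverg \<Omega> T \<tau> z * e z \<partial>M\<^sub>Q)
          - (\<integral>z. v z * e z \<partial>M\<^sub>Q)" .
  have "form e e = form y e - form \<eta> e" unfolding e_def by (intro form_diff H1_half_diff yh \<eta>h)
  also have "\<dots> = (\<integral>z. v z * e z \<partial>M\<^sub>Q) - (grad_pairing \<eta> e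
      + (\<integral>z. \<sigma> (fst z) * dt \<Omega> T \<eta> z * e z \<partial>M\<^sub>Q))"
    using y e form_H1_1(1)[OF \<eta> e] by (simp add: weak_state_iff)
  also have "\<dots> = (\<integral>z. - R1 \<Omega> T \<sigma> \<eta> \<tau> v z * e z \<partial>M\<^sub>Q) + (\<integral>z. R2 \<Omega> T \<nu> \<eta> \<tau> z \<bullet> grad \<Omega> T e z \<partial>M\<^sub>Q)"
    using R1p R2p(2) by simp
  also have "\<dots> \<le> (CF * nQ (\<lambda>z. - R1 \<Omega> T \<sigma> \<eta> \<tau> v z) + nQ (R2 \<Omega> T \<nu> \<eta> \<tau>)) * nQ (grad \<Omega> T e)"
    using residual_bound[OF L2_minus[OF R1L] R2p(1) e] by linarith
  finally have le: "form e e \<le> (CF * nQ (R1 \<Omega> T \<sigma> \<eta> \<tau> v) + nQ (R2 \<Omega> T \<nu> \<eta> \<tau>)) * nQ (grad \<Omega> T e)"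
    by (simp add: L2_norm_minus)
  have "\<mu> * nQ (grad \<Omega> T e) * nQ (grad \<Omega> T e) \<le> nu0 * (nQ (grad \<Omega> T e))\<^sup>2"
    using mu1_bounds by (simp add: power2_eq_square mult_right_mono mult.assoc)
  also have "\<dots> \<le> form e e" by (rule form_coercive[OF e])
  finally have "\<mu> * nQ (grad \<Omega> T e) * nQ (grad \<Omega> T e) \<le> (CF * nQ (R1 \<Omega> T \<sigma> \<eta> \<tau> v)
      + nQ (R2 \<Omega> T \<nu> \<eta> \<tau>)) * nQ (grad \<Omega> T e)"
    using le by linarith
  moreover have "0 \<le> CF * nQ (R1 \<Omega> T \<sigma> \<eta> \<tau> v) + nQ (R2 \<Omega> T \<nu> \<eta> \<tau>)" using CF_pos by simp
  ultimately have "\<mu> * nQ (grad \<Omega> T e) \<le> CF * nQ (R1 \<Omega> T \<sigma> \<eta> \<tau> v) + nQ (R2 \<Omega> T \<nu> \<eta> \<tau>)"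
    using L2_norm_nonneg[of M\<^sub>Q "grad \<Omega> T e"]
    by (cases "nQ (grad \<Omega> T e) = 0") (simp_all add: mult_le_cancel_right)
  then show ?thesis by (simp add: e_def)
qed

lemma Young_sum_sq:
  fixes a b \<beta> :: real
  assumes "\<beta> > 0" shows "(a + b)\<^sup>2 \<le> (1 + \<beta>) * (a\<^sup>2 + b\<^sup>2 / \<beta>)"
proof -
  have "0 \<le> (\<beta> * a - b)\<^sup>2 / \<beta>" using assms by simp
  then show ?thesis using assms by (simp add: power2_eq_square field_simps)
qed

text \<open>The distance of the state to \<open>y\<^sub>d\<close> is split at \<open>\<eta>\<close>. Young's inequality with \<open>\<alpha>\<close> separates
  the two summands, and with \<open>\<beta>\<close> the two residuals that bound \<open>y - \<eta>\<close>.\<close>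

lemma cost_le_J_major:
  assumes y: "weak_state \<Omega> T \<sigma> \<nu> v y" and v: "v \<in> L2 M\<^sub>Q" and \<eta>: "\<eta> \<in> H1_1 \<Omega> T" and \<tau>: "\<tau>
      \<in> Hdiv \<Omega> T"
    and yd: "yd \<in> L2 M\<^sub>Q" and \<alpha>: "\<alpha> > 0" and \<beta>: "\<beta> > 0"
  shows "cost \<Omega> T yd lam y v \<le> J_major \<Omega> T \<sigma> \<nu> yd lam CF \<mu> \<alpha> \<beta> \<eta> \<tau> v"
proof -
  have \<eta>h: "\<eta> \<in> H1_half \<Omega> T" using \<eta> H1_1_subset_H1_half by blast
  have yh: "y \<in> H1_half \<Omega> T" using y by (simp add: weak_state_iff)
  note e = H1_half_diff[OF yh \<eta>h]
  note eL = H1_half_D(1)[OF e]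
  define A where "A = nQ (\<lambda>z. \<eta> z - yd z)"
  define E where "E = nQ (\<lambda>z. y z - \<eta> z)"
  define a1 where "a1 = nQ (R1 \<Omega> T \<sigma> \<eta> \<tau> v)"
  define a2 where "a2 = nQ (R2 \<Omega> T \<nu> \<eta> \<tau>)"
  have dL: "(\<lambda>z. \<eta> z - yd z) \<in> L2 M\<^sub>Q" by (intro L2_diff H1_half_D \<eta>h yd)
  have "nQ (\<lambda>z. y z - yd z) \<le> A + E"
    using L2_norm_triangle[OF dL eL] by (simp add: A_def E_def algebra_simps)
  then have "(nQ (\<lambda>z. y z - yd z))\<^sup>2 \<le> (A + E)\<^sup>2" by (rule power_mono) simp
  also have "\<dots> \<le> (1 + \<alpha>) * (A\<^sup>2 + E\<^sup>2 / \<alpha>)" by (rule Young_sum_sq[OF \<alpha>])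
  finally have 1: "(nQ (\<lambda>z. y z - yd z))\<^sup>2 \<le> (1 + \<alpha>) * A\<^sup>2 + (1 + \<alpha>) / \<alpha> * E\<^sup>2"
    by (simp add: distrib_left)
  have "\<mu> * E \<le> CF * (a2 + CF * a1)"
  proof -
    have "\<mu> * E \<le> \<mu> * (CF * nQ (grad \<Omega> T (\<lambda>z. y z - \<eta> z)))"
      unfolding E_def using mu1_bounds by (intro mult_left_mono friedrichs_H1_half[OF e]) auto
    also have "\<dots> = CF * (\<mu> * nQ (grad \<Omega> T (\<lambda>z. y z - \<eta> z)))" by simp
    also have "\<dots> \<le> CF * (CF * a1 + a2)"
      unfolding a1_def a2_def using CF_pos
          by (intro mult_left_mono state_error_bound[OF y v \<eta> \<tau>]) auto
    finally show ?thesis by (simp add: add.commute)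
  qed
  then have "(\<mu> * E)\<^sup>2 \<le> (CF * (a2 + CF * a1))\<^sup>2"
    using mu1_bounds by (intro power_mono) (auto simp: E_def)
  also have "\<dots> = CF\<^sup>2 * (a2 + CF * a1)\<^sup>2" by (simp add: power_mult_distrib)
  also have "\<dots> \<le> CF\<^sup>2 * ((1 + \<beta>) * (a2\<^sup>2 + (CF * a1)\<^sup>2 / \<beta>))"
    by (intro mult_left_mono Young_sum_sq \<beta>) simp
  finally have "E\<^sup>2 \<le> CF\<^sup>2 * (1 + \<beta>) / \<mu>\<^sup>2 * (a2\<^sup>2 + CF\<^sup>2 / \<beta> * a1\<^sup>2)"
    using mu1_bounds by (simp add: power_mult_distrib field_simps)
  then have "(1 + \<alpha>) / (2 * \<alpha>) * E\<^sup>2 \<le> (1 + \<alpha>) / (2 * \<alpha>) * (CF\<^sup>2 * (1 + \<beta>) / \<mu>\<^sup>2 * (a2\<^sup>2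
      + CF\<^sup>2 / \<beta> * a1\<^sup>2))"
    using \<alpha> by (intro mult_left_mono) auto
  also have "\<dots> = gamma_coeff CF \<mu> \<alpha> \<beta> * (a2\<^sup>2 + CF\<^sup>2 / \<beta> * a1\<^sup>2)"
    by (simp add: gamma_coeff_def)
  finally have 2: "(1 + \<alpha>) / (2 * \<alpha>) * E\<^sup>2 \<le> gamma_coeff CF \<mu> \<alpha> \<beta> * (a2\<^sup>2 + CF\<^sup>2 / \<beta> * a1\<^sup>2)" .
  have "1 / 2 * (nQ (\<lambda>z. y z - yd z))\<^sup>2 \<le> (1 + \<alpha>) / 2 * A\<^sup>2 + (1 + \<alpha>) / (2 * \<alpha>) * E\<^sup>2"
    using 1 \<alpha> by (simp add: field_simps)
  with 2 show ?thesis
    unfolding cost_def J_major_def A_def[symmetric] a1_def[symmetric] a2_def[symmetric] by linarith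
qed

text \<open>After the exact expansion of both squares, the linear terms combine to \<open>De - form e \<zeta>\<close>,
  which is the pairing of the adjoint residuals with \<open>e\<close>. It is bounded by \<open>X \<parallel>\<nabla>e\<parallel>\<close>, and \<open>\<parallel>\<nabla>e\<parallel>\<close> by
  the residuals of the state equation. The latter contain the unknown control through \<open>s = u +
  \<zeta>/\<lambda>\<close> only, whose norm is absorbed by the square \<open>\<lambda>/2 \<parallel>s\<parallel>\<^sup>2\<close> left over from the expansion.\<close>

lemma J_minor_le_cost:
  assumes y: "weak_state \<Omega> T \<sigma> \<nu> u y" and u: "u \<in> L2 M\<^sub>Q" and yd: "yd \<in> L2 M\<^sub>Q" and lam: "lam > 0"
    and \<eta>: "\<eta> \<in> H1_1 \<Omega> T" and \<zeta>: "\<zeta> \<in> H1_1 \<Omega> T" and \<tau>: "\<tau> \<in> Hdiv \<Omega> T" and \<rho>: "\<rho> \<in> Hdiv \<Omega> T"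
  shows "J_minor \<Omega> T \<sigma> \<nu> yd lam CF \<mu> \<eta> \<zeta> \<tau> \<rho> \<le> cost \<Omega> T yd lam y u"
proof -
  have \<eta>h: "\<eta> \<in> H1_half \<Omega> T" and \<zeta>h: "\<zeta> \<in> H1_half \<Omega> T" using \<eta> \<zeta> H1_1_subset_H1_half by auto
  have yh: "y \<in> H1_half \<Omega> T" using y by (simp add: weak_state_iff)
  define e where "e = (\<lambda>z. y z - \<eta> z)"
  have e: "e \<in> H1_half \<Omega> T" unfolding e_def by (rule H1_half_diff[OF yh \<eta>h])
  note eL = H1_half_D(1)[OF e] and \<eta>L = H1_half_D(1)[OF \<eta>h] and \<zeta>L = H1_half_D(1)[OF \<zeta>h]
  define s where "s z = u z + inverse lam * \<zeta> z" for z
  have sL: "s \<in> L2 M\<^sub>Q" unfolding s_def[abs_def] by (intro L2_add L2_cmult u \<zeta>L)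
  define D where "D z = \<eta> z - yd z" for z
  have DL: "D \<in> L2 M\<^sub>Q" unfolding D_def[abs_def] by (intro L2_diff \<eta>L yd)
  define w where "w z = - inverse lam * \<zeta> z" for z
  have wL: "w \<in> L2 M\<^sub>Q" unfolding w_def[abs_def] by (intro L2_cmult \<zeta>L)
  define X where "X = CF * nQ (R3 \<Omega> T \<sigma> yd \<zeta> \<rho> \<eta>) + nQ (R4 \<Omega> T \<nu> \<zeta> \<rho>)"
  define Y where "Y = CF * nQ (R1 \<Omega> T \<sigma> \<eta> \<tau> w) + nQ (R2 \<Omega> T \<nu> \<eta> \<tau>)"
  define a where "a = nQ s"
  define z2 where "z2 = (nQ \<zeta>)\<^sup>2"
  define St where "St = (\<integral>z. \<sigma> (fst z) * dt \<Omega> T \<eta> z * \<zeta> z \<partial>M\<^sub>Q)"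
  define De where "De = (\<integral>z. D z * e z \<partial>M\<^sub>Q)"
  define uz where "uz = (\<integral>z. u z * \<zeta> z \<partial>M\<^sub>Q)"
  have X0: "0 \<le> X" unfolding X_def using CF_pos by simp
  have state: "(nQ (\<lambda>z. y z - yd z))\<^sup>2 = (nQ D)\<^sup>2 + 2 * De + (nQ e)\<^sup>2"
    using L2_norm_sq_add[OF DL eL, of 1] by (simp add: e_def D_def De_def)
  have control: "(nQ u)\<^sup>2 = a\<^sup>2 - 2 * inverse lam * (uz + inverse lam * z2) + (inverse lam)\<^sup>2 * z2"
  proof -
    have "(\<integral>z. s z * \<zeta> z \<partial>M\<^sub>Q) = (\<integral>z. u z * \<zeta> z + inverse lam * (\<zeta> z * \<zeta> z) \<partial>M\<^sub>Q)"
      by (simp add: s_def distrib_right mult.assoc)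
    also have "\<dots> = uz + inverse lam * z2"
      using L2_integrable_mult[OF u \<zeta>L] L2_integrable_mult[OF \<zeta>L \<zeta>L]
      by (simp add: uz_def z2_def L2_norm_sq_inner)
    finally show ?thesis
      using L2_norm_sq_add[OF sL \<zeta>L, of "- inverse lam"] by (simp add: s_def a_def z2_def)
  qed
  have uz: "uz = form e \<zeta> + (grad_pairing \<eta> \<zeta> + St)"
  proof -
    have "uz = form y \<zeta>" using y \<zeta>h by (simp add: weak_state_iff uz_def)
    also have "form e \<zeta> = form y \<zeta> - form \<eta> \<zeta>" unfolding e_def by (intro form_diff yh \<eta>h \<zeta>h)
    then have "form y \<zeta> = form e \<zeta> + form \<eta> \<zeta>" by simp
    finally show ?thesis using form_H1_1(1)[OF \<eta> \<zeta>h] by (simp add: St_def)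
  qed
  have R4_eq: "R4 \<Omega> T \<nu> \<zeta> \<rho> = R2 \<Omega> T \<nu> \<zeta> \<rho>" by (simp add: R4_def R2_def fun_eq_iff)
  note R4p = flux_residual_pairing[OF \<rho> \<zeta>h e, folded R4_eq]
  note R3L = R3_L2[OF \<zeta> \<rho> \<eta> yd]
  have "(\<integral>z. R3 \<Omega> T \<sigma> yd \<zeta> \<rho> \<eta> z * e z \<partial>M\<^sub>Q)
      = (\<integral>z. D z * e z + diverg \<Omega> T \<rho> z * e z + \<sigma> (fst z) * dt \<Omega> T \<zeta> z * e z \<partial>M\<^sub>Q)"
    by (simp add: R3_def D_def algebra_simps)
  also have "\<dots> = De + (\<integral>z. diverg \<Omega> T \<rho> z * e z \<partial>M\<^sub>Q) + (\<integral>z. \<sigma> (fst z) * dt \<Omega> T \<zeta> z * e z \<partial>M\<^sub>Q)"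
    using L2_integrable_mult[OF DL eL] L2_integrable_mult[OF divergence_pairing(1)[OF \<rho> e] eL]
      L2_integrable_mult[OF \<sigma>_dt_L2[OF \<zeta>] eL]
    by (simp add: De_def)
  finally have adj: "De - form e \<zeta> = (\<integral>z. R3 \<Omega> T \<sigma> yd \<zeta> \<rho> \<eta> z * e z \<partial>M\<^sub>Q)
      + (\<integral>z. R4 \<Omega> T \<nu> \<zeta> \<rho> z \<bullet> grad \<Omega> T e z \<partial>M\<^sub>Q)"
    using form_H1_1(2)[OF \<zeta> e] R4p(2) by (simp add: grad_pairing_def inner_commute)
  have "- (X * nQ (grad \<Omega> T e)) \<le> De - form e \<zeta>"
    unfolding adj X_def using residual_bound[OF R3L R4p(1) e] by linarith
  moreover have "nQ (grad \<Omega> T e) \<le> (Y + CF * a) / \<mu>"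
  proof -
    have "nQ (R1 \<Omega> T \<sigma> \<eta> \<tau> u) = nQ (\<lambda>z. R1 \<Omega> T \<sigma> \<eta> \<tau> w z - s z)"
      by (simp add: R1_def[abs_def] s_def w_def)
    also have "\<dots> \<le> nQ (R1 \<Omega> T \<sigma> \<eta> \<tau> w) + a"
      unfolding a_def by (rule L2_norm_triangle_diff[OF R1_L2[OF \<eta> \<tau> wL] sL])
    finally have "CF * nQ (R1 \<Omega> T \<sigma> \<eta> \<tau> u) \<le> CF * (nQ (R1 \<Omega> T \<sigma> \<eta> \<tau> w) + a)"
      using CF_pos by (intro mult_left_mono) auto
    then have "\<mu> * nQ (grad \<Omega> T e) \<le> Y + CF * a"
      using state_error_bound[OF y u \<eta> \<tau>] unfolding e_def Y_def by (simp add: distrib_left)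
    then show ?thesis using mu1_bounds by (simp add: field_simps)
  qed
  then have "X * nQ (grad \<Omega> T e) \<le> X * ((Y + CF * a) / \<mu>)" using X0 by (rule mult_left_mono)
  ultimately have key: "- (X * ((Y + CF * a) / \<mu>)) \<le> De - form e \<zeta>" by linarith
  have square: "- (CF\<^sup>2 / (\<mu>\<^sup>2 * lam) * X\<^sup>2) \<le> lam / 2 * a\<^sup>2 - X * (CF * a) / \<mu>"
  proof -
    have "0 \<le> lam / 2 * (a - CF * X / (\<mu> * lam))\<^sup>2 + CF\<^sup>2 * X\<^sup>2 / (2 * \<mu>\<^sup>2 * lam)"
      using lam by simp
    also have "\<dots> = lam / 2 * a\<^sup>2 - X * (CF * a) / \<mu> + CF\<^sup>2 / (\<mu>\<^sup>2 * lam) * X\<^sup>2"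
      using lam mu1_bounds by (simp add: power2_diff power_mult_distrib power_divide
          power2_eq_square field_simps)
    finally show ?thesis by linarith
  qed
  have int: "(\<integral>z. \<nu> (fst z) * (grad \<Omega> T \<eta> z \<bullet> grad \<Omega> T \<zeta> z) + \<sigma> (fst z) * dt \<Omega> T \<eta> z * \<zeta> z
      + inverse lam * (\<zeta> z)\<^sup>2 \<partial>M\<^sub>Q)
      = grad_pairing \<eta> \<zeta> + St + inverse lam * z2"
    using \<nu>_integrable[OF H1_half_D(3)[OF \<eta>h] H1_half_D(3)[OF \<zeta>h]] L2_integrable_mult[OF
        \<sigma>_dt_L2[OF \<eta>] \<zeta>L] L2_integrable_sq[OF \<zeta>L]
    by (simp add: grad_pairing_def St_def z2_def L2_norm_sq)
  have "lam / 2 * (nQ u)\<^sup>2 = lam / 2 * a\<^sup>2 - uz - inverse lam * z2 + 1 / (2 * lam) * z2"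
    unfolding control using lam by (simp add: power2_eq_square field_simps)
  then have "cost \<Omega> T yd lam y u = 1 / 2 * (nQ D)\<^sup>2 + 1 / (2 * lam) * z2 - (grad_pairing \<eta> \<zeta> + St
      + inverse lam * z2)
      + (De - form e \<zeta>) + lam / 2 * a\<^sup>2 + 1 / 2 * (nQ e)\<^sup>2"
    unfolding cost_def state uz by (simp add: algebra_simps)
  moreover have "X * ((Y + CF * a) / \<mu>) = 1 / \<mu> * Y * X + X * (CF * a) / \<mu>"
    by (simp add: add_divide_distrib distrib_left)
  moreover have "J_minor \<Omega> T \<sigma> \<nu> yd lam CF \<mu> \<eta> \<zeta> \<tau> \<rho> = 1 / 2 * (nQ D)\<^sup>2 + 1 / (2 * lam) * z2
      - (grad_pairing \<eta> \<zeta> + St + inverse lam * z2) - CF\<^sup>2 / (\<mu>\<^sup>2 * lam) * X\<^sup>2 - 1 / \<mu> * Y * X"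
    unfolding J_minor_def int by (simp add: D_def[abs_def] z2_def X_def Y_def w_def[abs_def])
  moreover have "0 \<le> 1 / 2 * (nQ e)\<^sup>2" by simp
  ultimately show ?thesis using key square by linarith
qed

lemma weak_state_unique:
  assumes "weak_state \<Omega> T \<sigma> \<nu> u y1" "weak_state \<Omega> T \<sigma> \<nu> u y2"
  shows "AE z in M\<^sub>Q. y1 z = y2 z"
proof -
  have y: "y1 \<in> H1_half \<Omega> T" "y2 \<in> H1_half \<Omega> T" using assms by (auto simp: weak_state_iff)
  note d = H1_half_diff[OF y]
  have "form (\<lambda>z. y1 z - y2 z) (\<lambda>z. y1 z - y2 z) = 0"
    using form_diff[OF y d] assms d by (simp add: weak_state_iff)
  then have "nu0 * (nQ (grad \<Omega> T (\<lambda>z. y1 z - y2 z)))\<^sup>2 \<le> 0" using form_coercive[OF d] by simp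
  then have "nQ (grad \<Omega> T (\<lambda>z. y1 z - y2 z)) = 0" using nu0_pos by (simp add: mult_le_0_iff)
  then have "nQ (\<lambda>z. y1 z - y2 z) = 0"
    using friedrichs_H1_half[OF d] L2_norm_nonneg[of M\<^sub>Q "\<lambda>z. y1 z - y2 z"] by simp
  from L2_norm_eq_0_AE[OF H1_half_D(1)[OF d] this] show ?thesis by eventually_elim simp
qed

text \<open>Along the line through \<open>u\<close> and \<open>v\<close> the cost is the quadratic polynomial \<open>s \<mapsto> cost u + s G +
  s\<^sup>2 K\<close>, by linearity of the state equation. Its minimum lies at \<open>s = 0\<close>, so \<open>G \<ge> 0\<close>, and at \<open>s =
  1\<close> it exceeds the minimum by at least \<open>K\<close>, the claimed gap. The definition of optimality
  provides some state of \<open>u\<close>; it agrees with the given one by uniqueness.\<close>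

lemma optimal_control_gap:
  assumes opt: "optimal_control \<Omega> T \<sigma> \<nu> yd lam u" and yu: "weak_state \<Omega> T \<sigma> \<nu> u yu"
    and v: "v \<in> L2 M\<^sub>Q" and yv: "weak_state \<Omega> T \<sigma> \<nu> v yv" and yd: "yd \<in> L2 M\<^sub>Q" and lam: "lam > 0"
  shows "1 / 2 * (nQ (\<lambda>z. yu z - yv z))\<^sup>2 + lam / 2 * (nQ (\<lambda>z. u z - v z))\<^sup>2
    \<le> cost \<Omega> T yd lam yv v - cost \<Omega> T yd lam yu u"
proof -
  obtain y where u: "u \<in> L2 M\<^sub>Q" and y: "weak_state \<Omega> T \<sigma> \<nu> u y"
    and min: "\<And>v y'. v \<in> L2 M\<^sub>Q \<Longrightarrow> weak_state \<Omega> T \<sigma> \<nu> v y' \<Longrightarrow> cost \<Omega> T yd lam y u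
        \<le> cost \<Omega> T yd lam y' v"
    using opt unfolding optimal_control_def by blast
  have yL: "yu \<in> L2 M\<^sub>Q" "yv \<in> L2 M\<^sub>Q" "y \<in> L2 M\<^sub>Q" using yu yv y
      by (auto simp: weak_state_iff H1_half_D)
  have "nQ (\<lambda>z. y z - yd z) = nQ (\<lambda>z. yu z - yd z)"
    by (intro L2_norm_cong_AE L2_measurable L2_diff yL yd)
       (use weak_state_unique[OF y yu] in \<open>auto elim: eventually_mono\<close>)
  then have yu_cost: "cost \<Omega> T yd lam y u = cost \<Omega> T yd lam yu u" by (simp add: cost_def)
  define d where "d z = yv z - yu z" for z
  define h where "h z = v z - u z" for z
  define f where "f z = yu z - yd z" for z
  have L: "d \<in> L2 M\<^sub>Q" "h \<in> L2 M\<^sub>Q" "f \<in> L2 M\<^sub>Q"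
    unfolding d_def[abs_def] h_def[abs_def] f_def[abs_def] by (intro L2_diff yL v u yd)+
  define K where "K = 1 / 2 * (nQ d)\<^sup>2 + lam / 2 * (nQ h)\<^sup>2"
  define G where "G = (\<integral>z. f z \<bullet> d z \<partial>M\<^sub>Q) + lam * (\<integral>z. u z \<bullet> h z \<partial>M\<^sub>Q)"
  have expand: "cost \<Omega> T yd lam (\<lambda>z. yu z + s * d z) (\<lambda>z. u z + s * h z) = cost \<Omega> T yd lam yu u
      + s * G + s\<^sup>2 * K" for s
  proof -
    have e: "(\<lambda>z. (yu z + s * d z) - yd z) = (\<lambda>z. f z + s *\<^sub>R d z)" by (simp add: f_def fun_eq_iff)
    show ?thesis
      unfolding cost_def e
      using L2_norm_sq_add[OF L(3) L(1), of s] L2_norm_sq_add[OF u L(2), of s]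
      by (simp add: K_def G_def f_def[abs_def] algebra_simps)
  qed
  have K0: "0 \<le> K" using lam by (simp add: K_def)
  have ws: "weak_state \<Omega> T \<sigma> \<nu> (\<lambda>z. u z + s * h z) (\<lambda>z. yu z + s * d z)" for s
  proof -
    have "weak_state \<Omega> T \<sigma> \<nu> h d"
      using weak_state_lincomb[OF yv yu v u, of "-1"] by (simp add: h_def[abs_def] d_def[abs_def])
    from weak_state_lincomb[OF yu this u L(2)] show ?thesis .
  qed
  have nonneg: "0 \<le> s * G + s\<^sup>2 * K" for s
    using min[OF L2_add[OF u L2_cmult[OF L(2)]] ws, of s] expand[of s] yu_cost by simp
  have G0: "0 \<le> G"
  proof (rule ccontr)
    assume "\<not> 0 \<le> G"
    then have G: "G < 0" by simp
    \<comment> \<open>A step short enough for the linear term to outweigh the quadratic one.\<close>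
    define s where "s = - G / (2 * (K + 1))"
    have s: "s > 0" using G K0 by (simp add: s_def divide_neg_pos)
    have "s * K \<le> s * (K + 1)" using s by simp
    also have "\<dots> = - G / 2" using K0 by (simp add: s_def field_simps)
    finally have "G + s * K < 0" using G by simp
    then have "s * (G + s * K) < 0" using s by (simp add: mult_pos_neg)
    then show False using nonneg[of s] by (simp add: distrib_left power2_eq_square mult.assoc)
  qed
  have "cost \<Omega> T yd lam yv v = cost \<Omega> T yd lam yu u + G + K"
    using expand[of 1] by (simp add: d_def h_def)
  moreover have "nQ (\<lambda>z. yu z - yv z) = nQ d" "nQ (\<lambda>z. u z - v z) = nQ h"
    using L2_norm_minus[of M\<^sub>Q d] L2_norm_minus[of M\<^sub>Q h] by (simp_all add: d_def h_def)
  ultimately show ?thesis using G0 by (simp add: K_def)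
qed

lemma error_le_majorant:
  assumes opt: "optimal_control \<Omega> T \<sigma> \<nu> yd lam u" and yu: "weak_state \<Omega> T \<sigma> \<nu> u yu"
    and v: "v \<in> L2 M\<^sub>Q" and yv: "weak_state \<Omega> T \<sigma> \<nu> v yv" and yd: "yd \<in> L2 M\<^sub>Q" and lam: "lam > 0"
    and \<alpha>: "\<alpha> > 0" and \<beta>: "\<beta> > 0"
    and \<eta>: "\<eta> \<in> H1_1 \<Omega> T" and \<zeta>: "\<zeta> \<in> H1_1 \<Omega> T" and \<tau>: "\<tau> \<in> Hdiv \<Omega> T" and \<rho>: "\<rho> \<in> Hdiv \<Omega> T"
  shows "error_sq \<Omega> T lam CF \<mu> yu yv \<le> M1_major \<Omega> T \<sigma> \<nu> yd lam CF \<mu> \<alpha> \<beta> \<eta> \<zeta> \<tau> \<rho> v"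
proof -
  have u: "u \<in> L2 M\<^sub>Q" using opt by (simp add: optimal_control_def)
  have y: "yu \<in> H1_half \<Omega> T" "yv \<in> H1_half \<Omega> T" using yu yv by (auto simp: weak_state_iff)
  have "\<mu>\<^sup>2 * seminorm_sq \<Omega> T (\<lambda>z. yu z - yv z) \<le> CF\<^sup>2 * (nQ (\<lambda>z. u z - v z))\<^sup>2"
  proof (rule stability[OF H1_half_diff[OF y] L2_diff[OF u v]])
    fix q assume q: "q \<in> H1_half \<Omega> T"
    note qL = H1_half_D(1)[OF q]
    show "form (\<lambda>z. yu z - yv z) q = (\<integral>z. (u z - v z) * q z \<partial>M\<^sub>Q)"
      using form_diff[OF y q] yu yv q L2_integrable_mult[OF u qL] L2_integrable_mult[OF v qL]
      by (simp add: weak_state_iff left_diff_distrib)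
  qed
  then have "lam / (2 * CF\<^sup>2) * (\<mu>\<^sup>2 * seminorm_sq \<Omega> T (\<lambda>z. yu z - yv z))
      \<le> lam / (2 * CF\<^sup>2) * (CF\<^sup>2 * (nQ (\<lambda>z. u z - v z))\<^sup>2)"
    using lam by (intro mult_left_mono) auto
  then have "lam * \<mu>\<^sup>2 / (2 * CF\<^sup>2) * seminorm_sq \<Omega> T (\<lambda>z. yu z - yv z)
      \<le> lam / 2 * (nQ (\<lambda>z. u z - v z))\<^sup>2"
    using CF_pos by simp
  then have "error_sq \<Omega> T lam CF \<mu> yu yv \<le> cost \<Omega> T yd lam yv v - cost \<Omega> T yd lam yu u"
    using optimal_control_gap[OF opt yu v yv yd lam] unfolding error_sq_def by linarith
  also have "\<dots> \<le> J_major \<Omega> T \<sigma> \<nu> yd lam CF \<mu> \<alpha> \<beta> \<eta> \<tau> v - J_minor \<Omega> T \<sigma> \<nu> yd lam CF \<mu> \<eta> \<zeta> \<tau> \<rho>"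
    using cost_le_J_major[OF yv v \<eta> \<tau> yd \<alpha> \<beta>] J_minor_le_cost[OF yu u yd lam \<eta> \<zeta> \<tau> \<rho>]
        by (intro diff_mono)
  also have "\<dots> \<le> M1_major \<Omega> T \<sigma> \<nu> yd lam CF \<mu> \<alpha> \<beta> \<eta> \<zeta> \<tau> \<rho> v"
    unfolding M1_major_def using lam CF_pos by simp
  finally show ?thesis .
qed

end

section \<open>The majorant for the error of a control\<close>

theorem proposition2:
  fixes \<Omega> :: "(real ^ 'd) set"
    and T lam CF sig0 sig1 nu0 nu1 \<alpha> \<beta> :: real
    and \<sigma> \<nu> :: "real ^ 'd \<Rightarrow> real"
    and yd u v yu yv \<eta> \<zeta> :: "(real ^ 'd) \<times> real \<Rightarrow> real"
    and \<tau> \<rho> :: "(real ^ 'd) \<times> real \<Rightarrow> real ^ 'd"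
  assumes "CARD('d) \<in> {1, 2, 3}"
    and "lipschitz_domain \<Omega>" "bounded \<Omega>"
    and "T > 0" "lam > 0"
    and "\<sigma> \<in> borel_measurable (lebesgue_on \<Omega>)" "\<nu> \<in> borel_measurable (lebesgue_on \<Omega>)"
    and "0 < sig0" "\<And>x. x \<in> \<Omega> \<Longrightarrow> sig0 \<le> \<sigma> x \<and> \<sigma> x \<le> sig1"
    and "0 < nu0" "\<And>x. x \<in> \<Omega> \<Longrightarrow> nu0 \<le> \<nu> x \<and> \<nu> x \<le> nu1"
    and "friedrichs_constant \<Omega> CF"
    and "yd \<in> L2 (cyl \<Omega> T)"
    and "optimal_control \<Omega> T \<sigma> \<nu> yd lam u" "weak_state \<Omega> T \<sigma> \<nu> u yu"
    and "v \<in> L2 (cyl \<Omega> T)" "weak_state \<Omega> T \<sigma> \<nu> v yv"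
    and "\<alpha> > 0" "\<beta> > 0"
    and "\<eta> \<in> H1_1 \<Omega> T" "\<zeta> \<in> H1_1 \<Omega> T" "\<tau> \<in> Hdiv \<Omega> T" "\<rho> \<in> Hdiv \<Omega> T"
  shows "error_sq \<Omega> T lam CF (mu1 nu0 sig0) yu yv
           \<le> M1_major \<Omega> T \<sigma> \<nu> yd lam CF (mu1 nu0 sig0) \<alpha> \<beta> \<eta> \<zeta> \<tau> \<rho> v
         \<and> M1_major \<Omega> T \<sigma> \<nu> yd lam CF (mu1 nu0 sig0) \<alpha> \<beta> \<eta> \<zeta> \<tau> \<rho> v =
           \<alpha> / 2 * (L2_norm (cyl \<Omega> T) (\<lambda>z. \<eta> z - yd z))\<^sup>2
           + gamma_coeff CF (mu1 nu0 sig0) \<alpha> \<beta> *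
               ((L2_norm (cyl \<Omega> T) (R2 \<Omega> T \<nu> \<eta> \<tau>))\<^sup>2
                + CF\<^sup>2 / \<beta> * (L2_norm (cyl \<Omega> T) (R1 \<Omega> T \<sigma> \<eta> \<tau> v))\<^sup>2)
           + lam / 2 * (L2_norm (cyl \<Omega> T) v)\<^sup>2
           - 1 / (2 * lam) * (L2_norm (cyl \<Omega> T) \<zeta>)\<^sup>2
           + (\<integral>z. \<nu> (fst z) * (grad \<Omega> T \<eta> z \<bullet> grad \<Omega> T \<zeta> z)
                   + \<sigma> (fst z) * dt \<Omega> T \<eta> z * \<zeta> z + inverse lam * (\<zeta> z)\<^sup>2 \<partial>cyl \<Omega> T)
           + CF\<^sup>2 / ((mu1 nu0 sig0)\<^sup>2 * lam) *
               (CF * L2_norm (cyl \<Omega> T) (R3 \<Omega> T \<sigma> yd \<zeta> \<rho> \<eta>)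
                + L2_norm (cyl \<Omega> T) (R4 \<Omega> T \<nu> \<zeta> \<rho>))\<^sup>2
           + 1 / mu1 nu0 sig0 *
               (CF * L2_norm (cyl \<Omega> T) (R1 \<Omega> T \<sigma> \<eta> \<tau> (\<lambda>z. - inverse lam * \<zeta> z))
                + L2_norm (cyl \<Omega> T) (R2 \<Omega> T \<nu> \<eta> \<tau>)) *
               (CF * L2_norm (cyl \<Omega> T) (R3 \<Omega> T \<sigma> yd \<zeta> \<rho> \<eta>)
                + L2_norm (cyl \<Omega> T) (R4 \<Omega> T \<nu> \<zeta> \<rho>))
           + 3 * lam / (4 * CF\<^sup>2) *
               (CF * L2_norm (cyl \<Omega> T) (R1 \<Omega> T \<sigma> \<eta> \<tau> v)
                + L2_norm (cyl \<Omega> T) (R2 \<Omega> T \<nu> \<eta> \<tau>))\<^sup>2"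
proof -
  interpret periodic_parabolic \<Omega> T \<sigma> \<nu> sig0 sig1 nu0 nu1 CF
    using assms by unfold_locales (auto simp: lipschitz_domain_def)
  have "error_sq \<Omega> T lam CF (mu1 nu0 sig0) yu yv
      \<le> M1_major \<Omega> T \<sigma> \<nu> yd lam CF (mu1 nu0 sig0) \<alpha> \<beta> \<eta> \<zeta> \<tau> \<rho> v"
    using assms by (intro error_le_majorant)
  moreover have "(1 + \<alpha>) / 2 * x = \<alpha> / 2 * x + 1 / 2 * x" for x :: real
    by (simp add: field_simps)
  ultimately show ?thesis
    by (simp only: M1_major_def J_major_def J_minor_def) simp
qed

end
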